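(* Let $L$ be a non-degenerate even lattice of rank $D$ with discriminant group $\mathcal{L}=L'/L$, let $k\in\frac12\mathbb{Z}$, let $p$ be an odd prime, let $s,l$ be positive integers with $s<2l$, and put $$K_p=p^{2l(k-1)+s(D/2-k)},\qquad \widetilde{K}_p=p^{2l(k-1)-sk+(2l-s)D/2}.$$ Let $f\in M_{k,L}$ have Fourier expansion $$f(\tau)=\sum_{\lambda\in\mathcal{L}}\ \sum_{\substack{n\in\mathbb{Z}+q(\lambda)\\ n\ge0}}c(\lambda,n)e(n\tau)\mathfrak{e}_\lambda,$$ and write $$\sum_{h\in(\mathbb{Z}/p^s\mathbb{Z})^*}g_{\beta_{h,s}}(\tau)=\sum_{\lambda\in\mathcal{L}}\ \sum_{\substack{n\in\mathbb{Z}+q(\lambda)\\ n\ge0}}b_s(\lambda,n)e(n\tau)\mathfrak{e}_\lambda,$$ where $g_{\beta_{h,s}}$ is the contribution of the coset representative $\beta_{h,s}=\begin{pmatrix}p^{2l-s}&h\\0&p^s\end{pmatrix}$ to $f\mid_{k,L}T(p^{2l})$. Let $\mu(\lambda,\lambda')$, $n(\lambda,\lambda')$, $G_{\nu,m}(s)$ and $\widetilde{G}_{\rho,r}(s)$ be as defined in the context. Let $\lambda\in\mathcal{L}$ and $n\in\mathbb{Z}+q(\lambda)$ with $n\ge0$. (i) If $1\le s\le l$, then $$b_s(\lambda,n)=K_p\sum_{\substack{\lambda'\in\mathcal{L}_{p^{l-s}}\\ n-p^{2(l-s)}q(\mu(\lambda,\lambda'))\in p^{2(l-s)}\mathbb{Z}}}c\big(\mu(\lambda,\lambda'),n(\lambda,\lambda')\big)\,G_{\mu(\lambda,\lambda'),\,n(\lambda,\lambda')}(s)$$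 if $\lambda\in\mathcal{L}^{p^{l-s}}$, and $b_s(\lambda,n)=0$ otherwise. (ii) If $l+1\le s\le 2l-1$, then $$b_s(\lambda,n)=\widetilde{K}_p\;c\big(p^{s-l}\lambda,\,p^{2(s-l)}n\big)\;\widetilde{G}_{\lambda,\,p^{2(s-l)}n}(s).$$
   Context: **Lattice and Weil representation.** $L$ is a non-degenerate even lattice of signature $(b^+,b^-)$ and rank $D=b^++b^-$, with bilinear form $b(\cdot,\cdot)$ and quadratic form $q(x)=\tfrac12 b(x,x)$, which is integer valued on $L$. $L'$ is the dual lattice and $\mathcal{L}=L'/L$ the (finite) discriminant group; $q$ induces a map $\mathcal{L}\to\mathbb{Q}/\mathbb{Z}$. For $m\in\mathbb{N}$, $\mathcal{L}^m=m\mathcal{L}$ is the image and $\mathcal{L}_m=\{\lambda\in\mathcal{L}: m\lambda=0\}$ the kernel of multiplication by $m$. $\mathbb{C}[\mathcal{L}]$ is the group algebra with standard basis $(\mathfrak{e}_\lambda)_{\lambda\in\mathcal{L}}$, and $e(x)=e^{2\pi i x}$. Consider the group of pairs $(M,\phi)$ with $M=\begin{pmatrix}a&b\\c&d\end{pmatrix}\in GL_2^+(\mathbb{Q})$ and $\phi$ holomorphic on the upper half plane with $\phi(\tau)^2=c\tau+d$, with multiplication $(M_1,\phi_1(\tau))(M_2,\phi_2(\tau))=(M_1M_2,\phi_1(M_2\tau)\phi_2(\tau))$. $Mp_2(\mathbb{Z})$ is the subgroup with $M\in SL_2(\mathbb{Z})$, generated by $T=\left(\begin{pmatrix}1&1\\0&1\end{pmatrix},1\right)$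 and $S=\left(\begin{pmatrix}0&-1\\1&0\end{pmatrix},\sqrt\tau\right)$. The Weil representation $\rho_L$ of $Mp_2(\mathbb{Z})$ on $\mathbb{C}[\mathcal{L}]$ is given by $$\rho_L(T)\mathfrak{e}_\lambda=e(q(\lambda))\mathfrak{e}_\lambda,\qquad \rho_L(S)\mathfrak{e}_\lambda=\frac{\sqrt{i}^{\,b^--b^+}}{\sqrt{|\mathcal{L}|}}\sum_{\mu\in\mathcal{L}}e(-b(\lambda,\mu))\mathfrak{e}_\mu,\qquad \sqrt{i}=e(1/8).$$ (If $b^+-b^-$ is even, $\rho_L$ factors through $SL_2(\mathbb{Z})$ and the second components may be ignored.) $M_{k,L}$ is the space of holomorphic functions $f=\sum_{\lambda}f_\lambda\mathfrak{e}_\lambda$ from the upper half plane to $\mathbb{C}[\mathcal{L}]$ with $f(M\tau)=\phi(\tau)^{2k}\rho_L(M,\phi)f(\tau)$ for all $(M,\phi)\in Mp_2(\mathbb{Z})$ that are holomorphic at $\infty$. **Extended action.** For $\gamma\in Mp_2(\mathbb{Z})$ put $\mathfrak{e}_\lambda\mid\gamma=\rho_L(\gamma)^{-1}\mathfrak{e}_\lambda$ (extended linearly). For $\alpha=\left(\begin{pmatrix}p^{2l}&0\\0&1\end{pmatrix},1\right)$ put $\mathfrak{e}_\lambda\mid\alpha=\mathfrak{e}_{p^l\lambda}$. For $\delta=\gamma\alpha\gamma'$ with $\gamma,\gamma'\in Mp_2(\mathbb{Z})$ put $\mathfrak{e}_\lambda\mid\delta=((\mathfrak{e}_\lambda\mid\gamma)\mid\alpha)\mid\gamma'$;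 it is known that this depends only on $\delta$. For $h$ coprime to $p$, $\mathfrak{e}_\lambda\mid\beta_{h,s}$ means $\mathfrak{e}_\lambda\mid(\beta_{h,s},p^{s/2})$, where $(\beta_{h,s},p^{s/2})=\gamma\alpha\gamma'$ for suitable $\gamma,\gamma'\in Mp_2(\mathbb{Z})$. **Hecke operator.** The Hecke operator $T(p^{2l})$ on $M_{k,L}$ attached to the double coset of $\alpha$ decomposes as $$f\mid_{k,L}T(p^{2l})=g_\alpha+\sum_{s=1}^{2l-1}\sum_{h\in(\mathbb{Z}/p^s\mathbb{Z})^*}g_{\beta_{h,s}}+\sum_{b\in\mathbb{Z}/p^{2l}\mathbb{Z}}g_b,$$ according to the representatives $\begin{pmatrix}p^{2l}&0\\0&1\end{pmatrix}$, $\beta_{h,s}$, $\begin{pmatrix}1&b\\0&p^{2l}\end{pmatrix}$, where $$g_{\beta_{h,s}}(\tau)=p^{2l(k-1)}\,p^{-sk}\sum_{\lambda\in\mathcal{L}}f_\lambda\left(\frac{p^{2l-s}\tau+h}{p^s}\right)\,(\mathfrak{e}_\lambda\mid\beta_{h,s}),$$ which is independent of the integer representative of $h$. **Quantities in the formulas.** For $s\le l$, $\lambda\in\mathcal{L}^{p^{l-s}}$, $\lambda'\in\mathcal{L}$ and $n\in\mathbb{Z}+q(\lambda)$, let $\lambda/p^{l-s}$ denote a fixed element of $\mathcal{L}$ whose $p^{l-s}$-multiple is $\lambda$, and put $$\mu(\lambda,\lambda')=\lambda/p^{l-s}+\lambda'\in\mathcal{L},\qquad n(\lambda,\lambda')=\frac{n-p^{2(l-s)}q(\mu(\lambda,\lambda'))}{p^{2(l-s)}}+q(\mu(\lambda,\lambda')),$$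 where $q(\mu(\lambda,\lambda'))$ is computed with any fixed representative in $L'$ (the value of $n(\lambda,\lambda')$ and the summation condition in (i) do not depend on it); under the summation condition in (i), $n(\lambda,\lambda')\in\mathbb{Z}+q(\mu(\lambda,\lambda'))$. For $\nu\in\mathcal{L}$, $m\in\mathbb{Z}+q(\nu)$, and, when $s>l$, $\rho\in\mathcal{L}$, $r\in\mathbb{Z}+p^{2(s-l)}q(\rho)$, and $a$ a divisor of $p^s$, put $$N_{\nu,m}(a)=\#\{v\in L/aL:\ q(v+\nu)-m\equiv0\bmod a\},$$ $$\widetilde{N}_{\rho,r}(a)=\#\{v\in L/(a,p^l)L:\ p^{2(s-l)}q(v+\rho)-r\equiv0\bmod a\},$$ where $(a,p^l)$ is the greatest common divisor, $\nu,\rho$ are replaced by representatives in $L'$ (the counts do not depend on the choice), and "$x\equiv 0\bmod a$" means $x\in a\mathbb{Z}$. With $\mu_{\mathrm{Mob}}$ the Möbius function, put $$G_{\nu,m}(s)=\sum_{a\mid p^s}\mu_{\mathrm{Mob}}\left(\frac{p^s}{a}\right)a^{1-D}N_{\nu,m}(a),\qquad \widetilde{G}_{\rho,r}(s)=\sum_{a\mid p^s}\mu_{\mathrm{Mob}}\left(\frac{p^s}{a}\right)a\,(a,p^l)^{-D}\,\widetilde{N}_{\rho,r}(a).$$ *)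

theory Defs
  imports
    "HOL-Analysis.Analysis"
    "HOL-Algebra.Bij"
    "HOL-Algebra.Coset"
    "HOL-Computational_Algebra.Squarefree"
    "HOL-Number_Theory.Totient"
begin

section \<open>Even lattices and discriminant groups\<close>

text \<open>
  The lattice \<open>L\<close> is a free \<open>\<int>\<close>-submodule of a real vector space whose basis is linearly
  independent over \<open>\<real>\<close>, so that \<open>span L\<close> is the space \<open>L \<otimes> \<real>\<close>. The ambient type may be
  larger than \<open>span L\<close>; in particular the zero lattice is allowed. Only the restriction
  of \<open>b\<close> to \<open>span L\<close> is ever used.
\<close>

locale even_lattice =
  fixes L :: "'v::real_vector set" and b :: "'v \<Rightarrow> 'v \<Rightarrow> real"
  assumes lattice: "\<exists>B. finite B \<and> independent B \<and>
      L = {\<Sum>x\<in>B. of_int (a x) *\<^sub>R x | a :: 'v \<Rightarrow> int. True}"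
    and bilinear: "bilinear b"
    and symmetric: "b x y = b y x"
    and nondegenerate: "x \<in> span L \<Longrightarrow> (\<forall>y\<in>span L. b x y = 0) \<Longrightarrow> x = 0"
    and even: "x \<in> L \<Longrightarrow> b x x / 2 \<in> \<int>"

definition qform :: "('v::real_vector \<Rightarrow> 'v \<Rightarrow> real) \<Rightarrow> 'v \<Rightarrow> real" where
  "qform b x = b x x / 2"

definition lattice_rank :: "'v::real_vector set \<Rightarrow> nat" where
  "lattice_rank L = dim (span L)"

definition pos_index :: "'v::real_vector set \<Rightarrow> ('v \<Rightarrow> 'v \<Rightarrow> real) \<Rightarrow> nat" where
  "pos_index L b =
     Max {dim W | W. subspace W \<and> W \<subseteq> span L \<and> (\<forall>x\<in>W. x \<noteq> 0 \<longrightarrow> b x x > 0)}"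

definition neg_index :: "'v::real_vector set \<Rightarrow> ('v \<Rightarrow> 'v \<Rightarrow> real) \<Rightarrow> nat" where
  "neg_index L b =
     Max {dim W | W. subspace W \<and> W \<subseteq> span L \<and> (\<forall>x\<in>W. x \<noteq> 0 \<longrightarrow> b x x < 0)}"

definition dual_lattice :: "'v::real_vector set \<Rightarrow> ('v \<Rightarrow> 'v \<Rightarrow> real) \<Rightarrow> 'v set" where
  "dual_lattice L b = {x \<in> span L. \<forall>y\<in>L. b x y \<in> \<int>}"

definition add_monoid_on :: "'v::real_vector set \<Rightarrow> 'v monoid" where
  "add_monoid_on A = \<lparr>carrier = A, mult = (+), one = 0\<rparr>"

text \<open>
  The discriminant group is written multiplicatively, following \<open>Mod\<close>: addition of classes is
  \<open>\<otimes>\<close> and the multiple \<open>m \<lambda>\<close> is \<open>\<lambda> [^] m\<close>.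
\<close>

definition disc_group ::
  "'v::real_vector set \<Rightarrow> ('v \<Rightarrow> 'v \<Rightarrow> real) \<Rightarrow> 'v set monoid" where
  "disc_group L b = add_monoid_on (dual_lattice L b) Mod L"

abbreviation disc :: "'v::real_vector set \<Rightarrow> ('v \<Rightarrow> 'v \<Rightarrow> real) \<Rightarrow> 'v set set" where
  "disc L b \<equiv> carrier (disc_group L b)"

definition disc_image ::
  "'v::real_vector set \<Rightarrow> ('v \<Rightarrow> 'v \<Rightarrow> real) \<Rightarrow> nat \<Rightarrow> 'v set set" where
  "disc_image L b m = (\<lambda>x. x [^]\<^bsub>disc_group L b\<^esub> m) ` disc L b"

definition disc_kernel ::
  "'v::real_vector set \<Rightarrow> ('v \<Rightarrow> 'v \<Rightarrow> real) \<Rightarrow> nat \<Rightarrow> 'v set set" where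
  "disc_kernel L b m =
     {x \<in> disc L b. x [^]\<^bsub>disc_group L b\<^esub> m = \<one>\<^bsub>disc_group L b\<^esub>}"

text \<open>
  The forms on classes are evaluated at a fixed representative. Hence \<open>qclass\<close> is meaningful
  modulo \<open>\<int>\<close> only, and so is \<open>bclass\<close>.
\<close>

definition class_rep :: "'v set \<Rightarrow> 'v" where
  "class_rep x = (SOME v. v \<in> x)"

definition qclass :: "('v::real_vector \<Rightarrow> 'v \<Rightarrow> real) \<Rightarrow> 'v set \<Rightarrow> real" where
  "qclass b x = qform b (class_rep x)"

definition bclass :: "('v::real_vector \<Rightarrow> 'v \<Rightarrow> real) \<Rightarrow> 'v set \<Rightarrow> 'v set \<Rightarrow> real" where
  "bclass b x y = b (class_rep x) (class_rep y)"

definition in_index :: "('v::real_vector \<Rightarrow> 'v \<Rightarrow> real) \<Rightarrow> 'v set \<Rightarrow> real set" where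
  "in_index b x = {n. n - qclass b x \<in> \<int>}"


section \<open>The metaplectic group\<close>

definition upper_half_plane :: "complex set" where
  "upper_half_plane = {\<tau>. Im \<tau> > 0}"

definition mat2 :: "rat \<Rightarrow> rat \<Rightarrow> rat \<Rightarrow> rat \<Rightarrow> rat^2^2" where
  "mat2 a b c d = vector [vector [a, b], vector [c, d]]"

definition automorphy :: "rat^2^2 \<Rightarrow> complex \<Rightarrow> complex" where
  "automorphy M \<tau> = of_rat (M$2$1) * \<tau> + of_rat (M$2$2)"

definition moebius :: "rat^2^2 \<Rightarrow> complex \<Rightarrow> complex" where
  "moebius M \<tau> = (of_rat (M$1$1) * \<tau> + of_rat (M$1$2)) / automorphy M \<tau>"

type_synonym mp_elem = "(rat^2^2) \<times> (complex \<Rightarrow> complex)"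

text \<open>Second components are restricted to the upper half plane to make equality of pairs
  equality of functions on that domain.\<close>

definition mp2_rat :: "mp_elem monoid" where
  "mp2_rat =
     \<lparr>carrier = {(M, \<phi>). det M > 0 \<and> \<phi> \<in> extensional upper_half_plane \<and>
                   \<phi> holomorphic_on upper_half_plane \<and>
                   (\<forall>\<tau>\<in>upper_half_plane. (\<phi> \<tau>)\<^sup>2 = automorphy M \<tau>)},
      mult = (\<lambda>(M1, \<phi>1) (M2, \<phi>2).
                (M1 ** M2, \<lambda>\<tau>\<in>upper_half_plane. \<phi>1 (moebius M2 \<tau>) * \<phi>2 \<tau>)),
      one = (mat 1, \<lambda>\<tau>\<in>upper_half_plane. 1)\<rparr>"

definition mp2_int :: "mp_elem monoid" where
  "mp2_int = mp2_rat
     \<lparr>carrier := {(M, \<phi>) \<in> carrier mp2_rat. det M = 1 \<and> (\<forall>i j. M$i$j \<in> \<int>)}\<rparr>"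

definition mp_T :: mp_elem where
  "mp_T = (mat2 1 1 0 1, \<lambda>\<tau>\<in>upper_half_plane. 1)"

definition mp_S :: mp_elem where
  "mp_S = (mat2 0 (-1) 1 0, \<lambda>\<tau>\<in>upper_half_plane. csqrt \<tau>)"


section \<open>The Weil representation\<close>

definition e :: "complex \<Rightarrow> complex" where
  "e x = exp (2 * of_real pi * \<i> * x)"

text \<open>Elements of the group algebra are complex functions on classes that vanish off
  \<open>disc L b\<close>.\<close>

definition group_algebra ::
  "'v::real_vector set \<Rightarrow> ('v \<Rightarrow> 'v \<Rightarrow> real) \<Rightarrow> ('v set \<Rightarrow> complex) set" where
  "group_algebra L b = {v. \<forall>x. x \<notin> disc L b \<longrightarrow> v x = 0}"

definition basis_elem :: "'v set \<Rightarrow> 'v set \<Rightarrow> complex" where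
  "basis_elem x = (\<lambda>y. if y = x then 1 else 0)"

text \<open>
  A homomorphism from the metaplectic group to the complex-linear bijections of the group
  algebra; since \<open>T\<close> and \<open>S\<close> generate, it is determined by the last two conditions.
\<close>

definition weil_representation ::
  "'v::real_vector set \<Rightarrow> ('v \<Rightarrow> 'v \<Rightarrow> real) \<Rightarrow>
     (mp_elem \<Rightarrow> ('v set \<Rightarrow> complex) \<Rightarrow> 'v set \<Rightarrow> complex) \<Rightarrow> bool" where
  "weil_representation L b \<rho> \<longleftrightarrow>
     \<rho> \<in> hom mp2_int (BijGroup (group_algebra L b)) \<and>
     (\<forall>\<gamma>\<in>carrier mp2_int. \<forall>v\<in>group_algebra L b. \<forall>w\<in>group_algebra L b. \<forall>z.
        \<rho> \<gamma> (\<lambda>x. z * v x + w x) = (\<lambda>x. z * \<rho> \<gamma> v x + \<rho> \<gamma> w x)) \<and>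
     (\<forall>x\<in>disc L b.
        \<rho> mp_T (basis_elem x) = (\<lambda>y. e (of_real (qclass b x)) * basis_elem x y)) \<and>
     (\<forall>x\<in>disc L b.
        \<rho> mp_S (basis_elem x) =
          (\<lambda>y. e (1/8) powi (int (neg_index L b) - int (pos_index L b))
                 / of_real (sqrt (real (card (disc L b))))
                 * (\<Sum>\<mu>\<in>disc L b. e (- of_real (bclass b x \<mu>)) * basis_elem \<mu> y)))"


section \<open>Vector valued modular forms\<close>

definition fourier_expansion ::
  "'v::real_vector set \<Rightarrow> ('v \<Rightarrow> 'v \<Rightarrow> real) \<Rightarrow> (complex \<Rightarrow> 'v set \<Rightarrow> complex) \<Rightarrow>
     ('v set \<Rightarrow> real \<Rightarrow> complex) \<Rightarrow> bool" where
  "fourier_expansion L b f c \<longleftrightarrow>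
     (\<forall>\<tau>\<in>upper_half_plane. \<forall>x\<in>disc L b.
        ((\<lambda>n. c x n * e (of_real n * \<tau>)) has_sum f \<tau> x) {n \<in> in_index b x. n \<ge> 0})"

text \<open>The weight \<open>k\<close> is a half-integer, so \<open>2 * k\<close> is an integer exponent. Holomorphy at
  infinity is the existence of a Fourier expansion without negative exponents.\<close>

definition modular_forms ::
  "'v::real_vector set \<Rightarrow> ('v \<Rightarrow> 'v \<Rightarrow> real) \<Rightarrow>
     (mp_elem \<Rightarrow> ('v set \<Rightarrow> complex) \<Rightarrow> 'v set \<Rightarrow> complex) \<Rightarrow> real \<Rightarrow>
     (complex \<Rightarrow> 'v set \<Rightarrow> complex) set" where
  "modular_forms L b \<rho> k =
     {f. (\<forall>\<tau>\<in>upper_half_plane. f \<tau> \<in> group_algebra L b) \<and>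
         (\<forall>x\<in>disc L b. (\<lambda>\<tau>. f \<tau> x) holomorphic_on upper_half_plane) \<and>
         (\<forall>(M, \<phi>)\<in>carrier mp2_int. \<forall>\<tau>\<in>upper_half_plane.
            f (moebius M \<tau>) = (\<lambda>x. \<phi> \<tau> powi \<lfloor>2 * k\<rfloor> * \<rho> (M, \<phi>) (f \<tau>) x)) \<and>
         (\<exists>c. fourier_expansion L b f c)}"


section \<open>The extended action and the Hecke operator\<close>

definition weil_act ::
  "'v::real_vector set \<Rightarrow> ('v \<Rightarrow> 'v \<Rightarrow> real) \<Rightarrow>
     (mp_elem \<Rightarrow> ('v set \<Rightarrow> complex) \<Rightarrow> 'v set \<Rightarrow> complex) \<Rightarrow> mp_elem \<Rightarrow>
     ('v set \<Rightarrow> complex) \<Rightarrow> 'v set \<Rightarrow> complex" where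
  "weil_act L b \<rho> \<gamma> v = inv_into (group_algebra L b) (\<rho> \<gamma>) v"

definition mp_alpha :: "nat \<Rightarrow> nat \<Rightarrow> mp_elem" where
  "mp_alpha p l = (mat2 (of_nat (p ^ (2 * l))) 0 0 1, \<lambda>\<tau>\<in>upper_half_plane. 1)"

definition alpha_act ::
  "'v::real_vector set \<Rightarrow> ('v \<Rightarrow> 'v \<Rightarrow> real) \<Rightarrow> nat \<Rightarrow> nat \<Rightarrow>
     ('v set \<Rightarrow> complex) \<Rightarrow> 'v set \<Rightarrow> complex" where
  "alpha_act L b p l v =
     (\<lambda>y. \<Sum>x\<in>disc L b. v x * basis_elem (x [^]\<^bsub>disc_group L b\<^esub> (p ^ l)) y)"

text \<open>Well-definedness (independence of the decomposition of \<open>\<delta>\<close>) is what makes the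
  definite description meaningful.\<close>

definition ext_act ::
  "'v::real_vector set \<Rightarrow> ('v \<Rightarrow> 'v \<Rightarrow> real) \<Rightarrow>
     (mp_elem \<Rightarrow> ('v set \<Rightarrow> complex) \<Rightarrow> 'v set \<Rightarrow> complex) \<Rightarrow> nat \<Rightarrow> nat \<Rightarrow>
     mp_elem \<Rightarrow> ('v set \<Rightarrow> complex) \<Rightarrow> 'v set \<Rightarrow> complex" where
  "ext_act L b \<rho> p l \<delta> v =
     (THE w. \<exists>\<gamma>\<in>carrier mp2_int. \<exists>\<gamma>'\<in>carrier mp2_int.
        \<delta> = \<gamma> \<otimes>\<^bsub>mp2_rat\<^esub> mp_alpha p l \<otimes>\<^bsub>mp2_rat\<^esub> \<gamma>' \<and>
        w = weil_act L b \<rho> \<gamma>' (alpha_act L b p l (weil_act L b \<rho> \<gamma> v)))"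

definition mp_beta :: "nat \<Rightarrow> nat \<Rightarrow> nat \<Rightarrow> int \<Rightarrow> mp_elem" where
  "mp_beta p l s h =
     (mat2 (of_nat (p ^ (2 * l - s))) (of_int h) 0 (of_nat (p ^ s)),
      \<lambda>\<tau>\<in>upper_half_plane. of_real (real p powr (real s / 2)))"

definition hecke_g ::
  "'v::real_vector set \<Rightarrow> ('v \<Rightarrow> 'v \<Rightarrow> real) \<Rightarrow>
     (mp_elem \<Rightarrow> ('v set \<Rightarrow> complex) \<Rightarrow> 'v set \<Rightarrow> complex) \<Rightarrow> real \<Rightarrow> nat \<Rightarrow> nat \<Rightarrow> nat \<Rightarrow>
     (complex \<Rightarrow> 'v set \<Rightarrow> complex) \<Rightarrow> int \<Rightarrow> complex \<Rightarrow> 'v set \<Rightarrow> complex" where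
  "hecke_g L b \<rho> k p l s f h \<tau> y =
     of_real (real p powr (2 * real l * (k - 1)) * real p powr (- real s * k)) *
     (\<Sum>x\<in>disc L b.
        f ((of_nat (p ^ (2 * l - s)) * \<tau> + of_int h) / of_nat (p ^ s)) x *
        ext_act L b \<rho> p l (mp_beta p l s h) (basis_elem x) y)"

definition hecke_beta_sum ::
  "'v::real_vector set \<Rightarrow> ('v \<Rightarrow> 'v \<Rightarrow> real) \<Rightarrow>
     (mp_elem \<Rightarrow> ('v set \<Rightarrow> complex) \<Rightarrow> 'v set \<Rightarrow> complex) \<Rightarrow> real \<Rightarrow> nat \<Rightarrow> nat \<Rightarrow> nat \<Rightarrow>
     (complex \<Rightarrow> 'v set \<Rightarrow> complex) \<Rightarrow> complex \<Rightarrow> 'v set \<Rightarrow> complex" where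
  "hecke_beta_sum L b \<rho> k p l s f \<tau> y =
     (\<Sum>h\<in>totatives (p ^ s). hecke_g L b \<rho> k p l s f (int h) \<tau> y)"


section \<open>Representation numbers\<close>

definition moebius_mu :: "nat \<Rightarrow> int" where
  "moebius_mu n = (if squarefree n then (-1) ^ card (prime_factors n) else 0)"

definition cong_zero :: "real \<Rightarrow> nat \<Rightarrow> bool" where
  "cong_zero x a \<longleftrightarrow> (\<exists>j::int. x = real a * of_int j)"

definition lattice_mod :: "'v::real_vector set \<Rightarrow> nat \<Rightarrow> 'v set set" where
  "lattice_mod L a = carrier (add_monoid_on L Mod ((\<lambda>v. real a *\<^sub>R v) ` L))"

definition rep_count ::
  "'v::real_vector set \<Rightarrow> ('v \<Rightarrow> 'v \<Rightarrow> real) \<Rightarrow> 'v set \<Rightarrow> real \<Rightarrow> nat \<Rightarrow> nat" where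
  "rep_count L b \<nu> m a =
     card {v \<in> lattice_mod L a. cong_zero (qform b (class_rep v + class_rep \<nu>) - m) a}"

definition rep_count_tilde ::
  "'v::real_vector set \<Rightarrow> ('v \<Rightarrow> 'v \<Rightarrow> real) \<Rightarrow> nat \<Rightarrow> nat \<Rightarrow> nat \<Rightarrow>
     'v set \<Rightarrow> real \<Rightarrow> nat \<Rightarrow> nat" where
  "rep_count_tilde L b p l s \<rho> r a =
     card {v \<in> lattice_mod L (gcd a (p ^ l)).
       cong_zero (real p ^ (2 * (s - l)) * qform b (class_rep v + class_rep \<rho>) - r) a}"

definition G_sum ::
  "'v::real_vector set \<Rightarrow> ('v \<Rightarrow> 'v \<Rightarrow> real) \<Rightarrow> nat \<Rightarrow> nat \<Rightarrow> 'v set \<Rightarrow> real \<Rightarrow> real" where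
  "G_sum L b p s \<nu> m =
     (\<Sum>a | a dvd p ^ s. of_int (moebius_mu (p ^ s div a)) *
        real a powi (1 - int (lattice_rank L)) * real (rep_count L b \<nu> m a))"

definition G_sum_tilde ::
  "'v::real_vector set \<Rightarrow> ('v \<Rightarrow> 'v \<Rightarrow> real) \<Rightarrow> nat \<Rightarrow> nat \<Rightarrow> nat \<Rightarrow>
     'v set \<Rightarrow> real \<Rightarrow> real" where
  "G_sum_tilde L b p l s \<rho> r =
     (\<Sum>a | a dvd p ^ s. of_int (moebius_mu (p ^ s div a)) * real a *
        real (gcd a (p ^ l)) powi (- int (lattice_rank L)) *
        real (rep_count_tilde L b p l s \<rho> r a))"

definition K_const :: "nat \<Rightarrow> real \<Rightarrow> nat \<Rightarrow> nat \<Rightarrow> nat \<Rightarrow> real" where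
  "K_const D k p l s = real p powr (2 * real l * (k - 1) + real s * (real D / 2 - k))"

definition K_const_tilde :: "nat \<Rightarrow> real \<Rightarrow> nat \<Rightarrow> nat \<Rightarrow> nat \<Rightarrow> real" where
  "K_const_tilde D k p l s =
     real p powr (2 * real l * (k - 1) - real s * k + (2 * real l - real s) * real D / 2)"

text \<open>With \<open>m = p\<^sup>l\<^sup>-\<^sup>s\<close> and \<open>\<mu> = \<mu>(\<lambda>,\<lambda>')\<close> this is the exponent \<open>n(\<lambda>,\<lambda>')\<close>.\<close>

definition n_shift :: "('v::real_vector \<Rightarrow> 'v \<Rightarrow> real) \<Rightarrow> nat \<Rightarrow> 'v set \<Rightarrow> real \<Rightarrow> real" where
  "n_shift b m \<mu> n = (n - (real m)\<^sup>2 * qclass b \<mu>) / (real m)\<^sup>2 + qclass b \<mu>"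

end

theory Submission
  imports Defs "HOL-Complex_Analysis.Conformal_Mappings" "HOL-Probability.Characteristic_Functions"
begin

text \<open>Poisson summation shows that the theta vectors \<open>\<Theta>(\<tau>; u, w)\<close> of \<open>L\<close> with real characteristics
  transform under \<open>\<rho>\<close>, with the matrix acting on the characteristic \<open>(u, w)\<close>. The operator of \<open>\<alpha>\<close> maps a
  theta vector to an average of theta vectors with shifted characteristics. Hence for any decomposition
  \<open>\<beta> = \<gamma>\<alpha>\<gamma>'\<close> the operator of \<open>\<gamma>\<alpha>\<gamma>'\<close> maps a theta vector to an average of theta vectors that depends only
  on \<open>\<beta>\<close>. Since the theta vectors with characteristic \<open>(0, w)\<close> at a fixed \<open>\<tau>\<close> span the group algebra, this
  determines the action of \<open>\<beta>\<close> on the standard basis; its coefficients are Gauss sums over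
  \<open>L / p^min(s,l) L\<close>. Summing over \<open>h\<close> turns them into Ramanujan sums modulo \<open>p^s\<close>, which only see the two
  top divisors \<open>p^s\<close> and \<open>p^(s-1)\<close>, the ones with nonzero Moebius value in the sums \<open>G\<close>.\<close>

text \<open>The representation is known through its values at \<open>mp_T\<close> and
  \<open>mp_S\<close> alone, while a decomposition of \<beta> may involve arbitrary \<gamma> and
  \<gamma>'. Theta vectors make a formula for \<rho>(\<gamma>) dispensable: their covariance is
  stable under products, so generators suffice. The characteristics have to be real, since averaging
  over \<alpha> creates denominators p^l and leaves L'; they have to come in pairs, since S
  exchanges u and w up to sign.

  L may be indefinite, where a holomorphic Gaussian of q would diverge. Hence \<tau> is conjugated
  in the negative directions of an orthogonal frame inside L. The frame also splits Poisson
  summation into one-variable sums; its sublattice is reconciled with L by orthogonality of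
  characters of the finite quotient.

  Oddness of p enters through the number 2: completing the square in the Gauss sums divides by it,
  and so does the character sum that describes \<alpha>.\<close>

lemma e_add: "e (x + y) = e x * e y"
  by (simp add: e_def exp_add [symmetric] algebra_simps)

lemma e_0 [simp]: "e 0 = 1"
  by (simp add: e_def)

lemma e_minus: "e (- x) = inverse (e x)"
  by (simp add: e_def exp_minus)

lemma e_nonzero [simp]: "e x \<noteq> 0"
  by (simp add: e_def)

lemma e_diff: "e (x - y) = e x / e y"
  by (simp add: e_def exp_diff [symmetric] algebra_simps)

lemma e_sum: "finite A \<Longrightarrow> e (\<Sum>i\<in>A. f i) = (\<Prod>i\<in>A. e (f i))"
  by (induction A rule: finite_induct) (simp_all add: e_add)

lemma e_of_real: "e (of_real x) = cis (2 * pi * x)"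
  by (simp add: e_def cis_conv_exp mult_ac)

lemma norm_e: "norm (e z) = exp (- 2 * pi * Im z)"
  by (simp add: e_def)

lemma norm_e_of_real [simp]: "norm (e (of_real x)) = 1"
  by (simp add: norm_e)

lemma cnj_e_of_real: "cnj (e (of_real x)) = e (- of_real x)"
  using e_of_real[of x] e_of_real[of "- x"] by (simp add: cis_cnj)

lemma e_int: "x \<in> \<int> \<Longrightarrow> e (of_real x) = 1"
  by (auto elim!: Ints_cases simp: e_of_real cis_multiple_2pi)

lemma e_1 [simp]: "e 1 = 1"
  using e_int[of 1] by simp

lemma e_of_real_eq_1_iff: "e (of_real x) = 1 \<longleftrightarrow> x \<in> \<int>"
proof
  assume "e (of_real x) = 1"
  then have "\<exists>n::int. 2 * pi * x = of_int (2 * n) * pi"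
    unfolding e_def by (simp add: exp_eq_1 mult_ac)
  then show "x \<in> \<int>" by auto
qed (rule e_int)

lemma e_cong: "x - y \<in> \<int> \<Longrightarrow> e (of_real x) = e (of_real y)"
  using e_int[of "x - y"] by (simp add: e_diff)

lemma continuous_on_e [continuous_intros]:
  "continuous_on S f \<Longrightarrow> continuous_on S (\<lambda>x. e (f x))"
  unfolding e_def by (intro continuous_intros)

subsection \<open>Uniqueness of Fourier coefficients\<close>

text \<open>The map x -> e(x) from the compact interval onto the circle is closed, hence a quotient
  map, so a function with equal end values descends. On the circle Stone-Weierstrass becomes
  available.\<close>

lemma continuous_on_circle_of_periodic:
  fixes g :: "real \<Rightarrow> complex"
  assumes g: "continuous_on {0..1} g" and per: "g 0 = g 1"
  obtains G where "continuous_on (sphere 0 1) G" "\<And>x. x \<in> {0..1} \<Longrightarrow> G (e (of_real x)) = g x"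
proof -
  define \<pi> where "\<pi> = (\<lambda>x::real. e (of_real x))"
  define G where "G = (\<lambda>z. g (Arg2pi z / (2 * pi)))"
  have G: "G (\<pi> x) = g x" if x: "x \<in> {0..1}" for x
  proof (cases "x = 1")
    case True
    then have "\<pi> x = 1" by (simp add: \<pi>_def)
    moreover have "Arg2pi 1 = 0" by (rule Arg2pi_unique[of 1]) auto
    moreover note True per
    ultimately show ?thesis by (simp add: G_def)
  next
    case False
    have "Arg2pi (\<pi> x) = 2 * pi * x"
      by (rule Arg2pi_unique[of 1]) (use x False in \<open>auto simp: \<pi>_def e_def mult_ac\<close>)
    then show ?thesis by (simp add: G_def)
  qed
  have img: "\<pi> ` {0..1} = sphere 0 1"
  proof
    show "sphere 0 1 \<subseteq> \<pi> ` {0..1}"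
    proof
      fix z :: complex assume "z \<in> sphere 0 1"
      then have z: "z = exp (\<i> * of_real (Arg2pi z))"
        using Arg2pi_eq[of z] by simp
      have "z = \<pi> (Arg2pi z / (2 * pi))"
        by (subst z) (simp add: \<pi>_def e_def)
      moreover have "Arg2pi z / (2 * pi) \<in> {0..1}"
        using Arg2pi_ge_0[of z] Arg2pi_lt_2pi[of z] by simp
      ultimately show "z \<in> \<pi> ` {0..1}" by blast
    qed
  qed (auto simp: \<pi>_def)
  have cont: "continuous_on (sphere 0 1) G"
    unfolding continuous_on_closed_vimage[OF closed_sphere]
  proof (intro allI impI)
    fix B :: "complex set" assume B: "closed B"
    have "G -` B \<inter> sphere 0 1 = \<pi> ` ({0..1} \<inter> g -` B)"
      unfolding img[symmetric] using G by auto
    moreover have "closed ({0..1} \<inter> g -` B)"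
      using continuous_closed_preimage[OF g closed_atLeastAtMost B] .
    then have "compact ({0..1} \<inter> g -` B)"
      by (metis compact_Int_closed compact_Icc inf.left_idem)
    then have "compact (\<pi> ` ({0..1} \<inter> g -` B))"
      by (rule compact_continuous_image[rotated]) (auto simp: \<pi>_def intro!: continuous_intros)
    ultimately show "closed (G -` B \<inter> sphere 0 1)"
      by (simp add: compact_imp_closed)
  qed
  show ?thesis by (rule that[OF cont]) (use G \<pi>_def in auto)
qed

text \<open>The functions whose products with everything orthogonal to the characters stay orthogonal
  form an algebra containing the characters, hence all polynomials on the circle.\<close>

lemma fourier_coefficients_zero:
  fixes g :: "real \<Rightarrow> complex"
  assumes g: "continuous_on {0..1} g" and per: "g 0 = g 1"
    and zero: "\<And>k::int. integral {0..1} (\<lambda>x. g x * e (of_real (of_int k * x))) = 0"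
    and x: "x \<in> {0..1}"
  shows "g x = 0"
proof -
  define Ann where "Ann = {r. continuous_on {0..1} r \<and>
    (\<forall>k::int. integral {0..1} (\<lambda>x. g x * r x * e (of_real (of_int k * x))) = 0)}"
  define Mul where "Mul = {q. continuous_on {0..1} q \<and> (\<forall>r\<in>Ann. (\<lambda>x::real. r x * q x :: complex) \<in> Ann)}"
  have one: "(\<lambda>x. 1) \<in> Ann" using zero by (simp add: Ann_def)
  have Mul_Ann: "q \<in> Ann" if "q \<in> Mul" for q using that one unfolding Mul_def by fastforce
  have intg: "(\<lambda>x. g x * r x * e (of_real (of_int k * x))) integrable_on {0..1}"
    if "continuous_on {0..1} r" for r and k :: int
    by (intro integrable_continuous_interval continuous_intros g that)
  have Ann_add: "(\<lambda>x. r x + r' x) \<in> Ann" if "r \<in> Ann" "r' \<in> Ann" for r r'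
  proof -
    have "integral {0..1} (\<lambda>x. g x * (r x + r' x) * e (of_real (of_int k * x))) = 0" for k :: int
      using that integral_add[OF intg[of r k] intg[of r' k]]
      by (simp add: Ann_def distrib_left distrib_right)
    then show ?thesis using that by (auto simp: Ann_def intro!: continuous_intros)
  qed
  have Ann_cmul: "(\<lambda>x. r x * c) \<in> Ann" if "r \<in> Ann" for r c
  proof -
    have "integral {0..1} (\<lambda>x. g x * (r x * c) * e (of_real (of_int k * x))) = 0" for k :: int
    proof -
      have "integral {0..1} (\<lambda>x. c * (g x * r x * e (of_real (of_int k * x)))) = 0"
        using that by (subst integral_mult_right) (auto simp: Ann_def)
      then show ?thesis by (simp add: mult_ac)
    qed
    then show ?thesis using that by (auto simp: Ann_def intro!: continuous_intros)
  qed
  have Mul_add: "(\<lambda>x. q x + q' x) \<in> Mul" if "q \<in> Mul" "q' \<in> Mul" for q q'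
    using that Ann_add by (auto simp: Mul_def distrib_left intro!: continuous_intros)
  have Mul_mult: "(\<lambda>x. q x * q' x) \<in> Mul" if "q \<in> Mul" "q' \<in> Mul" for q q'
    using that by (auto simp: Mul_def mult.assoc[symmetric] intro!: continuous_intros)
  have Mul_const: "(\<lambda>x. c) \<in> Mul" for c
    using Ann_cmul by (auto simp: Mul_def)
  have Mul_e: "(\<lambda>x. e (of_real (of_int j * x))) \<in> Mul" for j :: int
  proof -
    have "(\<lambda>x. r x * e (of_real (of_int j * x))) \<in> Ann" if "r \<in> Ann" for r
    proof -
      have "(\<lambda>x. g x * (r x * e (of_real (of_int j * x))) * e (of_real (of_int k * x))) =
          (\<lambda>x. g x * r x * e (of_real (of_int (j + k) * x)))" for k :: int
        by (simp add: fun_eq_iff e_add[symmetric] ring_distribs mult.assoc)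
      then have "integral {0..1} (\<lambda>x. g x * (r x * e (of_real (of_int j * x))) * e (of_real (of_int k * x))) = 0"
        for k :: int
        using that by (simp add: Ann_def del: of_real_mult of_int_add)
      then show ?thesis using that by (auto simp: Ann_def intro!: continuous_intros)
    qed
    then show ?thesis by (auto simp: Mul_def intro!: continuous_intros)
  qed
  \<comment> \<open>Polynomial functions on the plane are built from real-linear forms, and such a
    form is c z + d cnj z. On the circle cnj (e x) = e (-x), so it is a combination of two
    characters.\<close>
  have Mul_linear: "(\<lambda>x. of_real (h (e (of_real x)))) \<in> Mul" if "bounded_linear h" for h :: "complex \<Rightarrow> real"
  proof -
    interpret bounded_linear h by fact
    define c where "c = complex_of_real (h 1) / 2 - \<i> * of_real (h \<i>) / 2"
    define d where "d = complex_of_real (h 1) / 2 + \<i> * of_real (h \<i>) / 2"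
    have h: "of_real (h z) = c * z + d * cnj z" for z
    proof -
      have "h z = h (Re z *\<^sub>R 1 + Im z *\<^sub>R \<i>)"
        by (metis complex_eq mult.commute scaleR_conv_of_real mult.right_neutral)
      also have "\<dots> = Re z * h 1 + Im z * h \<i>" by (simp add: add scaleR)
      finally show ?thesis by (simp add: c_def d_def complex_eq_iff algebra_simps)
    qed
    show ?thesis
      unfolding h[of "e _"] cnj_e_of_real using Mul_e[of 1] Mul_e[of "-1"]
      by (intro Mul_add Mul_mult Mul_const) auto
  qed
  have Mul_poly: "(\<lambda>x. of_real (P (e (of_real x)))) \<in> Mul"
    if "real_polynomial_function P" for P :: "complex \<Rightarrow> real"
    using that
  proof induction
    case (linear f)
    then show ?case by (rule Mul_linear)
  qed (use Mul_const Mul_add Mul_mult in auto)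
  obtain G where G: "continuous_on (sphere 0 1) G"
    "\<And>x. x \<in> {0..1} \<Longrightarrow> G (e (of_real x)) = g x"
    using continuous_on_circle_of_periodic[OF g per] by blast
  \<comment> \<open>P approximates the conjugate of G, and g is orthogonal to P. Replacing cnj g by
    cnj g - P in the integral of |g|^2 changes nothing and leaves a factor \<epsilon>.\<close>
  have bound: "integral {0..1} (\<lambda>x. (norm (g x))\<^sup>2) \<le> integral {0..1} (\<lambda>x. norm (g x)) * \<epsilon>"
    if "\<epsilon> > 0" for \<epsilon>
  proof -
    have "continuous_on (sphere 0 1) (\<lambda>z. cnj (G z))" by (intro continuous_intros G)
    from Stone_Weierstrass_polynomial_function[OF compact_sphere this \<open>\<epsilon> > 0\<close>]
    obtain P where P: "polynomial_function P" "\<forall>z\<in>sphere 0 1. norm (cnj (G z) - P z) < \<epsilon>"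
      by blast
    have reP: "real_polynomial_function (\<lambda>z. Re (P z))" "real_polynomial_function (\<lambda>z. Im (P z))"
      using P(1) bounded_linear_Re bounded_linear_Im unfolding polynomial_function_def o_def by blast+
    have "(\<lambda>x. of_real (Re (P (e (of_real x)))) + \<i> * of_real (Im (P (e (of_real x))))) \<in> Mul"
      by (intro Mul_add Mul_mult Mul_const Mul_poly reP)
    then have PA: "(\<lambda>x. P (e (of_real x))) \<in> Ann"
      using Mul_Ann by (simp add: complex_eq[symmetric])
    then have contP: "continuous_on {0..1} (\<lambda>x. P (e (of_real x)))" by (simp add: Ann_def)
    have P0: "integral {0..1} (\<lambda>x. g x * P (e (of_real x))) = 0"
      using PA by (auto simp: Ann_def dest: spec[of _ 0])
    have "of_real (integral {0..1} (\<lambda>x. (norm (g x))\<^sup>2)) = integral {0..1} (\<lambda>x. complex_of_real ((norm (g x))\<^sup>2))"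
      by (rule integral_linear[OF _ bounded_linear_of_real, unfolded o_def, symmetric])
        (auto intro!: integrable_continuous_interval continuous_intros g)
    also have "\<dots> = integral {0..1} (\<lambda>x. g x * cnj (g x))"
      by (simp only: complex_norm_square)
    also have "\<dots> = integral {0..1} (\<lambda>x. g x * (cnj (g x) - P (e (of_real x)))) + integral {0..1} (\<lambda>x. g x * P (e (of_real x)))"
      by (subst integral_add[symmetric])
        (auto intro!: integrable_continuous_interval continuous_intros g contP simp: algebra_simps)
    finally have eq: "of_real (integral {0..1} (\<lambda>x. (norm (g x))\<^sup>2)) = integral {0..1} (\<lambda>x. g x * (cnj (g x) - P (e (of_real x))))"
      by (simp add: P0)
    have "norm (integral {0..1} (\<lambda>x. g x * (cnj (g x) - P (e (of_real x))))) \<le> integral {0..1} (\<lambda>x. norm (g x) * \<epsilon>)"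
    proof (rule integral_norm_bound_integral)
      fix x :: real assume x: "x \<in> {0..1}"
      have "norm (cnj (G (e (of_real x))) - P (e (of_real x))) < \<epsilon>" using P(2) by simp
      then have "norm (cnj (g x) - P (e (of_real x))) \<le> \<epsilon>" using G(2)[OF x] by simp
      then show "norm (g x * (cnj (g x) - P (e (of_real x)))) \<le> norm (g x) * \<epsilon>"
        by (simp add: norm_mult mult_left_mono)
    qed (auto intro!: integrable_continuous_interval continuous_intros g contP)
    then show ?thesis unfolding eq[symmetric] by simp
  qed
  define I where "I = integral {0..1} (\<lambda>x. norm (g x))"
  have I0: "I \<ge> 0" unfolding I_def by (rule integral_nonneg) (auto intro!: integrable_continuous_interval continuous_intros g)
  have "integral {0..1} (\<lambda>x. (norm (g x))\<^sup>2) \<le> 0"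
  proof (rule field_le_epsilon)
    fix d :: real assume "d > 0"
    have "I * (d / (I + 1)) \<le> d" using I0 \<open>d > 0\<close> by (simp add: field_simps)
    then show "integral {0..1} (\<lambda>x. (norm (g x))\<^sup>2) \<le> 0 + d"
      using bound[of "d / (I + 1)"] I0 \<open>d > 0\<close> by (simp add: I_def)
  qed
  moreover have "integral {0..1} (\<lambda>x. (norm (g x))\<^sup>2) \<ge> 0"
    by (rule integral_nonneg) (auto intro!: integrable_continuous_interval continuous_intros g)
  ultimately have "integral {0..1} (\<lambda>x. (norm (g x))\<^sup>2) = 0" by simp
  then have "\<forall>x\<in>{0..1}. (norm (g x))\<^sup>2 = 0"
    by (subst (asm) integral_eq_0_iff) (auto intro!: continuous_intros g)
  then show ?thesis using x by simp
qed

subsection \<open>Poisson summation for Gaussians on the line\<close>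

text \<open>Nonnegativity of (n + 2u)^2 gives n^2 \<le> 2(n + u)^2 + 2u^2; together with |n| \<le>
  n^2 this dominates the terms by a geometric series in |n|.\<close>

lemma summable_gaussian_int:
  fixes c u :: real
  assumes "c > 0"
  shows "(\<lambda>n::int. exp (- c * (of_int n + u)\<^sup>2)) summable_on UNIV"
proof -
  define q where "q = exp (- c / 2)"
  have q: "0 < q" "q < 1" using assms by (auto simp: q_def)
  have nat: "(\<lambda>n::nat. q ^ n) summable_on UNIV"
    using q by (subst summable_on_UNIV_nonneg_real_iff) (auto intro: summable_geometric)
  have "(\<lambda>n::int. q ^ nat \<bar>n\<bar>) summable_on range int"
    using nat by (subst summable_on_reindex) (auto simp: o_def)
  moreover have "(\<lambda>n::int. q ^ nat \<bar>n\<bar>) summable_on range (\<lambda>n. - int n)"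
    using nat by (subst summable_on_reindex) (auto simp: o_def inj_on_def)
  ultimately have "(\<lambda>n::int. q ^ nat \<bar>n\<bar>) summable_on (range int \<union> range (\<lambda>n. - int n))"
    by (rule summable_on_union)
  moreover have "UNIV = range int \<union> range (\<lambda>n. - int n)"
  proof (intro UNIV_eq_I)
    fix x :: int
    show "x \<in> range int \<union> range (\<lambda>n. - int n)"
      by (cases x rule: int_cases2) auto
  qed
  ultimately have "(\<lambda>n::int. exp (c * u\<^sup>2) * q ^ nat \<bar>n\<bar>) summable_on UNIV"
    by (intro summable_on_cmult_right) simp
  then show ?thesis
  proof (rule summable_on_comparison_test)
    fix n :: int
    have "real_of_int n ^ 2 \<le> 2 * (of_int n + u)\<^sup>2 + 2 * u\<^sup>2"
      using zero_le_power2[of "real_of_int n + 2 * u"] by (simp add: power2_eq_square algebra_simps)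
    moreover have "real (nat \<bar>n\<bar>) \<le> real_of_int n ^ 2"
    proof -
      have "\<bar>n\<bar> \<le> n\<^sup>2"
        using self_le_power[of "\<bar>n\<bar>" 2] by (cases "n = 0") auto
      then have "real_of_int \<bar>n\<bar> \<le> real_of_int (n\<^sup>2)" by (rule of_int_le_iff[THEN iffD2])
      then show ?thesis by simp
    qed
    ultimately have "c * real (nat \<bar>n\<bar>) \<le> c * (2 * (of_int n + u)\<^sup>2 + 2 * u\<^sup>2)"
      using assms by (intro mult_left_mono) auto
    then have "- c * (of_int n + u)\<^sup>2 \<le> c * u\<^sup>2 + real (nat \<bar>n\<bar>) * (- c / 2)"
      by (simp add: field_simps)
    then show "exp (- c * (of_int n + u)\<^sup>2) \<le> exp (c * u\<^sup>2) * q ^ nat \<bar>n\<bar>"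
      by (simp add: q_def exp_add[symmetric] exp_of_nat_mult[symmetric])
  qed auto
qed

section \<open>Termwise integration and the Fourier transform of a Gaussian\<close>

lemma
  fixes f :: "'i \<Rightarrow> real \<Rightarrow> complex"
  assumes cont: "\<And>n. n \<in> I \<Longrightarrow> continuous_on {a..b} (f n)"
    and bound: "\<And>n x. n \<in> I \<Longrightarrow> x \<in> {a..b} \<Longrightarrow> norm (f n x) \<le> M n" and M: "M summable_on I"
  shows continuous_on_infsum: "continuous_on {a..b} (\<lambda>x. \<Sum>\<^sub>\<infinity>n\<in>I. f n x)"
    and has_sum_integral_infsum:
      "((\<lambda>n. integral {a..b} (f n)) has_sum integral {a..b} (\<lambda>x. \<Sum>\<^sub>\<infinity>n\<in>I. f n x)) I"
proof -
  \<comment> \<open>Extension by zero makes the partial sums continuous for all finite index sets,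
    not only for those inside I.\<close>
  define f' where "f' = (\<lambda>n x. if n \<in> I then f n x else 0)"
  have contf': "continuous_on {a..b} (f' n)" for n
    using cont[of n] by (cases "n \<in> I") (auto simp: f'_def)
  have "uniform_limit {a..b} (\<lambda>X x. \<Sum>n\<in>X. f' n x) (\<lambda>x. \<Sum>\<^sub>\<infinity>n\<in>I. f' n x) (finite_subsets_at_top I)"
    by (rule Weierstrass_m_test_general[OF _ M]) (auto simp: f'_def bound)
  moreover have "(\<lambda>x. \<Sum>\<^sub>\<infinity>n\<in>I. f' n x) = (\<lambda>x. \<Sum>\<^sub>\<infinity>n\<in>I. f n x)"
    by (intro ext infsum_cong) (auto simp: f'_def)
  ultimately have lim: "uniform_limit {a..b} (\<lambda>X x. \<Sum>n\<in>X. f' n x) (\<lambda>x. \<Sum>\<^sub>\<infinity>n\<in>I. f n x) (finite_subsets_at_top I)"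
    by simp
  show "continuous_on {a..b} (\<lambda>x. \<Sum>\<^sub>\<infinity>n\<in>I. f n x)"
    by (rule uniform_limit_theorem[OF _ lim]) (auto intro!: always_eventually continuous_intros contf')
  obtain J K where JK: "\<And>X. ((\<lambda>x. \<Sum>n\<in>X. f' n x) has_integral J X) (cbox a b)"
    "((\<lambda>x. \<Sum>\<^sub>\<infinity>n\<in>I. f n x) has_integral K) (cbox a b)" "(J \<longlongrightarrow> K) (finite_subsets_at_top I)"
    by (rule uniform_limit_integral_cbox[where a = a and b = b
        and f = "\<lambda>X x. \<Sum>n\<in>X. f' n x" and F = "finite_subsets_at_top I"])
      (use lim in \<open>auto intro!: continuous_intros contf'\<close>)
  have J: "J X = (\<Sum>n\<in>X. integral {a..b} (f n))" if "finite X" "X \<subseteq> I" for X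
  proof -
    have "J X = integral {a..b} (\<lambda>x. \<Sum>n\<in>X. f' n x)"
      using JK(1)[of X] by (simp add: integral_unique)
    also have "\<dots> = (\<Sum>n\<in>X. integral {a..b} (f' n))"
      by (rule integral_sum) (use that contf' in \<open>auto intro!: integrable_continuous_interval\<close>)
    also have "\<dots> = (\<Sum>n\<in>X. integral {a..b} (f n))"
      by (intro sum.cong arg_cong2[of _ _ _ _ integral] refl) (use that in \<open>auto simp: f'_def\<close>)
    finally show ?thesis .
  qed
  have "((\<lambda>X. \<Sum>n\<in>X. integral {a..b} (f n)) \<longlongrightarrow> K) (finite_subsets_at_top I)"
    by (rule Lim_transform_eventually[OF JK(3)])
      (use J in \<open>auto intro!: eventually_finite_subsets_at_top_weakI\<close>)
  then show "((\<lambda>n. integral {a..b} (f n)) has_sum integral {a..b} (\<lambda>x. \<Sum>\<^sub>\<infinity>n\<in>I. f n x)) I"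
    using JK(2) by (simp add: has_sum_def integral_unique)
qed

text \<open>The intervals [n, n + 1] with -N \<le> n < N glue to [-N, N]. Unconditional summability
  gives the limit along these index sets, dominated convergence the integral over the line.\<close>

lemma has_sum_unit_intervals_eq_integral:
  fixes h :: "real \<Rightarrow> complex"
  assumes cont: "continuous_on UNIV h" and int: "integrable lborel h"
    and sum: "((\<lambda>n::int. integral {0..1} (\<lambda>u. h (of_int n + u))) has_sum S) UNIV"
  shows "S = (LINT x|lborel. h x)"
proof -
  have hint: "h integrable_on {a..b}" for a b
    by (intro integrable_continuous_interval continuous_on_subset[OF cont]) auto
  have part: "(\<Sum>n\<in>{- int N..<int N}. integral {0..1} (\<lambda>u. h (of_int n + u))) = integral {- real N..real N} h" for N
  proof (induction N)
    case (Suc N)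
    have one: "integral {0..1} (\<lambda>u. h (of_int n + u)) = integral {of_int n..of_int n + 1} h" for n :: int
      using integral_shift_Icc_real[of 0 1 h "of_int n"] by (simp add: o_def add_ac)
    have "{- int (Suc N)..<int (Suc N)} = insert (- int (Suc N)) (insert (int N) {- int N..<int N})"
      by auto
    then have "(\<Sum>n\<in>{- int (Suc N)..<int (Suc N)}. integral {0..1} (\<lambda>u. h (of_int n + u)))
        = integral {- 1 - real N..- real N} h + (integral {real N..real N + 1} h + integral {- real N..real N} h)"
      by (simp only:) (simp add: one Suc[unfolded one])
    also have "\<dots> = integral {- 1 - real N..- real N} h + integral {- real N..real N + 1} h"
      by (subst (2) add.commute) (simp add: Henstock_Kurzweil_Integration.integral_combine hint)
    also have "\<dots> = integral {- 1 - real N..real N + 1} h"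
      by (simp add: Henstock_Kurzweil_Integration.integral_combine hint)
    finally show ?case by (simp add: add.commute)
  qed auto
  have "filterlim (\<lambda>N. {- int N..<int N}) (finite_subsets_at_top UNIV) sequentially"
    unfolding filterlim_finite_subsets_at_top
  proof (intro allI impI)
    fix Y :: "int set" assume Y: "finite Y \<and> Y \<subseteq> UNIV"
    define K where "K = (\<Sum>y\<in>Y. \<bar>y\<bar>) + 1"
    have K: "\<bar>y\<bar> < K" if "y \<in> Y" for y
      using member_le_sum[of y Y abs] Y that by (simp add: K_def)
    show "\<forall>\<^sub>F N in sequentially. finite {- int N..<int N} \<and> Y \<subseteq> {- int N..<int N} \<and> {- int N..<int N} \<subseteq> UNIV"
      using eventually_ge_at_top[of "nat K"]
    proof eventually_elim
      case (elim N)
      then show ?case using K by fastforce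
    qed
  qed
  then have 1: "(\<lambda>N. integral {- real N..real N} h) \<longlonglongrightarrow> S"
    using sum unfolding has_sum_def part[symmetric] by (rule filterlim_compose[rotated])
  have eq: "integral {- real N..real N} h = (LINT x|lborel. indicator {- real N..real N} x *\<^sub>R h x)" for N
    using set_borel_integral_eq_integral(2)[of "{- real N..real N}" h]
      integrable_mult_indicator[OF _ int, of "{- real N..real N}"]
    by (simp add: set_integrable_def set_lebesgue_integral_def)
  have "(\<lambda>N. LINT x|lborel. indicator {- real N..real N} x *\<^sub>R h x) \<longlonglongrightarrow> (LINT x|lborel. h x)"
  proof (rule integral_dominated_convergence[where w = "\<lambda>x. norm (h x)"])
    show "AE x in lborel. (\<lambda>N. indicator {- real N..real N} x *\<^sub>R h x) \<longlonglongrightarrow> h x"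
    proof (intro AE_I2)
      fix x :: real
      have "eventually (\<lambda>N. indicator {- real N..real N} x *\<^sub>R h x = h x) sequentially"
        using eventually_ge_at_top[of "nat \<lceil>\<bar>x\<bar>\<rceil>"]
      proof eventually_elim
        case (elim N)
        then have "\<bar>x\<bar> \<le> real N" by linarith
        then show ?case by (auto simp: indicator_def)
      qed
      then show "(\<lambda>N. indicator {- real N..real N} x *\<^sub>R h x) \<longlonglongrightarrow> h x"
        by (rule tendsto_eventually)
    qed
  qed (use int in \<open>auto simp: indicator_def\<close>)
  then show ?thesis using 1 unfolding eq[symmetric] by (rule LIMSEQ_unique[rotated])
qed

lemma
  fixes t s :: real
  assumes t: "t > 0"
  shows integrable_gaussian_cis: "integrable lborel (\<lambda>x. of_real (exp (- pi * t * x\<^sup>2)) * cis (s * x))"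
    and integral_gaussian_cis: "(LINT x|lborel. of_real (exp (- pi * t * x\<^sup>2)) * cis (s * x))
      = of_real (exp (- s\<^sup>2 / (4 * pi * t)) / sqrt t)"
proof -
  \<comment> \<open>Chosen so that (r x)^2 / 2 = pi t x^2; the integral becomes the characteristic
    function of the standard normal distribution.\<close>
  define r where "r = sqrt (2 * pi * t)"
  have r: "r > 0" "r\<^sup>2 = 2 * pi * t" using t by (auto simp: r_def)
  define f where "f = (\<lambda>y. std_normal_density y *\<^sub>R cis (s / r * y))"
  interpret N: prob_space std_normal_distribution by (rule prob_space_normal_density) simp
  have meas: "(\<lambda>y. cis (s / r * y)) \<in> borel_measurable lborel"
  proof -
    have "continuous_on UNIV (\<lambda>y. cis (s / r * y))"
      unfolding cis_conv_exp by (intro continuous_intros)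
    then have "(\<lambda>y. cis (s / r * y)) \<in> borel_measurable borel"
      by (rule borel_measurable_continuous_onI)
    then show ?thesis by simp
  qed
  have f: "integrable lborel f"
  proof -
    have "integrable std_normal_distribution (\<lambda>y. cis (s / r * y))"
      by (rule N.integrable_const_bound[where B = 1]) (use meas in auto)
    then show ?thesis unfolding f_def
      by (subst (asm) integrable_density) (use meas in auto)
  qed
  have lf: "(LINT y|lborel. f y) = of_real (exp (- (s / r)\<^sup>2 / 2))"
  proof -
    have "(LINT y|lborel. f y) = (LINT y|std_normal_distribution. cis (s / r * y))"
      unfolding f_def by (subst integral_density) (use meas in auto)
    also have "\<dots> = char std_normal_distribution (s / r)"
      by (simp add: char_def cis_conv_exp)
    finally show ?thesis by (simp add: char_std_normal_distribution)
  qed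
  have fr: "of_real (exp (- pi * t * x\<^sup>2)) * cis (s * x) = sqrt (2 * pi) *\<^sub>R f (0 + r * x)" for x
  proof -
    have "(r * x)\<^sup>2 / 2 = pi * t * x\<^sup>2" using r by (simp add: power_mult_distrib)
    then show ?thesis using r(1)
      by (simp add: f_def std_normal_density_def scaleR_conv_of_real)
  qed
  show "integrable lborel (\<lambda>x. of_real (exp (- pi * t * x\<^sup>2)) * cis (s * x))"
    unfolding fr using lborel_integrable_real_affine[OF f, of r 0] r by simp
  have "(LINT x|lborel. f (0 + r * x)) = (LINT y|lborel. f y) /\<^sub>R r"
    by (subst lborel_integral_real_affine[of r f 0]) (use r in simp_all)
  then have "(LINT x|lborel. of_real (exp (- pi * t * x\<^sup>2)) * cis (s * x)) = (sqrt (2 * pi) / r) *\<^sub>R of_real (exp (- (s / r)\<^sup>2 / 2))"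
    unfolding fr using r(1) by (simp only: integral_scaleR_right lf) (simp add: scaleR_conv_of_real field_simps)
  also have "sqrt (2 * pi) / r = 1 / sqrt t" by (simp add: r_def real_sqrt_mult)
  also have "- (s / r)\<^sup>2 / 2 = - s\<^sup>2 / (4 * pi * t)" by (simp add: power_divide r)
  finally show "(LINT x|lborel. of_real (exp (- pi * t * x\<^sup>2)) * cis (s * x))
      = of_real (exp (- s\<^sup>2 / (4 * pi * t)) / sqrt t)"
    by (simp add: scaleR_conv_of_real power_divide r)
qed

lemma integral_e_int:
  fixes m :: int
  shows "integral {0..1} (\<lambda>x. e (of_real (of_int m * x))) = (if m = 0 then 1 else 0)"
proof (cases "m = 0")
  case False
  have "((\<lambda>x. e (of_real (of_int m * x))) has_integral
      e (of_real (of_int m * 1)) / (2 * of_real pi * \<i> * of_int m) - e (of_real (of_int m * 0)) / (2 * of_real pi * \<i> * of_int m)) {0..1}"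
  proof (rule fundamental_theorem_of_calculus)
    fix x :: real
    have "((\<lambda>z. e (of_int m * z) / (2 * of_real pi * \<i> * of_int m)) has_field_derivative e (of_int m * of_real x)) (at (of_real x))"
      unfolding e_def by (rule derivative_eq_intros refl | use False in simp)+
    from has_vector_derivative_real_field[OF this]
    show "((\<lambda>x. e (of_real (of_int m * x)) / (2 * of_real pi * \<i> * of_int m)) has_vector_derivative e (of_real (of_int m * x))) (at x within {0..1})"
      by simp
  qed simp
  moreover have "e (of_int m) = 1" using e_int[of "of_int m"] by simp
  ultimately show ?thesis using False by (simp add: integral_unique)
qed simp

lemma integral_e_int_mult:
  fixes m k :: int
  shows "integral {0..1} (\<lambda>x. e (of_real (of_int m * x)) * e (of_real (of_int k * x))) = (if m = - k then 1 else 0)"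
proof -
  have "e (of_real (of_int m * x)) * e (of_real (of_int k * x)) = e (of_real (of_int (m + k) * x))" for x
    by (simp add: e_add[symmetric] ring_distribs)
  then show ?thesis using integral_e_int[of "m + k"] by (auto simp del: of_int_add)
qed

text \<open>The periodisation \<open>F\<close> of \<open>h\<close> and the series \<open>G\<close>
  with the expected coefficients are continuous of period 1 and have the same Fourier coefficients,
  hence agree at u.\<close>

lemma poisson_gaussian_real:
  fixes t u w :: real
  assumes t: "t > 0"
  shows "(\<Sum>\<^sub>\<infinity>n::int. of_real (exp (- pi * t * (of_int n + u)\<^sup>2)) * e (of_real (of_int n * w))) =
    of_real (1 / sqrt t) *
      (\<Sum>\<^sub>\<infinity>n::int. of_real (exp (- pi / t * (of_int n - w)\<^sup>2)) * e (of_real (u * (of_int n - w))))"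
proof -
  \<comment> \<open>The phase is taken at x w instead of n w, which makes \<open>h\<close> a
    function on the line. The resulting factor e(u w) occurs on both sides and is cancelled at the
    end.\<close>
  define h where "h = (\<lambda>x. complex_of_real (exp (- pi * t * x\<^sup>2)) * e (of_real (x * w)))"
  define a where "a = (\<lambda>n::int. complex_of_real (exp (- pi / t * (of_int n - w)\<^sup>2) / sqrt t))"
  define F where "F = (\<lambda>x. \<Sum>\<^sub>\<infinity>n::int. h (of_int n + x))"
  define G where "G = (\<lambda>x. \<Sum>\<^sub>\<infinity>n::int. a n * e (of_real (of_int n * x)))"
  have conth: "continuous_on A (\<lambda>x. h (c + x))" for A c
    unfolding h_def by (intro continuous_intros)
  \<comment> \<open>A majorant of h(n + x) uniform for x in [0, 1]; the constant exp (pi t) absorbs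
    the shift by x.\<close>
  define M where "M = (\<lambda>n::int. exp (pi * t) * exp (- (pi * t / 2) * (of_int n + 0)\<^sup>2))"
  have M: "M summable_on UNIV" unfolding M_def
    by (intro summable_on_cmult_right summable_gaussian_int) (use t in simp)
  have hM: "norm (h (of_int n + x)) \<le> M n" if "x \<in> {0..1}" for n x
  proof -
    have "(of_int n)\<^sup>2 \<le> 2 * (of_int n + x)\<^sup>2 + 2 * x\<^sup>2"
      using zero_le_power2[of "real_of_int n + 2 * x"] by (simp add: power2_eq_square algebra_simps)
    moreover have "x\<^sup>2 \<le> 1" using that by (simp add: power_le_one)
    ultimately have "pi * t * (of_int n)\<^sup>2 \<le> pi * t * (2 * (of_int n + x)\<^sup>2 + 2)"
      using t by (intro mult_left_mono) auto
    then have "- pi * t * (of_int n + x)\<^sup>2 \<le> pi * t + (- (pi * t / 2) * (of_int n + 0)\<^sup>2)"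
      by (simp add: field_simps)
    then show ?thesis by (simp add: h_def M_def norm_mult norm_e exp_add[symmetric])
  qed
  have aM: "(\<lambda>n. norm (a n)) summable_on UNIV"
  proof -
    have "(\<lambda>n::int. exp (- (pi / t) * (of_int n + (- w))\<^sup>2) * (1 / sqrt t)) summable_on UNIV"
      by (intro summable_on_cmult_left summable_gaussian_int) (use t in simp)
    then show ?thesis using t by (simp add: a_def norm_mult norm_divide)
  qed
  have contF: "continuous_on {0..1} F" unfolding F_def
    by (rule continuous_on_infsum[OF _ _ M]) (use conth hM in auto)
  have contG: "continuous_on {0..1} G" unfolding G_def
    by (rule continuous_on_infsum[OF _ _ aM]) (auto simp: norm_mult norm_e intro!: continuous_intros)
  have perF: "F (x + of_int m) = F x" for x and m :: int
    unfolding F_def by (rule infsum_reindex_bij_witness[of _ "\<lambda>n. n - m" "\<lambda>n. n + m"]) (auto simp: add_ac)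
  have perG: "G (x + of_int m) = G x" for x and m :: int
  proof -
    have "e (of_real (of_int n * (x + of_int m))) = e (of_real (of_int n * x))" for n :: int
      by (rule e_cong) (simp add: ring_distribs)
    then show ?thesis by (simp add: G_def)
  qed
  have coeffF: "integral {0..1} (\<lambda>x. F x * e (of_real (of_int k * x))) = a (- k)" for k :: int
  proof -
    \<comment> \<open>The character e(k x) is unchanged by integral translations, so it can be moved
      into the summand, and the coefficient unfolds to an integral over the line.\<close>
    define h2 where "h2 = (\<lambda>x. h x * e (of_real (of_int k * x)))"
    have h2: "h (of_int n + x) * e (of_real (of_int k * x)) = h2 (of_int n + x)" for n :: int and x
    proof -
      have "e (of_real (of_int k * (of_int n + x))) = e (of_real (of_int k * x))"
        by (rule e_cong) (simp add: ring_distribs)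
      then show ?thesis by (simp add: h2_def)
    qed
    have h2': "h2 = (\<lambda>x. of_real (exp (- pi * t * x\<^sup>2)) * cis ((2 * pi * (w + of_int k)) * x))"
    proof
      fix x
      have "cis ((2 * pi * (w + of_int k)) * x) = e (of_real (x * w)) * e (of_real (of_int k * x))"
        by (simp only: e_of_real cis_mult) (simp add: algebra_simps)
      then show "h2 x = of_real (exp (- pi * t * x\<^sup>2)) * cis ((2 * pi * (w + of_int k)) * x)"
        by (simp add: h2_def h_def)
    qed
    have "((\<lambda>n::int. integral {0..1} (\<lambda>x. h2 (of_int n + x))) has_sum integral {0..1} (\<lambda>x. \<Sum>\<^sub>\<infinity>n::int. h2 (of_int n + x))) UNIV"
      by (rule has_sum_integral_infsum[OF _ _ M])
        (use hM in \<open>auto simp: h2[symmetric] norm_mult norm_e intro!: continuous_intros conth\<close>)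
    moreover have "continuous_on UNIV h2" unfolding h2_def h_def by (intro continuous_intros)
    moreover have "integrable lborel h2" unfolding h2' by (rule integrable_gaussian_cis[OF t])
    ultimately have "integral {0..1} (\<lambda>x. \<Sum>\<^sub>\<infinity>n::int. h2 (of_int n + x)) = (LINT x|lborel. h2 x)"
      by (intro has_sum_unit_intervals_eq_integral)
    also have "\<dots> = of_real (exp (- (2 * pi * (w + of_int k))\<^sup>2 / (4 * pi * t)) / sqrt t)"
      unfolding h2' by (rule integral_gaussian_cis[OF t])
    also have "- (2 * pi * (w + of_int k))\<^sup>2 / (4 * pi * t) = - pi / t * (of_int (- k) - w)\<^sup>2"
      using t by (simp add: field_simps power2_eq_square)
    finally have "integral {0..1} (\<lambda>x. \<Sum>\<^sub>\<infinity>n::int. h2 (of_int n + x)) = a (- k)"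
      by (simp only: a_def)
    then show ?thesis unfolding F_def h2[symmetric] by (simp add: infsum_cmult_left')
  qed
  have coeffG: "integral {0..1} (\<lambda>x. G x * e (of_real (of_int k * x))) = a (- k)" for k :: int
  proof -
    have *: "((\<lambda>n. integral {0..1} (\<lambda>x. a n * e (of_real (of_int n * x)) * e (of_real (of_int k * x)))) has_sum
        integral {0..1} (\<lambda>x. \<Sum>\<^sub>\<infinity>n. a n * e (of_real (of_int n * x)) * e (of_real (of_int k * x)))) UNIV"
      by (rule has_sum_integral_infsum[OF _ _ aM]) (auto simp: norm_mult norm_e intro!: continuous_intros)
    have **: "integral {0..1} (\<lambda>x. a n * e (of_real (of_int n * x)) * e (of_real (of_int k * x))) = (if n = - k then a (- k) else 0)" for n
      unfolding mult.assoc integral_mult_right integral_e_int_mult by simp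
    have "((\<lambda>n. if n = - k then a (- k) else 0) has_sum a (- k)) UNIV"
      by (rule has_sum_finite_neutralI[of "{- k}"]) auto
    then have "integral {0..1} (\<lambda>x. \<Sum>\<^sub>\<infinity>n. a n * e (of_real (of_int n * x)) * e (of_real (of_int k * x))) = a (- k)"
      using * unfolding ** by (rule has_sum_unique[rotated])
    then show ?thesis by (simp add: G_def infsum_cmult_left')
  qed
  have FG: "F x - G x = 0" if "x \<in> {0..1}" for x
  proof (rule fourier_coefficients_zero[OF _ _ _ that])
    show "continuous_on {0..1} (\<lambda>x. F x - G x)" by (intro continuous_intros contF contG)
    show "F 0 - G 0 = F 1 - G 1" using perF[of 0 1] perG[of 0 1] by simp
    fix k :: int
    have "integral {0..1} (\<lambda>x. (F x - G x) * e (of_real (of_int k * x))) =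
      integral {0..1} (\<lambda>x. F x * e (of_real (of_int k * x))) - integral {0..1} (\<lambda>x. G x * e (of_real (of_int k * x)))"
      unfolding left_diff_distrib
      by (rule integral_diff) (intro integrable_continuous_interval continuous_intros contF contG)+
    then show "integral {0..1} (\<lambda>x. (F x - G x) * e (of_real (of_int k * x))) = 0"
      by (simp only: coeffF coeffG diff_self)
  qed
  have 1: "F u = G u"
    using perF[of "frac u" "\<lfloor>u\<rfloor>"] perG[of "frac u" "\<lfloor>u\<rfloor>"] FG[of "frac u"] frac_lt_1[of u]
    by (simp add: frac_def)
  have 2: "F u = e (of_real (u * w)) * (\<Sum>\<^sub>\<infinity>n::int. of_real (exp (- pi * t * (of_int n + u)\<^sup>2)) * e (of_real (of_int n * w)))"
    unfolding F_def h_def infsum_cmult_right'[symmetric] by (intro infsum_cong) (simp add: e_add ring_distribs)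
  have 3: "G u = e (of_real (u * w)) * (of_real (1 / sqrt t) *
      (\<Sum>\<^sub>\<infinity>n::int. of_real (exp (- pi / t * (of_int n - w)\<^sup>2)) * e (of_real (u * (of_int n - w)))))"
    unfolding G_def a_def infsum_cmult_right'[symmetric]
    by (intro infsum_cong) (simp add: e_diff right_diff_distrib mult_ac)
  show ?thesis
    using trans[OF sym[OF 2] trans[OF 1 3]] by (simp only: mult_left_cancel[OF e_nonzero])
qed

text \<open>On the disc of radius Re z / 2 about z the real part stays at least Re z / 2, which
  gives uniform convergence there.\<close>

lemma holomorphic_exp_series:
  fixes a :: "'i \<Rightarrow> real" and c :: "'i \<Rightarrow> complex"
  assumes a: "\<And>n. n \<in> I \<Longrightarrow> a n \<ge> 0" and c: "\<And>n. n \<in> I \<Longrightarrow> norm (c n) \<le> 1"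
    and sum: "\<And>\<delta>. \<delta> > 0 \<Longrightarrow> (\<lambda>n. exp (- \<delta> * a n)) summable_on I"
  shows "(\<lambda>z. \<Sum>\<^sub>\<infinity>n\<in>I. exp (- z * of_real (a n)) * c n) holomorphic_on {z. Re z > 0}"
proof -
  define f where "f = (\<lambda>z. \<Sum>\<^sub>\<infinity>n\<in>I. exp (- z * of_real (a n)) * c n)"
  have "f field_differentiable (at z)" if z: "Re z > 0" for z
  proof -
    define r where "r = Re z / 2"
    have r: "r > 0" using z by (simp add: r_def)
    have re: "Re x \<ge> r" if "x \<in> cball z r" for x
      using that complex_Re_le_cmod[of "z - x"] by (simp add: dist_norm r_def)
    have "uniform_limit (cball z r) (\<lambda>X x. \<Sum>n\<in>X. exp (- x * of_real (a n)) * c n) f (finite_subsets_at_top I)"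
      unfolding f_def
    proof (rule Weierstrass_m_test_general[OF _ sum[OF r]])
      fix n x assume *: "n \<in> I" "x \<in> cball z r"
      have "norm (exp (- x * of_real (a n)) * c n) \<le> exp (- Re x * a n) * 1"
        unfolding norm_mult using c[OF *(1)] by (intro mult_mono) auto
      also have "\<dots> \<le> exp (- r * a n)" using re[OF *(2)] a[OF *(1)] by (simp add: mult_right_mono)
      finally show "norm (exp (- x * of_real (a n)) * c n) \<le> exp (- r * a n)" .
    qed
    then have "f holomorphic_on ball z r"
      by (rule holomorphic_uniform_limit[rotated])
        (auto intro!: always_eventually continuous_intros holomorphic_intros)
    then show ?thesis
      using r by (simp add: holomorphic_on_imp_differentiable_at)
  qed
  then show ?thesis unfolding f_def[symmetric]
    by (auto simp: holomorphic_on_def intro: field_differentiable_at_within)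
qed

text \<open>Both sides are holomorphic in the right half-plane and agree on the positive axis, which
  accumulates at 1.\<close>

theorem poisson_gaussian:
  fixes z :: complex and u w :: real
  assumes z: "Re z > 0"
  shows "(\<Sum>\<^sub>\<infinity>n::int. exp (- of_real pi * z * of_real ((of_int n + u)\<^sup>2)) * e (of_real (of_int n * w))) =
    inverse (csqrt z) *
      (\<Sum>\<^sub>\<infinity>n::int. exp (- of_real pi / z * of_real ((of_int n - w)\<^sup>2)) * e (of_real (u * (of_int n - w))))"
proof -
  define H where "H = {z::complex. Re z > 0}"
  define A where "A = (\<lambda>z. \<Sum>\<^sub>\<infinity>n::int. exp (- z * of_real (pi * (of_int n + u)\<^sup>2)) * e (of_real (of_int n * w)))"
  define B where "B = (\<lambda>z. \<Sum>\<^sub>\<infinity>n::int. exp (- z * of_real (pi * (of_int n + (- w))\<^sup>2)) * e (of_real (u * (of_int n - w))))"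
  have summ: "(\<lambda>n::int. exp (- \<delta> * (pi * (of_int n + v)\<^sup>2))) summable_on UNIV" if "\<delta> > 0" for \<delta> v
    using summable_gaussian_int[of "\<delta> * pi" v] that by (simp add: mult.assoc)
  have holA: "A holomorphic_on H" and holB: "B holomorphic_on H"
    unfolding A_def B_def H_def by (intro holomorphic_exp_series summ; simp add: norm_e)+
  have "(B \<circ> inverse) holomorphic_on H"
    by (rule holomorphic_on_compose_gen[OF _ holB])
      (auto simp: H_def intro!: holomorphic_intros divide_pos_pos add_pos_nonneg)
  then have holD: "(\<lambda>z. A z - inverse (csqrt z) * B (inverse z)) holomorphic_on H"
    by (intro holomorphic_intros holA) (auto simp: o_def H_def complex_nonpos_Reals_iff)
  have real0: "A x - inverse (csqrt x) * B (inverse x) = 0" if x: "x \<in> of_real ` {0<..}" for x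
  proof -
    obtain t where t: "t > 0" "x = of_real t" using x by auto
    have "exp (- x * of_real (pi * (of_int n + u)\<^sup>2)) = of_real (exp (- pi * t * (of_int n + u)\<^sup>2))"
      "exp (- inverse x * of_real (pi * (of_int n + (- w))\<^sup>2)) = of_real (exp (- pi / t * (of_int n - w)\<^sup>2))" for n :: int
      by (simp_all add: t exp_of_real[symmetric] field_simps)
    then show ?thesis
      using poisson_gaussian_real[OF t(1), of u w] t by (simp add: A_def B_def inverse_eq_divide)
  qed
  have "A z - inverse (csqrt z) * B (inverse z) = 0"
  proof (rule analytic_continuation[OF holD, where U = "of_real ` {0<..}" and \<xi> = 1])
    show "open H" "connected H" unfolding H_def
      by (simp_all add: open_halfspace_Re_gt convex_connected convex_halfspace_Re_gt)
    show "(1::complex) islimpt of_real ` {0<..}"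
    proof -
      have "\<exists>x'\<in>of_real ` {0<..}. x' \<noteq> 1 \<and> dist x' (1::complex) < d" if "d > 0" for d
        by (rule bexI[of _ "of_real (1 + d / 2)"], use that in \<open>simp add: dist_norm norm_divide\<close>)
          (rule imageI, use that in simp)
      then show ?thesis by (simp add: islimpt_approachable)
    qed
  qed (use z real0 in \<open>auto simp: H_def\<close>)
  then show ?thesis by (simp add: A_def B_def mult_ac divide_inverse)
qed

subsection \<open>Transversals\<close>

definition add_subgroup :: "'v::real_vector set \<Rightarrow> bool" where
  "add_subgroup A \<longleftrightarrow> 0 \<in> A \<and> (\<forall>x\<in>A. \<forall>y\<in>A. x - y \<in> A)"

lemma
  assumes "add_subgroup A"
  shows add_subgroup_0: "0 \<in> A"
    and add_subgroup_diff: "x \<in> A \<Longrightarrow> y \<in> A \<Longrightarrow> x - y \<in> A"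
    and add_subgroup_uminus: "x \<in> A \<Longrightarrow> - x \<in> A"
    and add_subgroup_add: "x \<in> A \<Longrightarrow> y \<in> A \<Longrightarrow> x + y \<in> A"
    and add_subgroup_diff_commute: "x - y \<in> A \<Longrightarrow> y - x \<in> A"
proof -
  show 0: "0 \<in> A" and d: "x \<in> A \<Longrightarrow> y \<in> A \<Longrightarrow> x - y \<in> A" for x y
    using assms by (auto simp: add_subgroup_def)
  show m: "x \<in> A \<Longrightarrow> - x \<in> A" for x using d[OF 0, of x] by simp
  show "x \<in> A \<Longrightarrow> y \<in> A \<Longrightarrow> x + y \<in> A" for x y using d[of x "- y"] m[of y] by simp
  show "x - y \<in> A \<Longrightarrow> y - x \<in> A" for x y using m[of "x - y"] by simp
qed

lemma add_subgroup_trans: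
  assumes "add_subgroup A" "x - y \<in> A" "y - z \<in> A"
  shows "x - z \<in> A"
  using add_subgroup_add[OF assms] by simp

lemma add_subgroup_int_scaleR:
  assumes "add_subgroup A" "x \<in> A"
  shows "of_int n *\<^sub>R x \<in> A"
proof -
  have nat: "of_nat m *\<^sub>R x \<in> A" for m
    by (induction m) (use assms in \<open>auto simp: add_subgroup_0 add_subgroup_add scaleR_left_distrib\<close>)
  then show ?thesis
    using nat[of "nat \<bar>n\<bar>"] add_subgroup_uminus[OF assms(1) nat[of "nat \<bar>n\<bar>"]] by (cases "n \<ge> 0") auto
qed

lemma add_subgroup_scaled:
  assumes "add_subgroup A"
  shows "add_subgroup ((*\<^sub>R) c ` A)"
  unfolding add_subgroup_def
proof (intro conjI ballI)
  show "0 \<in> (*\<^sub>R) c ` A"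
    using add_subgroup_0[OF assms] by force
  fix x y assume "x \<in> (*\<^sub>R) c ` A" "y \<in> (*\<^sub>R) c ` A"
  then show "x - y \<in> (*\<^sub>R) c ` A"
    using add_subgroup_diff[OF assms] by (auto simp: scaleR_diff_right[symmetric])
qed

text \<open>Representatives of A modulo M. Sums over quotients are taken over such sets of vectors
  because the summands are evaluated at vectors; for an M-periodic summand the choice does not
  matter.\<close>

definition transversal :: "'v::real_vector set \<Rightarrow> 'v set \<Rightarrow> 'v set \<Rightarrow> bool" where
  "transversal A M R \<longleftrightarrow> finite R \<and> R \<subseteq> A \<and> (\<forall>v\<in>A. \<exists>!r. r \<in> R \<and> v - r \<in> M)"

lemma transversal_finite: "transversal A M R \<Longrightarrow> finite R"
  and transversal_subset: "transversal A M R \<Longrightarrow> r \<in> R \<Longrightarrow> r \<in> A"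
  and transversal_ex: "transversal A M R \<Longrightarrow> v \<in> A \<Longrightarrow> \<exists>r\<in>R. v - r \<in> M"
  by (auto simp: transversal_def)

lemma transversal_unique:
  assumes "transversal A M R" "add_subgroup M" "r \<in> R" "r' \<in> R" "r - r' \<in> M"
  shows "r = r'"
proof -
  have "r \<in> A" "r - r \<in> M" using assms by (auto simp: transversal_def add_subgroup_0)
  then show ?thesis using assms unfolding transversal_def by blast
qed

lemma transversalI:
  assumes "finite R" "R \<subseteq> A" "add_subgroup M"
    and "\<And>v. v \<in> A \<Longrightarrow> \<exists>r\<in>R. v - r \<in> M"
    and "\<And>r r'. r \<in> R \<Longrightarrow> r' \<in> R \<Longrightarrow> r - r' \<in> M \<Longrightarrow> r = r'"
  shows "transversal A M R"
  unfolding transversal_def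
proof (intro conjI ballI)
  fix v assume "v \<in> A"
  then obtain r where r: "r \<in> R" "v - r \<in> M" using assms(4) by blast
  show "\<exists>!r. r \<in> R \<and> v - r \<in> M"
  proof (intro ex1I[of _ r] conjI r)
    fix r' assume "r' \<in> R \<and> v - r' \<in> M"
    then show "r' = r"
      using add_subgroup_trans[OF assms(3) add_subgroup_diff_commute[OF assms(3)], of v r' r] assms(5) r by blast
  qed
qed (use assms in auto)

text \<open>An injection of residue classes between finite sets of equal size is bijective. Change
  of transversal, translation and multiplication by a unit are instances.\<close>

lemma transversal_sum_inj:
  fixes F :: "'v::real_vector \<Rightarrow> 'a::comm_monoid_add"
  assumes R: "transversal A M R" and M: "add_subgroup M"
    and F: "\<And>v w. v \<in> A \<Longrightarrow> w \<in> A \<Longrightarrow> v - w \<in> M \<Longrightarrow> F v = F w"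
    and J: "finite J" "card J = card R"
    and g: "\<And>j. j \<in> J \<Longrightarrow> g j \<in> A" "\<And>j j'. j \<in> J \<Longrightarrow> j' \<in> J \<Longrightarrow> g j - g j' \<in> M \<Longrightarrow> j = j'"
  shows "(\<Sum>j\<in>J. F (g j)) = (\<Sum>r\<in>R. F r)"
proof -
  have "\<forall>v\<in>A. \<exists>r. r \<in> R \<and> v - r \<in> M" using transversal_ex[OF R] by blast
  then obtain rep where rep: "\<And>v. v \<in> A \<Longrightarrow> rep v \<in> R \<and> v - rep v \<in> M" by metis
  have inj: "inj_on (rep \<circ> g) J"
  proof (rule inj_onI)
    fix j j' assume j: "j \<in> J" "j' \<in> J" "(rep \<circ> g) j = (rep \<circ> g) j'"
    then have "g j - rep (g j) \<in> M" "rep (g j) - g j' \<in> M"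
      using rep[OF g(1)[OF j(1)]] rep[OF g(1)[OF j(2)]] add_subgroup_diff_commute[OF M] by (auto simp: o_def)
    then show "j = j'" using add_subgroup_trans[OF M] g(2) j by blast
  qed
  have "(rep \<circ> g) ` J = R"
    by (rule card_subset_eq) (use R J card_image[OF inj] rep g in \<open>auto simp: transversal_finite\<close>)
  then have bij: "bij_betw (rep \<circ> g) J R" using inj by (auto simp: bij_betw_def)
  have "(\<Sum>j\<in>J. F (g j)) = (\<Sum>j\<in>J. F ((rep \<circ> g) j))"
    by (rule sum.cong) (use F rep g R in \<open>auto simp: transversal_subset\<close>)
  also have "\<dots> = (\<Sum>r\<in>R. F r)" by (rule sum.reindex_bij_betw[OF bij])
  finally show ?thesis .
qed

lemma transversal_card_eq:
  assumes R: "transversal A M R" and R': "transversal A M R'" and M: "add_subgroup M"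
  shows "card R = card R'"
proof -
  have le: "card R \<le> card R'" if R: "transversal A M R" and R': "transversal A M R'" for R R'
  proof -
    have "\<forall>v\<in>A. \<exists>r. r \<in> R' \<and> v - r \<in> M" using transversal_ex[OF R'] by blast
    then obtain rep where rep: "\<And>v. v \<in> A \<Longrightarrow> rep v \<in> R' \<and> v - rep v \<in> M" by metis
    have "inj_on rep R"
    proof (rule inj_onI)
      fix r s assume rs: "r \<in> R" "s \<in> R" "rep r = rep s"
      then have "r - rep r \<in> M" "rep r - s \<in> M"
        using rep[OF transversal_subset[OF R rs(1)]] rep[OF transversal_subset[OF R rs(2)]]
          add_subgroup_diff_commute[OF M] by auto
      then show "r = s" using add_subgroup_trans[OF M] transversal_unique[OF R M] rs by blast
    qed
    then show ?thesis
      by (rule card_inj_on_le) (use R R' rep in \<open>auto simp: transversal_finite transversal_subset\<close>)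
  qed
  show ?thesis using le[OF R R'] le[OF R' R] by simp
qed

lemma transversal_sum_eq:
  fixes F :: "'v::real_vector \<Rightarrow> 'a::comm_monoid_add"
  assumes R: "transversal A M R" and R': "transversal A M R'" and M: "add_subgroup M"
    and F: "\<And>v w. v \<in> A \<Longrightarrow> w \<in> A \<Longrightarrow> v - w \<in> M \<Longrightarrow> F v = F w"
  shows "(\<Sum>r\<in>R'. F r) = (\<Sum>r\<in>R. F r)"
  by (rule transversal_sum_inj[OF R M F])
    (use R' transversal_card_eq[OF R R' M] in \<open>auto simp: transversal_finite transversal_subset transversal_unique[OF R' M]\<close>)

lemma transversal_sum_shift:
  fixes F :: "'v::real_vector \<Rightarrow> 'a::comm_monoid_add"
  assumes R: "transversal A M R" and A: "add_subgroup A" and M: "add_subgroup M"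
    and F: "\<And>v w. v \<in> A \<Longrightarrow> w \<in> A \<Longrightarrow> v - w \<in> M \<Longrightarrow> F v = F w" and a: "a \<in> A"
  shows "(\<Sum>r\<in>R. F (r + a)) = (\<Sum>r\<in>R. F r)"
  by (rule transversal_sum_inj[OF R M F])
    (use R a in \<open>auto simp: transversal_finite transversal_subset transversal_unique[OF R M] add_subgroup_add[OF A]\<close>)

text \<open>Translation by an a with \<psi> a \<noteq> 1 multiplies the sum by \<psi> a, so the sum
  vanishes.\<close>

lemma transversal_sum_character:
  fixes \<psi> :: "'v::real_vector \<Rightarrow> complex"
  assumes R: "transversal A M R" and A: "add_subgroup A" and M: "add_subgroup M" and MA: "M \<subseteq> A"
    and \<psi>: "\<And>x y. x \<in> A \<Longrightarrow> y \<in> A \<Longrightarrow> \<psi> (x + y) = \<psi> x * \<psi> y" and one: "\<And>m. m \<in> M \<Longrightarrow> \<psi> m = 1"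
  shows "(\<Sum>r\<in>R. \<psi> r) = (if \<forall>a\<in>A. \<psi> a = 1 then of_nat (card R) else 0)"
proof (cases "\<forall>a\<in>A. \<psi> a = 1")
  case True
  then show ?thesis using transversal_subset[OF R] by simp
next
  case False
  then obtain a where a: "a \<in> A" "\<psi> a \<noteq> 1" by blast
  have per: "\<psi> v = \<psi> w" if "v \<in> A" "w \<in> A" "v - w \<in> M" for v w
    using \<psi>[of "v - w" w] that one[of "v - w"] MA by auto
  have "(\<Sum>r\<in>R. \<psi> r) = (\<Sum>r\<in>R. \<psi> (r + a))"
    using transversal_sum_shift[OF R A M _ a(1), of \<psi>] per by simp
  also have "\<dots> = (\<Sum>r\<in>R. \<psi> r) * \<psi> a"
    unfolding sum_distrib_right by (rule sum.cong) (use \<psi> a transversal_subset[OF R] in auto)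
  finally show ?thesis using a False by (simp only: if_False) (metis mult_cancel_left1)
qed

lemma transversal_sum_trans:
  fixes F :: "'v::real_vector \<Rightarrow> 'a::comm_monoid_add"
  assumes R: "transversal A M R" and S: "transversal M N S" and T: "transversal A N T"
    and A: "add_subgroup A" and M: "add_subgroup M" and N: "add_subgroup N" and sub: "M \<subseteq> A" "N \<subseteq> M"
    and F: "\<And>v w. v \<in> A \<Longrightarrow> w \<in> A \<Longrightarrow> v - w \<in> N \<Longrightarrow> F v = F w"
  shows "(\<Sum>t\<in>T. F t) = (\<Sum>r\<in>R. \<Sum>s\<in>S. F (r + s))"
proof -
  have inj: "r = r' \<and> s = s'" if *: "r \<in> R" "s \<in> S" "r' \<in> R" "s' \<in> S" "(r + s) - (r' + s') \<in> N" for r s r' s'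
  proof -
    have "s - s' \<in> M" using * S M by (meson add_subgroup_diff transversal_subset)
    moreover have "(r + s) - (r' + s') \<in> M" using * sub by blast
    ultimately have "((r + s) - (r' + s')) - (s - s') \<in> M" using add_subgroup_diff[OF M] by blast
    then have "r - r' \<in> M" by (simp add: algebra_simps)
    then have "r = r'" using transversal_unique[OF R M] * by blast
    then show ?thesis using * transversal_unique[OF S N, of s s'] by simp
  qed
  define U where "U = (\<lambda>(r, s). r + s) ` (R \<times> S)"
  have injU: "inj_on (\<lambda>(r, s). r + s) (R \<times> S)"
    using inj add_subgroup_0[OF N] by (auto simp: inj_on_def)
  have "transversal A N U"
  proof (rule transversalI)
    show "finite U" using R S by (simp add: U_def transversal_finite)
    show "U \<subseteq> A"
      using add_subgroup_add[OF A] transversal_subset[OF R] transversal_subset[OF S] sub(1) by (auto simp: U_def subset_iff)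
    fix v assume "v \<in> A"
    then obtain r where r: "r \<in> R" "v - r \<in> M" using transversal_ex[OF R] by blast
    then obtain s where "s \<in> S" "v - r - s \<in> N" using transversal_ex[OF S] by blast
    then show "\<exists>u\<in>U. v - u \<in> N" using r by (auto simp: U_def diff_diff_eq)
  next
    fix u u' assume "u \<in> U" "u' \<in> U" "u - u' \<in> N"
    then show "u = u'" using inj by (auto simp: U_def)
  qed (rule N)
  then have "(\<Sum>t\<in>T. F t) = (\<Sum>u\<in>U. F u)" by (rule transversal_sum_eq[OF _ T N F])
  also have "\<dots> = (\<Sum>(r, s)\<in>R \<times> S. F (r + s))"
    unfolding U_def by (subst sum.reindex[OF injU]) (simp add: case_prod_unfold)
  finally show ?thesis by (simp add: sum.cartesian_product)
qed

text \<open>The choice \<open>g\<close> depends on the coset alone, because congruent vectors have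
  the same candidates; its values keep one representative per coset.\<close>

lemma transversal_exists:
  assumes "finite R" "R \<subseteq> A" "add_subgroup M" and ex: "\<And>v. v \<in> A \<Longrightarrow> \<exists>r\<in>R. v - r \<in> M"
  obtains R' where "transversal A M R'"
proof -
  define g where "g = (\<lambda>v. SOME r. r \<in> R \<and> v - r \<in> M)"
  have g: "g v \<in> R" "v - g v \<in> M" if "v \<in> A" for v
    using someI_ex[of "\<lambda>r. r \<in> R \<and> v - r \<in> M"] ex[OF that] by (auto simp: g_def)
  have geq: "g v = g w" if "v - w \<in> M" for v w
  proof -
    have "v - r \<in> M \<longleftrightarrow> w - r \<in> M" for r
      using that add_subgroup_trans[OF assms(3)] add_subgroup_diff_commute[OF assms(3)] by blast
    then show ?thesis by (simp add: g_def)
  qed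
  have "transversal A M (g ` R)"
  proof (rule transversalI)
    show "g ` R \<subseteq> A" using g(1) assms(2) by blast
    fix v assume v: "v \<in> A"
    have "g v = g (g v)" by (rule geq) (rule g(2)[OF v])
    then show "\<exists>r\<in>g ` R. v - r \<in> M" using g[OF v] by (metis image_eqI)
  next
    fix r r' assume rr: "r \<in> g ` R" "r' \<in> g ` R" "r - r' \<in> M"
    then obtain s s' where s: "s \<in> R" "s' \<in> R" "r = g s" "r' = g s'" by blast
    then have "g s = g r" "g s' = g r'" using geq g(2) assms(2) by blast+
    then show "r = r'" using geq[OF rr(3)] s by simp
  qed (use assms in auto)
  then show ?thesis by (rule that)
qed

lemma infsum_transversal:
  fixes F :: "'v::real_vector \<Rightarrow> complex"
  assumes R: "transversal A M R" and A: "add_subgroup A" and M: "add_subgroup M" and MA: "M \<subseteq> A"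
    and F: "F summable_on A"
  shows "(\<Sum>\<^sub>\<infinity>x\<in>A. F x) = (\<Sum>r\<in>R. \<Sum>\<^sub>\<infinity>m\<in>M. F (r + m))"
proof -
  have inj: "inj_on (\<lambda>(r, m). r + m) (R \<times> M)"
  proof (rule inj_onI, clarify)
    fix r m r' m' assume *: "r \<in> R" "m \<in> M" "r' \<in> R" "m' \<in> M" "r + m = r' + m'"
    then have "r - r' = m' - m" by (simp add: algebra_simps)
    then have "r = r'" using transversal_unique[OF R M] add_subgroup_diff[OF M] * by metis
    then show "r = r' \<and> m = m'" using * by simp
  qed
  have img: "(\<lambda>(r, m). r + m) ` (R \<times> M) = A"
  proof
    show "(\<lambda>(r, m). r + m) ` (R \<times> M) \<subseteq> A"
      using add_subgroup_add[OF A] transversal_subset[OF R] MA by auto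
    show "A \<subseteq> (\<lambda>(r, m). r + m) ` (R \<times> M)"
    proof
      fix v assume "v \<in> A"
      then obtain r where "r \<in> R" "v - r \<in> M" using transversal_ex[OF R] by blast
      then show "v \<in> (\<lambda>(r, m). r + m) ` (R \<times> M)" by (intro image_eqI[of _ _ "(r, v - r)"]) auto
    qed
  qed
  have "(\<lambda>(r, m). F (r + m)) summable_on R \<times> M"
    using F unfolding img[symmetric] by (subst (asm) summable_on_reindex[OF inj]) (simp add: o_def case_prod_unfold)
  moreover have "(\<Sum>\<^sub>\<infinity>x\<in>A. F x) = (\<Sum>\<^sub>\<infinity>(r, m)\<in>R \<times> M. F (r + m))"
    unfolding img[symmetric] by (subst infsum_reindex[OF inj]) (simp add: o_def case_prod_unfold)
  ultimately show ?thesis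
    using transversal_finite[OF R] by (simp add: infsum_Sigma'_banach[symmetric])
qed

subsection \<open>Lattices and their discriminant groups\<close>

lemma mem_translation_iff: "x \<in> (\<lambda>h. h + v) ` A \<longleftrightarrow> x - v \<in> A" for v x :: "'a::ab_group_add"
proof
  assume "x - v \<in> A"
  then have "x - v + v \<in> (\<lambda>h. h + v) ` A" by (rule imageI)
  then show "x \<in> (\<lambda>h. h + v) ` A" by simp
qed auto

context even_lattice
begin

abbreviation q :: "'v \<Rightarrow> real" where "q \<equiv> qform b"
abbreviation Ld :: "'v set" where "Ld \<equiv> dual_lattice L b"

lemma bil_add: "b (x + y) z = b x z + b y z" "b z (x + y) = b z x + b z y"
  and bil_diff: "b (x - y) z = b x z - b y z" "b z (x - y) = b z x - b z y"
  and bil_minus: "b (- x) z = - b x z" "b z (- x) = - b z x"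
  and bil_scale: "b (r *\<^sub>R x) z = r * b x z" "b z (r *\<^sub>R x) = r * b z x"
  and bil_0: "b 0 z = 0" "b z 0 = 0"
  and bil_sum: "b (\<Sum>i\<in>I. f i) z = (\<Sum>i\<in>I. b (f i) z)" "b z (\<Sum>i\<in>I. f i) = (\<Sum>i\<in>I. b z (f i))"
proof -
  have l: "linear (\<lambda>x. b x z)" "linear (b z)" for z
    using bilinear by (auto simp: bilinear_def)
  show "b (x + y) z = b x z + b y z" "b z (x + y) = b z x + b z y"
    "b (x - y) z = b x z - b y z" "b z (x - y) = b z x - b z y"
    "b (- x) z = - b x z" "b z (- x) = - b z x"
    "b (r *\<^sub>R x) z = r * b x z" "b z (r *\<^sub>R x) = r * b z x"
    "b 0 z = 0" "b z 0 = 0"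
    "b (\<Sum>i\<in>I. f i) z = (\<Sum>i\<in>I. b (f i) z)" "b z (\<Sum>i\<in>I. f i) = (\<Sum>i\<in>I. b z (f i))"
    using linear_add[OF l(1)] linear_add[OF l(2)] linear_diff[OF l(1)] linear_diff[OF l(2)]
      linear_neg[OF l(1)] linear_neg[OF l(2)] linear_scale[OF l(1)] linear_scale[OF l(2)]
      linear_0[OF l(1)] linear_0[OF l(2)] linear_sum[OF l(1)] linear_sum[OF l(2)]
    by simp_all
qed

lemmas bil_simps = bil_add bil_diff bil_minus bil_scale bil_0

lemma q_add: "q (x + y) = q x + q y + b x y"
  by (simp add: qform_def bil_simps symmetric[of y x] add_divide_distrib)

lemma q_diff: "q (x - y) = q x + q y - b x y"
  by (simp add: qform_def bil_simps symmetric[of y x] add_divide_distrib diff_divide_distrib)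

lemma q_scale: "q (r *\<^sub>R x) = r\<^sup>2 * q x"
  by (simp add: qform_def bil_simps power2_eq_square)

lemma obtain_basis:
  obtains B where "finite B" "independent B" "B \<subseteq> L" "card B = lattice_rank L" "span L = span B"
    "L = {\<Sum>x\<in>B. of_int (a x) *\<^sub>R x | a :: 'v \<Rightarrow> int. True}"
proof -
  obtain B where B: "finite B" "independent B"
    "L = {\<Sum>x\<in>B. of_int (a x) *\<^sub>R x | a :: 'v \<Rightarrow> int. True}"
    using lattice by blast
  have "x \<in> L" if "x \<in> B" for x
  proof -
    have "(\<Sum>y\<in>B. of_int (if y = x then 1 else 0) *\<^sub>R y) = (\<Sum>y\<in>B. if y = x then y else 0)"
      by (rule sum.cong) auto
    also have "\<dots> = x" using that B(1) by simp
    finally show ?thesis unfolding B(3) by (intro CollectI exI[of _ "\<lambda>y. if y = x then 1 else 0"]) simp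
  qed
  then have sub: "B \<subseteq> L" by blast
  have "L \<subseteq> span B" unfolding B(3) by (auto intro!: span_sum span_scale intro: span_base)
  then have sp: "span L = span B" using sub by (metis span_mono span_span subset_antisym)
  have "card B = lattice_rank L"
    unfolding lattice_rank_def sp by (simp only: dim_span_eq_card_independent[OF B(2)])
  then show ?thesis using that[OF B(1,2) sub _ sp B(3)] by blast
qed

lemma L_subgroup: "add_subgroup L"
proof -
  obtain B where B: "L = {\<Sum>x\<in>B. of_int (a x) *\<^sub>R x | a :: 'v \<Rightarrow> int. True}"
    using lattice by blast
  show ?thesis unfolding add_subgroup_def
  proof (intro conjI ballI)
    show "0 \<in> L" unfolding B by (intro CollectI exI[of _ "\<lambda>_. 0"]) simp
    fix x y assume "x \<in> L" "y \<in> L"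
    then obtain a c :: "'v \<Rightarrow> int" where ac: "x = (\<Sum>x\<in>B. of_int (a x) *\<^sub>R x)" "y = (\<Sum>x\<in>B. of_int (c x) *\<^sub>R x)"
      unfolding B by blast
    show "x - y \<in> L" unfolding B
      by (intro CollectI exI[of _ "\<lambda>x. a x - c x"]) (simp add: ac sum_subtractf scaleR_diff_left)
  qed
qed

lemma L_span: "x \<in> L \<Longrightarrow> x \<in> span L"
  by (rule span_base)

lemma q_int: "x \<in> L \<Longrightarrow> q x \<in> \<int>"
  using even by (simp add: qform_def)

lemma b_int: "x \<in> L \<Longrightarrow> y \<in> L \<Longrightarrow> b x y \<in> \<int>"
proof -
  assume "x \<in> L" "y \<in> L"
  moreover have "b x y = q (x + y) - q x - q y" by (simp add: q_add)
  ultimately show ?thesis using q_int add_subgroup_add[OF L_subgroup] by auto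
qed

lemma Ld_b: "x \<in> Ld \<Longrightarrow> y \<in> L \<Longrightarrow> b x y \<in> \<int>" "x \<in> Ld \<Longrightarrow> y \<in> L \<Longrightarrow> b y x \<in> \<int>"
  by (simp_all add: dual_lattice_def symmetric[of y x])

lemma L_sub_Ld: "L \<subseteq> Ld"
  by (auto simp: dual_lattice_def L_span b_int)

lemma Ld_subgroup: "add_subgroup Ld"
  by (auto simp: add_subgroup_def dual_lattice_def bil_simps span_diff span_zero)

lemma Ld_span: "x \<in> Ld \<Longrightarrow> x \<in> span L"
  by (simp add: dual_lattice_def)

lemma q_cong: "x \<in> Ld \<Longrightarrow> y \<in> L \<Longrightarrow> q (x + y) - q x \<in> \<int>"
  by (simp add: q_add q_int Ld_b)

lemma q_cong': "x \<in> Ld \<Longrightarrow> x' \<in> Ld \<Longrightarrow> x - x' \<in> L \<Longrightarrow> q x - q x' \<in> \<int>"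
  using q_cong[of x' "x - x'"] by simp

definition cls :: "'v \<Rightarrow> 'v set" where
  "cls v = (\<lambda>h. h + v) ` L"

lemma in_cls_iff: "x \<in> cls v \<longleftrightarrow> x - v \<in> L"
  unfolding cls_def by (rule mem_translation_iff)

lemma cls_self [simp]: "v \<in> cls v"
  by (simp add: in_cls_iff add_subgroup_0[OF L_subgroup])

lemma cls_eq_iff: "cls v = cls w \<longleftrightarrow> v - w \<in> L"
proof
  assume "cls v = cls w" then show "v - w \<in> L" using cls_self[of v] by (simp add: in_cls_iff)
next
  assume *: "v - w \<in> L"
  have "x - v \<in> L \<longleftrightarrow> x - w \<in> L" for x
    using * add_subgroup_trans[OF L_subgroup, of x v w] add_subgroup_trans[OF L_subgroup, of x w v]
      add_subgroup_diff_commute[OF L_subgroup, of v w] by blast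
  then show "cls v = cls w" by (auto simp: in_cls_iff set_eq_iff)
qed

lemma disc_eq: "disc L b = cls ` Ld"
  by (auto simp: disc_group_def FactGroup_def RCOSETS_def r_coset_def add_monoid_on_def cls_def)

lemma cls_in_disc: "v \<in> Ld \<Longrightarrow> cls v \<in> disc L b"
  by (simp add: disc_eq)

lemma disc_memD:
  assumes "x \<in> disc L b" "v \<in> x"
  shows "v \<in> Ld" "x = cls v"
proof -
  obtain w where w: "w \<in> Ld" "x = cls w" using assms by (auto simp: disc_eq)
  have "v - w \<in> L" using assms w by (simp add: in_cls_iff)
  then show "x = cls v" using w by (metis cls_eq_iff)
  show "v \<in> Ld"
    using add_subgroup_add[OF Ld_subgroup w(1), of "v - w"] \<open>v - w \<in> L\<close> L_sub_Ld by auto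
qed

lemma disc_cases:
  assumes "x \<in> disc L b"
  obtains v where "v \<in> Ld" "x = cls v"
  using assms by (auto simp: disc_eq)

lemma class_rep_cls: "class_rep (cls v) - v \<in> L"
  using someI[of "\<lambda>w. w \<in> cls v" v] by (simp add: class_rep_def in_cls_iff)

lemma class_rep_in: "x \<in> disc L b \<Longrightarrow> class_rep x \<in> x"
  by (elim disc_cases) (simp add: in_cls_iff class_rep_cls)

lemma class_rep_Ld: "x \<in> disc L b \<Longrightarrow> class_rep x \<in> Ld"
  using class_rep_in disc_memD(1) by blast

lemma cls_class_rep: "x \<in> disc L b \<Longrightarrow> cls (class_rep x) = x"
  using class_rep_in disc_memD(2) by blast

lemma qclass_cong: "x \<in> disc L b \<Longrightarrow> v \<in> x \<Longrightarrow> qclass b x - q v \<in> \<int>"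
  unfolding qclass_def
  by (metis class_rep_Ld class_rep_in disc_memD in_cls_iff q_cong')

lemma disc_mult: "cls v \<otimes>\<^bsub>disc_group L b\<^esub> cls w = cls (v + w)"
proof -
  have "cls v \<otimes>\<^bsub>disc_group L b\<^esub> cls w = {x + y | x y. x \<in> cls v \<and> y \<in> cls w}"
    by (auto simp: disc_group_def FactGroup_def set_mult_def add_monoid_on_def)
  also have "\<dots> = cls (v + w)"
  proof (rule equalityI; rule subsetI)
    fix z assume "z \<in> {x + y | x y. x \<in> cls v \<and> y \<in> cls w}"
    then obtain x y where "z = x + y" "x - v \<in> L" "y - w \<in> L" by (auto simp: in_cls_iff)
    then show "z \<in> cls (v + w)"
      using add_subgroup_add[OF L_subgroup, of "x - v" "y - w"] by (simp add: in_cls_iff algebra_simps)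
  next
    fix z assume "z \<in> cls (v + w)"
    then have "z = (z - w) + w" "z - w \<in> cls v" "w \<in> cls w" by (auto simp: in_cls_iff algebra_simps)
    then show "z \<in> {x + y | x y. x \<in> cls v \<and> y \<in> cls w}" by blast
  qed
  finally show ?thesis .
qed

lemma disc_one: "\<one>\<^bsub>disc_group L b\<^esub> = cls 0"
  by (simp add: disc_group_def FactGroup_def cls_def)

lemma disc_pow: "cls v [^]\<^bsub>disc_group L b\<^esub> (n::nat) = cls (real n *\<^sub>R v)"
  by (induction n) (simp_all add: disc_one disc_mult algebra_simps)

lemma disc_kernel_eq: "disc_kernel L b m = {cls v | v. v \<in> Ld \<and> real m *\<^sub>R v \<in> L}"
proof -
  have "{x \<in> cls ` Ld. P x} = {cls v | v. v \<in> Ld \<and> P (cls v)}" for P by blast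
  then show ?thesis
    unfolding disc_kernel_def disc_eq by (simp only: disc_pow disc_one cls_eq_iff diff_zero)
qed

section \<open>Residue systems of L modulo nL\<close>

abbreviation nL :: "nat \<Rightarrow> 'v set" where "nL n \<equiv> (\<lambda>v. real n *\<^sub>R v) ` L"

lemma nL_subgroup: "add_subgroup (nL n)"
  by (rule add_subgroup_scaled[OF L_subgroup])

lemma L_scale: "x \<in> L \<Longrightarrow> of_int n *\<^sub>R x \<in> L" "x \<in> L \<Longrightarrow> real m *\<^sub>R x \<in> L"
  using add_subgroup_int_scaleR[OF L_subgroup, of x n] add_subgroup_int_scaleR[OF L_subgroup, of x "int m"]
  by simp_all

lemma Ld_scale: "x \<in> Ld \<Longrightarrow> of_int n *\<^sub>R x \<in> Ld" "x \<in> Ld \<Longrightarrow> real m *\<^sub>R x \<in> Ld"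
  using add_subgroup_int_scaleR[OF Ld_subgroup, of x n] add_subgroup_int_scaleR[OF Ld_subgroup, of x "int m"]
  by simp_all

lemma nL_sub: "nL n \<subseteq> L"
  using L_scale(2) by blast

text \<open>Division with remainder by n in each coordinate of a basis leaves digits 0, ..., n -
  1.\<close>

lemma obtain_transversal_nL:
  assumes "n > 0"
  obtains R where "transversal L (nL n) R" "card R = n ^ lattice_rank L"
proof -
  obtain B where B: "finite B" "independent B" "card B = lattice_rank L"
    "L = {\<Sum>x\<in>B. of_int (a x) *\<^sub>R x | a :: 'v \<Rightarrow> int. True}"
    by (rule obtain_basis)
  define s where "s = (\<lambda>a :: 'v \<Rightarrow> int. \<Sum>x\<in>B. of_int (a x) *\<^sub>R x)"
  have sL: "s a \<in> L" for a unfolding B(4) s_def by blast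
  have s_diff: "s a - s c = s (\<lambda>x. a x - c x)" for a c
    by (simp add: s_def sum_subtractf scaleR_diff_left)
  have s_n: "real n *\<^sub>R s c = s (\<lambda>x. int n * c x)" for c
    by (simp add: s_def scaleR_sum_right)
  have s_inj: "a x = c x" if "s a = s c" "x \<in> B" for a c x
  proof -
    have "(\<Sum>x\<in>B. of_int (a x - c x) *\<^sub>R x) = 0"
      using that(1) s_diff[of a c] by (simp add: s_def)
    then have "real_of_int (a x - c x) = 0"
      using independentD[OF B(2,1) subset_refl, of "\<lambda>z. real_of_int (a z - c z)" x] that(2) by blast
    then show ?thesis by simp
  qed
  define P where "P = PiE B (\<lambda>_. {0..<int n})"
  have inj: "inj_on s P"
  proof (rule inj_onI)
    fix a c assume "a \<in> P" "c \<in> P" "s a = s c"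
    then show "a = c" unfolding P_def using s_inj by (intro PiE_ext) auto
  qed
  have "card (s ` P) = n ^ lattice_rank L"
    unfolding card_image[OF inj] by (simp add: P_def card_PiE B)
  moreover have "transversal L (nL n) (s ` P)"
  proof (rule transversalI)
    show "finite (s ` P)" using B by (auto simp: P_def intro!: finite_PiE)
    show "s ` P \<subseteq> L" using sL by auto
    fix v assume "v \<in> L"
    then obtain a where a: "v = s a" unfolding B(4) s_def by blast
    have "v - s (restrict (\<lambda>x. a x mod int n) B) = real n *\<^sub>R s (\<lambda>x. a x div int n)"
      unfolding a s_diff s_n unfolding s_def
      by (rule sum.cong) (auto simp: minus_mod_eq_mult_div[symmetric])
    moreover have "restrict (\<lambda>x. a x mod int n) B \<in> P" using assms by (auto simp: P_def)
    ultimately show "\<exists>r\<in>s ` P. v - r \<in> nL n" using sL by blast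
  next
    fix r r' assume *: "r \<in> s ` P" "r' \<in> s ` P" "r - r' \<in> nL n"
    then obtain a a' where a: "a \<in> P" "a' \<in> P" "r = s a" "r' = s a'" by blast
    obtain c where "r - r' = real n *\<^sub>R s c" using *(3) unfolding B(4) s_def by blast
    then have "s (\<lambda>x. a x - a' x) = s (\<lambda>x. int n * c x)" by (simp add: a s_diff s_n)
    then have eq: "a x - a' x = int n * c x" if "x \<in> B" for x using s_inj that by blast
    have "a x = a' x" if x: "x \<in> B" for x
    proof -
      have "a x \<in> {0..<int n}" "a' x \<in> {0..<int n}" using a x by (auto simp: P_def)
      moreover have "a x mod int n = a' x mod int n" using eq[OF x] by (metis mod_eq_dvd_iff dvd_triv_left)
      ultimately show ?thesis by simp
    qed
    then show "r = r'" by (simp add: a s_def)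
  qed (rule nL_subgroup)
  ultimately show ?thesis using that by blast
qed

lemma card_transversal_nL:
  assumes "n > 0" "transversal L (nL n) R"
  shows "card R = n ^ lattice_rank L"
  by (metis assms obtain_transversal_nL transversal_card_eq nL_subgroup)

lemma lattice_mod_eq: "lattice_mod L n = (\<lambda>v. (\<lambda>h. h + v) ` nL n) ` L"
  by (auto simp: lattice_mod_def FactGroup_def RCOSETS_def r_coset_def add_monoid_on_def)

text \<open>The representation numbers are counted over cosets with a chosen representative; this
  moves them to an arbitrary transversal.\<close>

lemma sum_lattice_mod:
  fixes F :: "'v \<Rightarrow> 'c::comm_monoid_add"
  assumes R: "transversal L (nL n) R"
    and F: "\<And>v w. v \<in> L \<Longrightarrow> w \<in> L \<Longrightarrow> v - w \<in> nL n \<Longrightarrow> F v = F w"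
  shows "(\<Sum>v\<in>lattice_mod L n. F (class_rep v)) = (\<Sum>r\<in>R. F r)"
proof -
  define c where "c = (\<lambda>v. (\<lambda>h. h + v) ` nL n)"
  have in_c: "x \<in> c v \<longleftrightarrow> x - v \<in> nL n" for x v
    unfolding c_def by (rule mem_translation_iff)
  have c_self: "v \<in> c v" for v by (simp add: in_c add_subgroup_0[OF nL_subgroup])
  have c_eq: "c v = c w \<longleftrightarrow> v - w \<in> nL n" for v w
  proof
    assume "c v = c w" then show "v - w \<in> nL n" using c_self[of v] by (simp add: in_c)
  next
    assume "v - w \<in> nL n"
    then have "x - v \<in> nL n \<longleftrightarrow> x - w \<in> nL n" for x
      using add_subgroup_trans[OF nL_subgroup, of x v n w] add_subgroup_trans[OF nL_subgroup, of x w n v]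
        add_subgroup_diff_commute[OF nL_subgroup, of v w n] by blast
    then show "c v = c w" by (auto simp: in_c set_eq_iff)
  qed
  have bij: "bij_betw c R (lattice_mod L n)"
  proof (rule bij_betwI')
    show "(c r = c r') = (r = r')" if "r \<in> R" "r' \<in> R" for r r'
      using that transversal_unique[OF R nL_subgroup] add_subgroup_0[OF nL_subgroup] by (auto simp: c_eq)
    show "c r \<in> lattice_mod L n" if "r \<in> R" for r
      using transversal_subset[OF R that] by (auto simp: lattice_mod_eq c_def)
    fix y assume "y \<in> lattice_mod L n"
    then obtain v where v: "v \<in> L" "y = c v" by (auto simp: lattice_mod_eq c_def)
    then show "\<exists>r\<in>R. y = c r" using transversal_ex[OF R v(1)] c_eq by blast
  qed
  have "(\<Sum>v\<in>lattice_mod L n. F (class_rep v)) = (\<Sum>r\<in>R. F (class_rep (c r)))"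
    by (rule sum.reindex_bij_betw[OF bij, symmetric])
  also have "\<dots> = (\<Sum>r\<in>R. F r)"
  proof (rule sum.cong)
    fix r assume r: "r \<in> R"
    have d: "class_rep (c r) - r \<in> nL n"
      using someI[of "\<lambda>w. w \<in> c r" r] c_self by (simp add: class_rep_def in_c)
    then have "class_rep (c r) - r \<in> L" using nL_sub by blast
    then have "class_rep (c r) \<in> L"
      using add_subgroup_add[OF L_subgroup _ transversal_subset[OF R r]] by fastforce
    then show "F (class_rep (c r)) = F r"
      using F d transversal_subset[OF R r] by blast
  qed simp
  finally show ?thesis .
qed

text \<open>\<open>card\<close> is 0 on infinite sets, so a positive cardinality proves
  finiteness.\<close>

lemma finite_lattice_mod: "n > 0 \<Longrightarrow> finite (lattice_mod L n)"
proof -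
  assume "n > 0"
  then obtain R where R: "transversal L (nL n) R" "card R = n ^ lattice_rank L"
    by (rule obtain_transversal_nL)
  have "(\<Sum>v\<in>lattice_mod L n. (1::nat)) = (\<Sum>r\<in>R. 1)"
    by (rule sum_lattice_mod[OF R(1)]) simp
  then have "card (lattice_mod L n) > 0" using R(2) \<open>n > 0\<close> by simp
  then show ?thesis by (rule card_ge_0_finite)
qed

subsection \<open>Orthogonal frames\<close>

lemma orthogonal_independent:
  assumes "\<And>v. v \<in> F \<Longrightarrow> b v v \<noteq> 0" "\<And>v w. v \<in> F \<Longrightarrow> w \<in> F \<Longrightarrow> v \<noteq> w \<Longrightarrow> b v w = 0"
  shows "independent F"
proof
  assume "dependent F"
  then obtain T u v where T: "finite T" "T \<subseteq> F" "v \<in> T" "u v \<noteq> 0" "(\<Sum>w\<in>T. u w *\<^sub>R w) = 0"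
    unfolding dependent_explicit by blast
  have "0 = b (\<Sum>w\<in>T. u w *\<^sub>R w) v" by (simp add: T bil_0)
  also have "\<dots> = (\<Sum>w\<in>T. if w = v then u v * b v v else 0)"
    unfolding bil_sum by (rule sum.cong) (use T assms(2) in \<open>auto simp: bil_simps\<close>)
  also have "\<dots> = u v * b v v" using T by simp
  finally show False using T assms(1) by auto
qed

text \<open>Take an orthogonal family of anisotropic lattice vectors of maximal size. On its
  complement \<open>K\<close> in L the form vanishes, by maximality and polarisation. Every lattice
  vector projects into \<open>K\<close> after scaling, so \<open>K\<close> lies in the radical and
  is trivial.\<close>

lemma obtain_orthogonal_frame:
  obtains F where "finite F" "F \<subseteq> L" "independent F" "span F = span L" "\<And>v. v \<in> F \<Longrightarrow> b v v \<noteq> 0"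
    "\<And>v w. v \<in> F \<Longrightarrow> w \<in> F \<Longrightarrow> v \<noteq> w \<Longrightarrow> b v w = 0"
proof -
  obtain B where B: "finite B" "independent B" "B \<subseteq> L" "span L = span B"
    by (rule obtain_basis)
  define P where "P = (\<lambda>F. F \<subseteq> L \<and> (\<forall>v\<in>F. b v v \<noteq> 0) \<and> (\<forall>v\<in>F. \<forall>w\<in>F. v \<noteq> w \<longrightarrow> b v w = 0))"
  have bound: "finite F \<and> card F \<le> card B" if "P F" for F
  proof (rule independent_span_bound[OF B(1)])
    show "independent F" using that by (intro orthogonal_independent) (auto simp: P_def)
    show "F \<subseteq> span B" using that L_span B(4) by (auto simp: P_def)
  qed
  have "P {}" by (simp add: P_def)
  then obtain F where F: "P F" "\<And>F'. P F' \<Longrightarrow> card F' \<le> card F"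
    using ex_has_greatest_nat[of P "{}" card "card B + 1"] bound by (metis Suc_eq_plus1 le_imp_less_Suc)
  have fin: "finite F" using bound F by blast
  define K where "K = {x \<in> L. \<forall>v\<in>F. b x v = 0}"
  have K_iso: "b k k = 0" if "k \<in> K" for k
  proof (rule ccontr)
    assume k: "b k k \<noteq> 0"
    then have "k \<notin> F" using that by (auto simp: K_def)
    have "b v k = 0" if "v \<in> F" for v
      using \<open>k \<in> K\<close> that unfolding symmetric[of v k] by (simp add: K_def)
    then have "P (insert k F)" using F(1) \<open>k \<in> K\<close> k by (simp add: P_def K_def)
    then have "card (insert k F) \<le> card F" by (rule F(2))
    then show False using \<open>k \<notin> F\<close> fin by simp
  qed
  have K_b: "b x y = 0" if "x \<in> K" "y \<in> K" for x y
  proof -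
    have "x + y \<in> K" using that add_subgroup_add[OF L_subgroup] by (auto simp: K_def bil_simps)
    then have "b (x + y) (x + y) = 0" by (rule K_iso)
    then show ?thesis using K_iso[OF that(1)] K_iso[OF that(2)] by (simp add: bil_simps symmetric[of y x])
  qed
  \<comment> \<open>The product of the norms clears the denominators b(v, v) of the projection and
    so keeps it inside L.\<close>
  define N where "N = (\<Prod>v\<in>F. b v v)"
  have N: "N \<noteq> 0" using F(1) fin by (simp add: N_def P_def)
  define \<pi> where "\<pi> = (\<lambda>y. N *\<^sub>R y - (\<Sum>v\<in>F. (N / b v v * b y v) *\<^sub>R v))"
  have bF: "b (\<Sum>v\<in>F. c v *\<^sub>R v) w = c w * b w w" if "w \<in> F" for c w
  proof -
    have "b (\<Sum>v\<in>F. c v *\<^sub>R v) w = (\<Sum>v\<in>F. if v = w then c w * b w w else 0)"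
      unfolding bil_sum by (rule sum.cong) (use F(1) that in \<open>auto simp: bil_simps P_def\<close>)
    then show ?thesis using fin that by simp
  qed
  have int: "x *\<^sub>R v \<in> L" if "x \<in> \<int>" "v \<in> L" for x v using that L_scale(1) by (auto elim!: Ints_cases)
  have F_int: "b v w \<in> \<int>" if "v \<in> L" "w \<in> F" for v w using that b_int F(1) by (auto simp: P_def)
  have pi_K: "\<pi> y \<in> K" if y: "y \<in> L" for y
  proof -
    have "N / b v v \<in> \<int>" if v: "v \<in> F" for v
    proof -
      have "N = b v v * (\<Prod>w\<in>F - {v}. b w w)" unfolding N_def by (rule prod.remove[OF fin v])
      then have "N / b v v = (\<Prod>w\<in>F - {v}. b w w)" using F(1) v by (simp add: P_def)
      also have "\<dots> \<in> \<int>" by (rule Ints_prod) (use F_int F(1) in \<open>auto simp: P_def\<close>)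
      finally show ?thesis .
    qed
    then have "(N / b v v * b y v) *\<^sub>R v \<in> L" if "v \<in> F" for v
      by (intro int Ints_mult F_int that y) (use F(1) that in \<open>auto simp: P_def\<close>)
    then have "(\<Sum>v\<in>F. (N / b v v * b y v) *\<^sub>R v) \<in> L"
      by (induction rule: finite_induct[OF fin])
        (use add_subgroup_0[OF L_subgroup] add_subgroup_add[OF L_subgroup] in auto)
    moreover have "N \<in> \<int>" unfolding N_def by (rule Ints_prod) (use F_int F(1) in \<open>auto simp: P_def\<close>)
    ultimately have "\<pi> y \<in> L" unfolding \<pi>_def by (intro add_subgroup_diff[OF L_subgroup] int y)
    moreover have "b (\<pi> y) w = 0" if "w \<in> F" for w
      using F(1) that by (simp add: \<pi>_def bil_simps bF P_def)
    ultimately show ?thesis by (simp add: K_def)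
  qed
  have K0: "x = 0" if x: "x \<in> K" for x
  proof (rule nondegenerate)
    show "x \<in> span L" using x L_span by (simp add: K_def)
    have "b x y = 0" if "y \<in> L" for y
    proof -
      have "0 = b x (\<pi> y)" using K_b[OF x pi_K[OF that]] by simp
      also have "\<dots> = N * b x y" using x by (simp add: \<pi>_def bil_simps bil_sum K_def)
      finally show ?thesis using N by simp
    qed
    then have "L \<subseteq> {y. b x y = 0}" by blast
    then have "span L \<subseteq> {y. b x y = 0}"
      by (intro span_minimal) (auto simp: subspace_def bil_simps)
    then show "\<forall>y\<in>span L. b x y = 0" by blast
  qed
  have "y \<in> span F" if "y \<in> L" for y
  proof -
    have "N *\<^sub>R y = (\<Sum>v\<in>F. (N / b v v * b y v) *\<^sub>R v)" using K0[OF pi_K[OF that]] by (simp add: \<pi>_def)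
    also have "\<dots> \<in> span F" by (intro span_sum span_scale span_base)
    finally have "(1 / N) *\<^sub>R (N *\<^sub>R y) \<in> span F" by (rule span_scale)
    then show ?thesis using N by simp
  qed
  then have "span F = span L" using F(1) by (metis P_def span_mono span_span subsetI subset_antisym)
  moreover have "independent F" using F(1) by (intro orthogonal_independent) (auto simp: P_def)
  ultimately show ?thesis using that[of F] fin F(1) by (auto simp: P_def)
qed

end

subsection \<open>The Gaussian of a majorant\<close>

text \<open>Orthogonality turns q into a sum of one-variable squares, so Gaussians and their Poisson
  summation factor over F. F spans the same space as L, but over the integers only a sublattice of
  finite index.\<close>

locale framed_lattice = even_lattice L b for L :: "'v::real_vector set" and b +
  fixes F :: "'v set"
  assumes finF: "finite F" and FL: "F \<subseteq> L" and indF: "independent F" and spanF: "span F = span L"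
    and F_nonzero: "v \<in> F \<Longrightarrow> b v v \<noteq> 0"
    and F_orth: "v \<in> F \<Longrightarrow> w \<in> F \<Longrightarrow> v \<noteq> w \<Longrightarrow> b v w = 0"
begin

definition coord :: "'v \<Rightarrow> 'v \<Rightarrow> real" where
  "coord v x = b x v / b v v"

lemma coord_simps: "coord v (x + y) = coord v x + coord v y" "coord v (x - y) = coord v x - coord v y"
    "coord v (- x) = - coord v x" "coord v (r *\<^sub>R x) = r * coord v x" "coord v 0 = 0"
  by (simp_all add: coord_def bil_simps add_divide_distrib diff_divide_distrib)

lemma coord_frame_sum:
  assumes "v \<in> F" shows "coord v (\<Sum>w\<in>F. c w *\<^sub>R w) = c v"
proof -
  have "b (\<Sum>w\<in>F. c w *\<^sub>R w) v = (\<Sum>w\<in>F. if w = v then c v * b v v else 0)"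
    unfolding bil_sum by (rule sum.cong) (use F_orth assms in \<open>auto simp: bil_simps\<close>)
  then show ?thesis using finF assms F_nonzero by (simp add: coord_def)
qed

lemma frame_expansion:
  assumes "x \<in> span L" shows "x = (\<Sum>v\<in>F. coord v x *\<^sub>R v)"
proof -
  have "x \<in> span F" using assms by (simp add: spanF)
  then obtain c where c: "x = (\<Sum>v\<in>F. c v *\<^sub>R v)" by (auto simp: span_finite[OF finF])
  have "coord v x = c v" if "v \<in> F" for v unfolding c by (rule coord_frame_sum[OF that])
  then show ?thesis using c by simp
qed

lemma b_frame:
  assumes "x \<in> span L" shows "b x y = (\<Sum>v\<in>F. b v v * coord v x * coord v y)"
proof -
  have "b x y = (\<Sum>v\<in>F. coord v x * b v y)"
    by (subst frame_expansion[OF assms]) (simp add: bil_sum bil_simps)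
  also have "\<dots> = (\<Sum>v\<in>F. b v v * coord v x * coord v y)"
    by (rule sum.cong) (use F_nonzero in \<open>auto simp: coord_def symmetric[of y]\<close>)
  finally show ?thesis .
qed

lemma q_frame: "x \<in> span L \<Longrightarrow> q x = (\<Sum>v\<in>F. b v v / 2 * (coord v x)\<^sup>2)"
  by (simp add: qform_def b_frame sum_divide_distrib power2_eq_square mult.assoc)

text \<open>Sylvester's law of inertia: on a definite subspace the projection to the directions of
  the same sign is injective, since a vector x in its kernel has s b(x, x) \<le> 0. The factor s
  treats both indices at once.\<close>

lemma Max_dim_definite:
  assumes s: "s = 1 \<or> s = -1"
  shows "Max {dim W | W. subspace W \<and> W \<subseteq> span L \<and> (\<forall>x\<in>W. x \<noteq> 0 \<longrightarrow> s * b x x > 0)} = card {v\<in>F. s * b v v > 0}"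
    (is "Max ?D = card ?P")
proof (rule Max_eqI)
  have fP: "finite ?P" using finF by simp
  have le: "dim W \<le> card ?P"
    if W: "subspace W" "W \<subseteq> span L" "\<forall>x\<in>W. x \<noteq> 0 \<longrightarrow> s * b x x > 0" for W
  proof -
    obtain B where B: "B \<subseteq> W" "independent B" "W \<subseteq> span B" "card B = dim W"
      using basis_exists[of W] by blast
    have spB: "span B = W" using B W(1) by (metis span_minimal subset_antisym)
    define \<pi> where "\<pi> = (\<lambda>x. \<Sum>v\<in>?P. coord v x *\<^sub>R v)"
    have lin: "linear \<pi>" unfolding \<pi>_def
      by (rule linearI) (simp_all add: coord_simps scaleR_left_distrib sum.distrib scaleR_sum_right)
    have "x = 0" if x: "x \<in> W" "\<pi> x = 0" for x
    proof (rule ccontr)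
      assume "x \<noteq> 0"
      then have "s * b x x > 0" using W x by blast
      have crd0: "coord v x = 0" if "v \<in> ?P" for v
        using independentD[OF independent_mono[OF indF, of ?P] fP subset_refl _ that, of "\<lambda>v. coord v x"] x(2)
        by (auto simp: \<pi>_def)
      have "s * b x x = (\<Sum>v\<in>F. s * b v v * (coord v x)\<^sup>2)"
        using x(1) W(2) by (subst b_frame) (auto simp: sum_distrib_left power2_eq_square mult_ac)
      also have "\<dots> \<le> 0"
      proof (rule sum_nonpos)
        fix v assume "v \<in> F"
        then show "s * b v v * (coord v x)\<^sup>2 \<le> 0"
          using crd0[of v] by (cases "s * b v v > 0") (auto intro: mult_nonpos_nonneg)
      qed
      finally show False using \<open>s * b x x > 0\<close> by simp
    qed
    then have inj: "inj_on \<pi> (span B)"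
      unfolding spB using linear_injective_on_subspace_0[OF lin W(1)] by blast
    have "independent (\<pi> ` B)" by (rule linear_independent_injective_image[OF lin B(2) inj])
    moreover have "\<pi> ` B \<subseteq> span ?P" unfolding \<pi>_def by (auto intro!: span_sum span_scale intro: span_base)
    ultimately have "card (\<pi> ` B) \<le> card ?P" using independent_span_bound[OF fP] by blast
    moreover have "card (\<pi> ` B) = card B"
      by (rule card_image) (rule inj_on_subset[OF inj], rule span_superset)
    ultimately show ?thesis using B(4) by simp
  qed
  show leD: "y \<le> card ?P" if D: "y \<in> ?D" for y
  proof -
    obtain W where W: "y = dim W" "subspace W" "W \<subseteq> span L" "\<forall>x\<in>W. x \<noteq> 0 \<longrightarrow> s * b x x > 0"
      using D by (elim CollectE exE conjE)
    show ?thesis unfolding W(1) by (rule le[OF W(2-4)])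
  qed
  show "finite ?D" by (rule finite_subset[of _ "{..card ?P}"], rule subsetI, rule atMost_iff[THEN iffD2], erule leD, simp)
  have "dim (span ?P) = card ?P"
    by (rule dim_span_eq_card_independent, rule independent_mono[OF indF]) simp
  moreover have "span ?P \<subseteq> span L" unfolding spanF[symmetric] by (rule span_mono) blast
  moreover have "s * b x x > 0" if x: "x \<in> span ?P" "x \<noteq> 0" for x
  proof -
    have xL: "x \<in> span L" using calculation(2) x by blast
    have crd0: "coord v x = 0" if "v \<in> F - ?P" for v
      using x(1)
    proof (induction rule: span_induct_alt)
      case (step c w y)
      then show ?case using that F_orth[of w v] by (auto simp: coord_simps) (auto simp: coord_def)
    qed (simp add: coord_simps)
    have ex: "\<exists>v\<in>?P. coord v x \<noteq> 0"
    proof (rule ccontr)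
      assume "\<not> ?thesis"
      then have "(\<Sum>v\<in>F. coord v x *\<^sub>R v) = 0" using crd0 by (intro sum.neutral) auto
      then show False using frame_expansion[OF xL] x by simp
    qed
    have "0 < (\<Sum>v\<in>?P. s * b v v * (coord v x)\<^sup>2)"
    proof -
      obtain v where v: "v \<in> ?P" "coord v x \<noteq> 0" using ex by blast
      show ?thesis by (rule sum_pos2[OF fP v(1)]) (use v in auto)
    qed
    also have "\<dots> = (\<Sum>v\<in>F. s * b v v * (coord v x)\<^sup>2)"
      by (rule sum.mono_neutral_left[OF finF]) (use crd0 in auto)
    also have "\<dots> = s * b x x"
      by (subst b_frame[OF xL]) (simp add: sum_distrib_left power2_eq_square mult_ac)
    finally show ?thesis .
  qed
  ultimately show "card ?P \<in> ?D" by (intro CollectI exI[of _ "span ?P"]) auto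
qed

definition pos_rank :: nat where "pos_rank = card {v\<in>F. b v v > 0}"
definition neg_rank :: nat where "neg_rank = card {v\<in>F. b v v < 0}"

lemma pos_index_eq: "pos_index L b = pos_rank"
  using Max_dim_definite[of 1] by (simp add: pos_index_def pos_rank_def)

lemma neg_index_eq: "neg_index L b = neg_rank"
  using Max_dim_definite[of "-1"] by (simp add: neg_index_def neg_rank_def)

lemma rank_eq: "lattice_rank L = pos_rank + neg_rank"
proof -
  have "lattice_rank L = card F"
    unfolding lattice_rank_def spanF[symmetric] by (rule dim_span_eq_card_independent[OF indF])
  also have "F = {v\<in>F. b v v > 0} \<union> {v\<in>F. b v v < 0}" using F_nonzero by (auto simp: linorder_neq_iff)
  also have "card \<dots> = pos_rank + neg_rank"
    unfolding pos_rank_def neg_rank_def by (rule card_Un_disjoint) (use finF in auto)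
  finally show ?thesis .
qed

text \<open>The positive directions carry the variable \<open>\<tau>\<close>, the negative ones its conjugate.\<close>

definition gauss :: "complex \<Rightarrow> 'v \<Rightarrow> complex" where
  "gauss \<tau> x = (\<Prod>v\<in>F. e ((if b v v > 0 then \<tau> else cnj \<tau>) * of_real (b v v / 2 * (coord v x)\<^sup>2)))"

text \<open>At z with z^2 = c \<tau> + d this is the automorphy factor of the theta vectors, of
  weight half the positive index in \<tau> and half the negative index in its conjugate.\<close>

definition frame_factor :: "complex \<Rightarrow> complex" where
  "frame_factor z = z ^ pos_rank * cnj z ^ neg_rank"

lemma frame_factor_mult: "frame_factor (z * w) = frame_factor z * frame_factor w"
  by (simp add: frame_factor_def power_mult_distrib)

lemma frame_factor_of_real: "frame_factor (of_real r) = of_real (r ^ lattice_rank L)"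
  by (simp add: frame_factor_def rank_eq power_add)

lemma frame_factor_prod: "(\<Prod>v\<in>F. if b v v > 0 then z else cnj z) = frame_factor z"
proof -
  have "(\<Prod>v\<in>F. if b v v > 0 then z else cnj z) = (\<Prod>v\<in>{v\<in>F. b v v > 0}. z) * (\<Prod>v\<in>{v\<in>F. \<not> b v v > 0}. cnj z)"
    by (subst prod.If_cases[OF finF]) (simp add: Collect_conj_eq Collect_neg_eq Int_commute)
  also have "{v\<in>F. \<not> b v v > 0} = {v\<in>F. b v v < 0}"
    using F_nonzero by (auto simp: linorder_neq_iff not_less) force
  finally show ?thesis by (simp add: frame_factor_def pos_rank_def neg_rank_def)
qed

lemma gauss_uminus: "gauss \<tau> (- x) = gauss \<tau> x"
  by (simp add: gauss_def coord_simps)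

text \<open>A real translation is fixed by conjugation, so positive and negative directions combine
  to the phase of q itself.\<close>

lemma gauss_add_real:
  assumes "x \<in> span L" shows "gauss (\<tau> + of_real r) x = e (of_real (r * q x)) * gauss \<tau> x"
proof -
  have "e (of_real (r * q x)) = (\<Prod>v\<in>F. e (of_real (r * (b v v / 2 * (coord v x)\<^sup>2))))"
    unfolding q_frame[OF assms] sum_distrib_left of_real_sum by (rule e_sum[OF finF])
  show ?thesis
  proof -
    have *: "e ((z + of_real r) * of_real X) = e (of_real (r * X)) * e (z * of_real X)" for z X
      by (simp add: e_add[symmetric] algebra_simps)
    have **: "(if c then \<tau> + of_real r else cnj (\<tau> + of_real r)) = (if c then \<tau> else cnj \<tau>) + of_real r" for c
      by simp
    show ?thesis
      unfolding gauss_def ** * prod.distrib \<open>e (of_real (r * q x)) = _\<close> ..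
  qed
qed

lemma gauss_scale: "gauss \<tau> (r *\<^sub>R x) = gauss (of_real (r\<^sup>2) * \<tau>) x"
  unfolding gauss_def by (intro prod.cong refl) (auto simp: coord_simps power_mult_distrib mult_ac)

lemma norm_gauss: "norm (gauss \<tau> x) = (\<Prod>v\<in>F. exp (- (pi * Im \<tau> * \<bar>b v v\<bar>) * (coord v x)\<^sup>2))"
  unfolding gauss_def prod_norm[symmetric]
  by (intro prod.cong refl) (auto simp: norm_e algebra_simps)

lemma gauss_imaginary: "gauss (\<i> * of_real y) x = of_real (\<Prod>v\<in>F. exp (- (pi * y * \<bar>b v v\<bar>) * (coord v x)\<^sup>2))"
proof -
  have *: "e (\<i> * of_real y * of_real X) = of_real (exp (- (2 * pi * y * X)))"
    "e (cnj (\<i> * of_real y) * of_real X) = of_real (exp (2 * pi * y * X))" for X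
    by (simp_all add: e_def exp_of_real[symmetric] algebra_simps)
  show ?thesis
    unfolding gauss_def of_real_prod if_distrib[of "\<lambda>z. e (z * _)"] *
    by (intro prod.cong refl) (auto simp: mult_ac simp del: of_real_mult of_real_power of_real_prod)
qed

section \<open>The lattice spanned by the frame and its dual\<close>

definition frame_vec :: "('v \<Rightarrow> real) \<Rightarrow> ('v \<Rightarrow> int) \<Rightarrow> 'v" where
  "frame_vec c n = (\<Sum>v\<in>F. (of_int (n v) * c v) *\<^sub>R v)"

text \<open>The two lattices enclose the given ones: \<open>frame_lattice\<close> \<subseteq> L
  \<subseteq> L' \<subseteq> \<open>dual_frame_lattice\<close>. The vectors v / b(v, v) are the
  basis dual to F.\<close>

definition frame_lattice :: "'v set" where "frame_lattice = frame_vec (\<lambda>_. 1) ` (F \<rightarrow>\<^sub>E UNIV)"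
definition dual_frame_lattice :: "'v set" where "dual_frame_lattice = frame_vec (\<lambda>v. 1 / b v v) ` (F \<rightarrow>\<^sub>E UNIV)"

lemma coord_frame_vec: "v \<in> F \<Longrightarrow> coord v (frame_vec c n) = of_int (n v) * c v"
  unfolding frame_vec_def by (rule coord_frame_sum)

lemma frame_vec_span: "frame_vec c n \<in> span L"
  unfolding frame_vec_def spanF[symmetric] by (intro span_sum span_scale span_base)

lemma inj_frame_vec:
  assumes "\<And>v. v \<in> F \<Longrightarrow> c v \<noteq> 0" shows "inj_on (frame_vec c) (F \<rightarrow>\<^sub>E UNIV)"
proof (rule inj_onI)
  fix n m assume *: "n \<in> F \<rightarrow>\<^sub>E UNIV" "m \<in> F \<rightarrow>\<^sub>E UNIV" "frame_vec c n = frame_vec c m"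
  have "n v = m v" if "v \<in> F" for v
    using coord_frame_vec[OF that, of c n] coord_frame_vec[OF that, of c m] *(3) assms[OF that] by simp
  then show "n = m" using * by (intro PiE_ext) auto
qed

lemma frame_vec_mem: "frame_vec c (restrict n F) \<in> frame_vec c ` (F \<rightarrow>\<^sub>E UNIV)"
  by auto

text \<open>The norm is a product of one-variable Gaussians. Summability over the largest of the
  four lattices passes to all subsets.\<close>

lemma gauss_summable_dual_frame:
  assumes "Im \<tau> > 0"
  shows "(\<lambda>x. gauss \<tau> (x + u)) summable_on dual_frame_lattice"
proof -
  have inj: "inj_on (frame_vec (\<lambda>v. 1 / b v v)) (F \<rightarrow>\<^sub>E UNIV)"
    by (rule inj_frame_vec) (simp add: F_nonzero)
  define f where "f = (\<lambda>v (n::int). exp (- (pi * Im \<tau> * \<bar>b v v\<bar>) * (of_int n * (1 / b v v) + coord v u)\<^sup>2))"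
  have f: "(\<lambda>n. norm (f v n)) summable_on UNIV" if "v \<in> F" for v
  proof -
    have "(\<lambda>n::int. exp (- (pi * Im \<tau> / \<bar>b v v\<bar>) * (of_int n + b v v * coord v u)\<^sup>2)) summable_on UNIV"
      by (rule summable_gaussian_int) (use assms F_nonzero[OF that] in simp)
    moreover have "pi * Im \<tau> / \<bar>b v v\<bar> * (of_int n + b v v * coord v u)\<^sup>2
        = pi * Im \<tau> * \<bar>b v v\<bar> * (of_int n * (1 / b v v) + coord v u)\<^sup>2" for n :: int
      using F_nonzero[OF that]
      by (cases "b v v > 0") (auto simp: power2_eq_square field_simps)
    ultimately show ?thesis by (simp add: f_def)
  qed
  have "Infinite_Set_Sum.abs_summable_on (\<lambda>n. \<Prod>v\<in>F. f v (n v)) (F \<rightarrow>\<^sub>E UNIV)"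
    by (rule abs_summable_on_prod_PiE[OF finF], simp, unfold abs_summable_equivalent[symmetric], rule f)
  then have "(\<lambda>n. norm (\<Prod>v\<in>F. f v (n v))) summable_on (F \<rightarrow>\<^sub>E UNIV)"
    by (unfold abs_summable_equivalent[symmetric])
  then have "(\<lambda>n. norm (gauss \<tau> (frame_vec (\<lambda>v. 1 / b v v) n + u))) summable_on (F \<rightarrow>\<^sub>E UNIV)"
    by (simp add: norm_gauss coord_simps coord_frame_vec f_def prod_nonneg)
  then have "(\<lambda>n. gauss \<tau> (frame_vec (\<lambda>v. 1 / b v v) n + u)) summable_on (F \<rightarrow>\<^sub>E UNIV)"
    by (rule abs_summable_summable)
  then show ?thesis unfolding dual_frame_lattice_def by (subst summable_on_reindex[OF inj]) (simp add: o_def)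
qed

lemma Ld_sub_dual_frame: "Ld \<subseteq> dual_frame_lattice"
proof
  fix x assume x: "x \<in> Ld"
  have "b x v = of_int \<lfloor>b x v\<rfloor>" if "v \<in> F" for v
    using Ld_b(1)[OF x, of v] that FL by (auto elim: Ints_cases)
  then have "frame_vec (\<lambda>v. 1 / b v v) (restrict (\<lambda>v. \<lfloor>b x v\<rfloor>) F) = (\<Sum>v\<in>F. coord v x *\<^sub>R v)"
    unfolding frame_vec_def by (intro sum.cong) (auto simp: coord_def)
  also have "\<dots> = x" using frame_expansion[OF Ld_span[OF x]] by simp
  finally show "x \<in> dual_frame_lattice" unfolding dual_frame_lattice_def by (metis frame_vec_mem)
qed

lemma frame_lattice_subgroup: "add_subgroup frame_lattice"
  unfolding add_subgroup_def
proof (intro conjI ballI)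
  have "frame_vec (\<lambda>_. 1) (\<lambda>v\<in>F. 0) = 0" by (auto simp: frame_vec_def intro: sum.neutral)
  then show "0 \<in> frame_lattice" unfolding frame_lattice_def by (metis frame_vec_mem)
  fix x y assume "x \<in> frame_lattice" "y \<in> frame_lattice"
  then obtain n m where *: "x = frame_vec (\<lambda>_. 1) n" "y = frame_vec (\<lambda>_. 1) m" by (auto simp: frame_lattice_def)
  have "x - y = frame_vec (\<lambda>_. 1) (\<lambda>v\<in>F. n v - m v)"
    unfolding * frame_vec_def sum_subtractf[symmetric] by (rule sum.cong) (auto simp: scaleR_diff_left)
  then show "x - y \<in> frame_lattice" unfolding frame_lattice_def by (metis frame_vec_mem)
qed

lemma frame_lattice_subset: "frame_lattice \<subseteq> L"
proof -
  have "frame_vec (\<lambda>_. 1) n \<in> L" for n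
  proof -
    have "(\<Sum>v\<in>G. (of_int (n v) * 1) *\<^sub>R v) \<in> L" if "finite G" "G \<subseteq> F" for G
      using that by (induction rule: finite_induct)
        (use FL L_scale(1) add_subgroup_0[OF L_subgroup] add_subgroup_add[OF L_subgroup] in auto)
    then show ?thesis using finF by (simp add: frame_vec_def)
  qed
  then show ?thesis by (auto simp: frame_lattice_def)
qed

text \<open>Up to sign the Gram determinant of F; it clears the denominators in the coordinates b(x,
  v) / b(v, v) of a dual vector.\<close>

definition exponent :: nat where "exponent = nat \<bar>\<lfloor>\<Prod>v\<in>F. b v v\<rfloor>\<bar>"

lemma exponent_pos: "exponent > 0" and exponent_Ld: "x \<in> Ld \<Longrightarrow> real exponent *\<^sub>R x \<in> frame_lattice"
proof -
  define N where "N = (\<Prod>v\<in>F. b v v)"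
  have int: "b v v \<in> \<int>" if "v \<in> F" for v using that FL b_int by blast
  then have "N \<in> \<int>" unfolding N_def by (rule Ints_prod)
  then obtain k where k: "N = of_int k" by (auto elim: Ints_cases)
  have N0: "N \<noteq> 0" using F_nonzero finF by (simp add: N_def)
  have ex: "real exponent = \<bar>N\<bar>" by (simp add: exponent_def N_def[symmetric] k)
  show "exponent > 0" using ex N0 by (metis of_nat_0_less_iff zero_less_abs_iff)
  assume x: "x \<in> Ld"
  have "\<bar>N\<bar> * coord v x \<in> \<int>" if v: "v \<in> F" for v
  proof -
    have "N = b v v * (\<Prod>w\<in>F - {v}. b w w)" unfolding N_def by (rule prod.remove[OF finF v])
    then have "N * coord v x = (\<Prod>w\<in>F - {v}. b w w) * b x v" using F_nonzero[OF v] by (simp add: coord_def)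
    also have "\<dots> \<in> \<int>" by (intro Ints_mult Ints_prod int Ld_b(1)[OF x]) (use v FL in auto)
    finally have "N * coord v x \<in> \<int>" .
    then show ?thesis by (cases "N \<ge> 0") auto
  qed
  then have fl: "of_int \<lfloor>\<bar>N\<bar> * coord v x\<rfloor> = \<bar>N\<bar> * coord v x" if "v \<in> F" for v
    using that by (auto elim: Ints_cases)
  have "frame_vec (\<lambda>_. 1) (\<lambda>v\<in>F. \<lfloor>\<bar>N\<bar> * coord v x\<rfloor>) = (\<Sum>v\<in>F. \<bar>N\<bar> *\<^sub>R (coord v x *\<^sub>R v))"
    unfolding frame_vec_def by (intro sum.cong) (auto simp: fl)
  also have "\<dots> = real exponent *\<^sub>R x"
    unfolding ex scaleR_sum_right[symmetric] frame_expansion[OF Ld_span[OF x], symmetric] by simp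
  finally show "real exponent *\<^sub>R x \<in> frame_lattice" unfolding frame_lattice_def by (metis frame_vec_mem)
qed

text \<open>As \<open>exponent\<close> maps L' into L, each class contains some r /
  \<open>exponent\<close> with r from a finite residue system modulo
  \<open>exponent\<close>.\<close>

lemma finite_disc: "finite (disc L b)"
proof -
  obtain R where R: "transversal L (nL exponent) R"
    using obtain_transversal_nL[OF exponent_pos] by blast
  have "disc L b \<subseteq> (\<lambda>r. cls ((1 / real exponent) *\<^sub>R r)) ` R"
  proof
    fix x assume "x \<in> disc L b"
    then obtain v where v: "v \<in> Ld" "x = cls v" by (rule disc_cases)
    then have "real exponent *\<^sub>R v \<in> L" using exponent_Ld frame_lattice_subset by blast
    then obtain r l where r: "r \<in> R" "l \<in> L" "real exponent *\<^sub>R v - r = real exponent *\<^sub>R l"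
      using transversal_ex[OF R] by blast
    have "(1 / real exponent) *\<^sub>R (real exponent *\<^sub>R v - r) = l"
      unfolding r(3) using exponent_pos by simp
    then have "v - (1 / real exponent) *\<^sub>R r = l" using exponent_pos by (simp add: scaleR_diff_right)
    then have "x = cls ((1 / real exponent) *\<^sub>R r)" using r v by (simp add: cls_eq_iff)
    then show "x \<in> (\<lambda>r. cls ((1 / real exponent) *\<^sub>R r)) ` R" using r by blast
  qed
  then show ?thesis using transversal_finite[OF R] finite_subset by blast
qed

lemma transversal_disc: "transversal Ld L (class_rep ` disc L b)"
proof (rule transversalI)
  show "class_rep ` disc L b \<subseteq> Ld" using class_rep_Ld by auto
  show "\<exists>r\<in>class_rep ` disc L b. v - r \<in> L" if "v \<in> Ld" for v
    using that class_rep_cls[of v] add_subgroup_diff_commute[OF L_subgroup] cls_in_disc by blast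
  show "r = r'" if "r \<in> class_rep ` disc L b" "r' \<in> class_rep ` disc L b" "r - r' \<in> L" for r r'
    using that cls_class_rep cls_eq_iff by (metis imageE)
qed (use finite_disc L_subgroup in auto)

lemma infsum_cls: "infsum G (cls v) = (\<Sum>\<^sub>\<infinity>l\<in>L. G (v + l))"
  by (rule infsum_reindex_bij_witness[of _ "\<lambda>l. v + l" "\<lambda>x. x - v"]) (auto simp: in_cls_iff)

lemma inj_class_rep: "inj_on class_rep (disc L b)"
  by (rule inj_on_inverseI[of _ cls]) (rule cls_class_rep)

lemma infsum_Ld_disc:
  fixes G :: "'v \<Rightarrow> complex"
  assumes "G summable_on Ld"
  shows "(\<Sum>\<^sub>\<infinity>y\<in>Ld. G y) = (\<Sum>x\<in>disc L b. \<Sum>\<^sub>\<infinity>y\<in>x. G y)"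
proof -
  have "(\<Sum>\<^sub>\<infinity>y\<in>Ld. G y) = (\<Sum>r\<in>class_rep ` disc L b. \<Sum>\<^sub>\<infinity>l\<in>L. G (r + l))"
    by (rule infsum_transversal[OF transversal_disc Ld_subgroup L_subgroup L_sub_Ld assms])
  also have "\<dots> = (\<Sum>x\<in>disc L b. infsum G (cls (class_rep x)))"
    by (subst sum.reindex[OF inj_class_rep]) (simp add: infsum_cls)
  finally show ?thesis by (simp add: cls_class_rep)
qed

end

section \<open>Poisson summation with \<tau> in the upper half plane and a parameter of either
  sign\<close>

lemma csqrt_upper_half_plane:
  assumes "Im \<tau> > 0" shows "Re (csqrt \<tau>) > 0" "Im (csqrt \<tau>) > 0"
proof -
  have *: "Re z > 0 \<and> Im z > 0" if "Re z \<ge> 0" "Im (z\<^sup>2) > 0" for z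
  proof -
    have "Im (z\<^sup>2) = 2 * (Re z * Im z)" by (simp add: power2_eq_square)
    then show ?thesis using that by (auto simp: zero_less_mult_iff)
  qed
  have "Re (csqrt \<tau>) \<ge> 0" using csqrt_principal[of \<tau>] by auto
  moreover have "Im ((csqrt \<tau>)\<^sup>2) > 0" using assms by simp
  ultimately show "Re (csqrt \<tau>) > 0" "Im (csqrt \<tau>) > 0" using * by blast+
qed

lemma norm_e_signed:
  "norm (e ((if m > 0 then \<zeta> else cnj \<zeta>) * of_real (m / 2 * r))) = exp (- (pi * Im \<zeta> * \<bar>m\<bar>) * r)"
  by (auto simp: norm_e algebra_simps)

lemma e_neg_eighth: "e (- (1 / 8)) = of_real (1 / sqrt 2) * (1 - \<i>)"
proof -
  have "e (- (1 / 8)) = e (of_real (- (1 / 8)))" by simp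
  also have "\<dots> = cis (- (pi / 4))" unfolding e_of_real by simp
  also have "\<dots> = of_real (1 / sqrt 2) * (1 - \<i>)"
    by (simp add: complex_eq_iff cos_45 sin_45 real_div_sqrt field_simps)
  finally show ?thesis .
qed

text \<open>For \<tau> in the upper half plane \<open>csqrt\<close> lies in the open first quadrant.
  Rotation by -pi/4 keeps it in the right half-plane, so no sign appears.\<close>

lemma csqrt_minus_i_times:
  assumes "Im \<tau> > 0" shows "csqrt (- \<i> * \<tau>) = csqrt \<tau> * e (- (1 / 8))"
proof (rule csqrt_unique)
  have "(e (- (1 / 8)))\<^sup>2 = - \<i>"
    by (simp add: e_neg_eighth power_mult_distrib power2_eq_square complex_eq_iff)
       (simp add: power2_eq_square[symmetric] complex_eq_iff)?
  then show "(csqrt \<tau> * e (- (1 / 8)))\<^sup>2 = - \<i> * \<tau>" by (simp add: power_mult_distrib)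
  show "0 < Re (csqrt \<tau> * e (- (1 / 8))) \<or> Re (csqrt \<tau> * e (- (1 / 8))) = 0 \<and> 0 \<le> Im (csqrt \<tau> * e (- (1 / 8)))"
    using csqrt_upper_half_plane[OF assms] by (intro disjI1) (simp add: e_neg_eighth add_pos_pos)
qed

lemma poisson_gaussian_upper:
  fixes m u w :: real
  assumes m: "m > 0" and \<tau>: "Im \<tau> > 0"
  shows "(\<Sum>\<^sub>\<infinity>n::int. e ((- 1 / \<tau>) * of_real (m / 2 * (of_int n + u)\<^sup>2)) * e (of_real (of_int n * m * w))) =
    of_real (1 / sqrt m) * (csqrt \<tau> * e (- (1 / 8))) *
      (\<Sum>\<^sub>\<infinity>n::int. e (\<tau> * of_real (m / 2 * (of_int n / m - w)\<^sup>2)) * e (of_real (u * m * (of_int n / m - w))))"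
proof -
  define s where "s = csqrt (- \<i> * \<tau>)"
  \<comment> \<open>With this z the exponent -pi z x^2 equals 2 pi \<i> (-1/\<tau>) (m/2)
    x^2.\<close>
  define z where "z = \<i> * of_real m / \<tau>"
  have \<tau>0: "\<tau> \<noteq> 0" using \<tau> by auto
  have "Re z = m * Im \<tau> / (cmod \<tau>)\<^sup>2" by (simp add: z_def Re_divide cmod_power2)
  also have "\<dots> > 0" using m \<tau> \<tau>0 by simp
  finally have z: "Re z > 0" .
  have s_sq: "s\<^sup>2 = - \<i> * \<tau>" by (simp add: s_def)
  have s0: "s \<noteq> 0" using s_sq \<tau>0 by auto
  have s_pos: "Re s > 0"
  proof -
    have "Re s = (Re (csqrt \<tau>) + Im (csqrt \<tau>)) / sqrt 2"
      unfolding s_def csqrt_minus_i_times[OF \<tau>] e_neg_eighth by (simp add: field_simps)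
    then show ?thesis using csqrt_upper_half_plane[OF \<tau>] by (simp only:) (intro divide_pos_pos add_pos_pos, simp_all only: real_sqrt_gt_0_iff zero_less_numeral)
  qed
  have "csqrt z = of_real (sqrt m) / s"
  proof (rule csqrt_unique)
    have "(of_real (sqrt m) / s)\<^sup>2 = of_real ((sqrt m)\<^sup>2) / (- \<i> * \<tau>)"
      by (simp only: power_divide s_sq of_real_power)
    also have "\<dots> = z" using m \<tau>0 by (simp add: z_def field_simps)
    finally show "(of_real (sqrt m) / s)\<^sup>2 = z" .
    have "Re (of_real (sqrt m) / s) = sqrt m * Re s / (cmod s)\<^sup>2" by (simp add: Re_divide cmod_power2)
    also have "\<dots> > 0" using m s_pos s0 by simp
    finally show "0 < Re (of_real (sqrt m) / s) \<or> Re (of_real (sqrt m) / s) = 0 \<and> 0 \<le> Im (of_real (sqrt m) / s)" by blast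
  qed
  then have inv: "inverse (csqrt z) = of_real (1 / sqrt m) * (csqrt \<tau> * e (- (1 / 8)))"
    using csqrt_minus_i_times[OF \<tau>] by (simp add: s_def)
  have 1: "exp (- of_real pi * z * of_real ((of_int n + u)\<^sup>2)) = e ((- 1 / \<tau>) * of_real (m / 2 * (of_int n + u)\<^sup>2))" for n :: int
    by (simp add: e_def z_def field_simps)
  have 2: "exp (- of_real pi / z * of_real ((of_int n - m * w)\<^sup>2)) = e (\<tau> * of_real (m / 2 * (of_int n / m - w)\<^sup>2))" for n :: int
  proof -
    have "(of_int n - m * w)\<^sup>2 = m * (m * (of_int n / m - w)\<^sup>2)" using m by (simp add: power2_eq_square field_simps)
    moreover have "- of_real pi / z * of_real (m * (m * X)) = 2 * of_real pi * \<i> * (\<tau> * of_real (m / 2 * X))" for X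
      using m \<tau>0 by (simp add: z_def field_simps)
    ultimately show ?thesis by (simp only: e_def)
  qed
  have 3: "of_int n - m * w = m * (of_int n / m - w)" for n :: int using m by (simp add: field_simps)
  show ?thesis
    using poisson_gaussian[OF z, of u "m * w"] unfolding 1 2 inv by (simp only: 3 mult.assoc)
qed

lemma poisson_gaussian_signed:
  fixes m u w :: real
  assumes m: "m \<noteq> 0" and \<tau>: "Im \<tau> > 0"
  shows "(\<Sum>\<^sub>\<infinity>n::int. e ((if m > 0 then - 1 / \<tau> else cnj (- 1 / \<tau>)) * of_real (m / 2 * (of_int n + u)\<^sup>2)) * e (of_real (of_int n * m * w))) =
    of_real (1 / sqrt \<bar>m\<bar>) * (if m > 0 then csqrt \<tau> * e (- (1 / 8)) else cnj (csqrt \<tau> * e (- (1 / 8)))) *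
      (\<Sum>\<^sub>\<infinity>n::int. e ((if m > 0 then \<tau> else cnj \<tau>) * of_real (m / 2 * (of_int n / m - w)\<^sup>2)) * e (of_real (u * m * (of_int n / m - w))))"
proof (cases "m > 0")
  case True
  then show ?thesis using poisson_gaussian_upper[OF True \<tau>, of u w] by simp
next
  case False
  \<comment> \<open>The negative case is the complex conjugate of the positive one.\<close>
  define k where "k = - m"
  have k: "k > 0" "m = - k" using False m by (auto simp: k_def)
  have cnj_e: "cnj (e z) = e (- cnj z)" for z
    by (simp add: e_def exp_cnj)
  have "cnj (\<Sum>\<^sub>\<infinity>n::int. e ((- 1 / \<tau>) * of_real (k / 2 * (of_int n + u)\<^sup>2)) * e (of_real (of_int n * k * w)))
    = cnj (of_real (1 / sqrt k) * (csqrt \<tau> * e (- (1 / 8))) *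
      (\<Sum>\<^sub>\<infinity>n::int. e (\<tau> * of_real (k / 2 * (of_int n / k - w)\<^sup>2)) * e (of_real (u * k * (of_int n / k - w)))))"
    by (simp only: poisson_gaussian_upper[OF k(1) \<tau>])
  also have "cnj (\<Sum>\<^sub>\<infinity>n::int. e ((- 1 / \<tau>) * of_real (k / 2 * (of_int n + u)\<^sup>2)) * e (of_real (of_int n * k * w)))
    = (\<Sum>\<^sub>\<infinity>n::int. e (cnj (- 1 / \<tau>) * of_real (m / 2 * (of_int n + u)\<^sup>2)) * e (of_real (of_int n * m * w)))"
    unfolding infsum_cnj[symmetric] by (rule infsum_cong) (simp add: cnj_e k)
  also have "cnj (of_real (1 / sqrt k) * (csqrt \<tau> * e (- (1 / 8))) *
      (\<Sum>\<^sub>\<infinity>n::int. e (\<tau> * of_real (k / 2 * (of_int n / k - w)\<^sup>2)) * e (of_real (u * k * (of_int n / k - w)))))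
    = of_real (1 / sqrt k) * cnj (csqrt \<tau> * e (- (1 / 8))) *
      (\<Sum>\<^sub>\<infinity>n::int. e (cnj \<tau> * of_real (m / 2 * (of_int n / k - w)\<^sup>2)) * e (of_real (u * m * (of_int n / k - w))))"
    unfolding complex_cnj_mult infsum_cnj[symmetric]
    by (intro arg_cong2[of _ _ _ _ "(*)"] infsum_cong) (simp_all add: cnj_e k)
  \<comment> \<open>Conjugation leaves n divided by k = -m; the reflection n -> -n restores the
    division by m.\<close>
  also have "(\<Sum>\<^sub>\<infinity>n::int. e (cnj \<tau> * of_real (m / 2 * (of_int n / k - w)\<^sup>2)) * e (of_real (u * m * (of_int n / k - w))))
     = (\<Sum>\<^sub>\<infinity>n::int. e (cnj \<tau> * of_real (m / 2 * (of_int n / m - w)\<^sup>2)) * e (of_real (u * m * (of_int n / m - w))))"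
    by (rule infsum_reindex_bij_witness[of _ uminus uminus]) (auto simp: k)
  finally show ?thesis using False k by simp
qed

context framed_lattice
begin

text \<open>Inverse square root of the absolute Gram determinant of F, the covolume factor in
  Poisson summation over \<open>frame_lattice\<close>.\<close>

definition gauss_const :: real where "gauss_const = (\<Prod>v\<in>F. 1 / sqrt \<bar>b v v\<bar>)"

lemma gauss_const_pos: "gauss_const > 0"
  unfolding gauss_const_def by (rule prod_pos) (simp add: F_nonzero)

text \<open>In frame coordinates both sides are absolutely convergent products of one-variable sums,
  which are transformed factor by factor.\<close>

lemma poisson_frame_lattice:
  assumes \<tau>: "Im \<tau> > 0" and u: "u \<in> span L" and w: "w \<in> span L"
  shows "(\<Sum>\<^sub>\<infinity>x\<in>frame_lattice. gauss (- 1 / \<tau>) (x + u) * e (of_real (b x w))) =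
    of_real gauss_const * frame_factor (csqrt \<tau> * e (- (1 / 8))) *
      (\<Sum>\<^sub>\<infinity>y\<in>dual_frame_lattice. gauss \<tau> (y - w) * e (of_real (b u (y - w))))"
proof -
  define f where "f = (\<lambda>v (n::int). e ((if b v v > 0 then - 1 / \<tau> else cnj (- 1 / \<tau>)) *
      of_real (b v v / 2 * (of_int n + coord v u)\<^sup>2)) * e (of_real (of_int n * b v v * coord v w)))"
  define g where "g = (\<lambda>v (n::int). e ((if b v v > 0 then \<tau> else cnj \<tau>) *
      of_real (b v v / 2 * (of_int n / b v v - coord v w)\<^sup>2)) * e (of_real (coord v u * b v v * (of_int n / b v v - coord v w))))"
  have fg: "infsum (f v) UNIV = of_real (1 / sqrt \<bar>b v v\<bar>) *
      (if b v v > 0 then csqrt \<tau> * e (- (1 / 8)) else cnj (csqrt \<tau> * e (- (1 / 8)))) * infsum (g v) UNIV" if "v \<in> F" for v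
    unfolding f_def g_def by (rule poisson_gaussian_signed[OF F_nonzero[OF that] \<tau>])
  have Im1: "Im (- 1 / \<tau>) > 0"
  proof -
    have "Im (- 1 / \<tau>) = Im \<tau> / (cmod \<tau>)\<^sup>2" by (simp add: Im_divide cmod_power2)
    moreover have "\<tau> \<noteq> 0" using \<tau> by auto
    ultimately show ?thesis using \<tau> by simp
  qed
  have nf: "(\<lambda>n. norm (f v n)) summable_on UNIV" if v: "v \<in> F" for v
  proof -
    have "norm (f v n) = exp (- (pi * Im (- 1 / \<tau>) * \<bar>b v v\<bar>) * (of_int n + coord v u)\<^sup>2)" for n
      unfolding f_def norm_mult norm_e_of_real norm_e_signed by simp
    then show ?thesis
      by (simp only:) (rule summable_gaussian_int, intro mult_pos_pos, use Im1 F_nonzero[OF v] in simp_all)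
  qed
  have ng: "(\<lambda>n. norm (g v n)) summable_on UNIV" if v: "v \<in> F" for v
  proof -
    have "norm (g v n) = exp (- (pi * Im \<tau> / \<bar>b v v\<bar>) * (of_int n + (- b v v * coord v w))\<^sup>2)" for n
    proof -
      have "norm (g v n) = exp (- (pi * Im \<tau> * \<bar>b v v\<bar>) * (of_int n / b v v - coord v w)\<^sup>2)"
        unfolding g_def norm_mult norm_e_of_real norm_e_signed by simp
      also have "- (pi * Im \<tau> * \<bar>b v v\<bar>) * (of_int n / b v v - coord v w)\<^sup>2 =
          - (pi * Im \<tau> / \<bar>b v v\<bar>) * (of_int n + (- b v v * coord v w))\<^sup>2"
        using F_nonzero[OF v] by (cases "b v v > 0") (auto simp: power2_eq_square field_simps)
      finally show ?thesis .
    qed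
    then show ?thesis using summable_gaussian_int[of "pi * Im \<tau> / \<bar>b v v\<bar>" "- b v v * coord v w"] \<tau> F_nonzero[OF v]
      by simp
  qed
  have "(\<Sum>\<^sub>\<infinity>x\<in>frame_lattice. gauss (- 1 / \<tau>) (x + u) * e (of_real (b x w))) = (\<Sum>\<^sub>\<infinity>n\<in>F \<rightarrow>\<^sub>E UNIV. \<Prod>v\<in>F. f v (n v))"
    unfolding frame_lattice_def
  proof (subst infsum_reindex[OF inj_frame_vec], simp, unfold o_def, rule infsum_cong)
    fix n :: "'v \<Rightarrow> int"
    have "b (frame_vec (\<lambda>_. 1) n) w = (\<Sum>v\<in>F. of_int (n v) * b v v * coord v w)"
      unfolding b_frame[OF frame_vec_span] by (rule sum.cong) (auto simp: coord_frame_vec)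
    then have "e (of_real (b (frame_vec (\<lambda>_. 1) n) w)) = (\<Prod>v\<in>F. e (of_real (of_int (n v) * b v v * coord v w)))"
      using e_sum[OF finF] by (simp only: of_real_sum)
    then show "gauss (- 1 / \<tau>) (frame_vec (\<lambda>_. 1) n + u) * e (of_real (b (frame_vec (\<lambda>_. 1) n) w)) = (\<Prod>v\<in>F. f v (n v))"
      unfolding gauss_def f_def by (simp only: prod.distrib[symmetric]) (intro prod.cong refl, simp add: coord_simps coord_frame_vec)
  qed
  also have "\<dots> = (\<Prod>v\<in>F. infsum (f v) UNIV)"
    by (rule infsum_prod_PiE_abs[OF finF]) (rule nf)
  also have "\<dots> = of_real gauss_const * frame_factor (csqrt \<tau> * e (- (1 / 8))) * (\<Prod>v\<in>F. infsum (g v) UNIV)"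
    unfolding gauss_const_def of_real_prod frame_factor_prod[symmetric] prod.distrib[symmetric]
    by (rule prod.cong) (auto simp only: fg)
  also have "(\<Prod>v\<in>F. infsum (g v) UNIV) = (\<Sum>\<^sub>\<infinity>n\<in>F \<rightarrow>\<^sub>E UNIV. \<Prod>v\<in>F. g v (n v))"
    by (rule infsum_prod_PiE_abs[OF finF, symmetric]) (rule ng)
  also have "\<dots> = (\<Sum>\<^sub>\<infinity>y\<in>dual_frame_lattice. gauss \<tau> (y - w) * e (of_real (b u (y - w))))"
    unfolding dual_frame_lattice_def
  proof (subst infsum_reindex[OF inj_frame_vec], simp add: F_nonzero, unfold o_def, rule infsum_cong)
    fix n :: "'v \<Rightarrow> int"
    have "b u (frame_vec (\<lambda>v. 1 / b v v) n - w) = (\<Sum>v\<in>F. coord v u * b v v * (of_int (n v) / b v v - coord v w))"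
      unfolding b_frame[OF u] by (rule sum.cong) (auto simp: coord_frame_vec coord_simps)
    then have "e (of_real (b u (frame_vec (\<lambda>v. 1 / b v v) n - w))) = (\<Prod>v\<in>F. e (of_real (coord v u * b v v * (of_int (n v) / b v v - coord v w))))"
      using e_sum[OF finF] by (simp only: of_real_sum)
    then show "(\<Prod>v\<in>F. g v (n v)) = gauss \<tau> (frame_vec (\<lambda>v. 1 / b v v) n - w) * e (of_real (b u (frame_vec (\<lambda>v. 1 / b v v) n - w)))"
      unfolding gauss_def g_def by (simp only: prod.distrib[symmetric]) (intro prod.cong refl, simp add: coord_simps coord_frame_vec)
  qed
  finally show ?thesis .
qed

end

subsection \<open>Theta functions with characteristics\<close>

lemma summable_on_mult_e:
  fixes g :: "'i \<Rightarrow> complex"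
  assumes "g summable_on A"
  shows "(\<lambda>x. g x * e (of_real (f x))) summable_on A"
  using assms by (simp add: summable_on_iff_abs_summable_on_complex norm_mult norm_e)

lemma
  fixes f :: "'i \<Rightarrow> 'j \<Rightarrow> complex"
  assumes "finite R" "\<And>r. r \<in> R \<Longrightarrow> f r summable_on A"
  shows summable_on_sum_finite: "(\<lambda>y. \<Sum>r\<in>R. f r y) summable_on A"
    and infsum_sum_finite: "(\<Sum>\<^sub>\<infinity>y\<in>A. \<Sum>r\<in>R. f r y) = (\<Sum>r\<in>R. \<Sum>\<^sub>\<infinity>y\<in>A. f r y)"
proof -
  have "(\<lambda>y. \<Sum>r\<in>R. f r y) summable_on A \<and> (\<Sum>\<^sub>\<infinity>y\<in>A. \<Sum>r\<in>R. f r y) = (\<Sum>r\<in>R. \<Sum>\<^sub>\<infinity>y\<in>A. f r y)"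
    using assms by (induction R rule: finite_induct) (auto simp: infsum_add intro: summable_on_add)
  then show "(\<lambda>y. \<Sum>r\<in>R. f r y) summable_on A"
    "(\<Sum>\<^sub>\<infinity>y\<in>A. \<Sum>r\<in>R. f r y) = (\<Sum>r\<in>R. \<Sum>\<^sub>\<infinity>y\<in>A. f r y)" by auto
qed

context framed_lattice
begin

text \<open>The phase \<open>b(u, w)/2\<close> makes the transformation law free of cocycles in \<open>(u, w)\<close>.\<close>

definition theta :: "complex \<Rightarrow> 'v \<Rightarrow> 'v \<Rightarrow> 'v set \<Rightarrow> complex" where
  "theta \<tau> u w x = (\<Sum>\<^sub>\<infinity>v\<in>x. gauss \<tau> (v + u) * e (of_real (b v w + b u w / 2)))"

definition theta_vec :: "complex \<Rightarrow> 'v \<Rightarrow> 'v \<Rightarrow> 'v set \<Rightarrow> complex" where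
  "theta_vec \<tau> u w = (\<lambda>x. if x \<in> disc L b then theta \<tau> u w x else 0)"

lemma theta_vec_in_group_algebra: "theta_vec \<tau> u w \<in> group_algebra L b"
  by (simp add: theta_vec_def group_algebra_def)

lemma gauss_summable:
  assumes "Im \<tau> > 0" "A \<subseteq> Ld"
  shows "(\<lambda>x. gauss \<tau> (x + u)) summable_on A"
  using gauss_summable_dual_frame[OF assms(1)] assms(2) Ld_sub_dual_frame by (rule summable_on_subset_banach[OF _ subset_trans])

lemma disc_sub_Ld: "x \<in> disc L b \<Longrightarrow> x \<subseteq> Ld"
  using disc_memD(1) by blast

lemma theta_T:
  assumes x: "x \<in> disc L b" and uw: "u \<in> span L"
  shows "theta (\<tau> + 1) u w x = e (of_real (qclass b x)) * theta \<tau> u (u + w) x"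
  unfolding theta_def infsum_cmult_right'[symmetric]
proof (rule infsum_cong)
  fix v assume v: "v \<in> x"
  have vL: "v \<in> Ld" using disc_memD[OF x v] by simp
  have "gauss (\<tau> + of_real 1) (v + u) = e (of_real (1 * q (v + u))) * gauss \<tau> (v + u)"
    by (rule gauss_add_real) (use Ld_span[OF vL] uw in \<open>simp add: span_add\<close>)
  then have "gauss (\<tau> + 1) (v + u) * e (of_real (b v w + b u w / 2)) =
      gauss \<tau> (v + u) * (e (of_real (q (v + u))) * e (of_real (b v w + b u w / 2)))" by simp
  \<comment> \<open>By q(v + u) = q(v) + b(v, u) + b(u, u)/2 the surplus over q(v) is exactly the
    change of phase when w becomes u + w.\<close>
  also have "e (of_real (q (v + u))) * e (of_real (b v w + b u w / 2)) =
      e (of_real (q v)) * e (of_real (b v (u + w) + b u (u + w) / 2))"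
    unfolding e_add[symmetric] of_real_add[symmetric]
    by (rule arg_cong[of _ _ "\<lambda>z. e (of_real z)"]) (simp add: q_add bil_simps, simp add: qform_def field_simps)
  also have "e (of_real (q v)) = e (of_real (qclass b x))"
    by (rule e_cong[symmetric]) (rule qclass_cong[OF x v])
  finally show "gauss (\<tau> + 1) (v + u) * e (of_real (b v w + b u w / 2)) =
      e (of_real (qclass b x)) * (gauss \<tau> (v + u) * e (of_real (b v (u + w) + b u (u + w) / 2)))"
    by (simp only: mult_ac)
qed

text \<open>\<open>exponent\<close> L lies in \<open>frame_lattice\<close>, so a residue system
  modulo \<open>exponent\<close> meets all cosets.\<close>

lemma obtain_transversal_frame_lattice:
  obtains R where "transversal L frame_lattice R"
proof -
  obtain R where R: "transversal L (nL exponent) R"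
    using obtain_transversal_nL[OF exponent_pos] by blast
  have "nL exponent \<subseteq> frame_lattice" using exponent_Ld L_sub_Ld by blast
  then have "\<exists>r\<in>R. v - r \<in> frame_lattice" if "v \<in> L" for v using transversal_ex[OF R that] by blast
  then show ?thesis
    using transversal_exists[of R L frame_lattice] that R frame_lattice_subgroup by (auto simp: transversal_def)
qed

text \<open>Poisson summation is available on cosets of \<open>frame_lattice\<close>, so L is cut
  into these. On the dual side the sum over the cosets reduces \<open>dual_frame_lattice\<close> to
  L', which is then sorted by classes.\<close>

lemma theta_S_up_to_constant:
  obtains C :: real where "C > 0"
    "\<And>\<tau> u w v0. Im \<tau> > 0 \<Longrightarrow> u \<in> span L \<Longrightarrow> w \<in> span L \<Longrightarrow> v0 \<in> Ld \<Longrightarrow>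
      theta (- 1 / \<tau>) u w (cls v0) = of_real C * frame_factor (csqrt \<tau> * e (- (1 / 8))) *
        (\<Sum>\<mu>\<in>disc L b. e (- of_real (b v0 (class_rep \<mu>))) * theta \<tau> w (- u) \<mu>)"
proof -
  obtain R where R: "transversal L frame_lattice R" by (rule obtain_transversal_frame_lattice)
  have "R \<noteq> {}" using transversal_ex[OF R add_subgroup_0[OF L_subgroup]] by blast
  then have cR: "card R > 0" using transversal_finite[OF R] by (simp add: card_gt_0_iff)
  show ?thesis
  proof (rule that)
    show "gauss_const * real (card R) > 0" using gauss_const_pos cR by simp
    fix \<tau> u w v0
    assume \<tau>: "Im \<tau> > 0" and u: "u \<in> span L" and w: "w \<in> span L" and v0: "v0 \<in> Ld"
    define \<kappa> where "\<kappa> = of_real gauss_const * frame_factor (csqrt \<tau> * e (- (1 / 8)))"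
    define G where "G = (\<lambda>x. gauss (- 1 / \<tau>) (x + u) * e (of_real (b x w + b u w / 2)))"
    define H where "H = (\<lambda>y. gauss \<tau> (y - w) * e (of_real (b u y - b u w / 2)) * e (of_real (b v0 y)))"
    have "Im (- 1 / \<tau>) = Im \<tau> / (cmod \<tau>)\<^sup>2" by (simp add: Im_divide cmod_power2)
    moreover have "\<tau> \<noteq> 0" using \<tau> by auto
    ultimately have Im1: "Im (- 1 / \<tau>) > 0" using \<tau> by simp
    have sumG: "G summable_on A" if "A \<subseteq> Ld" for A
      unfolding G_def by (rule summable_on_mult_e[OF gauss_summable[OF Im1 that]])
    have clsL: "cls v0 \<subseteq> Ld" using disc_sub_Ld[OF cls_in_disc[OF v0]] .
    have sumG': "(\<lambda>l. G (v0 + l)) summable_on L"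
      using sumG[OF clsL]
      by (rule summable_on_reindex_bij_witness[of L "\<lambda>x. x - v0" "\<lambda>l. v0 + l", THEN iffD2, rotated -1])
        (auto simp: in_cls_iff)
    have sumH: "(\<lambda>y. H y * e (of_real (f y))) summable_on dual_frame_lattice" for f
      using gauss_summable_dual_frame[OF \<tau>, of "- w"] unfolding H_def
      by (intro summable_on_mult_e) simp
    have "theta (- 1 / \<tau>) u w (cls v0) = (\<Sum>\<^sub>\<infinity>l\<in>L. G (v0 + l))"
      by (simp add: theta_def G_def infsum_cls)
    also have "\<dots> = (\<Sum>r\<in>R. \<Sum>\<^sub>\<infinity>m\<in>frame_lattice. G (v0 + (r + m)))"
      by (rule infsum_transversal[OF R L_subgroup frame_lattice_subgroup frame_lattice_subset sumG'])
    also have "\<dots> = (\<Sum>r\<in>R. \<kappa> * (\<Sum>\<^sub>\<infinity>y\<in>dual_frame_lattice. H y * e (of_real (b r y))))"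
    proof (rule sum.cong)
      fix r assume "r \<in> R"
      then have r: "r \<in> span L" using transversal_subset[OF R] L_span by blast
      have "(\<Sum>\<^sub>\<infinity>m\<in>frame_lattice. G (v0 + (r + m))) =
        (\<Sum>\<^sub>\<infinity>m\<in>frame_lattice. gauss (- 1 / \<tau>) (m + (v0 + r + u)) * e (of_real (b m w))) * e (of_real (b (v0 + r) w + b u w / 2))"
        unfolding infsum_cmult_left'[symmetric] G_def
        by (rule infsum_cong) (simp add: e_add bil_simps add_ac mult_ac)
      also have "\<dots> = \<kappa> * (\<Sum>\<^sub>\<infinity>y\<in>dual_frame_lattice. gauss \<tau> (y - w) * e (of_real (b (v0 + r + u) (y - w)))) * e (of_real (b (v0 + r) w + b u w / 2))"
        unfolding \<kappa>_def by (subst poisson_frame_lattice[OF \<tau> _ w]) (use r u Ld_span[OF v0] in \<open>auto intro!: span_add\<close>)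
      also have "\<dots> = \<kappa> * (\<Sum>\<^sub>\<infinity>y\<in>dual_frame_lattice. gauss \<tau> (y - w) * e (of_real (b (v0 + r + u) (y - w))) * e (of_real (b (v0 + r) w + b u w / 2)))"
        by (simp only: infsum_cmult_left'[symmetric] mult.assoc)
      also have "\<dots> = \<kappa> * (\<Sum>\<^sub>\<infinity>y\<in>dual_frame_lattice. H y * e (of_real (b r y)))"
        unfolding H_def mult.assoc e_add[symmetric] of_real_add[symmetric]
        by (intro arg_cong2[of _ _ _ _ "(*)"] infsum_cong arg_cong[of _ _ "\<lambda>z. _ * e (of_real z)"] refl)
          (simp add: bil_simps)
      finally show "(\<Sum>\<^sub>\<infinity>m\<in>frame_lattice. G (v0 + (r + m))) = \<kappa> * (\<Sum>\<^sub>\<infinity>y\<in>dual_frame_lattice. H y * e (of_real (b r y)))" .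
    qed simp
    also have "\<dots> = \<kappa> * (\<Sum>\<^sub>\<infinity>y\<in>dual_frame_lattice. \<Sum>r\<in>R. H y * e (of_real (b r y)))"
      by (subst infsum_sum_finite[OF transversal_finite[OF R] sumH]) (rule sum_distrib_left[symmetric])
    \<comment> \<open>The characters e(b(r, y)) of L / \<open>frame_lattice\<close> sum to card R if
      y lies in L' and to 0 otherwise.\<close>
    also have "(\<Sum>\<^sub>\<infinity>y\<in>dual_frame_lattice. \<Sum>r\<in>R. H y * e (of_real (b r y))) = (\<Sum>\<^sub>\<infinity>y\<in>Ld. of_nat (card R) * H y)"
    proof (rule infsum_cong_neutral)
      have char: "(\<Sum>r\<in>R. e (of_real (b r y))) = (if \<forall>l\<in>L. e (of_real (b l y)) = 1 then of_nat (card R) else 0)"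
        if yMd: "y \<in> dual_frame_lattice" for y
      proof (rule transversal_sum_character[OF R L_subgroup frame_lattice_subgroup frame_lattice_subset])
        show "e (of_real (b (x + x') y)) = e (of_real (b x y)) * e (of_real (b x' y))" for x x'
          by (simp add: bil_simps e_add)
        fix m assume "m \<in> frame_lattice"
        then obtain n where n: "m = frame_vec (\<lambda>_. 1) n" by (auto simp: frame_lattice_def)
        obtain k where k: "y = frame_vec (\<lambda>v. 1 / b v v) k" using yMd by (auto simp: dual_frame_lattice_def)
        have "b m y = (\<Sum>v\<in>F. of_int (n v * k v))"
          unfolding n b_frame[OF frame_vec_span] k
          by (rule sum.cong) (auto simp: coord_frame_vec F_nonzero)
        then show "e (of_real (b m y)) = 1" by (intro e_int) (auto intro!: Ints_sum)
      qed
      have iff: "(\<forall>l\<in>L. e (of_real (b l y)) = 1) \<longleftrightarrow> y \<in> Ld" if "y \<in> dual_frame_lattice" for y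
        using that frame_vec_span by (auto simp: e_of_real_eq_1_iff dual_lattice_def symmetric[of y] dual_frame_lattice_def)
      show "(\<Sum>r\<in>R. H y * e (of_real (b r y))) = 0" if "y \<in> dual_frame_lattice - Ld" for y
        using that char iff by (simp add: sum_distrib_left[symmetric])
      show "(\<Sum>r\<in>R. H y * e (of_real (b r y))) = of_nat (card R) * H y" if "y \<in> dual_frame_lattice \<inter> Ld" for y
        using that char iff by (simp add: sum_distrib_left[symmetric])
    qed (use Ld_sub_dual_frame in auto)
    \<comment> \<open>The reflection y -> -y produces the sign of the kernel e(-b) in \<rho>(S) and
      the characteristic (w, -u).\<close>
    also have "\<dots> = of_nat (card R) * (\<Sum>\<^sub>\<infinity>y\<in>Ld. H (- y))"
      unfolding infsum_cmult_right'
      by (intro arg_cong2[of _ _ _ _ "(*)"] refl infsum_reindex_bij_witness[of _ uminus uminus])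
        (auto intro: add_subgroup_uminus[OF Ld_subgroup])
    also have "(\<Sum>\<^sub>\<infinity>y\<in>Ld. H (- y)) = (\<Sum>\<mu>\<in>disc L b. \<Sum>\<^sub>\<infinity>y\<in>\<mu>. H (- y))"
    proof (rule infsum_Ld_disc)
      have "(\<lambda>y. gauss \<tau> (y + w) * e (of_real (- b u y - b u w / 2)) * e (of_real (- b v0 y))) summable_on Ld"
        by (intro summable_on_mult_e gauss_summable \<tau> subset_refl)
      moreover have "gauss \<tau> (- y - w) = gauss \<tau> (y + w)" for y
        using gauss_uminus[of \<tau> "y + w"] by simp
      ultimately show "(\<lambda>y. H (- y)) summable_on Ld" by (simp add: H_def bil_simps)
    qed
    also have "\<dots> = (\<Sum>\<mu>\<in>disc L b. e (- of_real (b v0 (class_rep \<mu>))) * theta \<tau> w (- u) \<mu>)"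
    proof (rule sum.cong)
      fix \<mu> assume \<mu>: "\<mu> \<in> disc L b"
      show "(\<Sum>\<^sub>\<infinity>y\<in>\<mu>. H (- y)) = e (- of_real (b v0 (class_rep \<mu>))) * theta \<tau> w (- u) \<mu>"
        unfolding theta_def infsum_cmult_right'[symmetric]
      proof (rule infsum_cong)
        fix y assume y: "y \<in> \<mu>"
        have "y - class_rep \<mu> \<in> L"
          using y \<mu> disc_memD class_rep_in in_cls_iff by metis
        then have "b v0 y - b v0 (class_rep \<mu>) \<in> \<int>"
          using Ld_b(1)[OF v0] by (simp add: bil_diff[symmetric])
        then have 1: "e (of_real (- b v0 y)) = e (of_real (- b v0 (class_rep \<mu>)))"
          by (intro e_cong) (metis Ints_minus add.commute diff_minus_eq_add minus_diff_eq uminus_add_conv_diff)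
        have 2: "gauss \<tau> (- y - w) = gauss \<tau> (y + w)"
          using gauss_uminus[of \<tau> "y + w"] by simp
        show "H (- y) = e (- of_real (b v0 (class_rep \<mu>))) * (gauss \<tau> (y + w) * e (of_real (b y (- u) + b w (- u) / 2)))"
          using 1 by (simp add: H_def 2 bil_simps symmetric[of u y] symmetric[of u w])
      qed
    qed simp
    finally show "theta (- 1 / \<tau>) u w (cls v0) = of_real (gauss_const * real (card R)) * frame_factor (csqrt \<tau> * e (- (1 / 8))) *
        (\<Sum>\<mu>\<in>disc L b. e (- of_real (b v0 (class_rep \<mu>))) * theta \<tau> w (- u) \<mu>)"
      by (simp add: \<kappa>_def mult_ac)
  qed
qed

end

subsection \<open>The metaplectic group\<close>

abbreviation "UH \<equiv> upper_half_plane"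

lemma UH_iff: "\<tau> \<in> UH \<longleftrightarrow> Im \<tau> > 0"
  by (simp add: upper_half_plane_def)

lemma mat2_sel [simp]:
  "mat2 a b c d $ 1 $ 1 = a" "mat2 a b c d $ 1 $ 2 = b" "mat2 a b c d $ 2 $ 1 = c" "mat2 a b c d $ 2 $ 2 = d"
  by (simp_all add: mat2_def)

lemma mat2_eqI:
  fixes M N :: "rat^2^2"
  assumes "M$1$1 = N$1$1" "M$1$2 = N$1$2" "M$2$1 = N$2$1" "M$2$2 = N$2$2"
  shows "M = N"
  using assms by (simp add: vec_eq_iff forall_2)

lemma mat2_cases:
  fixes M :: "rat^2^2"
  obtains a b c d where "M = mat2 a b c d"
  by (rule that[of "M$1$1" "M$1$2" "M$2$1" "M$2$2"]) (rule mat2_eqI; simp)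

lemma mat2_inject: "mat2 a b c d = mat2 a' b' c' d' \<longleftrightarrow> a = a' \<and> b = b' \<and> c = c' \<and> d = d'"
  by (metis mat2_sel)

lemma mat2_mult: "mat2 a b c d ** mat2 a' b' c' d' =
    mat2 (a * a' + b * c') (a * b' + b * d') (c * a' + d * c') (c * b' + d * d')"
  by (rule mat2_eqI) (simp_all add: matrix_matrix_mult_def sum_2)

lemma det_mat2: "det (mat2 a b c d) = a * d - b * c"
  by (simp add: det_2)

lemma automorphy_mat2: "automorphy (mat2 a b c d) \<tau> = of_rat c * \<tau> + of_rat d"
  by (simp add: automorphy_def)

lemma moebius_mat2: "moebius (mat2 a b c d) \<tau> = (of_rat a * \<tau> + of_rat b) / (of_rat c * \<tau> + of_rat d)"
  by (simp add: moebius_def automorphy_def)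

lemma of_rat_complex: "(of_rat x :: complex) = of_real (of_rat x)"
  by (induction x) (simp add: Fract_of_int_quotient of_rat_divide)

lemma
  assumes d: "det M > 0" and \<tau>: "Im \<tau> > 0"
  shows automorphy_nonzero: "automorphy M \<tau> \<noteq> 0" and Im_moebius: "Im (moebius M \<tau>) > 0"
proof -
  obtain a b c d where M: "M = mat2 a b c d" by (rule mat2_cases)
  define A B C D :: real where "A = of_rat a" and "B = of_rat b" and "C = of_rat c" and "D = of_rat d"
  have "(of_rat (a * d - b * c) :: real) > 0" using d by (simp add: M det_mat2 del: of_rat_diff)
  then have det: "A * D - B * C > 0" by (simp add: A_def B_def C_def D_def of_rat_diff of_rat_mult)
  have aut: "automorphy M \<tau> = of_real C * \<tau> + of_real D"
    by (simp add: M automorphy_mat2 of_rat_complex C_def D_def)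
  show nz: "automorphy M \<tau> \<noteq> 0"
  proof
    assume 0: "automorphy M \<tau> = 0"
    then have "C * Im \<tau> = 0" unfolding aut by (auto simp: complex_eq_iff)
    then have "C = 0" using \<tau> by simp
    moreover from this have "D = 0" using 0 unfolding aut by (auto simp: complex_eq_iff)
    ultimately show False using det by simp
  qed
  have "moebius M \<tau> = (of_real A * \<tau> + of_real B) / (of_real C * \<tau> + of_real D)"
    by (simp add: M moebius_mat2 of_rat_complex A_def B_def C_def D_def)
  then have "Im (moebius M \<tau>) = (A * D - B * C) * Im \<tau> / (cmod (of_real C * \<tau> + of_real D))\<^sup>2"
    by (simp add: Im_divide cmod_power2 algebra_simps)
  then show "Im (moebius M \<tau>) > 0" using nz det \<tau> unfolding aut by simp
qed

lemma automorphy_mult: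
  assumes "det N > 0" "Im \<tau> > 0"
  shows "automorphy (M ** N) \<tau> = automorphy M (moebius N \<tau>) * automorphy N \<tau>"
proof -
  obtain a b c d where M: "M = mat2 a b c d" by (rule mat2_cases)
  obtain a' b' c' d' where N: "N = mat2 a' b' c' d'" by (rule mat2_cases)
  have "of_rat c' * \<tau> + of_rat d' \<noteq> 0" using automorphy_nonzero[OF assms] by (simp add: N automorphy_mat2)
  then show ?thesis
    by (simp add: M N mat2_mult automorphy_mat2 moebius_mat2 of_rat_add of_rat_mult field_simps)
qed

lemma moebius_mult:
  assumes "det M > 0" "det N > 0" "Im \<tau> > 0"
  shows "moebius (M ** N) \<tau> = moebius M (moebius N \<tau>)"
proof -
  obtain a b c d where M: "M = mat2 a b c d" by (rule mat2_cases)
  obtain a' b' c' d' where N: "N = mat2 a' b' c' d'" by (rule mat2_cases)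
  have nz: "of_rat c' * \<tau> + of_rat d' \<noteq> 0" using automorphy_nonzero[OF assms(2,3)] by (simp add: N automorphy_mat2)
  have "(x * (y / z) + v) / (u * (y / z) + t) = (x * y + v * z) / (u * y + t * z)" if "z \<noteq> 0" for x y z u v t :: complex
  proof -
    have "x * (y / z) + v = (x * y + v * z) / z" "u * (y / z) + t = (u * y + t * z) / z"
      using that by (simp_all add: add_divide_distrib)
    then show ?thesis using that by simp
  qed
  note * = this[OF nz]
  show ?thesis
    unfolding M N mat2_mult moebius_mat2 * by (simp add: of_rat_add of_rat_mult algebra_simps)
qed

lemma mp_mult: "(M1, \<phi>1) \<otimes>\<^bsub>mp2_rat\<^esub> (M2, \<phi>2) = (M1 ** M2, \<lambda>\<tau>\<in>UH. \<phi>1 (moebius M2 \<tau>) * \<phi>2 \<tau>)"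
  by (simp add: mp2_rat_def)

lemma mp_int_mult: "x \<otimes>\<^bsub>mp2_int\<^esub> y = x \<otimes>\<^bsub>mp2_rat\<^esub> y"
  by (simp add: mp2_int_def)

lemma mp_rat_carrier_iff: "(M, \<phi>) \<in> carrier mp2_rat \<longleftrightarrow> det M > 0 \<and> \<phi> \<in> extensional UH \<and>
    \<phi> holomorphic_on UH \<and> (\<forall>\<tau>\<in>UH. (\<phi> \<tau>)\<^sup>2 = automorphy M \<tau>)"
  by (simp add: mp2_rat_def)

lemma mp_int_carrier_iff: "(M, \<phi>) \<in> carrier mp2_int \<longleftrightarrow>
    (M, \<phi>) \<in> carrier mp2_rat \<and> det M = 1 \<and> (\<forall>i j. M$i$j \<in> \<int>)"
  by (simp add: mp2_int_def)

lemma mp_int_carrierD: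
  assumes "(M, \<phi>) \<in> carrier mp2_int"
  shows "det M = 1" "M$i$j \<in> \<int>" "\<phi> \<in> extensional UH" "\<phi> holomorphic_on UH" "\<tau> \<in> UH \<Longrightarrow> (\<phi> \<tau>)\<^sup>2 = automorphy M \<tau>"
  using assms by (auto simp: mp_int_carrier_iff mp_rat_carrier_iff)

lemma mp_rat_mult_closed:
  assumes "x \<in> carrier mp2_rat" "y \<in> carrier mp2_rat"
  shows "x \<otimes>\<^bsub>mp2_rat\<^esub> y \<in> carrier mp2_rat"
proof -
  obtain M \<phi> N \<psi> where xy: "x = (M, \<phi>)" "y = (N, \<psi>)" by (cases x, cases y)
  have M: "det M > 0" "\<phi> holomorphic_on UH" "\<And>\<tau>. Im \<tau> > 0 \<Longrightarrow> (\<phi> \<tau>)\<^sup>2 = automorphy M \<tau>"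
    and N: "det N > 0" "\<psi> holomorphic_on UH" "\<And>\<tau>. Im \<tau> > 0 \<Longrightarrow> (\<psi> \<tau>)\<^sup>2 = automorphy N \<tau>"
    using assms by (auto simp: xy mp_rat_carrier_iff UH_iff)
  have hm: "moebius N holomorphic_on UH"
    unfolding moebius_def[abs_def]
    by (rule holomorphic_on_divide)
      (use automorphy_nonzero[OF N(1)] in \<open>auto simp: automorphy_def UH_iff intro!: holomorphic_intros\<close>)
  have "(\<phi> \<circ> moebius N) holomorphic_on UH"
    by (rule holomorphic_on_compose_gen[OF hm M(2)]) (use Im_moebius[OF N(1)] in \<open>auto simp: UH_iff\<close>)
  then have "(\<lambda>\<tau>. \<phi> (moebius N \<tau>) * \<psi> \<tau>) holomorphic_on UH"
    using N(2) by (auto simp: o_def intro!: holomorphic_intros)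
  then have "(\<lambda>\<tau>\<in>UH. \<phi> (moebius N \<tau>) * \<psi> \<tau>) holomorphic_on UH"
    by (rule holomorphic_transform) auto
  moreover have "(\<phi> (moebius N \<tau>) * \<psi> \<tau>)\<^sup>2 = automorphy (M ** N) \<tau>" if "Im \<tau> > 0" for \<tau>
    using that M(3) N(3) Im_moebius[OF N(1) that] automorphy_mult[OF N(1) that]
    by (simp add: power_mult_distrib)
  ultimately show ?thesis
    using M(1) N(1) by (auto simp: xy mp_mult mp_rat_carrier_iff det_mul UH_iff)
qed

lemma mp_int_mult_closed:
  assumes "x \<in> carrier mp2_int" "y \<in> carrier mp2_int"
  shows "x \<otimes>\<^bsub>mp2_rat\<^esub> y \<in> carrier mp2_int"
proof -
  obtain M \<phi> N \<psi> where xy: "x = (M, \<phi>)" "y = (N, \<psi>)" by (cases x, cases y)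
  have "x \<otimes>\<^bsub>mp2_rat\<^esub> y \<in> carrier mp2_rat"
    by (rule mp_rat_mult_closed) (use assms in \<open>auto simp: xy mp_int_carrier_iff\<close>)
  moreover have "det (M ** N) = 1" using assms by (simp add: xy mp_int_carrier_iff det_mul)
  moreover have "(M ** N)$i$j \<in> \<int>" for i j
    using assms by (auto simp: xy mp_int_carrier_iff matrix_matrix_mult_def intro!: Ints_sum)
  ultimately show ?thesis by (simp add: xy mp_mult mp_int_carrier_iff)
qed

text \<open>The quotient is continuous with values 1 and -1 on a connected set.\<close>

lemma mp_sign_unique:
  assumes "\<phi> holomorphic_on UH" "\<psi> holomorphic_on UH"
    and sq: "\<And>\<tau>. \<tau> \<in> UH \<Longrightarrow> (\<phi> \<tau>)\<^sup>2 = (\<psi> \<tau>)\<^sup>2" and nz: "\<And>\<tau>. \<tau> \<in> UH \<Longrightarrow> \<psi> \<tau> \<noteq> 0"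
  obtains s where "s = 1 \<or> s = -1" "\<And>\<tau>. \<tau> \<in> UH \<Longrightarrow> \<phi> \<tau> = s * \<psi> \<tau>"
proof -
  define r where "r = (\<lambda>\<tau>. \<phi> \<tau> / \<psi> \<tau>)"
  have r: "r \<tau> = 1 \<or> r \<tau> = -1" if "\<tau> \<in> UH" for \<tau>
    using sq[OF that] nz[OF that] by (auto simp: r_def power2_eq_iff)
  have "continuous_on UH r"
    unfolding r_def using assms by (intro continuous_on_divide holomorphic_on_imp_continuous_on) auto
  moreover have "connected UH"
    unfolding upper_half_plane_def by (intro convex_connected convex_halfspace_Im_gt)
  ultimately have "r constant_on UH"
    by (intro continuous_finite_range_constant) (auto intro!: finite_subset[of _ "{1, -1}"] dest: r)
  then obtain s where s: "\<And>\<tau>. \<tau> \<in> UH \<Longrightarrow> r \<tau> = s" by (auto simp: constant_on_def)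
  have i: "\<i> \<in> UH" by (simp add: UH_iff)
  show ?thesis
  proof (rule that)
    show "s = 1 \<or> s = -1" using r[OF i] s[OF i] by simp
    show "\<phi> \<tau> = s * \<psi> \<tau>" if "\<tau> \<in> UH" for \<tau> using s[OF that] nz[OF that] by (auto simp: r_def field_simps)
  qed
qed

lemma mp_int_carrier_mat2:
  assumes "a * d - b * c = 1" and int: "a \<in> \<int>" "b \<in> \<int>" "c \<in> \<int>" "d \<in> \<int>"
    and "\<phi> holomorphic_on UH" "\<And>\<tau>. Im \<tau> > 0 \<Longrightarrow> (\<phi> \<tau>)\<^sup>2 = of_rat c * \<tau> + of_rat d"
  shows "(mat2 a b c d, restrict \<phi> UH) \<in> carrier mp2_int"
proof -
  have "restrict \<phi> UH holomorphic_on UH"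
    using assms(6) by (rule holomorphic_transform) auto
  then show ?thesis
    using assms by (auto simp: mp_int_carrier_iff mp_rat_carrier_iff det_mat2 automorphy_mat2 forall_2 UH_iff)
qed

lemma mp_T_carrier: "mp_T \<in> carrier mp2_int"
  unfolding mp_T_def by (rule mp_int_carrier_mat2) (auto intro: holomorphic_intros)

lemma mp_S_carrier: "mp_S \<in> carrier mp2_int"
  unfolding mp_S_def by (rule mp_int_carrier_mat2) (auto intro!: holomorphic_intros simp: UH_iff complex_nonpos_Reals_iff)

definition mp_T_inv :: mp_elem where
  "mp_T_inv = (mat2 1 (-1) 0 1, \<lambda>\<tau>\<in>UH. 1)"

lemma mp_T_inv_carrier: "mp_T_inv \<in> carrier mp2_int"
  unfolding mp_T_inv_def by (rule mp_int_carrier_mat2) (auto intro: holomorphic_intros)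

lemma restrict_UH_cong: "(\<And>\<tau>. Im \<tau> > 0 \<Longrightarrow> f \<tau> = g \<tau>) \<Longrightarrow> restrict f UH = restrict g UH"
  by (rule restrict_ext) (simp add: UH_iff)

text \<open>The start of S^2 = (-1, \<i>), S^4 = (1, -1), S^8 = 1. The finite order determines the
  constant in the transformation law, and S^4 supplies the other square root.\<close>

lemma mp_S_S: "mp_S \<otimes>\<^bsub>mp2_rat\<^esub> mp_S = (mat2 (-1) 0 0 (-1), \<lambda>\<tau>\<in>UH. \<i>)"
proof -
  have "csqrt (- 1 / \<tau>) * csqrt \<tau> = \<i>" if \<tau>: "Im \<tau> > 0" for \<tau>
  proof -
    have nz: "csqrt \<tau> \<noteq> 0" using \<tau> by auto
    have pos: "Im (csqrt \<tau>) > 0" by (rule csqrt_upper_half_plane[OF \<tau>])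
    have "csqrt (- 1 / \<tau>) = \<i> / csqrt \<tau>"
    proof (rule csqrt_unique)
      show "(\<i> / csqrt \<tau>)\<^sup>2 = - 1 / \<tau>" by (simp add: power_divide)
      have "Re (\<i> / z) = Im z / (cmod z)\<^sup>2" for z by (simp add: Re_divide cmod_power2)
      then have "Re (\<i> / csqrt \<tau>) = Im (csqrt \<tau>) / (cmod (csqrt \<tau>))\<^sup>2" .
      also have "\<dots> > 0" using pos nz by (simp del: csqrt.simps)
      finally show "0 < Re (\<i> / csqrt \<tau>) \<or> Re (\<i> / csqrt \<tau>) = 0 \<and> 0 \<le> Im (\<i> / csqrt \<tau>)" by blast
    qed
    then show ?thesis using nz by simp
  qed
  moreover have "Im (- 1 / \<tau>) > 0" if "Im \<tau> > 0" for \<tau>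
    using Im_moebius[of "mat2 0 (-1) 1 0" \<tau>] that by (simp add: det_mat2 moebius_mat2)
  ultimately show ?thesis
    by (auto simp: mp_S_def mp_mult mat2_mult moebius_mat2 UH_iff intro!: restrict_UH_cong)
qed

lemma mp_S4: "(mp_S \<otimes>\<^bsub>mp2_rat\<^esub> mp_S) \<otimes>\<^bsub>mp2_rat\<^esub> (mp_S \<otimes>\<^bsub>mp2_rat\<^esub> mp_S) = (mat2 1 0 0 1, \<lambda>\<tau>\<in>UH. -1)"
  by (auto simp: mp_S_S mp_mult mat2_mult moebius_mat2 UH_iff intro!: restrict_UH_cong)

lemma mp_S8: "(mat2 1 0 0 1, \<lambda>\<tau>\<in>UH. -1) \<otimes>\<^bsub>mp2_rat\<^esub> (mat2 1 0 0 1, \<lambda>\<tau>\<in>UH. -1) = (mat2 1 0 0 1, \<lambda>\<tau>\<in>UH. 1)"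
  by (auto simp: mp_mult mat2_mult moebius_mat2 UH_iff intro!: restrict_UH_cong)

lemma mp_T_inv_T: "mp_T_inv \<otimes>\<^bsub>mp2_rat\<^esub> mp_T = (mat2 1 0 0 1, \<lambda>\<tau>\<in>UH. 1)"
  by (auto simp: mp_T_inv_def mp_T_def mp_mult mat2_mult moebius_mat2 UH_iff intro!: restrict_UH_cong)

subsection \<open>Theta functions transform under the Weil representation\<close>

lemma bij_carrier_iff: "f \<in> carrier (BijGroup A) \<longleftrightarrow> bij_betw f A A \<and> f \<in> extensional A"
  by (auto simp: BijGroup_def Bij_def)

locale weil_lattice = framed_lattice L b F for L :: "'v::real_vector set" and b F +
  fixes \<rho> :: "mp_elem \<Rightarrow> ('v set \<Rightarrow> complex) \<Rightarrow> 'v set \<Rightarrow> complex"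
  assumes weil: "weil_representation L b \<rho>"
begin

abbreviation "GA \<equiv> group_algebra L b"

lemma rho_hom: "\<rho> \<in> hom mp2_int (BijGroup GA)"
  using weil by (simp add: weil_representation_def)

lemma rho_bij:
  assumes "\<gamma> \<in> carrier mp2_int" shows "bij_betw (\<rho> \<gamma>) GA GA"
  using hom_in_carrier[OF rho_hom assms] by (simp add: bij_carrier_iff)

lemma rho_in: "\<gamma> \<in> carrier mp2_int \<Longrightarrow> v \<in> GA \<Longrightarrow> \<rho> \<gamma> v \<in> GA"
  using rho_bij bij_betwE by blast

lemma rho_inject: "\<gamma> \<in> carrier mp2_int \<Longrightarrow> v \<in> GA \<Longrightarrow> w \<in> GA \<Longrightarrow> \<rho> \<gamma> v = \<rho> \<gamma> w \<Longrightarrow> v = w"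
  using rho_bij[of \<gamma>] by (auto simp: bij_betw_def inj_on_def)

lemma rho_mult:
  assumes "\<gamma> \<in> carrier mp2_int" "\<gamma>' \<in> carrier mp2_int" "v \<in> GA"
  shows "\<rho> (\<gamma> \<otimes>\<^bsub>mp2_rat\<^esub> \<gamma>') v = \<rho> \<gamma> (\<rho> \<gamma>' v)"
proof -
  have "\<rho> (\<gamma> \<otimes>\<^bsub>mp2_rat\<^esub> \<gamma>') = \<rho> \<gamma> \<otimes>\<^bsub>BijGroup GA\<^esub> \<rho> \<gamma>'"
    using hom_mult[OF rho_hom assms(1,2)] by (simp add: mp_int_mult)
  moreover have "\<rho> \<gamma> \<in> Bij GA" "\<rho> \<gamma>' \<in> Bij GA"
    using hom_in_carrier[OF rho_hom] assms by (auto simp: BijGroup_def)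
  ultimately show ?thesis using assms(3) by (simp add: BijGroup_def compose_def)
qed

lemma GA_0: "(\<lambda>x. 0) \<in> GA"
  and GA_add: "v \<in> GA \<Longrightarrow> w \<in> GA \<Longrightarrow> (\<lambda>x. z * v x + w x) \<in> GA"
  and GA_scale: "v \<in> GA \<Longrightarrow> (\<lambda>x. z * v x) \<in> GA"
  and GA_sum: "(\<And>i. i \<in> I \<Longrightarrow> f i \<in> GA) \<Longrightarrow> (\<lambda>x. \<Sum>i\<in>I. c i * f i x) \<in> GA"
  and GA_basis: "y \<in> disc L b \<Longrightarrow> basis_elem y \<in> GA"
  by (auto simp: group_algebra_def basis_elem_def)

lemma rho_linear:
  assumes "\<gamma> \<in> carrier mp2_int" "v \<in> GA" "w \<in> GA"
  shows "\<rho> \<gamma> (\<lambda>x. z * v x + w x) = (\<lambda>x. z * \<rho> \<gamma> v x + \<rho> \<gamma> w x)"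
  using weil assms by (auto simp: weil_representation_def)

lemma rho_0: "\<gamma> \<in> carrier mp2_int \<Longrightarrow> \<rho> \<gamma> (\<lambda>x. 0) = (\<lambda>x. 0)"
  using rho_linear[of \<gamma> "\<lambda>x. 0" "\<lambda>x. 0" "-1"] GA_0 by (simp add: fun_eq_iff)

lemma rho_scale:
  assumes "\<gamma> \<in> carrier mp2_int" "v \<in> GA"
  shows "\<rho> \<gamma> (\<lambda>x. z * v x) = (\<lambda>x. z * \<rho> \<gamma> v x)"
  using rho_linear[OF assms GA_0, of z] rho_0[OF assms(1)] by simp

lemma rho_sum:
  assumes "\<gamma> \<in> carrier mp2_int" "finite I" "\<And>i. i \<in> I \<Longrightarrow> f i \<in> GA"
  shows "\<rho> \<gamma> (\<lambda>x. \<Sum>i\<in>I. z i * f i x) = (\<lambda>x. \<Sum>i\<in>I. z i * \<rho> \<gamma> (f i) x)"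
  using assms(2,3)
proof (induction I rule: finite_induct)
  case (insert i I)
  have "(\<lambda>x. \<Sum>i\<in>I. z i * f i x) \<in> GA" by (rule GA_sum) (use insert in auto)
  then have "\<rho> \<gamma> (\<lambda>x. z i * f i x + (\<Sum>i\<in>I. z i * f i x)) = (\<lambda>x. z i * \<rho> \<gamma> (f i) x + \<rho> \<gamma> (\<lambda>x. \<Sum>i\<in>I. z i * f i x) x)"
    by (intro rho_linear assms(1)) (use insert.prems in auto)
  also have "\<rho> \<gamma> (\<lambda>x. \<Sum>i\<in>I. z i * f i x) = (\<lambda>x. \<Sum>i\<in>I. z i * \<rho> \<gamma> (f i) x)"
    by (rule insert.IH) (use insert.prems in auto)
  finally show ?case using insert.hyps by simp
qed (simp add: rho_0 assms)

lemma GA_expand: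
  assumes "v \<in> GA" shows "v = (\<lambda>x. \<Sum>y\<in>disc L b. v y * basis_elem y x)"
proof
  fix x
  have "(\<Sum>y\<in>disc L b. v y * basis_elem y x) = (\<Sum>y\<in>disc L b. if y = x then v x else 0)"
    by (rule sum.cong) (auto simp: basis_elem_def)
  also have "\<dots> = v x" using assms finite_disc by (simp add: group_algebra_def)
  finally show "v x = (\<Sum>y\<in>disc L b. v y * basis_elem y x)" by simp
qed

lemma rho_expand:
  assumes "\<gamma> \<in> carrier mp2_int" "v \<in> GA"
  shows "\<rho> \<gamma> v = (\<lambda>x. \<Sum>y\<in>disc L b. v y * \<rho> \<gamma> (basis_elem y) x)"
  using rho_sum[OF assms(1) finite_disc, of "basis_elem" v] GA_expand[OF assms(2)] GA_basis by simp

lemma rho_T: "v \<in> GA \<Longrightarrow> \<rho> mp_T v = (\<lambda>x. e (of_real (qclass b x)) * v x)"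
proof
  fix x assume v: "v \<in> GA"
  have "\<rho> mp_T v x = (\<Sum>y\<in>disc L b. v y * (e (of_real (qclass b y)) * basis_elem y x))"
    unfolding rho_expand[OF mp_T_carrier v] by (rule sum.cong) (use weil in \<open>auto simp: weil_representation_def\<close>)
  also have "\<dots> = (\<Sum>y\<in>disc L b. if y = x then e (of_real (qclass b x)) * v x else 0)"
    by (rule sum.cong) (auto simp: basis_elem_def)
  also have "\<dots> = e (of_real (qclass b x)) * v x" using v finite_disc by (simp add: group_algebra_def)
  finally show "\<rho> mp_T v x = e (of_real (qclass b x)) * v x" .
qed

definition \<zeta> :: complex where "\<zeta> = e (1 / 8) powi (int neg_rank - int pos_rank)"

definition sqrt_disc :: real where "sqrt_disc = sqrt (real (card (disc L b)))"

lemma sqrt_disc_pos: "sqrt_disc > 0"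
proof -
  have "cls 0 \<in> disc L b" by (rule cls_in_disc) (rule add_subgroup_0[OF Ld_subgroup])
  then have "card (disc L b) > 0" using finite_disc by (auto simp: card_gt_0_iff)
  then show ?thesis by (simp add: sqrt_disc_def)
qed

lemma rho_S:
  assumes v: "v \<in> GA" and x: "x \<in> disc L b"
  shows "\<rho> mp_S v x = \<zeta> / of_real sqrt_disc * (\<Sum>y\<in>disc L b. e (- of_real (bclass b x y)) * v y)"
proof -
  have "\<rho> mp_S v x = (\<Sum>y\<in>disc L b. v y * (\<zeta> / of_real sqrt_disc * (\<Sum>\<mu>\<in>disc L b. e (- of_real (bclass b y \<mu>)) * basis_elem \<mu> x)))"
    unfolding rho_expand[OF mp_S_carrier v]
    by (rule sum.cong) (use weil in \<open>auto simp: weil_representation_def \<zeta>_def sqrt_disc_def pos_index_eq neg_index_eq\<close>)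
  also have "\<dots> = (\<Sum>y\<in>disc L b. v y * (\<zeta> / of_real sqrt_disc * e (- of_real (bclass b x y))))"
  proof (rule sum.cong)
    fix y assume "y \<in> disc L b"
    have "(\<Sum>\<mu>\<in>disc L b. e (- of_real (bclass b y \<mu>)) * basis_elem \<mu> x) = (\<Sum>\<mu>\<in>disc L b. if \<mu> = x then e (- of_real (bclass b x y)) else 0)"
      by (rule sum.cong) (auto simp: basis_elem_def bclass_def symmetric)
    then show "v y * (\<zeta> / of_real sqrt_disc * (\<Sum>\<mu>\<in>disc L b. e (- of_real (bclass b y \<mu>)) * basis_elem \<mu> x)) = v y * (\<zeta> / of_real sqrt_disc * e (- of_real (bclass b x y)))"
      using x finite_disc by simp
  qed simp
  finally show ?thesis by (simp add: sum_distrib_left mult_ac)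
qed

text \<open>Poisson summation contributes one eighth root of unity per positive direction and its
  conjugate per negative one; together they are the constant in \<rho>(S).\<close>

lemma frame_factor_eighth: "frame_factor (e (- (1 / 8))) = \<zeta>"
proof -
  have inv: "e (- (1 / 8)) = inverse (e (1 / 8))" by (rule e_minus)
  have "cnj (e (of_real (- (1 / 8)))) = e (- of_real (- (1 / 8)))" by (rule cnj_e_of_real)
  then have "cnj (e (- (1 / 8))) = e (1 / 8)" by simp
  then have "frame_factor (e (- (1 / 8))) = inverse (e (1 / 8)) ^ pos_rank * e (1 / 8) ^ neg_rank" by (simp only: frame_factor_def inv)
  also have "\<dots> = \<zeta>" by (simp add: \<zeta>_def power_int_diff field_simps)
  finally show ?thesis .
qed

lemma norm_frame_factor: "norm (frame_factor z) = norm z ^ (pos_rank + neg_rank)"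
  by (simp add: frame_factor_def norm_mult norm_power power_add)

text \<open>On the imaginary axis every term of the series is positive.\<close>

lemma theta_imaginary_nonzero:
  assumes y: "y > 0" and x: "x \<in> disc L b"
  shows "theta (\<i> * of_real y) 0 0 x \<noteq> 0"
proof -
  define g where "g = (\<lambda>v. \<Prod>w\<in>F. exp (- (pi * y * \<bar>b w w\<bar>) * (coord w v)\<^sup>2))"
  have gpos: "g v > 0" for v unfolding g_def by (rule prod_pos) simp
  obtain v0 where v0: "v0 \<in> x" using class_rep_in[OF x] by blast
  have "(\<lambda>v. gauss (\<i> * of_real y) (v + 0)) summable_on x"
    by (rule gauss_summable) (use y disc_sub_Ld[OF x] in auto)
  then have s: "(\<lambda>v. complex_of_real (g v)) summable_on x"
    by (simp add: gauss_imaginary g_def)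
  then have sg: "g summable_on x"
    using summable_on_Re[OF s] by simp
  have "0 < g v0" by (rule gpos)
  also have "\<dots> \<le> infsum g x"
    using finite_sum_le_infsum[OF sg, of "{v0}"] v0 gpos by (simp add: less_imp_le)
  finally have "infsum g x > 0" .
  moreover have "theta (\<i> * of_real y) 0 0 x = infsum (\<lambda>v. complex_of_real (g v)) x"
    by (simp add: theta_def bil_0 gauss_imaginary g_def)
  moreover have "\<dots> = of_real (infsum g x)"
    using infsumI[OF has_sum_of_real[OF has_sum_infsum[OF sg]]] .
  ultimately show ?thesis by simp
qed

text \<open>Characteristics form a row vector (u, w) multiplied by the matrix from the right. With
  this order covariance is multiplicative in \<gamma>.\<close>

definition theta_covariant :: "mp_elem \<Rightarrow> bool" where
  "theta_covariant \<gamma> \<longleftrightarrow> \<gamma> \<in> carrier mp2_int \<and> (\<forall>\<tau> u w. Im \<tau> > 0 \<longrightarrow> u \<in> span L \<longrightarrow> w \<in> span L \<longrightarrow>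
     theta_vec (moebius (fst \<gamma>) \<tau>) u w = (\<lambda>x. frame_factor (snd \<gamma> \<tau>) *
       \<rho> \<gamma> (theta_vec \<tau> (of_rat (fst \<gamma> $ 1 $ 1) *\<^sub>R u + of_rat (fst \<gamma> $ 2 $ 1) *\<^sub>R w)
                (of_rat (fst \<gamma> $ 1 $ 2) *\<^sub>R u + of_rat (fst \<gamma> $ 2 $ 2) *\<^sub>R w)) x))"

lemma theta_covariant_mult:
  assumes "theta_covariant x" "theta_covariant y" shows "theta_covariant (x \<otimes>\<^bsub>mp2_rat\<^esub> y)"
proof -
  obtain M \<phi> N \<psi> where xy: "x = (M, \<phi>)" "y = (N, \<psi>)" by (cases x, cases y)
  have x: "(M, \<phi>) \<in> carrier mp2_int" and y: "(N, \<psi>) \<in> carrier mp2_int"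
    using assms by (auto simp: xy theta_covariant_def)
  have det: "det M > 0" "det N > 0" using mp_int_carrierD(1)[OF x] mp_int_carrierD(1)[OF y] by auto
  show ?thesis unfolding theta_covariant_def
  proof (intro conjI allI impI)
    show "x \<otimes>\<^bsub>mp2_rat\<^esub> y \<in> carrier mp2_int" using x y by (simp add: xy mp_int_mult_closed)
    fix \<tau> u w assume \<tau>: "Im \<tau> > 0" and u: "u \<in> span L" and w: "w \<in> span L"
    define u1 where "u1 = (of_rat (M$1$1) :: real) *\<^sub>R u + of_rat (M$2$1) *\<^sub>R w"
    define w1 where "w1 = (of_rat (M$1$2) :: real) *\<^sub>R u + of_rat (M$2$2) *\<^sub>R w"
    define u2 where "u2 = (of_rat (N$1$1) :: real) *\<^sub>R u1 + of_rat (N$2$1) *\<^sub>R w1"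
    define w2 where "w2 = (of_rat (N$1$2) :: real) *\<^sub>R u1 + of_rat (N$2$2) *\<^sub>R w1"
    have uw1: "u1 \<in> span L" "w1 \<in> span L" unfolding u1_def w1_def using u w by (auto intro: span_add span_scale)
    have Im: "Im (moebius N \<tau>) > 0" by (rule Im_moebius[OF det(2) \<tau>])
    have "theta_vec (moebius (M ** N) \<tau>) u w = theta_vec (moebius M (moebius N \<tau>)) u w"
      by (simp only: moebius_mult[OF det \<tau>])
    also have "\<dots> = (\<lambda>x. frame_factor (\<phi> (moebius N \<tau>)) * \<rho> (M, \<phi>) (theta_vec (moebius N \<tau>) u1 w1) x)"
      using assms(1) Im u w by (simp add: xy theta_covariant_def u1_def w1_def)
    also have "theta_vec (moebius N \<tau>) u1 w1 = (\<lambda>x. frame_factor (\<psi> \<tau>) * \<rho> (N, \<psi>) (theta_vec \<tau> u2 w2) x)"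
      using assms(2) \<tau> uw1 by (simp add: xy theta_covariant_def u2_def w2_def)
    also have "\<rho> (M, \<phi>) (\<lambda>x. frame_factor (\<psi> \<tau>) * \<rho> (N, \<psi>) (theta_vec \<tau> u2 w2) x) = (\<lambda>z. frame_factor (\<psi> \<tau>) * \<rho> (x \<otimes>\<^bsub>mp2_rat\<^esub> y) (theta_vec \<tau> u2 w2) z)"
      using rho_scale[OF x rho_in[OF y theta_vec_in_group_algebra]] rho_mult[OF x y theta_vec_in_group_algebra] by (simp add: xy)
    also have "u2 = of_rat ((M ** N)$1$1) *\<^sub>R u + of_rat ((M ** N)$2$1) *\<^sub>R w"
      by (simp add: u2_def u1_def w1_def matrix_matrix_mult_def sum_2 of_rat_add of_rat_mult algebra_simps)
    also have "w2 = of_rat ((M ** N)$1$2) *\<^sub>R u + of_rat ((M ** N)$2$2) *\<^sub>R w"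
      by (simp add: w2_def u1_def w1_def matrix_matrix_mult_def sum_2 of_rat_add of_rat_mult algebra_simps)
    finally show "theta_vec (moebius (fst (x \<otimes>\<^bsub>mp2_rat\<^esub> y)) \<tau>) u w = (\<lambda>z. frame_factor (snd (x \<otimes>\<^bsub>mp2_rat\<^esub> y) \<tau>) *
       \<rho> (x \<otimes>\<^bsub>mp2_rat\<^esub> y) (theta_vec \<tau> (of_rat (fst (x \<otimes>\<^bsub>mp2_rat\<^esub> y) $ 1 $ 1) *\<^sub>R u + of_rat (fst (x \<otimes>\<^bsub>mp2_rat\<^esub> y) $ 2 $ 1) *\<^sub>R w)
                (of_rat (fst (x \<otimes>\<^bsub>mp2_rat\<^esub> y) $ 1 $ 2) *\<^sub>R u + of_rat (fst (x \<otimes>\<^bsub>mp2_rat\<^esub> y) $ 2 $ 2) *\<^sub>R w)) z)"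
      using \<tau> by (simp add: xy mp_mult UH_iff frame_factor_mult mult.assoc)
  qed
qed

lemma theta_vec_T:
  assumes "u \<in> span L" shows "theta_vec (\<tau> + 1) u w = \<rho> mp_T (theta_vec \<tau> u (u + w))"
  unfolding rho_T[OF theta_vec_in_group_algebra] by (auto simp: theta_vec_def theta_T[OF _ assms] fun_eq_iff)

lemma frame_factor_1 [simp]: "frame_factor 1 = 1"
  by (simp add: frame_factor_def)

lemma theta_covariant_T: "theta_covariant mp_T"
  unfolding theta_covariant_def using mp_T_carrier theta_vec_T
  by (auto simp: mp_T_def moebius_mat2 UH_iff)

lemma rho_one:
  assumes v: "v \<in> GA" shows "\<rho> (mat2 1 0 0 1, \<lambda>\<tau>\<in>UH. 1) v = v"
proof -
  let ?I = "(mat2 1 0 0 1, \<lambda>\<tau>\<in>UH. 1)"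
  have c: "?I \<in> carrier mp2_int" by (rule mp_int_carrier_mat2) (auto intro: holomorphic_intros)
  have "?I \<otimes>\<^bsub>mp2_rat\<^esub> ?I = ?I"
    by (auto simp: mp_mult mat2_mult moebius_mat2 UH_iff intro!: restrict_UH_cong)
  then have "\<rho> ?I (\<rho> ?I v) = \<rho> ?I v" using rho_mult[OF c c v] by simp
  then show ?thesis using rho_inject[OF c rho_in[OF c v] v] by simp
qed

lemma theta_covariant_T_inv: "theta_covariant mp_T_inv"
proof -
  have "theta_vec (\<tau> - 1) u w = \<rho> mp_T_inv (theta_vec \<tau> u (w - u))" if u: "u \<in> span L" for \<tau> u w
  proof -
    have "theta_vec \<tau> u (w - u) = \<rho> mp_T (theta_vec (\<tau> - 1) u w)" using theta_vec_T[OF u, of "\<tau> - 1" "w - u"] by simp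
    then have "\<rho> mp_T_inv (theta_vec \<tau> u (w - u)) = \<rho> (mp_T_inv \<otimes>\<^bsub>mp2_rat\<^esub> mp_T) (theta_vec (\<tau> - 1) u w)"
      using rho_mult[OF mp_T_inv_carrier mp_T_carrier theta_vec_in_group_algebra] by simp
    then show ?thesis unfolding mp_T_inv_T rho_one[OF theta_vec_in_group_algebra] by simp
  qed
  then show ?thesis
    unfolding theta_covariant_def using mp_T_inv_carrier by (auto simp: mp_T_inv_def moebius_mat2 UH_iff)
qed

text \<open>Poisson summation yields the transformation under \<open>S\<close> only up to a positive constant. The
  constant is 1 because the theta vector at \<open>\<i>\<close> is an eigenvector of \<open>\<rho>(S)\<close>, which has finite
  order.\<close>

lemma theta_covariant_S: "theta_covariant mp_S"
proof -
  obtain C where C: "C > 0"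
    "\<And>\<tau> u w v0. Im \<tau> > 0 \<Longrightarrow> u \<in> span L \<Longrightarrow> w \<in> span L \<Longrightarrow> v0 \<in> Ld \<Longrightarrow>
      theta (- 1 / \<tau>) u w (cls v0) = of_real C * frame_factor (csqrt \<tau> * e (- (1 / 8))) *
        (\<Sum>\<mu>\<in>disc L b. e (- of_real (b v0 (class_rep \<mu>))) * theta \<tau> w (- u) \<mu>)"
    using theta_S_up_to_constant by blast
  define K where "K = complex_of_real (C * sqrt_disc)"
  have K: "theta_vec (- 1 / \<tau>) u w = (\<lambda>x. K * frame_factor (csqrt \<tau>) * \<rho> mp_S (theta_vec \<tau> w (- u)) x)"
    if "Im \<tau> > 0" "u \<in> span L" "w \<in> span L" for \<tau> u w
  proof
    fix x
    show "theta_vec (- 1 / \<tau>) u w x = K * frame_factor (csqrt \<tau>) * \<rho> mp_S (theta_vec \<tau> w (- u)) x"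
    proof (cases "x \<in> disc L b")
      case True
      have "theta_vec (- 1 / \<tau>) u w x = of_real C * frame_factor (csqrt \<tau> * e (- (1 / 8))) *
        (\<Sum>\<mu>\<in>disc L b. e (- of_real (b (class_rep x) (class_rep \<mu>))) * theta \<tau> w (- u) \<mu>)"
        using C(2)[OF that class_rep_Ld[OF True]] True by (simp add: theta_vec_def cls_class_rep)
      also have "\<dots> = K * frame_factor (csqrt \<tau>) * \<rho> mp_S (theta_vec \<tau> w (- u)) x"
        unfolding rho_S[OF theta_vec_in_group_algebra True] frame_factor_mult frame_factor_eighth bclass_def
        using sqrt_disc_pos by (simp add: K_def theta_vec_def)
      finally show ?thesis .
    next
      case False
      then show ?thesis
        using rho_in[OF mp_S_carrier theta_vec_in_group_algebra, of \<tau> w "- u"] by (simp add: theta_vec_def group_algebra_def)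
    qed
  qed
  define \<Theta> where "\<Theta> = theta_vec \<i> 0 0"
  have \<Theta>: "\<Theta> \<in> GA" by (simp add: \<Theta>_def theta_vec_in_group_algebra)
  define z where "z = 1 / (K * frame_factor (csqrt \<i>))"
  have nK: "norm K = C * sqrt_disc" "K \<noteq> 0" using C(1) sqrt_disc_pos by (auto simp: K_def norm_mult)
  have njj: "norm (frame_factor (csqrt \<i>)) = 1"
  proof -
    have "norm s = 1" if "s\<^sup>2 = \<i>" for s :: complex
    proof -
      have "norm s ^ 2 = 1" using that by (metis norm_power norm_ii)
      then show ?thesis using norm_ge_zero[of s] by (auto simp: power2_eq_1_iff)
    qed
    then show ?thesis unfolding norm_frame_factor by (simp only: power2_csqrt power_one)
  qed
  have "\<Theta> = (\<lambda>x. K * frame_factor (csqrt \<i>) * \<rho> mp_S \<Theta> x)"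
    using K[of \<i> 0 0] by (simp add: \<Theta>_def span_zero)
  then have S: "\<rho> mp_S \<Theta> = (\<lambda>x. z * \<Theta> x)"
    using nK(2) njj by (auto simp: z_def fun_eq_iff)
  \<comment> \<open>Three squarings lead from S to S^8 = 1, whence z^8 = 1; positivity of the
    constant then leaves only 1.\<close>
  have iter: "\<rho> (x \<otimes>\<^bsub>mp2_rat\<^esub> x) \<Theta> = (\<lambda>y. (a * a) * \<Theta> y)"
    if "x \<in> carrier mp2_int" "\<rho> x \<Theta> = (\<lambda>y. a * \<Theta> y)" for x a
    using rho_mult[OF that(1,1) \<Theta>] rho_scale[OF that(1) \<Theta>, of a] that(2) by (simp add: mult.assoc)
  let ?S2 = "mp_S \<otimes>\<^bsub>mp2_rat\<^esub> mp_S" and ?S4 = "(mat2 1 0 0 1, \<lambda>\<tau>\<in>UH. -1)"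
  have c2: "?S2 \<in> carrier mp2_int" by (intro mp_int_mult_closed mp_S_carrier)
  have c4: "?S4 \<in> carrier mp2_int" unfolding mp_S4[symmetric] by (intro mp_int_mult_closed c2)
  have "\<Theta> = (\<lambda>y. z ^ 8 * \<Theta> y)"
    using iter[OF c4 iter[OF c2 iter[OF mp_S_carrier S], unfolded mp_S4]]
    unfolding mp_S8 rho_one[OF \<Theta>] by (simp add: power_numeral_reduce mult.assoc)
  moreover have "cls 0 \<in> disc L b" by (rule cls_in_disc) (rule add_subgroup_0[OF Ld_subgroup])
  then have "\<Theta> (cls 0) \<noteq> 0" using theta_imaginary_nonzero[of 1] by (simp add: \<Theta>_def theta_vec_def)
  ultimately have "z ^ 8 = 1" by (metis mult_cancel_right1)
  then have "norm z ^ 8 = 1" by (metis norm_one norm_power)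
  then have "norm z = 1" using power_eq_imp_eq_base[of "norm z" 8 1] by simp
  then have "C * sqrt_disc = 1" using nK(1) njj by (simp add: z_def norm_divide norm_mult field_simps)
  then have "K = 1" by (simp add: K_def del: of_real_mult)
  then show ?thesis
    unfolding theta_covariant_def using mp_S_carrier K by (auto simp: mp_S_def moebius_mat2 UH_iff)
qed

end

section \<open>Generation of SL_2(Z) and covariance for all of Mp_2(Z)\<close>

context weil_lattice
begin

text \<open>The second component is left open while matrices are factored; it is determined up to
  sign afterwards.\<close>

definition theta_covariant_mat :: "rat^2^2 \<Rightarrow> bool" where "theta_covariant_mat A \<longleftrightarrow> (\<exists>\<phi>. theta_covariant (A, \<phi>))"

lemma theta_covariant_mat_mult: "theta_covariant_mat A \<Longrightarrow> theta_covariant_mat B \<Longrightarrow> theta_covariant_mat (A ** B)"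
  using theta_covariant_mult unfolding theta_covariant_mat_def by (metis mp_mult)

lemma theta_covariant_mat_S: "theta_covariant_mat (mat2 0 (-1) 1 0)"
  using theta_covariant_S unfolding theta_covariant_mat_def mp_S_def by blast

lemma theta_covariant_mat_T: "theta_covariant_mat (mat2 1 (of_int k) 0 1)"
proof -
  have T: "theta_covariant_mat (mat2 1 1 0 1)" using theta_covariant_T unfolding theta_covariant_mat_def mp_T_def by blast
  have Ti: "theta_covariant_mat (mat2 1 (-1) 0 1)" using theta_covariant_T_inv unfolding theta_covariant_mat_def mp_T_inv_def by blast
  show ?thesis
  proof (induction k rule: int_induct[of _ 0])
    case base
    show ?case using theta_covariant_mat_mult[OF T Ti] by (simp add: mat2_mult)
  next
    case (step1 i)
    then show ?case using theta_covariant_mat_mult[OF T step1(2)] by (simp add: mat2_mult add.commute)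
  next
    case (step2 i)
    then show ?case using theta_covariant_mat_mult[OF Ti step2(2)] by (simp add: mat2_mult)
  qed
qed

text \<open>Euclidean algorithm on the first column: a power of T reduces a modulo c, and S moves
  the remainder to the lower left corner.\<close>

lemma theta_covariant_mat_SL2:
  fixes a t c d :: int
  assumes "a * d - t * c = 1"
  shows "theta_covariant_mat (mat2 (of_int a) (of_int t) (of_int c) (of_int d))"
  using assms
proof (induction "nat \<bar>c\<bar>" arbitrary: a t c d rule: less_induct)
  case less
  have S2: "theta_covariant_mat (mat2 (-1) 0 0 (-1))" using theta_covariant_mat_mult[OF theta_covariant_mat_S theta_covariant_mat_S] by (simp add: mat2_mult)
  show ?case
  proof (cases "c = 0")
    case True
    then have "a * d = 1" using less.prems by simp
    then consider "a = 1" "d = 1" | "a = -1" "d = -1" by (auto simp: zmult_eq_1_iff)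
    then show ?thesis
    proof cases
      case 1
      then show ?thesis using True theta_covariant_mat_T[of t] by simp
    next
      case 2
      then show ?thesis using True theta_covariant_mat_mult[OF S2 theta_covariant_mat_T[of "- t"]] by (simp add: mat2_mult)
    qed
  next
    case False
    define k where "k = a div c"
    have r: "a mod c = a - k * c" by (simp add: k_def minus_div_mult_eq_mod[symmetric])
    have "\<bar>a mod c\<bar> < \<bar>c\<bar>" using False by (rule abs_mod_less)
    then have "theta_covariant_mat (mat2 (of_int (- c)) (of_int (- d)) (of_int (a - k * c)) (of_int (t - k * d)))"
      using less.prems False unfolding r by (intro less.hyps) (auto simp: algebra_simps)
    moreover have "theta_covariant_mat (mat2 0 1 (-1) 0)" using theta_covariant_mat_mult[OF S2 theta_covariant_mat_S] by (simp add: mat2_mult)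
    ultimately have "theta_covariant_mat (mat2 1 (of_int k) 0 1 ** (mat2 0 1 (-1) 0 **
        mat2 (of_int (- c)) (of_int (- d)) (of_int (a - k * c)) (of_int (t - k * d))))"
      using theta_covariant_mat_T[of k] theta_covariant_mat_mult by blast
    then show ?thesis by (simp add: mat2_mult algebra_simps)
  qed
qed

text \<open>The matrix fixes the second component up to sign, and the sign -1 over the identity
  matrix is S^4.\<close>

theorem theta_covariant_all:
  assumes "\<gamma> \<in> carrier mp2_int" shows "theta_covariant \<gamma>"
proof -
  obtain M \<phi> where \<gamma>: "\<gamma> = (M, \<phi>)" by (cases \<gamma>)
  note D = mp_int_carrierD[OF assms[unfolded \<gamma>]]
  obtain x1 x2 x3 x4 where M0: "M = mat2 x1 x2 x3 x4" by (rule mat2_cases)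
  have "x1 \<in> \<int>" "x2 \<in> \<int>" "x3 \<in> \<int>" "x4 \<in> \<int>"
    using D(2)[of 1 1] D(2)[of 1 2] D(2)[of 2 1] D(2)[of 2 2] by (auto simp: M0)
  then obtain a t c d where M: "M = mat2 (of_int a) (of_int t) (of_int c) (of_int d)"
    unfolding M0 by (metis Ints_cases)
  have "(of_int (a * d - t * c) :: rat) = 1" using D(1) by (simp add: M det_mat2)
  then have "a * d - t * c = 1" by (simp only: of_int_eq_1_iff)
  then obtain \<psi> where \<psi>: "theta_covariant (M, \<psi>)" using theta_covariant_mat_SL2 unfolding M theta_covariant_mat_def by blast
  then have c: "(M, \<psi>) \<in> carrier mp2_int" by (simp add: theta_covariant_def)
  note D' = mp_int_carrierD[OF c]
  have nz: "\<psi> \<tau> \<noteq> 0" if "\<tau> \<in> UH" for \<tau>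
    using D'(5)[OF that] automorphy_nonzero[of M \<tau>] D(1) that by (auto simp: UH_iff)
  obtain s where s: "s = 1 \<or> s = -1" "\<And>\<tau>. \<tau> \<in> UH \<Longrightarrow> \<phi> \<tau> = s * \<psi> \<tau>"
    by (rule mp_sign_unique[OF D(4) D'(4) _ nz]) (use D(5) D'(5) in auto)
  show ?thesis
  proof (cases "s = 1")
    case True
    then have "\<phi> = \<psi>" using s D(3) D'(3) by (intro extensionalityI[of _ UH]) auto
    then show ?thesis using \<psi> \<gamma> by simp
  next
    case False
    then have "\<phi> \<tau> = - \<psi> \<tau>" if "\<tau> \<in> UH" for \<tau> using s that by simp
    then have eq: "(M, \<phi>) = (M, \<psi>) \<otimes>\<^bsub>mp2_rat\<^esub> (mat2 1 0 0 1, \<lambda>\<tau>\<in>UH. -1)"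
      using D(3) by (auto simp: mp_mult moebius_mat2 M mat2_mult intro!: extensionalityI[of _ UH])
    have "theta_covariant (mat2 1 0 0 1, \<lambda>\<tau>\<in>UH. -1)" unfolding mp_S4[symmetric] by (intro theta_covariant_mult theta_covariant_S)
    then show ?thesis unfolding \<gamma> eq by (rule theta_covariant_mult[OF \<psi>])
  qed
qed

lemma rho_theta_vec:
  assumes "(mat2 (of_int a) (of_int t) (of_int c) (of_int d), \<phi>) \<in> carrier mp2_int"
    and "Im \<tau> > 0" "u \<in> span L" "w \<in> span L"
  shows "theta_vec (moebius (mat2 (of_int a) (of_int t) (of_int c) (of_int d)) \<tau>) u w = (\<lambda>x. frame_factor (\<phi> \<tau>) *
     \<rho> (mat2 (of_int a) (of_int t) (of_int c) (of_int d), \<phi>)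
       (theta_vec \<tau> (of_int a *\<^sub>R u + of_int c *\<^sub>R w) (of_int t *\<^sub>R u + of_int d *\<^sub>R w)) x)"
  using theta_covariant_all[OF assms(1)] assms(2-4) by (simp add: theta_covariant_def)

lemma weil_act_eqI:
  assumes "\<gamma> \<in> carrier mp2_int" "Y \<in> GA" "\<rho> \<gamma> Y = X"
  shows "weil_act L b \<rho> \<gamma> X = Y"
  unfolding weil_act_def assms(3)[symmetric]
  by (rule inv_into_f_f) (use rho_bij[OF assms(1)] assms(2) in \<open>auto simp: bij_betw_def\<close>)

text \<open>Push-forward of a lattice sum under multiplication by N: the vectors in the classes x
  with N x = y are the z / N in L' with z in y.\<close>

lemma infsum_disc_power:
  fixes G :: "'v \<Rightarrow> complex"
  assumes y: "y \<in> disc L b" and N: "N > 0" and G: "G summable_on Ld"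
  shows "(\<Sum>x\<in>disc L b. (\<Sum>\<^sub>\<infinity>v\<in>x. G v) * basis_elem (x [^]\<^bsub>disc_group L b\<^esub> (N::nat)) y)
    = (\<Sum>\<^sub>\<infinity>z\<in>{z\<in>y. (1 / real N) *\<^sub>R z \<in> Ld}. G ((1 / real N) *\<^sub>R z))"
proof -
  define X where "X = {x \<in> disc L b. x [^]\<^bsub>disc_group L b\<^esub> N = y}"
  have "(\<Sum>x\<in>disc L b. (\<Sum>\<^sub>\<infinity>v\<in>x. G v) * basis_elem (x [^]\<^bsub>disc_group L b\<^esub> N) y) = (\<Sum>x\<in>X. \<Sum>\<^sub>\<infinity>v\<in>x. G v)"
    unfolding X_def using finite_disc
    by (subst sum.inter_filter) (auto simp: basis_elem_def intro!: sum.cong)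
  also have "\<dots> = (\<Sum>x\<in>disc L b. \<Sum>\<^sub>\<infinity>v\<in>x. if x [^]\<^bsub>disc_group L b\<^esub> N = y then G v else 0)"
    unfolding X_def using finite_disc
    by (subst sum.inter_filter) (auto intro!: sum.cong)
  also have "\<dots> = (\<Sum>x\<in>disc L b. \<Sum>\<^sub>\<infinity>v\<in>x. if real N *\<^sub>R v \<in> y then G v else 0)"
  proof (intro sum.cong infsum_cong refl)
    fix x v assume x: "x \<in> disc L b" and v: "v \<in> x"
    have vx: "v \<in> Ld" "x = cls v" using disc_memD[OF x v] by auto
    have "x [^]\<^bsub>disc_group L b\<^esub> N = cls (real N *\<^sub>R v)" by (simp add: vx disc_pow)
    then have "x [^]\<^bsub>disc_group L b\<^esub> N = y \<longleftrightarrow> real N *\<^sub>R v \<in> y"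
      using disc_memD(2)[OF y] cls_self by metis
    then show "(if x [^]\<^bsub>disc_group L b\<^esub> N = y then G v else 0) = (if real N *\<^sub>R v \<in> y then G v else 0)" by simp
  qed
  also have "\<dots> = (\<Sum>\<^sub>\<infinity>v\<in>Ld. if real N *\<^sub>R v \<in> y then G v else 0)"
  proof (rule infsum_Ld_disc[symmetric])
    have "G summable_on {v\<in>Ld. real N *\<^sub>R v \<in> y}" by (rule summable_on_subset_banach[OF G]) auto
    then show "(\<lambda>v. if real N *\<^sub>R v \<in> y then G v else 0) summable_on Ld"
      by (rule summable_on_cong_neutral[THEN iffD1, rotated -1]) auto
  qed
  also have "\<dots> = (\<Sum>\<^sub>\<infinity>v\<in>{v\<in>Ld. real N *\<^sub>R v \<in> y}. G v)"
    by (rule infsum_cong_neutral) auto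
  also have "\<dots> = (\<Sum>\<^sub>\<infinity>z\<in>{z\<in>y. (1 / real N) *\<^sub>R z \<in> Ld}. G ((1 / real N) *\<^sub>R z))"
    by (rule infsum_reindex_bij_witness[of _ "\<lambda>z. (1 / real N) *\<^sub>R z" "\<lambda>v. real N *\<^sub>R v"]) (use N in auto)
  finally show ?thesis .
qed

text \<open>For odd N the factor 2 does not change which z are detected. It is present because
  \<open>alpha_act_theta_vec\<close> shifts characteristics by 2 r / N.\<close>

lemma character_sum_divisible:
  assumes z: "z \<in> Ld" and N: "N > 0" "odd N" and R: "transversal L (nL N) R"
  shows "(\<Sum>r\<in>R. e (of_real (2 / real N * b z r))) = (if (1 / real N) *\<^sub>R z \<in> Ld then of_nat (N ^ lattice_rank L) else 0)"
proof -
  have "(\<Sum>r\<in>R. e (of_real (2 / real N * b z r))) =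
     (if \<forall>l\<in>L. e (of_real (2 / real N * b z l)) = 1 then of_nat (card R) else 0)"
  proof (rule transversal_sum_character[OF R L_subgroup nL_subgroup nL_sub])
    show "e (of_real (2 / real N * b z (x + y))) = e (of_real (2 / real N * b z x)) * e (of_real (2 / real N * b z y))" for x y
      by (simp add: bil_simps e_add ring_distribs)
    fix m assume "m \<in> nL N"
    then obtain l where l: "l \<in> L" "m = real N *\<^sub>R l" by blast
    then have "2 / real N * b z m = 2 * b z l" using N by (simp add: bil_simps)
    then show "e (of_real (2 / real N * b z m)) = 1" using Ld_b(1)[OF z l(1)] by (intro e_int) simp
  qed
  moreover have "e (of_real (2 / real N * b z l)) = 1 \<longleftrightarrow> b z l / real N \<in> \<int>" if l: "l \<in> L" for l
  proof -
    obtain k where k: "b z l = of_int k" using Ld_b(1)[OF z l] by (auto elim: Ints_cases)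
    have "2 / real N * b z l \<in> \<int> \<longleftrightarrow> b z l / real N \<in> \<int>"
    proof
      assume "2 / real N * b z l \<in> \<int>"
      then obtain m where "2 * of_int k = of_int m * real N" using N k by (auto elim!: Ints_cases simp: field_simps)
      then have km: "2 * k = m * int N" by (metis of_int_eq_iff of_int_mult of_int_numeral of_int_of_nat_eq)
      then have "even m" using N(2) by (metis dvd_triv_left even_mult_iff even_of_nat)
      then obtain m' where "m = 2 * m'" by (rule evenE)
      then have "k = m' * int N" using km by simp
      then show "b z l / real N \<in> \<int>" using N k by simp
    next
      assume "b z l / real N \<in> \<int>"
      then have "2 * (b z l / real N) \<in> \<int>" by (intro Ints_mult) auto
      then show "2 / real N * b z l \<in> \<int>" by simp
    qed
    then show ?thesis by (simp only: e_of_real_eq_1_iff)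
  qed
  moreover have "(1 / real N) *\<^sub>R z \<in> Ld \<longleftrightarrow> (\<forall>l\<in>L. b z l / real N \<in> \<int>)"
    using Ld_span[OF z] by (auto simp: dual_lattice_def bil_simps span_scale)
  ultimately show ?thesis using card_transversal_nL[OF N(1) R] by simp
qed

text \<open>The factor 2 makes the shifts compatible with the half-integral phase \<open>b(u, w)/2\<close>; it is harmless as
  \<open>N\<close> is odd.\<close>

lemma alpha_act_theta_vec:
  assumes N: "p ^ l = N" "N > 0" "odd N" and u: "u \<in> Ld" and w: "w \<in> span L" and \<tau>: "Im \<tau> > 0"
    and R: "transversal L (nL N) R"
  shows "alpha_act L b p l (theta_vec (of_real ((real N)\<^sup>2) * \<tau>) u w) =
    (\<lambda>y. of_real (1 / real N ^ lattice_rank L) *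
       (\<Sum>r\<in>R. theta_vec \<tau> (real N *\<^sub>R u) ((1 / real N) *\<^sub>R w + (2 / real N) *\<^sub>R r) y))"
proof
  fix y
  show "alpha_act L b p l (theta_vec (of_real ((real N)\<^sup>2) * \<tau>) u w) y = of_real (1 / real N ^ lattice_rank L) *
       (\<Sum>r\<in>R. theta_vec \<tau> (real N *\<^sub>R u) ((1 / real N) *\<^sub>R w + (2 / real N) *\<^sub>R r) y)"
  proof (cases "y \<in> disc L b")
    case False
    have "basis_elem (x [^]\<^bsub>disc_group L b\<^esub> N) y = 0" if x: "x \<in> disc L b" for x
    proof -
      have "x [^]\<^bsub>disc_group L b\<^esub> N \<in> disc L b"
        using x by (elim disc_cases) (simp add: disc_pow cls_in_disc Ld_scale)
      then show ?thesis using False by (auto simp: basis_elem_def)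
    qed
    then show ?thesis using False by (simp add: alpha_act_def N(1) theta_vec_def)
  next
    case True
    define G where "G = (\<lambda>v. gauss (of_real ((real N)\<^sup>2) * \<tau>) (v + u) * e (of_real (b v w + b u w / 2)))"
    have sG: "G summable_on Ld" unfolding G_def
      by (intro summable_on_mult_e gauss_summable) (use \<tau> N in auto)
    define H where "H = (\<lambda>z. gauss \<tau> (z + real N *\<^sub>R u) * e (of_real (b z ((1 / real N) *\<^sub>R w) + b u w / 2)))"
    have GH: "G ((1 / real N) *\<^sub>R z) = H z" for z
    proof -
      have "z + real N *\<^sub>R u = real N *\<^sub>R ((1 / real N) *\<^sub>R z + u)" using N by (simp add: algebra_simps)
      then show ?thesis by (simp only: G_def H_def gauss_scale) (simp add: bil_simps)
    qed
    have sH: "(\<lambda>z. H z * e (of_real (2 / real N * b z r))) summable_on y" for r unfolding H_def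
      by (intro summable_on_mult_e gauss_summable \<tau> disc_sub_Ld True)
    have "alpha_act L b p l (theta_vec (of_real ((real N)\<^sup>2) * \<tau>) u w) y =
       (\<Sum>x\<in>disc L b. (\<Sum>\<^sub>\<infinity>v\<in>x. G v) * basis_elem (x [^]\<^bsub>disc_group L b\<^esub> N) y)"
      by (simp add: alpha_act_def N(1) theta_vec_def theta_def G_def)
    also have "\<dots> = (\<Sum>\<^sub>\<infinity>z\<in>{z\<in>y. (1 / real N) *\<^sub>R z \<in> Ld}. H z)"
      unfolding infsum_disc_power[OF True N(2) sG] GH ..
    also have "\<dots> = (\<Sum>\<^sub>\<infinity>z\<in>y. of_real (1 / real N ^ lattice_rank L) * (\<Sum>r\<in>R. H z * e (of_real (2 / real N * b z r))))"
      by (rule infsum_cong_neutral)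
        (use character_sum_divisible[OF _ N(2,3) R] disc_sub_Ld[OF True] N in
          \<open>auto simp: sum_distrib_left[symmetric]\<close>)
    also have "\<dots> = of_real (1 / real N ^ lattice_rank L) * (\<Sum>r\<in>R. \<Sum>\<^sub>\<infinity>z\<in>y. H z * e (of_real (2 / real N * b z r)))"
      unfolding infsum_cmult_right' by (subst infsum_sum_finite[OF transversal_finite[OF R] sH]) simp
    also have "(\<Sum>r\<in>R. \<Sum>\<^sub>\<infinity>z\<in>y. H z * e (of_real (2 / real N * b z r))) =
        (\<Sum>r\<in>R. theta_vec \<tau> (real N *\<^sub>R u) ((1 / real N) *\<^sub>R w + (2 / real N) *\<^sub>R r) y)"
    proof (rule sum.cong)
      fix r assume "r \<in> R"
      then have "b u r \<in> \<int>" using transversal_subset[OF R] Ld_b(1)[OF u] by blast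
      have "H z * e (of_real (2 / real N * b z r)) =
          gauss \<tau> (z + real N *\<^sub>R u) * e (of_real (b z ((1 / real N) *\<^sub>R w + (2 / real N) *\<^sub>R r) + b (real N *\<^sub>R u) ((1 / real N) *\<^sub>R w + (2 / real N) *\<^sub>R r) / 2))" for z
        unfolding H_def mult.assoc e_add[symmetric] of_real_add[symmetric]
      proof (intro arg_cong2[of _ _ _ _ "(*)"] refl e_cong)
        have "b z ((1 / real N) *\<^sub>R w) + b u w / 2 + 2 / real N * b z r -
           (b z ((1 / real N) *\<^sub>R w + (2 / real N) *\<^sub>R r) + b (real N *\<^sub>R u) ((1 / real N) *\<^sub>R w + (2 / real N) *\<^sub>R r) / 2) = - b u r"
          using N(2) by (simp add: bil_simps field_simps)
        then show "b z ((1 / real N) *\<^sub>R w) + b u w / 2 + 2 / real N * b z r -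
           (b z ((1 / real N) *\<^sub>R w + (2 / real N) *\<^sub>R r) + b (real N *\<^sub>R u) ((1 / real N) *\<^sub>R w + (2 / real N) *\<^sub>R r) / 2) \<in> \<int>"
          using \<open>b u r \<in> \<int>\<close> by simp
      qed
      then show "(\<Sum>\<^sub>\<infinity>z\<in>y. H z * e (of_real (2 / real N * b z r))) = theta_vec \<tau> (real N *\<^sub>R u) ((1 / real N) *\<^sub>R w + (2 / real N) *\<^sub>R r) y"
        using True by (simp add: theta_vec_def theta_def)
    qed simp
    finally show ?thesis .
  qed
qed

end

subsection \<open>The action of upper triangular representatives\<close>

context weil_lattice
begin

definition lin_op :: "(('v set \<Rightarrow> complex) \<Rightarrow> 'v set \<Rightarrow> complex) \<Rightarrow> bool" where
  "lin_op T \<longleftrightarrow> (\<forall>v\<in>GA. T v \<in> GA) \<and> (\<forall>c f. (\<forall>x\<in>disc L b. f x \<in> GA) \<longrightarrow>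
     T (\<lambda>y. \<Sum>x\<in>disc L b. c x * f x y) = (\<lambda>y. \<Sum>x\<in>disc L b. c x * T (f x) y))"

lemma lin_op_expand:
  assumes "lin_op T" "v \<in> GA"
  shows "T v y = (\<Sum>x\<in>disc L b. v x * T (basis_elem x) y)"
proof -
  have "T (\<lambda>y. \<Sum>x\<in>disc L b. v x * basis_elem x y) = (\<lambda>y. \<Sum>x\<in>disc L b. v x * T (basis_elem x) y)"
    using assms(1) GA_basis by (simp add: lin_op_def)
  then show ?thesis by (simp only: GA_expand[OF assms(2), symmetric])
qed

lemma lin_op_comp: "lin_op S \<Longrightarrow> lin_op T \<Longrightarrow> lin_op (\<lambda>v. S (T v))"
  by (simp add: lin_op_def)

lemma lin_op_weil_act:
  assumes \<gamma>: "\<gamma> \<in> carrier mp2_int" shows "lin_op (weil_act L b \<rho> \<gamma>)"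
proof -
  have img: "\<rho> \<gamma> ` GA = GA" using rho_bij[OF \<gamma>] by (simp add: bij_betw_def)
  have inv: "weil_act L b \<rho> \<gamma> v \<in> GA" "\<rho> \<gamma> (weil_act L b \<rho> \<gamma> v) = v" if "v \<in> GA" for v
    unfolding weil_act_def using that img inv_into_into[of v "\<rho> \<gamma>" GA] f_inv_into_f[of v "\<rho> \<gamma>" GA] by auto
  show ?thesis unfolding lin_op_def
  proof (intro conjI allI impI ballI inv)
    fix c :: "'v set \<Rightarrow> complex" and f assume f: "\<forall>x\<in>disc L b. f x \<in> GA"
    show "weil_act L b \<rho> \<gamma> (\<lambda>y. \<Sum>x\<in>disc L b. c x * f x y) = (\<lambda>y. \<Sum>x\<in>disc L b. c x * weil_act L b \<rho> \<gamma> (f x) y)"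
    proof (rule weil_act_eqI[OF \<gamma>])
      show "(\<lambda>y. \<Sum>x\<in>disc L b. c x * weil_act L b \<rho> \<gamma> (f x) y) \<in> GA"
        by (rule GA_sum) (use f inv in auto)
      have "\<rho> \<gamma> (\<lambda>y. \<Sum>x\<in>disc L b. c x * weil_act L b \<rho> \<gamma> (f x) y) = (\<lambda>y. \<Sum>x\<in>disc L b. c x * \<rho> \<gamma> (weil_act L b \<rho> \<gamma> (f x)) y)"
        by (rule rho_sum[OF \<gamma> finite_disc]) (use f inv in auto)
      also have "\<dots> = (\<lambda>y. \<Sum>x\<in>disc L b. c x * f x y)"
        using f inv(2) by (intro ext sum.cong) auto
      finally show "\<rho> \<gamma> (\<lambda>y. \<Sum>x\<in>disc L b. c x * weil_act L b \<rho> \<gamma> (f x) y) = (\<lambda>y. \<Sum>x\<in>disc L b. c x * f x y)" .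
    qed
  qed
qed

lemma disc_pow_closed: "x \<in> disc L b \<Longrightarrow> x [^]\<^bsub>disc_group L b\<^esub> (n::nat) \<in> disc L b"
  by (elim disc_cases) (simp add: disc_pow cls_in_disc Ld_scale)

lemma lin_op_alpha_act: "lin_op (alpha_act L b p l)"
  unfolding lin_op_def
proof (intro conjI allI impI ballI)
  fix v :: "'v set \<Rightarrow> complex"
  show "alpha_act L b p l v \<in> GA"
    using disc_pow_closed by (auto simp: alpha_act_def group_algebra_def basis_elem_def intro!: sum.neutral)
  fix c :: "'v set \<Rightarrow> complex" and f :: "'v set \<Rightarrow> 'v set \<Rightarrow> complex"
  show "alpha_act L b p l (\<lambda>y. \<Sum>x\<in>disc L b. c x * f x y) = (\<lambda>y. \<Sum>x\<in>disc L b. c x * alpha_act L b p l (f x) y)"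
    unfolding alpha_act_def sum_distrib_left sum_distrib_right
    by (rule ext, subst sum.swap) (simp add: mult.assoc)
qed

text \<open>The characters \<open>b(\<cdot>, w)\<close> separate the classes since \<open>\<rho>(S)\<close> is injective. Hence theta
  vectors with characteristic \<open>(0, w)\<close> span the group algebra.\<close>

lemma characters_separate:
  assumes zero: "\<And>w. w \<in> Ld \<Longrightarrow> (\<Sum>x\<in>disc L b. a x * e (of_real (b (class_rep x) w))) = 0"
    and x: "x \<in> disc L b"
  shows "a x = 0"
proof -
  define a' where "a' = (\<lambda>x. if x \<in> disc L b then a x else 0)"
  have a': "a' \<in> GA" by (simp add: a'_def group_algebra_def)
  have "\<rho> mp_S a' = (\<lambda>x. 0)"
  proof
    fix y
    show "\<rho> mp_S a' y = 0"
    proof (cases "y \<in> disc L b")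
      case True
      have "(\<Sum>x\<in>disc L b. e (- of_real (bclass b y x)) * a' x) = (\<Sum>x\<in>disc L b. a x * e (of_real (b (class_rep x) (- class_rep y))))"
        by (rule sum.cong) (auto simp: a'_def bclass_def bil_simps symmetric)
      also have "\<dots> = 0" by (rule zero) (rule add_subgroup_uminus[OF Ld_subgroup class_rep_Ld[OF True]])
      finally show ?thesis by (simp add: rho_S[OF a' True])
    next
      case False
      then show ?thesis using rho_in[OF mp_S_carrier a'] by (simp add: group_algebra_def)
    qed
  qed
  then have "a' = (\<lambda>x. 0)"
    using rho_inject[OF mp_S_carrier a' GA_0] rho_0[OF mp_S_carrier] by simp
  then show ?thesis using x by (metis a'_def)
qed

text \<open>For w in L' the phase depends on v only through its class.\<close>

lemma theta_char_dual:
  assumes x: "x \<in> disc L b" and w: "w \<in> Ld"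
  shows "theta \<tau> 0 w x = theta \<tau> 0 0 x * e (of_real (b (class_rep x) w))"
  unfolding theta_def infsum_cmult_left'[symmetric]
proof (rule infsum_cong)
  fix v assume v: "v \<in> x"
  have "v - class_rep x \<in> L"
    using v x disc_memD class_rep_in in_cls_iff by metis
  then have "b v w - b (class_rep x) w \<in> \<int>"
    using Ld_b(2)[OF w] by (simp add: bil_diff[symmetric])
  then have "e (of_real (b v w)) = e (of_real (b (class_rep x) w))" by (rule e_cong)
  then show "gauss \<tau> (v + 0) * e (of_real (b v w + b 0 w / 2)) =
      gauss \<tau> (v + 0) * e (of_real (b v 0 + b 0 0 / 2)) * e (of_real (b (class_rep x) w))"
    by (simp add: bil_0)
qed

text \<open>At \<i> the theta vectors with w in L' are twists by characters of one vector without
  zero components. The characters separate the classes, and the components are divided out.\<close>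

lemma lin_op_unique:
  assumes T: "lin_op T" and x: "x \<in> disc L b"
    and U: "\<And>w. w \<in> Ld \<Longrightarrow> T (theta_vec \<i> 0 w) y = (\<Sum>x\<in>disc L b. theta_vec \<i> 0 w x * U x)"
  shows "T (basis_elem x) y = U x"
proof -
  have "theta \<i> 0 0 x * (T (basis_elem x) y - U x) = 0"
  proof (rule characters_separate[OF _ x])
    fix w assume w: "w \<in> Ld"
    have "(\<Sum>x\<in>disc L b. theta_vec \<i> 0 w x * T (basis_elem x) y) = (\<Sum>x\<in>disc L b. theta_vec \<i> 0 w x * U x)"
      using U[OF w] lin_op_expand[OF T theta_vec_in_group_algebra, of \<i> 0 w y] by simp
    then have "(\<Sum>x\<in>disc L b. theta_vec \<i> 0 w x * (T (basis_elem x) y - U x)) = 0"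
      by (simp add: right_diff_distrib sum_subtractf)
    moreover have "theta_vec \<i> 0 w x * (T (basis_elem x) y - U x) =
        theta \<i> 0 0 x * (T (basis_elem x) y - U x) * e (of_real (b (class_rep x) w))" if "x \<in> disc L b" for x
      unfolding theta_vec_def using that by (simp only: if_True theta_char_dual[OF that w] mult_ac)
    ultimately show "(\<Sum>x\<in>disc L b. theta \<i> 0 0 x * (T (basis_elem x) y - U x) * e (of_real (b (class_rep x) w))) = 0"
      by simp
  qed
  then show ?thesis using theta_imaginary_nonzero[of 1 x] x by simp
qed

text \<open>The operator prescribed by one decomposition. That it depends on the product alone is
  what gives \<open>ext_act\<close> its meaning.\<close>

definition dc_op :: "nat \<Rightarrow> nat \<Rightarrow> mp_elem \<Rightarrow> mp_elem \<Rightarrow> ('v set \<Rightarrow> complex) \<Rightarrow> 'v set \<Rightarrow> complex" where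
  "dc_op p l \<gamma> \<gamma>' v = weil_act L b \<rho> \<gamma>' (alpha_act L b p l (weil_act L b \<rho> \<gamma> v))"

lemma lin_op_dc_op:
  "\<gamma> \<in> carrier mp2_int \<Longrightarrow> \<gamma>' \<in> carrier mp2_int \<Longrightarrow> lin_op (dc_op p l \<gamma> \<gamma>')"
  unfolding dc_op_def[abs_def] by (rule lin_op_comp[OF lin_op_weil_act lin_op_comp[OF lin_op_alpha_act lin_op_weil_act]])

lemma mp_int_cases:
  assumes "\<gamma> \<in> carrier mp2_int"
  obtains a t c d :: int and \<phi> where "\<gamma> = (mat2 (of_int a) (of_int t) (of_int c) (of_int d), \<phi>)" "a * d - t * c = 1"
proof -
  obtain A \<phi> where \<gamma>: "\<gamma> = (A, \<phi>)" by (cases \<gamma>)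
  note D = mp_int_carrierD[OF assms[unfolded \<gamma>]]
  obtain x1 x2 x3 x4 where A0: "A = mat2 x1 x2 x3 x4" by (rule mat2_cases)
  have "x1 \<in> \<int>" "x2 \<in> \<int>" "x3 \<in> \<int>" "x4 \<in> \<int>"
    using D(2)[of 1 1] D(2)[of 1 2] D(2)[of 2 1] D(2)[of 2 2] by (auto simp: A0)
  then obtain a t c d where A: "A = mat2 (of_int a) (of_int t) (of_int c) (of_int d)"
    unfolding A0 by (metis Ints_cases)
  have "(of_int (a * d - t * c) :: rat) = 1" using D(1) by (simp add: A det_mat2)
  then have "a * d - t * c = 1" by (simp only: of_int_eq_1_iff)
  then show ?thesis using that A \<gamma> by blast
qed

text \<open>Follows the characteristic (0, w) through \<gamma>, \<alpha> and \<gamma>'. From the two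
  matrices only k, minus the lower left entry of \<gamma>, and d, the lower right entry of
  \<gamma>', survive; \<beta> ties them together modulo p^s. This makes the later evaluation
  independent of the decomposition.\<close>

lemma dc_op_theta_vec:
  fixes p l s :: nat and h :: int
  assumes p: "prime p" "odd p" and s: "0 < s" "s < 2 * l"
    and \<gamma>: "\<gamma> \<in> carrier mp2_int" and \<gamma>': "\<gamma>' \<in> carrier mp2_int"
    and eq: "mp_beta p l s h = \<gamma> \<otimes>\<^bsub>mp2_rat\<^esub> mp_alpha p l \<otimes>\<^bsub>mp2_rat\<^esub> \<gamma>'"
    and R: "transversal L (nL (p ^ l)) R"
  obtains k d :: int where "coprime k (int p)" "[d = k * h] (mod int (p ^ s))"
    "\<And>\<tau> w. Im \<tau> > 0 \<Longrightarrow> w \<in> Ld \<Longrightarrow>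
       dc_op p l \<gamma> \<gamma>' (theta_vec (moebius (fst (mp_beta p l s h)) \<tau>) 0 w) =
       (\<lambda>y. of_real ((real p powr (real s / 2)) ^ lattice_rank L / real (p ^ l) ^ lattice_rank L) *
         (\<Sum>r\<in>R. theta_vec \<tau> ((2 * of_int k * real (p ^ (2 * l - s)) / real (p ^ l)) *\<^sub>R r)
                        ((real (p ^ s) / real (p ^ l)) *\<^sub>R w + (2 * of_int d / real (p ^ l)) *\<^sub>R r) y))"
proof -
  define N P Q where "N = p ^ l" and "P = p ^ (2 * l - s)" and "Q = p ^ s"
  have p0: "p > 0" using p(1) by (simp add: prime_gt_0_nat)
  have pos: "N > 0" "P > 0" "Q > 0" using p0 by (auto simp: N_def P_def Q_def)
  have oddN: "odd N" using p(2) by (simp add: N_def)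
  have NN: "N\<^sup>2 = P * Q" using s by (simp add: N_def P_def Q_def power_mult[symmetric] power_add[symmetric] mult.commute)
  obtain a t c d \<phi> where g: "\<gamma> = (mat2 (of_int a) (of_int t) (of_int c) (of_int d), \<phi>)" and det: "a * d - t * c = 1"
    using mp_int_cases[OF \<gamma>] by blast
  obtain a' t' c' d' \<phi>' where g': "\<gamma>' = (mat2 (of_int a') (of_int t') (of_int c') (of_int d'), \<phi>')" and det': "a' * d' - t' * c' = 1"
    using mp_int_cases[OF \<gamma>'] by blast
  define A where "A = mat2 (of_int a) (of_int t) (of_int c) (of_int d)"
  define A' where "A' = mat2 (of_int a') (of_int t') (of_int c') (of_int d')"
  define B where "B = mat2 (of_nat (p ^ (2 * l))) 0 0 1"
  have B: "B = mat2 (of_int (int N ^ 2)) 0 0 1" by (simp add: B_def N_def power_mult[symmetric] mult.commute)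
  have eqs: "mat2 (of_int (int P)) (of_int h) 0 (of_int (int Q)) = A ** B ** A'"
      "(\<lambda>\<tau>\<in>UH. complex_of_real (real p powr (real s / 2))) =
       (\<lambda>\<tau>\<in>UH. (\<lambda>\<tau>\<in>UH. \<phi> (moebius B \<tau>) * (\<lambda>\<tau>\<in>UH. 1) \<tau>) (moebius A' \<tau>) * \<phi>' \<tau>)"
    using eq unfolding g g' mp_beta_def mp_alpha_def mp_mult A_def[symmetric] A'_def[symmetric] B_def[symmetric]
    by (simp_all add: P_def Q_def)
  have "of_int (int P) = (of_int (a * int N ^ 2 * a' + t * c') :: rat)"
    "of_int h = (of_int (a * int N ^ 2 * t' + t * d') :: rat)"
    "(of_int 0 :: rat) = of_int (c * int N ^ 2 * a' + d * c')"
    "of_int (int Q) = (of_int (c * int N ^ 2 * t' + d * d') :: rat)"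
    using eqs(1) unfolding A_def A'_def B mat2_mult mat2_inject by simp_all
  then have e1: "int P = a * int N ^ 2 * a' + t * c'" and e2: "h = a * int N ^ 2 * t' + t * d'"
    and e3: "0 = c * int N ^ 2 * a' + d * c'" and e4: "int Q = c * int N ^ 2 * t' + d * d'"
    by (simp_all only: of_int_eq_iff)
  \<comment> \<open>Second row of \<alpha>\<gamma>' = \<gamma>^{-1}\<beta>, with the inverse written
    out by det \<gamma> = 1.\<close>
  have c': "c' = - c * int P"
  proof -
    have "c' = c' * (a * d - t * c)" by (simp add: det)
    also have "\<dots> = a * (c * int N ^ 2 * a' + d * c') - c * (a * int N ^ 2 * a' + t * c')" by (simp add: algebra_simps)
    finally show ?thesis unfolding e1[symmetric] e3[symmetric] by simp
  qed
  have d': "d' = a * int Q - c * h"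
  proof -
    have "d' = d' * (a * d - t * c)" by (simp add: det)
    also have "\<dots> = a * (c * int N ^ 2 * t' + d * d') - c * (a * int N ^ 2 * t' + t * d')" by (simp add: algebra_simps)
    finally show ?thesis unfolding e2[symmetric] e4[symmetric] .
  qed
  \<comment> \<open>Upper left entry of the same equation, N^2 a' = d P, combined with N^2 = P
    Q.\<close>
  have "int P * (int Q * a') = int P * d"
  proof -
    have "int P * (int Q * a') = int N ^ 2 * a' * (a * d - t * c)"
      using NN det by (metis mult.assoc mult.right_neutral of_nat_mult of_nat_power)
    also have "\<dots> = d * (a * int N ^ 2 * a' + t * c') - t * (c * int N ^ 2 * a' + d * c')" by (simp add: algebra_simps)
    finally show ?thesis unfolding e1[symmetric] e3[symmetric] by simp
  qed
  then have d: "d = int Q * a'" using pos by simp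
  have "coprime (- c) (int p)"
  proof -
    have "int p dvd d" using s by (simp add: d Q_def)
    then have "coprime c (int p)" if "coprime c d" using that by (meson coprime_divisors dvd_refl)
    moreover have "coprime c d"
      by (rule coprimeI) (metis det dvd_diff dvd_mult dvd_mult2)
    ultimately show ?thesis by simp
  qed
  moreover have "[d' = (- c) * h] (mod int (p ^ s))"
    by (simp add: d' Q_def cong_iff_dvd_diff)
  moreover have "dc_op p l \<gamma> \<gamma>' (theta_vec (moebius (fst (mp_beta p l s h)) \<tau>) 0 w) =
       (\<lambda>y. of_real ((real p powr (real s / 2)) ^ lattice_rank L / real (p ^ l) ^ lattice_rank L) *
         (\<Sum>r\<in>R. theta_vec \<tau> ((2 * of_int (- c) * real (p ^ (2 * l - s)) / real (p ^ l)) *\<^sub>R r)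
                        ((real (p ^ s) / real (p ^ l)) *\<^sub>R w + (2 * of_int d' / real (p ^ l)) *\<^sub>R r) y))"
    if \<tau>: "Im \<tau> > 0" and w: "w \<in> Ld" for \<tau> w
  proof -
    define \<tau>1 where "\<tau>1 = moebius A' \<tau>"
    define \<sigma> where "\<sigma> = of_real ((real N)\<^sup>2) * \<tau>1"
    have detA: "det A > 0" "det A' > 0"
      using mp_int_carrierD(1)[OF \<gamma>[unfolded g]] mp_int_carrierD(1)[OF \<gamma>'[unfolded g']] by (auto simp: A_def A'_def)
    have detB: "det B > 0" using p0 by (simp add: B_def det_mat2)
    have t1: "Im \<tau>1 > 0" unfolding \<tau>1_def by (rule Im_moebius[OF detA(2) \<tau>])
    have mB: "moebius B \<tau>1 = \<sigma>" by (simp add: B moebius_mat2 \<sigma>_def of_rat_power)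
    have Im\<sigma>: "Im \<sigma> > 0" unfolding mB[symmetric] by (rule Im_moebius[OF detB t1])
    have mob: "moebius (fst (mp_beta p l s h)) \<tau> = moebius A \<sigma>"
    proof -
      have "fst (mp_beta p l s h) = A ** B ** A'" using eqs(1) by (simp add: mp_beta_def P_def Q_def)
      moreover have "moebius (A ** B ** A') \<tau> = moebius (A ** B) \<tau>1"
        unfolding \<tau>1_def by (rule moebius_mult[OF _ detA(2) \<tau>]) (use detA detB in \<open>simp add: det_mul\<close>)
      moreover have "\<dots> = moebius A \<sigma>" unfolding mB[symmetric] by (rule moebius_mult[OF detA(1) detB t1])
      ultimately show ?thesis by simp
    qed
    \<comment> \<open>The square roots combine to the constant second component of \<beta>; its
      \<open>frame_factor\<close> is the source of p^{sD/2}.\<close>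
    have phi: "\<phi> \<sigma> * \<phi>' \<tau> = of_real (real p powr (real s / 2))"
      using fun_cong[OF eqs(2), of \<tau>] \<tau> t1 Im\<sigma> by (simp add: UH_iff \<tau>1_def[symmetric] mB)
    define u1 where "u1 = of_int c *\<^sub>R w"
    define w1 where "w1 = of_int d *\<^sub>R w"
    have u1: "u1 \<in> Ld" "w1 \<in> Ld" unfolding u1_def w1_def by (rule Ld_scale(1)[OF w])+
    define J where "J = frame_factor (\<phi> \<sigma>)"
    have "theta_vec (moebius A \<sigma>) 0 w = (\<lambda>x. J * \<rho> \<gamma> (theta_vec \<sigma> u1 w1) x)"
      using rho_theta_vec[OF \<gamma>[unfolded g] Im\<sigma> _ Ld_span[OF w], of 0] by (simp add: span_zero g A_def u1_def w1_def J_def)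
    then have s1: "weil_act L b \<rho> \<gamma> (theta_vec (moebius A \<sigma>) 0 w) = (\<lambda>x. J * theta_vec \<sigma> u1 w1 x)"
      by (intro weil_act_eqI[OF \<gamma> GA_scale[OF theta_vec_in_group_algebra]])
        (simp add: rho_scale[OF \<gamma> theta_vec_in_group_algebra])
    define W where "W = (\<lambda>r. (1 / real N) *\<^sub>R w1 + (2 / real N) *\<^sub>R r)"
    have s2: "alpha_act L b p l (\<lambda>x. J * theta_vec \<sigma> u1 w1 x) = (\<lambda>y. J * of_real (1 / real N ^ lattice_rank L) * (\<Sum>r\<in>R. theta_vec \<tau>1 (real N *\<^sub>R u1) (W r) y))"
    proof -
      have "alpha_act L b p l (\<lambda>x. J * theta_vec \<sigma> u1 w1 x) = (\<lambda>y. J * alpha_act L b p l (theta_vec \<sigma> u1 w1) y)"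
        by (simp add: alpha_act_def sum_distrib_left mult_ac)
      also have "\<dots> = (\<lambda>y. J * (of_real (1 / real N ^ lattice_rank L) * (\<Sum>r\<in>R. theta_vec \<tau>1 (real N *\<^sub>R u1) (W r) y)))"
        unfolding \<sigma>_def W_def
        by (subst alpha_act_theta_vec[OF N_def[symmetric] pos(1) oddN u1(1) Ld_span[OF u1(2)] t1]) (use R in \<open>simp_all add: N_def\<close>)
      finally show ?thesis by (simp only: mult.assoc)
    qed
    define U2 where "U2 = (\<lambda>r::'v. (2 * of_int (- c) * real P / real N) *\<^sub>R r)"
    define W2 where "W2 = (\<lambda>r. (real Q / real N) *\<^sub>R w + (2 * of_int d' / real N) *\<^sub>R r)"
    have Rspan: "r \<in> span L" if "r \<in> R" for r using transversal_subset[OF R that] L_span by blast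
    have s3: "theta_vec \<tau>1 (real N *\<^sub>R u1) (W r) = (\<lambda>x. frame_factor (\<phi>' \<tau>) * \<rho> \<gamma>' (theta_vec \<tau> (U2 r) (W2 r)) x)" if r: "r \<in> R" for r
    proof -
      have sp: "real N *\<^sub>R u1 \<in> span L" "W r \<in> span L"
        unfolding W_def using Ld_span u1 Rspan[OF r] by (auto intro!: span_add span_scale)
      \<comment> \<open>The coefficient of w is 1/N times the lower left entry of \<beta>, which is
        0; in \<open>eqW\<close> it is the lower right entry, giving Q/N.\<close>
      have eqU: "of_int a' *\<^sub>R (real N *\<^sub>R u1) + of_int c' *\<^sub>R W r = U2 r"
      proof -
        have "real_of_int (c * int N ^ 2 * a' + d * c') = 0" using e3 by simp
        then have z: "of_int a' * real N * of_int c + of_int c' * of_int d / real N = 0"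
          using pos(1) by (simp add: field_simps power2_eq_square)
        have "of_int a' *\<^sub>R (real N *\<^sub>R u1) + of_int c' *\<^sub>R W r =
            (of_int a' * real N * of_int c + of_int c' * of_int d / real N) *\<^sub>R w + (of_int c' * 2 / real N) *\<^sub>R r"
          by (simp add: W_def u1_def w1_def scaleR_add_left scaleR_add_right)
        also have "\<dots> = U2 r" unfolding z by (simp add: U2_def c' mult_ac)
        finally show ?thesis .
      qed
      have eqW: "of_int t' *\<^sub>R (real N *\<^sub>R u1) + of_int d' *\<^sub>R W r = W2 r"
      proof -
        have "real Q = real_of_int (c * int N ^ 2 * t' + d * d')" using e4 by (metis of_int_of_nat_eq)
        then have z: "of_int t' * real N * of_int c + of_int d' * of_int d / real N = real Q / real N"
          using pos(1) by (simp add: field_simps power2_eq_square)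
        have "of_int t' *\<^sub>R (real N *\<^sub>R u1) + of_int d' *\<^sub>R W r =
            (of_int t' * real N * of_int c + of_int d' * of_int d / real N) *\<^sub>R w + (of_int d' * 2 / real N) *\<^sub>R r"
          by (simp add: W_def u1_def w1_def scaleR_add_left scaleR_add_right)
        also have "\<dots> = W2 r" unfolding z by (simp add: W2_def mult_ac)
        finally show ?thesis .
      qed
      show ?thesis
        using rho_theta_vec[OF \<gamma>'[unfolded g'] \<tau> sp] unfolding eqU eqW by (simp only: g' A'_def \<tau>1_def)
    qed
    define K where "K = J * of_real (1 / real N ^ lattice_rank L) * frame_factor (\<phi>' \<tau>)"
    have s4: "weil_act L b \<rho> \<gamma>' (\<lambda>y. J * of_real (1 / real N ^ lattice_rank L) * (\<Sum>r\<in>R. theta_vec \<tau>1 (real N *\<^sub>R u1) (W r) y))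
        = (\<lambda>y. \<Sum>r\<in>R. K * theta_vec \<tau> (U2 r) (W2 r) y)"
    proof (rule weil_act_eqI[OF \<gamma>' GA_sum[OF theta_vec_in_group_algebra]])
      have "\<rho> \<gamma>' (\<lambda>y. \<Sum>r\<in>R. K * theta_vec \<tau> (U2 r) (W2 r) y) = (\<lambda>y. \<Sum>r\<in>R. K * \<rho> \<gamma>' (theta_vec \<tau> (U2 r) (W2 r)) y)"
        by (rule rho_sum[OF \<gamma>' transversal_finite[OF R] theta_vec_in_group_algebra])
      also have "\<dots> = (\<lambda>y. J * of_real (1 / real N ^ lattice_rank L) * (\<Sum>r\<in>R. theta_vec \<tau>1 (real N *\<^sub>R u1) (W r) y))"
        unfolding sum_distrib_left by (intro ext sum.cong refl) (simp add: s3 K_def)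
      finally show "\<rho> \<gamma>' (\<lambda>y. \<Sum>r\<in>R. K * theta_vec \<tau> (U2 r) (W2 r) y) =
        (\<lambda>y. J * of_real (1 / real N ^ lattice_rank L) * (\<Sum>r\<in>R. theta_vec \<tau>1 (real N *\<^sub>R u1) (W r) y))" .
    qed
    have "K = frame_factor (\<phi> \<sigma> * \<phi>' \<tau>) * of_real (1 / real N ^ lattice_rank L)"
      by (simp add: K_def J_def frame_factor_mult)
    also have "\<dots> = of_real ((real p powr (real s / 2)) ^ lattice_rank L / real N ^ lattice_rank L)"
      unfolding phi frame_factor_of_real by simp
    finally have K: "K = of_real ((real p powr (real s / 2)) ^ lattice_rank L / real N ^ lattice_rank L)" .
    have "dc_op p l \<gamma> \<gamma>' (theta_vec (moebius (fst (mp_beta p l s h)) \<tau>) 0 w) = (\<lambda>y. K * (\<Sum>r\<in>R. theta_vec \<tau> (U2 r) (W2 r) y))"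
      unfolding dc_op_def mob s1 s2 s4 sum_distrib_left[symmetric] ..
    then show ?thesis unfolding K U2_def W2_def N_def P_def Q_def .
  qed
  ultimately show ?thesis by (rule that)
qed

end

subsection \<open>Evaluation of the averaged theta functions\<close>

context even_lattice
begin

text \<open>Residues modulo n m are r + n s with digits r modulo n and s modulo m.\<close>

lemma transversal_nL_refine:
  fixes H :: "'v \<Rightarrow> 'c::comm_monoid_add"
  assumes R: "transversal L (nL n) R" and S: "transversal L (nL m) S" and T: "transversal L (nL (n * m)) T"
    and n: "n > 0"
    and H: "\<And>v w. v \<in> L \<Longrightarrow> w \<in> L \<Longrightarrow> v - w \<in> nL (n * m) \<Longrightarrow> H v = H w"
  shows "(\<Sum>t\<in>T. H t) = (\<Sum>r\<in>R. \<Sum>s\<in>S. H (r + real n *\<^sub>R s))"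
proof -
  have inj: "inj_on (\<lambda>s. real n *\<^sub>R s) A" for A :: "'v set" using n by (auto simp: inj_on_def)
  have "transversal (nL n) (nL (n * m)) ((\<lambda>s. real n *\<^sub>R s) ` S)"
  proof (rule transversalI)
    show "finite ((\<lambda>s. real n *\<^sub>R s) ` S)" using transversal_finite[OF S] by simp
    show "(\<lambda>s. real n *\<^sub>R s) ` S \<subseteq> nL n" using transversal_subset[OF S] by blast
    fix v assume "v \<in> nL n"
    then obtain l where l: "l \<in> L" "v = real n *\<^sub>R l" by blast
    obtain s z where s: "s \<in> S" "z \<in> L" "l - s = real m *\<^sub>R z" using transversal_ex[OF S l(1)] by blast
    have "v - real n *\<^sub>R s = real n *\<^sub>R (l - s)" by (simp add: l scaleR_diff_right)
    also have "\<dots> = real (n * m) *\<^sub>R z" by (simp add: s(3))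
    finally show "\<exists>r\<in>(\<lambda>s. real n *\<^sub>R s) ` S. v - r \<in> nL (n * m)" using s by blast
  next
    fix r r' assume *: "r \<in> (\<lambda>s. real n *\<^sub>R s) ` S" "r' \<in> (\<lambda>s. real n *\<^sub>R s) ` S" "r - r' \<in> nL (n * m)"
    then obtain s s' z where s: "s \<in> S" "s' \<in> S" "r = real n *\<^sub>R s" "r' = real n *\<^sub>R s'" "z \<in> L"
      "r - r' = real (n * m) *\<^sub>R z" by blast
    then have "real n *\<^sub>R (s - s') = real n *\<^sub>R (real m *\<^sub>R z)" by (simp add: scaleR_diff_right)
    from scaleR_left_imp_eq[OF _ this] have "s - s' = real m *\<^sub>R z" using n by simp
    then show "r = r'" using transversal_unique[OF S nL_subgroup s(1,2)] s by blast
  qed (rule nL_subgroup)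
  moreover have "nL (n * m) \<subseteq> nL n"
  proof
    fix v assume "v \<in> nL (n * m)"
    then obtain l where "l \<in> L" "v = real n *\<^sub>R (real m *\<^sub>R l)" by auto
    then show "v \<in> nL n" using L_scale(2) by blast
  qed
  ultimately have "(\<Sum>t\<in>T. H t) = (\<Sum>r\<in>R. \<Sum>s\<in>(\<lambda>s. real n *\<^sub>R s) ` S. H (r + s))"
    by (intro transversal_sum_trans[OF R _ T L_subgroup nL_subgroup nL_subgroup nL_sub _ H])
  then show ?thesis by (simp add: sum.reindex[OF inj])
qed

text \<open>A unit modulo n permutes L / nL; its inverse comes from Bezout.\<close>

lemma transversal_nL_unit:
  fixes H :: "'v \<Rightarrow> 'c::comm_monoid_add"
  assumes R: "transversal L (nL n) R" and j: "coprime j (int n)"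
    and H: "\<And>v w. v \<in> L \<Longrightarrow> w \<in> L \<Longrightarrow> v - w \<in> nL n \<Longrightarrow> H v = H w"
  shows "(\<Sum>r\<in>R. H (of_int j *\<^sub>R r)) = (\<Sum>r\<in>R. H r)"
proof (rule transversal_sum_inj[OF R nL_subgroup H])
  show "of_int j *\<^sub>R r \<in> L" if "r \<in> R" for r using transversal_subset[OF R that] by (rule L_scale(1))
  fix r r' assume r: "r \<in> R" "r' \<in> R" "of_int j *\<^sub>R r - of_int j *\<^sub>R r' \<in> nL n"
  obtain x y where xy: "x * j + y * int n = 1" using j by (metis bezout_int coprime_iff_gcd_eq_1)
  obtain l where l: "l \<in> L" "of_int j *\<^sub>R r - of_int j *\<^sub>R r' = real n *\<^sub>R l" using r(3) by blast
  have d: "r - r' \<in> L" using transversal_subset[OF R] r add_subgroup_diff[OF L_subgroup] by blast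
  have "r - r' = of_int (x * j + y * int n) *\<^sub>R (r - r')" by (simp add: xy)
  also have "\<dots> = of_int x *\<^sub>R (of_int j *\<^sub>R r - of_int j *\<^sub>R r') + real n *\<^sub>R (of_int y *\<^sub>R (r - r'))"
    by (simp add: algebra_simps)
  also have "\<dots> = real n *\<^sub>R (of_int x *\<^sub>R l + of_int y *\<^sub>R (r - r'))"
    unfolding l(2) by (simp add: scaleR_add_right mult.commute)
  finally have "r - r' \<in> nL n"
    using add_subgroup_add[OF L_subgroup L_scale(1)[OF l(1)] L_scale(1)[OF d]] by blast
  then show "r = r'" by (rule transversal_unique[OF R nL_subgroup r(1,2)])
qed (use transversal_finite[OF R] in auto)

lemma character_sum_nL:
  assumes z: "z \<in> Ld" and N: "N > 0" and j: "coprime j (int N)" and R: "transversal L (nL N) R"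
  shows "(\<Sum>r\<in>R. e (of_real (of_int j / real N * b z r))) = (if (1 / real N) *\<^sub>R z \<in> Ld then of_nat (N ^ lattice_rank L) else 0)"
proof -
  have "(\<Sum>r\<in>R. e (of_real (of_int j / real N * b z r))) =
     (if \<forall>l\<in>L. e (of_real (of_int j / real N * b z l)) = 1 then of_nat (card R) else 0)"
  proof (rule transversal_sum_character[OF R L_subgroup nL_subgroup nL_sub])
    show "e (of_real (of_int j / real N * b z (x + y))) = e (of_real (of_int j / real N * b z x)) * e (of_real (of_int j / real N * b z y))" for x y
      by (simp add: bil_simps e_add ring_distribs)
    fix m assume "m \<in> nL N"
    then obtain l where l: "l \<in> L" "m = real N *\<^sub>R l" by blast
    then have "of_int j / real N * b z m = of_int j * b z l" using N by (simp add: bil_simps)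
    then show "e (of_real (of_int j / real N * b z m)) = 1" using Ld_b(1)[OF z l(1)] by (intro e_int) simp
  qed
  moreover have "e (of_real (of_int j / real N * b z l)) = 1 \<longleftrightarrow> b z l / real N \<in> \<int>" if l: "l \<in> L" for l
  proof -
    obtain k where k: "b z l = of_int k" using Ld_b(1)[OF z l] by (auto elim: Ints_cases)
    have "of_int j / real N * b z l \<in> \<int> \<longleftrightarrow> b z l / real N \<in> \<int>"
    proof
      assume "of_int j / real N * b z l \<in> \<int>"
      then obtain m where "of_int j * of_int k = of_int m * real N" using N k by (auto elim!: Ints_cases simp: field_simps)
      then have "j * k = m * int N" by (metis of_int_eq_iff of_int_mult of_int_of_nat_eq)
      then have "int N dvd k" using j by (metis coprime_commute coprime_dvd_mult_right_iff dvd_triv_right)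
      then obtain m' where "k = int N * m'" by (rule dvdE)
      then show "b z l / real N \<in> \<int>" using N k by simp
    next
      assume "b z l / real N \<in> \<int>"
      then have "of_int j * (b z l / real N) \<in> \<int>" by (intro Ints_mult) auto
      then show "of_int j / real N * b z l \<in> \<int>" by simp
    qed
    then show ?thesis by (simp only: e_of_real_eq_1_iff)
  qed
  moreover have "(1 / real N) *\<^sub>R z \<in> Ld \<longleftrightarrow> (\<forall>l\<in>L. b z l / real N \<in> \<int>)"
    using Ld_span[OF z] by (auto simp: dual_lattice_def bil_simps span_scale)
  ultimately show ?thesis using card_transversal_nL[OF N R] by simp
qed

lemma e_q_periodic:
  assumes x: "x \<in> Ld" and vw: "v \<in> L" "w \<in> L" "v - w \<in> nL n" and n: "n > 0"
  shows "e (of_real (of_int h / real n * q (x + v))) = e (of_real (of_int h / real n * q (x + w)))"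
proof (rule e_cong)
  obtain l where l: "l \<in> L" "v = w + real n *\<^sub>R l" using vw(3) by (metis diff_add_cancel add.commute imageE)
  have "q (x + v) = q (x + w) + real n * (real n * q l + b (x + w) l)"
    unfolding l(2) add.assoc[symmetric] q_add[of "x + w"] by (simp add: q_scale bil_simps power2_eq_square algebra_simps)
  then have "of_int h / real n * q (x + v) - of_int h / real n * q (x + w) = of_int h * (real n * q l + b (x + w) l)"
    using n by (simp add: algebra_simps)
  also have "\<dots> \<in> \<int>"
    using q_int[OF l(1)] Ld_b(1)[OF add_subgroup_add[OF Ld_subgroup x] l(1)] vw(2) L_sub_Ld by (intro Ints_mult Ints_add) auto
  finally show "of_int h / real n * q (x + v) - of_int h / real n * q (x + w) \<in> \<int>" .
qed

definition gauss_sum :: "nat \<Rightarrow> int \<Rightarrow> 'v set \<Rightarrow> 'v \<Rightarrow> complex" where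
  "gauss_sum n h R x = (\<Sum>r\<in>R. e (of_real (of_int h / real n * q (x + r))))"

lemma gauss_sum_shift:
  assumes R: "transversal L (nL n) R" and n: "n > 0" and x: "x \<in> Ld" and a: "a \<in> L"
  shows "gauss_sum n h R (x + a) = gauss_sum n h R x"
proof -
  have "gauss_sum n h R (x + a) = (\<Sum>r\<in>R. e (of_real (of_int h / real n * q (x + (r + a)))))"
    by (simp add: gauss_sum_def add_ac)
  also have "\<dots> = gauss_sum n h R x"
    unfolding gauss_sum_def by (rule transversal_sum_shift[OF R L_subgroup nL_subgroup _ a])
      (rule e_q_periodic[OF x _ _ _ n])
  finally show ?thesis .
qed

lemma gauss_sum_cls:
  assumes R: "transversal L (nL n) R" and n: "n > 0" and x: "x \<in> disc L b" and v: "v \<in> x"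
  shows "gauss_sum n h R v = gauss_sum n h R (class_rep x)"
proof -
  have "v - class_rep x \<in> L"
    using v x disc_memD class_rep_in in_cls_iff by metis
  then show ?thesis using gauss_sum_shift[OF R n class_rep_Ld[OF x], of "v - class_rep x" h] by simp
qed

end

context weil_lattice
begin

text \<open>Applied with Q = p^s and m = p^{l-s}. The first characteristic lies in L, so a
  translation turns it into a phase. With r = r' + Q s the sum over s modulo m forces v into m L',
  and the sum over r' modulo Q becomes a Gauss sum.\<close>

lemma theta_sum_small:
  fixes k d h :: int and Q m :: nat
  assumes Q: "Q > 0" and m: "m > 0" and k: "coprime (2 * k) (int Q)" and dk: "[d = k * h] (mod int Q)"
    and d: "coprime (2 * d) (int m)"
    and \<tau>: "Im \<tau> > 0" and w: "w \<in> Ld" and y: "y \<in> disc L b"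
    and R: "transversal L (nL (Q * m)) R" and RQ: "transversal L (nL Q) RQ"
  shows "(\<Sum>r\<in>R. theta \<tau> ((2 * of_int k * real m) *\<^sub>R r) ((1 / real m) *\<^sub>R w + (2 * of_int d / real (Q * m)) *\<^sub>R r) y)
    = of_real (real m ^ lattice_rank L) * (\<Sum>x\<in>disc L b.
        theta (of_real ((real m)\<^sup>2) * \<tau> + of_real (of_int h / real Q)) 0 w x * gauss_sum Q (- h) RQ (class_rep x)
          * basis_elem (x [^]\<^bsub>disc_group L b\<^esub> m) y)"
proof -
  obtain Rm where Rm: "transversal L (nL m) Rm" using obtain_transversal_nL[OF m] by blast
  define \<tau>' where "\<tau>' = of_real ((real m)\<^sup>2) * \<tau> + of_real (of_int h / real Q)"
  have \<tau>': "Im \<tau>' > 0" using \<tau> m by (simp add: \<tau>'_def)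
  define \<psi> where "\<psi> = (\<lambda>v r. e (of_real (2 * of_int d / real (Q * m) * b v r - 4 * of_int (k * d) / real Q * q r)))"
  define H where "H = (\<lambda>v. gauss \<tau> v * e (of_real (b v w / real m)))"
  have sH: "(\<lambda>v. H v * \<psi> v r) summable_on y" for r
    unfolding H_def \<psi>_def using gauss_summable[OF \<tau> disc_sub_Ld[OF y], of 0] by (intro summable_on_mult_e) simp
  have shift: "theta \<tau> ((2 * of_int k * real m) *\<^sub>R r) ((1 / real m) *\<^sub>R w + (2 * of_int d / real (Q * m)) *\<^sub>R r) y
      = (\<Sum>\<^sub>\<infinity>v\<in>y. H v * \<psi> v r)" if r: "r \<in> R" for r
  proof -
    have rL: "r \<in> L" using transversal_subset[OF R r] .
    define a where "a = (2 * of_int k * real m) *\<^sub>R r"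
    have aL: "a \<in> L" using L_scale(1)[OF rL, of "2 * k * int m"] by (simp add: a_def)
    define X where "X = (1 / real m) *\<^sub>R w + (2 * of_int d / real (Q * m)) *\<^sub>R r"
    have mem: "v - a \<in> y \<longleftrightarrow> v \<in> y" for v
    proof -
      obtain v0 where v0: "y = cls v0" using y by (auto simp: disc_eq)
      have "v - v0 \<in> L \<longleftrightarrow> v - v0 - a \<in> L"
        using add_subgroup_diff[OF L_subgroup _ aL, of "v - v0"] add_subgroup_add[OF L_subgroup _ aL, of "v - v0 - a"] by auto
      moreover have "v - a - v0 = v - v0 - a" by simp
      ultimately show ?thesis unfolding v0 in_cls_iff by (simp only:)
    qed
    have mem2: "v + a \<in> y \<longleftrightarrow> v \<in> y" for v using mem[of "v + a"] by simp
    have "theta \<tau> a X y = (\<Sum>\<^sub>\<infinity>v\<in>y. gauss \<tau> v * e (of_real (b (v - a) X + b a X / 2)))"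
      unfolding theta_def by (rule infsum_reindex_bij_witness[of _ "\<lambda>v. v - a" "\<lambda>v. v + a"])
        (simp_all only: mem mem2 diff_add_cancel add_diff_cancel)
    also have "\<dots> = (\<Sum>\<^sub>\<infinity>v\<in>y. H v * \<psi> v r)"
    proof (rule infsum_cong)
      fix v
      have "b (v - a) X + b a X / 2 = b v w / real m + (2 * of_int d / real (Q * m) * b v r - 4 * of_int (k * d) / real Q * q r) - of_int k * b r w"
        using m Q by (simp add: X_def a_def bil_simps qform_def field_simps)
      moreover have "of_int k * b r w \<in> \<int>" using Ld_b(2)[OF w rL] by (intro Ints_mult) auto
      ultimately have "e (of_real (b (v - a) X + b a X / 2)) =
          e (of_real (b v w / real m + (2 * of_int d / real (Q * m) * b v r - 4 * of_int (k * d) / real Q * q r)))"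
        by (intro e_cong) simp
      then show "gauss \<tau> v * e (of_real (b (v - a) X + b a X / 2)) = H v * \<psi> v r"
        by (simp add: H_def \<psi>_def e_add mult.assoc)
    qed
    finally show ?thesis by (simp only: a_def X_def)
  qed
  \<comment> \<open>The quadratic term sees r only modulo Q, so the contribution of s is a character
    of L / mL.\<close>
  have psi_add: "\<psi> v (r + real Q *\<^sub>R s) = \<psi> v r * e (of_real (of_int (2 * d) / real m * b v s))"
    if "v \<in> Ld" "r \<in> L" "s \<in> L" for v r s
  proof -
    define i where "i = of_int (4 * k * d) * (real Q * q s + b r s)"
    have "i \<in> \<int>" unfolding i_def using q_int b_int that by (intro Ints_mult Ints_add) auto
    moreover have "2 * of_int d / real (Q * m) * b v (r + real Q *\<^sub>R s) - 4 * of_int (k * d) / real Q * q (r + real Q *\<^sub>R s) =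
       (2 * of_int d / real (Q * m) * b v r - 4 * of_int (k * d) / real Q * q r) + of_int (2 * d) / real m * b v s - i"
      using m Q by (simp add: bil_simps q_add q_scale power2_eq_square i_def field_simps)
    ultimately show ?thesis
      unfolding \<psi>_def e_add[symmetric] of_real_add[symmetric] by (intro e_cong) simp
  qed
  have psi_sum: "(\<Sum>r\<in>R. \<psi> v r) = (if (1 / real m) *\<^sub>R v \<in> Ld then of_real (real m ^ lattice_rank L) * (\<Sum>r\<in>RQ. \<psi> v r) else 0)"
    if v: "v \<in> Ld" for v
  proof -
    have per: "\<psi> v r = \<psi> v r'" if r: "r \<in> L" "r' \<in> L" "r - r' \<in> nL (Q * m)" for r r'
    proof -
      obtain l where l: "l \<in> L" "r - r' = real (Q * m) *\<^sub>R l" using r(3) by blast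
      have "r = r' + real Q *\<^sub>R (real m *\<^sub>R l)" using l(2) by (simp add: algebra_simps)
      then have "\<psi> v r = \<psi> v r' * e (of_real (of_int (2 * d) / real m * b v (real m *\<^sub>R l)))"
        using psi_add[OF v r(2) L_scale(2)[OF l(1), of m]] by simp
      also have "e (of_real (of_int (2 * d) / real m * b v (real m *\<^sub>R l))) = 1"
        using Ld_b(1)[OF v l(1)] m by (intro e_int) (auto simp: bil_simps)
      finally show ?thesis by simp
    qed
    have "(\<Sum>r\<in>R. \<psi> v r) = (\<Sum>r\<in>RQ. \<Sum>s\<in>Rm. \<psi> v (r + real Q *\<^sub>R s))"
      by (rule transversal_nL_refine[OF RQ Rm R Q per])
    also have "\<dots> = (\<Sum>r\<in>RQ. \<psi> v r) * (\<Sum>s\<in>Rm. e (of_real (of_int (2 * d) / real m * b v s)))"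
      unfolding sum_product
      by (intro sum.cong refl psi_add v) (auto intro: transversal_subset[OF RQ] transversal_subset[OF Rm])
    finally show ?thesis unfolding character_sum_nL[OF v m d Rm] by simp
  qed
  \<comment> \<open>Completing the square: d may be replaced by k h modulo Q, and the linear and
    quadratic terms are those of q(x - 2k r). As 2k is a unit modulo Q, the substitution permutes
    the residues.\<close>
  have psi_Q: "(\<Sum>r\<in>RQ. \<psi> (real m *\<^sub>R x) r) = e (of_real (of_int h / real Q * q x)) * gauss_sum Q (- h) RQ x" if x: "x \<in> Ld" for x
  proof -
    define g where "g = (\<lambda>v. e (of_real (of_int (- h) / real Q * q (x + v))))"
    have "\<psi> (real m *\<^sub>R x) r = e (of_real (of_int h / real Q * q x)) * g (of_int (- (2 * k)) *\<^sub>R r)" if r: "r \<in> RQ" for r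
      unfolding \<psi>_def g_def e_add[symmetric] of_real_add[symmetric]
    proof (rule e_cong)
      have rL: "r \<in> L" using transversal_subset[OF RQ r] .
      obtain t where t: "d = k * h + int Q * t"
        using dk by (metis cong_iff_lin cong_sym)
      have "2 * of_int d / real (Q * m) * b (real m *\<^sub>R x) r - 4 * of_int (k * d) / real Q * q r -
        (of_int h / real Q * q x + of_int (- h) / real Q * q (x + of_int (- (2 * k)) *\<^sub>R r)) =
        of_int (2 * t) * b x r - of_int (4 * k * t) * q r"
        using m Q by (simp add: t q_add q_diff q_scale bil_simps power2_eq_square field_simps)
      also have "\<dots> \<in> \<int>" using Ld_b(1)[OF x rL] q_int[OF rL] by (intro Ints_diff Ints_mult) auto
      finally show "2 * of_int d / real (Q * m) * b (real m *\<^sub>R x) r - 4 * of_int (k * d) / real Q * q r -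
        (of_int h / real Q * q x + of_int (- h) / real Q * q (x + of_int (- (2 * k)) *\<^sub>R r)) \<in> \<int>" .
    qed
    then have "(\<Sum>r\<in>RQ. \<psi> (real m *\<^sub>R x) r) = e (of_real (of_int h / real Q * q x)) * (\<Sum>r\<in>RQ. g (of_int (- (2 * k)) *\<^sub>R r))"
      by (simp add: sum_distrib_left)
    also have "(\<Sum>r\<in>RQ. g (of_int (- (2 * k)) *\<^sub>R r)) = (\<Sum>r\<in>RQ. g r)"
    proof (rule transversal_nL_unit[OF RQ])
      show "coprime (- (2 * k)) (int Q)" using k by simp
      show "g v = g v'" if "v \<in> L" "v' \<in> L" "v - v' \<in> nL Q" for v v'
        unfolding g_def by (rule e_q_periodic[OF x that Q])
    qed
    finally show ?thesis by (simp add: gauss_sum_def g_def)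
  qed
  define G where "G = (\<lambda>x. gauss \<tau>' x * e (of_real (b x w)) * gauss_sum Q (- h) RQ x)"
  have sG: "G summable_on Ld"
  proof -
    have "(\<lambda>x. gauss \<tau>' (x + 0) * e (of_real (b x w)) * e (of_real (of_int (- h) / real Q * q (x + r)))) summable_on Ld" for r
      by (intro summable_on_mult_e gauss_summable \<tau>' subset_refl)
    then have "(\<lambda>x. \<Sum>r\<in>RQ. gauss \<tau>' x * e (of_real (b x w)) * e (of_real (of_int (- h) / real Q * q (x + r)))) summable_on Ld"
      by (intro summable_on_sum_finite transversal_finite[OF RQ]) simp
    then show ?thesis by (simp add: G_def gauss_sum_def sum_distrib_left)
  qed
  have "(\<Sum>r\<in>R. theta \<tau> ((2 * of_int k * real m) *\<^sub>R r) ((1 / real m) *\<^sub>R w + (2 * of_int d / real (Q * m)) *\<^sub>R r) y)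
      = (\<Sum>r\<in>R. \<Sum>\<^sub>\<infinity>v\<in>y. H v * \<psi> v r)"
    by (rule sum.cong) (simp_all only: shift)
  also have "\<dots> = (\<Sum>\<^sub>\<infinity>v\<in>y. \<Sum>r\<in>R. H v * \<psi> v r)"
    by (rule infsum_sum_finite[OF transversal_finite[OF R] sH, symmetric])
  also have "\<dots> = (\<Sum>\<^sub>\<infinity>v\<in>{v\<in>y. (1 / real m) *\<^sub>R v \<in> Ld}. of_real (real m ^ lattice_rank L) * G ((1 / real m) *\<^sub>R v))"
  proof (rule infsum_cong_neutral)
    fix v assume "v \<in> y - {v\<in>y. (1 / real m) *\<^sub>R v \<in> Ld}"
    then show "(\<Sum>r\<in>R. H v * \<psi> v r) = 0"
      using psi_sum[of v] disc_sub_Ld[OF y] by (auto simp: sum_distrib_left[symmetric])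
  next
    fix v assume v: "v \<in> y \<inter> {v\<in>y. (1 / real m) *\<^sub>R v \<in> Ld}"
    define x where "x = (1 / real m) *\<^sub>R v"
    have x: "x \<in> Ld" "v = real m *\<^sub>R x" "v \<in> Ld" using v m disc_sub_Ld[OF y] by (auto simp: x_def)
    have "H v = gauss (of_real ((real m)\<^sup>2) * \<tau>) x * e (of_real (b x w))"
      using m by (simp add: H_def x(2) gauss_scale bil_simps)
    moreover have "gauss \<tau>' x = e (of_real (of_int h / real Q * q x)) * gauss (of_real ((real m)\<^sup>2) * \<tau>) x"
      unfolding \<tau>'_def by (rule gauss_add_real[OF Ld_span[OF x(1)]])
    moreover have "(\<Sum>r\<in>R. \<psi> v r) = of_real (real m ^ lattice_rank L) * (e (of_real (of_int h / real Q * q x)) * gauss_sum Q (- h) RQ x)"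
      using psi_sum[OF x(3)] psi_Q[OF x(1)] x(1) by (simp add: x_def[symmetric] x(2)[symmetric])
    ultimately show "(\<Sum>r\<in>R. H v * \<psi> v r) = of_real (real m ^ lattice_rank L) * G ((1 / real m) *\<^sub>R v)"
      unfolding sum_distrib_left[symmetric] x_def[symmetric] G_def by (simp only: mult_ac)
  qed auto
  also have "\<dots> = of_real (real m ^ lattice_rank L) *
      (\<Sum>x\<in>disc L b. (\<Sum>\<^sub>\<infinity>v\<in>x. G v) * basis_elem (x [^]\<^bsub>disc_group L b\<^esub> m) y)"
    unfolding infsum_cmult_right' infsum_disc_power[OF y m sG] ..
  also have "(\<Sum>x\<in>disc L b. (\<Sum>\<^sub>\<infinity>v\<in>x. G v) * basis_elem (x [^]\<^bsub>disc_group L b\<^esub> m) y) =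
      (\<Sum>x\<in>disc L b. theta \<tau>' 0 w x * gauss_sum Q (- h) RQ (class_rep x) * basis_elem (x [^]\<^bsub>disc_group L b\<^esub> m) y)"
  proof (intro sum.cong refl arg_cong2[of _ _ _ _ "(*)"])
    fix x assume x: "x \<in> disc L b"
    have "G v = gauss \<tau>' v * e (of_real (b v w)) * gauss_sum Q (- h) RQ (class_rep x)" if "v \<in> x" for v
      unfolding G_def gauss_sum_cls[OF RQ Q x that] ..
    then have "(\<Sum>\<^sub>\<infinity>v\<in>x. G v) = (\<Sum>\<^sub>\<infinity>v\<in>x. gauss \<tau>' v * e (of_real (b v w)) * gauss_sum Q (- h) RQ (class_rep x))"
      by (rule infsum_cong)
    then show "(\<Sum>\<^sub>\<infinity>v\<in>x. G v) = theta \<tau>' 0 w x * gauss_sum Q (- h) RQ (class_rep x)"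
      by (simp add: infsum_cmult_left' theta_def bil_0)
  qed
  finally show ?thesis unfolding \<tau>'_def .
qed

text \<open>Applied with P m = p^l and m = p^{s-l}. The first characteristic now has denominator m,
  so v + 2k r / m = x / m with x = m v + 2k r. Running r through the residues modulo m lets x
  exhaust the class m y; the remaining digits of r only move a quadratic exponential of v and yield
  a Gauss sum modulo P.\<close>

lemma theta_sum_large:
  fixes k d h :: int and P m :: nat
  assumes P: "P > 0" and m: "m > 0" and k: "coprime (2 * k) (int P)" "coprime (2 * k) (int m)"
    and dk: "[d = k * h] (mod int (P * m * m))"
    and \<tau>: "Im \<tau> > 0" and w: "w \<in> Ld" and y: "y \<in> disc L b"
    and R: "transversal L (nL (P * m)) R"
  shows "of_real (real m ^ lattice_rank L) *
      (\<Sum>r\<in>R. theta \<tau> ((2 * of_int k / real m) *\<^sub>R r) (real m *\<^sub>R w + (2 * of_int d / real (P * m)) *\<^sub>R r) y)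
    = theta (of_real (1 / (real m)\<^sup>2) * \<tau> + of_real (of_int h / real (P * m * m))) 0 w (y [^]\<^bsub>disc_group L b\<^esub> m) *
      (\<Sum>r\<in>R. e (of_real (of_int (- h) / real P * q (class_rep y + r))))"
proof -
  define N Q where "N = P * m" and "Q = P * m * m"
  have pos: "N > 0" "Q > 0" using P m by (auto simp: N_def Q_def)
  obtain Rm where Rm: "transversal L (nL m) Rm" using obtain_transversal_nL[OF m] by blast
  obtain RP where RP: "transversal L (nL P) RP" using obtain_transversal_nL[OF P] by blast
  have R': "transversal L (nL (m * P)) R" using R by (simp add: mult.commute)
  define \<tau>' where "\<tau>' = of_real (1 / (real m)\<^sup>2) * \<tau> + of_real (of_int h / real Q)"
  have "Im \<tau>' = Im \<tau> / (real m)\<^sup>2" by (simp add: \<tau>'_def)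
  then have \<tau>': "Im \<tau>' > 0" using \<tau> m by simp
  define G where "G = (\<lambda>x. gauss \<tau>' x * e (of_real (b x w)))"
  define X where "X = (\<lambda>v. e (of_real (of_int (- h) / real P * q v)))"
  have X_per: "X (v + l) = X (v + l')" if "v \<in> Ld" "l \<in> L" "l' \<in> L" "l - l' \<in> nL P" for v l l'
    unfolding X_def by (rule e_q_periodic[OF that P])
  obtain y0 where y0: "y0 \<in> Ld" "y = cls y0" using y by (rule disc_cases)
  have mem: "v + l \<in> y \<longleftrightarrow> v \<in> y" if "l \<in> L" for v l
  proof -
    have "v - y0 \<in> L \<longleftrightarrow> v - y0 + l \<in> L"
      using add_subgroup_add[OF L_subgroup _ that, of "v - y0"] add_subgroup_diff[OF L_subgroup _ that, of "v - y0 + l"] by auto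
    moreover have "v + l - y0 = v - y0 + l" by simp
    ultimately show ?thesis unfolding y0(2) in_cls_iff by (simp only:)
  qed
  have mem': "v - l \<in> y \<longleftrightarrow> v \<in> y" if "l \<in> L" for v l
    using mem[OF that, of "v - l"] by simp
  define A where "A = (\<lambda>r. \<Sum>\<^sub>\<infinity>v\<in>y. G (real m *\<^sub>R v + of_int (2 * k) *\<^sub>R r) * X v)"
  have shift: "theta \<tau> ((2 * of_int k / real m) *\<^sub>R r) (real m *\<^sub>R w + (2 * of_int d / real N) *\<^sub>R r) y = A r"
    if rL: "r \<in> L" for r
    unfolding theta_def A_def
  proof (rule infsum_cong)
    fix v assume v: "v \<in> y"
    have vL: "v \<in> Ld" using disc_memD(1)[OF y v] .
    define x where "x = real m *\<^sub>R v + of_int (2 * k) *\<^sub>R r"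
    have xL: "x \<in> Ld" unfolding x_def
      using Ld_scale(2)[OF vL, of m] L_scale(1)[OF rL, of "2 * k"] L_sub_Ld add_subgroup_add[OF Ld_subgroup] by blast
    have va: "v + (2 * of_int k / real m) *\<^sub>R r = (1 / real m) *\<^sub>R x"
      using m by (simp add: x_def scaleR_add_right)
    obtain t where t: "d = k * h + int Q * t"
      using dk unfolding Q_def by (metis cong_iff_lin cong_sym)
    define W where "W = real m *\<^sub>R w + (2 * of_int d / real N) *\<^sub>R r"
    have g1: "gauss \<tau> ((1 / real m) *\<^sub>R x) = gauss (of_real (1 / (real m)\<^sup>2) * \<tau>) x"
      by (simp add: gauss_scale power_divide)
    have g2: "gauss \<tau>' x = e (of_real (of_int h / real Q * q x)) * gauss (of_real (1 / (real m)\<^sup>2) * \<tau>) x"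
      unfolding \<tau>'_def by (rule gauss_add_real[OF Ld_span[OF xL]])
    have "e (of_real (b v W + b ((2 * of_int k / real m) *\<^sub>R r) W / 2)) =
        e (of_real (of_int h / real Q * q x + b x w + of_int (- h) / real P * q v))"
    proof (rule e_cong)
      have "b v W + b ((2 * of_int k / real m) *\<^sub>R r) W / 2 - (of_int h / real Q * q x + b x w + of_int (- h) / real P * q v)
          = of_int (2 * int m * t) * b v r + of_int (4 * k * t) * q r - of_int k * b r w"
      proof -
        have qr: "b r r = 2 * q r" by (simp add: qform_def)
        show ?thesis
          using P m by (simp add: W_def x_def t Q_def N_def q_add q_scale bil_simps qr symmetric[of r v] power2_eq_square field_simps)
      qed
      also have "\<dots> \<in> \<int>" using Ld_b(1)[OF vL rL] q_int[OF rL] Ld_b(2)[OF w rL] by (intro Ints_add Ints_diff Ints_mult) auto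
      finally show "b v W + b ((2 * of_int k / real m) *\<^sub>R r) W / 2 - (of_int h / real Q * q x + b x w + of_int (- h) / real P * q v) \<in> \<int>" .
    qed
    then show "gauss \<tau> (v + (2 * of_int k / real m) *\<^sub>R r) * e (of_real (b v (real m *\<^sub>R w + (2 * of_int d / real N) *\<^sub>R r) +
        b ((2 * of_int k / real m) *\<^sub>R r) (real m *\<^sub>R w + (2 * of_int d / real N) *\<^sub>R r) / 2)) =
        G (real m *\<^sub>R v + of_int (2 * k) *\<^sub>R r) * X v"
      unfolding W_def[symmetric] x_def[symmetric] va g1 G_def g2 X_def by (simp only: of_real_add e_add mult_ac)
  qed
  \<comment> \<open>Adding m s to r and moving v by -2k s keeps m v + 2k r fixed, so s survives only
    inside \<open>X\<close>.\<close>
  have A_shift: "A (r + real m *\<^sub>R s) = (\<Sum>\<^sub>\<infinity>v\<in>y. G (real m *\<^sub>R v + of_int (2 * k) *\<^sub>R r) * X (v - of_int (2 * k) *\<^sub>R s))"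
    if "s \<in> L" for r s
    unfolding A_def
    by (rule infsum_reindex_bij_witness[of _ "\<lambda>v. v - of_int (2 * k) *\<^sub>R s" "\<lambda>v. v + of_int (2 * k) *\<^sub>R s"])
      (simp_all add: mem[OF L_scale(1)[OF that]] mem'[OF L_scale(1)[OF that]] algebra_simps del: of_int_mult)
  have X_shift: "X (v - of_int (2 * k) *\<^sub>R s) = X (v - of_int (2 * k) *\<^sub>R s')"
    if vs: "v \<in> Ld" "s \<in> L" "s' \<in> L" "s - s' \<in> nL P" for v s s'
  proof -
    obtain l where l: "l \<in> L" "s - s' = real P *\<^sub>R l" using vs(4) by blast
    have "of_int (- (2 * k)) *\<^sub>R s - of_int (- (2 * k)) *\<^sub>R s' = real P *\<^sub>R (of_int (- (2 * k)) *\<^sub>R l)"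
      unfolding scaleR_diff_right[symmetric] l(2) by (simp add: mult.commute)
    then have "of_int (- (2 * k)) *\<^sub>R s - of_int (- (2 * k)) *\<^sub>R s' \<in> nL P" using L_scale(1)[OF l(1)] by blast
    then show ?thesis
      using X_per[OF vs(1) L_scale(1)[OF vs(2)] L_scale(1)[OF vs(3)], of "- (2 * k)" "- (2 * k)"] by simp
  qed
  have A_per: "A r = A r'" if r: "r \<in> L" "r' \<in> L" "r - r' \<in> nL (m * P)" for r r'
  proof -
    obtain l where l: "l \<in> L" "r - r' = real (m * P) *\<^sub>R l" using r(3) by blast
    have "r = r' + real m *\<^sub>R (real P *\<^sub>R l)" using l(2) by (simp add: algebra_simps)
    then have "A r = (\<Sum>\<^sub>\<infinity>v\<in>y. G (real m *\<^sub>R v + of_int (2 * k) *\<^sub>R r') * X (v - of_int (2 * k) *\<^sub>R (real P *\<^sub>R l)))"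
      using A_shift[OF L_scale(2)[OF l(1)], of r' P] by simp
    also have "\<dots> = A r'"
      unfolding A_def
      by (intro infsum_cong arg_cong2[of _ _ _ _ "(*)"] refl, subst X_shift[of _ _ 0])
        (use disc_memD(1)[OF y] L_scale(2)[OF l(1)] l(1) add_subgroup_0[OF L_subgroup] in auto)
    finally show ?thesis .
  qed
  define \<Psi> where "\<Psi> = (\<Sum>r\<in>RP. X (y0 + r))"
  \<comment> \<open>Because -2k is a unit modulo P and v lies in y0 + L, the sum runs over all
    residues of y0 + L, whichever v is taken.\<close>
  have Psi: "(\<Sum>s\<in>RP. X (v - of_int (2 * k) *\<^sub>R s)) = \<Psi>" if v: "v \<in> y" for v
  proof -
    have vL: "v \<in> Ld" using disc_memD(1)[OF y v] .
    have vy: "v - y0 \<in> L" using v by (simp add: y0(2) in_cls_iff)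
    have "(\<Sum>s\<in>RP. X (v + of_int (- (2 * k)) *\<^sub>R s)) = (\<Sum>s\<in>RP. X (v + s))"
      by (rule transversal_nL_unit[OF RP _ X_per[OF vL]]) (use k in auto)
    also have "\<dots> = (\<Sum>s\<in>RP. X (y0 + (s + (v - y0))))" by (simp add: add_ac)
    also have "\<dots> = \<Psi>" unfolding \<Psi>_def
      by (rule transversal_sum_shift[OF RP L_subgroup nL_subgroup X_per[OF y0(1)] vy])
    finally show ?thesis by simp
  qed
  have my: "y [^]\<^bsub>disc_group L b\<^esub> m = cls (real m *\<^sub>R y0)" by (simp add: y0(2) disc_pow)
  have myL: "real m *\<^sub>R y0 \<in> Ld" by (rule Ld_scale(2)[OF y0(1)])
  have sG: "G summable_on B" if "B \<subseteq> Ld" for B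
    unfolding G_def using gauss_summable[OF \<tau>' that, of 0] by (intro summable_on_mult_e) simp
  have sGX: "(\<lambda>v. G (real m *\<^sub>R v + of_int (2 * k) *\<^sub>R r) * X (v - of_int (2 * k) *\<^sub>R s)) summable_on y"
    if rL: "r \<in> L" for r s
    unfolding X_def
  proof (rule summable_on_mult_e)
    have inj: "inj_on (\<lambda>v. real m *\<^sub>R v + of_int (2 * k) *\<^sub>R r) y" using m by (auto simp: inj_on_def)
    have sub: "(\<lambda>v. real m *\<^sub>R v + of_int (2 * k) *\<^sub>R r) ` y \<subseteq> Ld"
      using Ld_scale(2)[OF disc_memD(1)[OF y], of _ m] L_scale(1)[OF rL, of "2 * k"] L_sub_Ld add_subgroup_add[OF Ld_subgroup] by blast
    show "(\<lambda>v. G (real m *\<^sub>R v + of_int (2 * k) *\<^sub>R r)) summable_on y"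
      using sG[OF sub] by (subst (asm) summable_on_reindex[OF inj]) (simp add: o_def)
  qed
  have inner: "(\<Sum>s\<in>RP. A (r + real m *\<^sub>R s)) = \<Psi> * (\<Sum>\<^sub>\<infinity>v\<in>y. G (real m *\<^sub>R v + of_int (2 * k) *\<^sub>R r))"
    if rL: "r \<in> L" for r
  proof -
    have "(\<Sum>s\<in>RP. A (r + real m *\<^sub>R s)) =
        (\<Sum>s\<in>RP. \<Sum>\<^sub>\<infinity>v\<in>y. G (real m *\<^sub>R v + of_int (2 * k) *\<^sub>R r) * X (v - of_int (2 * k) *\<^sub>R s))"
      by (intro sum.cong refl A_shift transversal_subset[OF RP])
    also have "\<dots> = (\<Sum>\<^sub>\<infinity>v\<in>y. \<Sum>s\<in>RP. G (real m *\<^sub>R v + of_int (2 * k) *\<^sub>R r) * X (v - of_int (2 * k) *\<^sub>R s))"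
      by (rule infsum_sum_finite[OF transversal_finite[OF RP] sGX[OF rL], symmetric])
    also have "\<dots> = (\<Sum>\<^sub>\<infinity>v\<in>y. \<Psi> * G (real m *\<^sub>R v + of_int (2 * k) *\<^sub>R r))"
      by (rule infsum_cong) (simp add: sum_distrib_left[symmetric] Psi del: of_int_mult)
    finally show ?thesis by (simp only: infsum_cmult_right')
  qed
  \<comment> \<open>A partial sum over the coset of m L through m y0 + r; summed over r modulo m
    these exhaust the class of m y0.\<close>
  define D where "D = (\<lambda>r. \<Sum>\<^sub>\<infinity>l\<in>L. G (real m *\<^sub>R y0 + (r + real m *\<^sub>R l)))"
  have D_per: "D r = D r'" if r: "r \<in> L" "r' \<in> L" "r - r' \<in> nL m" for r r'
  proof -
    obtain l where l: "l \<in> L" "r - r' = real m *\<^sub>R l" using r(3) by blast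
    then have "r = r' + real m *\<^sub>R l" by (simp add: algebra_simps)
    then show ?thesis unfolding D_def
      by (intro infsum_reindex_bij_witness[of _ "\<lambda>z. z - l" "\<lambda>z. z + l"])
        (use l(1) add_subgroup_add[OF L_subgroup] add_subgroup_diff[OF L_subgroup] in \<open>auto simp: algebra_simps\<close>)
  qed
  have yD: "(\<Sum>\<^sub>\<infinity>v\<in>y. G (real m *\<^sub>R v + of_int (2 * k) *\<^sub>R r)) = D (of_int (2 * k) *\<^sub>R r)" for r
    unfolding y0(2) infsum_cls D_def by (simp add: algebra_simps)
  have sumD: "(\<Sum>r\<in>Rm. D r) = theta \<tau>' 0 w (y [^]\<^bsub>disc_group L b\<^esub> m)"
  proof -
    have "(\<lambda>l. G (real m *\<^sub>R y0 + l)) summable_on L"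
    proof -
      have inj: "inj_on (\<lambda>l. real m *\<^sub>R y0 + l) L" by (auto simp: inj_on_def)
      have sub: "(\<lambda>l. real m *\<^sub>R y0 + l) ` L \<subseteq> Ld" using myL L_sub_Ld add_subgroup_add[OF Ld_subgroup] by blast
      show ?thesis using sG[OF sub] by (subst (asm) summable_on_reindex[OF inj]) (simp add: o_def)
    qed
    then have "(\<Sum>\<^sub>\<infinity>l\<in>L. G (real m *\<^sub>R y0 + l)) = (\<Sum>r\<in>Rm. \<Sum>\<^sub>\<infinity>z\<in>nL m. G (real m *\<^sub>R y0 + (r + z)))"
      by (rule infsum_transversal[OF Rm L_subgroup nL_subgroup nL_sub])
    also have "\<dots> = (\<Sum>r\<in>Rm. D r)"
    proof -
      have inj: "inj_on (\<lambda>l. real m *\<^sub>R l) L" using m by (auto simp: inj_on_def)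
      show ?thesis unfolding D_def by (subst infsum_reindex[OF inj]) (simp add: o_def)
    qed
    finally show ?thesis by (simp add: theta_def my infsum_cls G_def bil_0)
  qed
  have total: "(\<Sum>r\<in>R. A r) = \<Psi> * theta \<tau>' 0 w (y [^]\<^bsub>disc_group L b\<^esub> m)"
  proof -
    have "(\<Sum>r\<in>R. A r) = (\<Sum>r\<in>Rm. \<Sum>s\<in>RP. A (r + real m *\<^sub>R s))"
      by (rule transversal_nL_refine[OF Rm RP R' m A_per])
    also have "\<dots> = (\<Sum>r\<in>Rm. \<Psi> * D (of_int (2 * k) *\<^sub>R r))"
      by (intro sum.cong refl) (simp only: inner[OF transversal_subset[OF Rm]] yD)
    also have "\<dots> = \<Psi> * (\<Sum>r\<in>Rm. D r)"
      unfolding sum_distrib_left[symmetric]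
      by (subst transversal_nL_unit[OF Rm k(2) D_per]) auto
    finally show ?thesis by (simp only: sumD)
  qed
  \<comment> \<open>Representatives modulo P m meet each residue modulo P exactly m^D times, which
    accounts for the factor m^D on the left of the claim.\<close>
  have Psi_R: "(\<Sum>r\<in>R. X (class_rep y + r)) = of_real (real m ^ lattice_rank L) * \<Psi>"
  proof -
    have c: "class_rep y - y0 \<in> L" using class_rep_cls[of y0] by (simp add: y0(2))
    have cL: "class_rep y \<in> Ld" by (rule class_rep_Ld[OF y])
    have R'': "transversal L (nL (P * m)) R" by (rule R)
    have perN: "X (class_rep y + v) = X (class_rep y + v')" if v: "v \<in> L" "v' \<in> L" "v - v' \<in> nL (P * m)" for v v'
    proof (rule X_per[OF cL v(1,2)])
      obtain l where "l \<in> L" "v - v' = real P *\<^sub>R (real m *\<^sub>R l)" using v(3) by auto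
      then show "v - v' \<in> nL P" using L_scale(2) by blast
    qed
    have "(\<Sum>r\<in>R. X (class_rep y + r)) = (\<Sum>r\<in>RP. \<Sum>s\<in>Rm. X (class_rep y + (r + real P *\<^sub>R s)))"
      by (rule transversal_nL_refine[OF RP Rm R'' P perN])
    also have "\<dots> = (\<Sum>r\<in>RP. \<Sum>s\<in>Rm. X (class_rep y + r))"
    proof (intro sum.cong refl X_per[OF cL])
      fix r s assume rs: "r \<in> RP" "s \<in> Rm"
      have sL: "s \<in> L" "r \<in> L" using rs transversal_subset[OF Rm] transversal_subset[OF RP] by auto
      show "r + real P *\<^sub>R s \<in> L" "r \<in> L" "r + real P *\<^sub>R s - r \<in> nL P"
        using add_subgroup_add[OF L_subgroup sL(2) L_scale(2)[OF sL(1)]] sL by auto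
    qed
    also have "\<dots> = of_nat (card Rm) * (\<Sum>r\<in>RP. X (class_rep y + r))" by (simp add: sum_distrib_left)
    also have "(\<Sum>r\<in>RP. X (class_rep y + r)) = (\<Sum>r\<in>RP. X (y0 + (r + (class_rep y - y0))))" by (simp add: add_ac)
    also have "\<dots> = \<Psi>" unfolding \<Psi>_def
      by (rule transversal_sum_shift[OF RP L_subgroup nL_subgroup X_per[OF y0(1)] c])
    finally show ?thesis using card_transversal_nL[OF m Rm] by simp
  qed
  have "(\<Sum>r\<in>R. theta \<tau> ((2 * of_int k / real m) *\<^sub>R r) (real m *\<^sub>R w + (2 * of_int d / real (P * m)) *\<^sub>R r) y) = (\<Sum>r\<in>R. A r)"
    unfolding N_def[symmetric] by (intro sum.cong refl shift transversal_subset[OF R])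
  then show ?thesis
    unfolding total \<tau>'_def[unfolded Q_def, symmetric] using Psi_R by (simp add: X_def mult_ac)
qed

end

section \<open>Existence of a decomposition of \<beta>\<close>

lemma csqrt_linear_holomorphic:
  assumes "c \<noteq> 0"
  shows "(\<lambda>\<tau>. csqrt (of_real c * \<tau> + of_real d)) holomorphic_on UH"
  by (intro holomorphic_intros) (use assms in \<open>auto simp: complex_nonpos_Reals_iff UH_iff\<close>)

text \<open>The second column of \<beta> is primitive, so Bezout completes it to a matrix \<gamma>
  in SL_2(Z); \<gamma>' can then be taken lower unipotent.\<close>

lemma mp_beta_decomposition:
  fixes p l s :: nat and h :: int
  assumes p: "prime p" and s: "0 < s" "s < 2 * l" and h: "coprime h (int p)"
  obtains \<gamma> \<gamma>' where "\<gamma> \<in> carrier mp2_int" "\<gamma>' \<in> carrier mp2_int"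
    "mp_beta p l s h = \<gamma> \<otimes>\<^bsub>mp2_rat\<^esub> mp_alpha p l \<otimes>\<^bsub>mp2_rat\<^esub> \<gamma>'"
proof -
  define P Q where "P = p ^ (2 * l - s)" and "Q = p ^ s"
  have p1: "p > 1" using p prime_gt_1_nat by blast
  have pos: "P > 0" "Q > 1" using p1 one_less_power[OF p1 s(1)] by (auto simp: P_def Q_def)
  have PQ: "p ^ (2 * l) = P * Q" using s by (simp add: P_def Q_def power_add[symmetric])
  have "coprime h (int Q)" using h by (simp add: Q_def)
  then obtain x y where "x * h + y * int Q = 1" by (metis bezout_int coprime_iff_gcd_eq_1)
  then obtain a c where ac: "a * int Q - h * c = 1" by (metis add.commute diff_minus_eq_add minus_mult_right mult.commute)
  \<comment> \<open>Here Q > 1, that is s > 0, is used. With c nonzero the arguments of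
    \<open>csqrt\<close> stay off the real axis.\<close>
  have c0: "c \<noteq> 0"
  proof
    assume "c = 0"
    then have "a * int Q = 1" using ac by simp
    then show False using pos by (auto simp: zmult_eq_1_iff)
  qed
  define A A' B \<beta> where "A = mat2 (of_int a) (of_int h) (of_int c) (of_int (int Q))"
    and "A' = mat2 1 0 (of_int (- c * int P)) 1" and "B = mat2 (of_nat (p ^ (2 * l))) 0 0 1"
    and "\<beta> = mat2 (of_nat P) (of_int h) 0 (of_nat Q)"
  have beta: "A ** B ** A' = \<beta>"
  proof -
    have "of_int (a * int Q - h * c) = (1 :: rat)" by (simp only: ac of_int_1)
    then have ac': "of_int a * of_nat Q - of_int h * of_int c = (1 :: rat)" by simp
    have "of_int a * (of_nat P * of_nat Q) - of_int h * (of_int c * of_nat P) = (of_nat P :: rat)"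
      using arg_cong[OF ac', of "\<lambda>z. of_nat P * z"] by (simp add: algebra_simps)
    then show ?thesis
      unfolding A_def A'_def B_def \<beta>_def PQ mat2_mult mat2_inject by (simp add: algebra_simps)
  qed
  define \<phi> where "\<phi> = restrict (\<lambda>\<tau>. csqrt (of_real (of_int c) * \<tau> + of_real (real Q))) UH"
  define f where "f = (\<lambda>\<tau>. csqrt (of_real (of_int (- c * int P)) * \<tau> + of_real 1))"
  have cP: "- c * int P \<noteq> 0" using c0 pos by simp
  have f: "f holomorphic_on UH" unfolding f_def by (rule csqrt_linear_holomorphic) (use cP in simp)
  have \<gamma>: "(A, \<phi>) \<in> carrier mp2_int" unfolding A_def \<phi>_def
  proof (rule mp_int_carrier_mat2)
    show "of_int a * of_int (int Q) - of_int h * of_int c = (1::rat)"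
      using ac by (metis of_int_1 of_int_diff of_int_mult)
    show "(\<lambda>\<tau>. csqrt (of_real (of_int c) * \<tau> + of_real (real Q))) holomorphic_on UH"
      by (rule csqrt_linear_holomorphic) (use c0 in simp)
  qed auto
  \<comment> \<open>Both square roots are kept; the sign is fixed at the end, when the product must
    have the positive constant p^{s/2} as second component.\<close>
  have \<gamma>': "(A', restrict (\<lambda>\<tau>. \<sigma> * f \<tau>) UH) \<in> carrier mp2_int" if "\<sigma> = 1 \<or> \<sigma> = -1" for \<sigma>
    unfolding A'_def
  proof (rule mp_int_carrier_mat2)
    show "(\<lambda>\<tau>. \<sigma> * f \<tau>) holomorphic_on UH" by (intro holomorphic_intros f)
    show "(\<sigma> * f \<tau>)\<^sup>2 = of_rat (of_int (- c * int P)) * \<tau> + of_rat 1" for \<tau>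
      using that by (auto simp: f_def power_mult_distrib of_rat_minus of_rat_mult)
  qed auto
  have alpha: "mp_alpha p l = (B, \<lambda>\<tau>\<in>UH. 1)" by (simp add: mp_alpha_def B_def)
  have alpha_c: "mp_alpha p l \<in> carrier mp2_rat"
  proof -
    have "(\<lambda>\<tau>\<in>UH. 1::complex) holomorphic_on UH" by (rule holomorphic_transform[of "\<lambda>_. 1"]) auto
    then show ?thesis using p1 by (auto simp: alpha mp_rat_carrier_iff B_def det_mat2 automorphy_mat2)
  qed
  define X where "X = (\<lambda>\<sigma>. (A, \<phi>) \<otimes>\<^bsub>mp2_rat\<^esub> mp_alpha p l \<otimes>\<^bsub>mp2_rat\<^esub> (A', restrict (\<lambda>\<tau>. \<sigma> * f \<tau>) UH))"
  define \<psi> where "\<psi> = (\<lambda>\<tau>. \<phi> (moebius B (moebius A' \<tau>)) * f \<tau>)"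
  have detA': "det A' > 0" by (simp add: A'_def det_mat2)
  have detB: "det B > 0" using p1 by (simp add: B_def det_mat2)
  have X: "X \<sigma> = (\<beta>, \<lambda>\<tau>\<in>UH. \<sigma> * \<psi> \<tau>)" for \<sigma>
    unfolding X_def alpha mp_mult beta \<psi>_def
    using Im_moebius[OF detA'] by (auto simp: UH_iff intro!: restrict_UH_cong)
  have "X 1 \<in> carrier mp2_rat"
    unfolding X_def using \<gamma> \<gamma>'[of 1] alpha_c by (intro mp_rat_mult_closed) (auto simp: mp_int_carrier_iff)
  then have c1: "(\<lambda>\<tau>\<in>UH. \<psi> \<tau>) holomorphic_on UH" "\<And>\<tau>. \<tau> \<in> UH \<Longrightarrow> (\<psi> \<tau>)\<^sup>2 = automorphy \<beta> \<tau>"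
    unfolding X mp_rat_carrier_iff by auto
  have psi: "\<psi> holomorphic_on UH" by (rule holomorphic_transform[OF c1(1)]) simp
  have psi2: "(\<psi> \<tau>)\<^sup>2 = of_nat Q" if "\<tau> \<in> UH" for \<tau>
    using c1(2)[OF that] by (simp add: \<beta>_def automorphy_mat2)
  define r where "r = real p powr (real s / 2)"
  have "r\<^sup>2 = real p powr (real s)" using p1 by (simp add: r_def powr_powr[symmetric] powr_power)
  then have r2: "r\<^sup>2 = real Q" using p1 by (simp add: powr_realpow Q_def)
  obtain \<sigma> where \<sigma>: "\<sigma> = 1 \<or> \<sigma> = -1" "\<And>\<tau>. \<tau> \<in> UH \<Longrightarrow> complex_of_real r = \<sigma> * \<psi> \<tau>"
  proof (rule mp_sign_unique[of "\<lambda>_. complex_of_real r" \<psi>])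
    show "(complex_of_real r)\<^sup>2 = (\<psi> \<tau>)\<^sup>2" if "\<tau> \<in> UH" for \<tau>
      unfolding psi2[OF that] using r2 by (metis of_real_of_nat_eq of_real_power)
    show "\<psi> \<tau> \<noteq> 0" if "\<tau> \<in> UH" for \<tau> using psi2[OF that] pos by auto
  qed (use psi in auto)
  have "mp_beta p l s h = X \<sigma>"
    unfolding X mp_beta_def using \<sigma>(2) by (auto simp: \<beta>_def P_def Q_def r_def intro!: restrict_ext)
  then show ?thesis using that[OF \<gamma> \<gamma>'[OF \<sigma>(1)]] by (simp add: X_def)
qed

section \<open>The action of \<beta> on the standard basis\<close>

context weil_lattice
begin

text \<open>The Gauss sum is attached to the source class x if s \<le> l and to the target class y
  otherwise, according to which of them is multiplied by a power of p. R stands for residues modulo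
  p^min(s,l); for s > l this is finer than the denominator p^{2l-s} of the phase, and gives both
  cases the same normalisation p^{-sD/2}.\<close>

definition beta_coeff :: "nat \<Rightarrow> nat \<Rightarrow> nat \<Rightarrow> int \<Rightarrow> 'v set \<Rightarrow> 'v set \<Rightarrow> 'v set \<Rightarrow> complex" where
  "beta_coeff p l s h R x y = of_real ((real p powr (- real s / 2)) ^ lattice_rank L) *
     (if s \<le> l then gauss_sum (p ^ s) (- h) R (class_rep x) * basis_elem (x [^]\<^bsub>disc_group L b\<^esub> (p ^ (l - s))) y
      else if y \<in> disc L b then (\<Sum>r\<in>R. e (of_real (of_int (- h) / real (p ^ (2 * l - s)) * q (class_rep y + r))))
        * basis_elem (y [^]\<^bsub>disc_group L b\<^esub> (p ^ (s - l))) x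
      else 0)"

text \<open>The point \<tau> is chosen so that \<beta> maps it to \<i>. There the averaged theta
  vectors are expressed through theta vectors at \<i>, which determine the operator.\<close>

lemma dc_op_basis:
  fixes p l s :: nat and h :: int
  assumes p: "prime p" "odd p" and s: "0 < s" "s < 2 * l" and h: "coprime h (int p)"
    and \<gamma>: "\<gamma> \<in> carrier mp2_int" and \<gamma>': "\<gamma>' \<in> carrier mp2_int"
    and eq: "mp_beta p l s h = \<gamma> \<otimes>\<^bsub>mp2_rat\<^esub> mp_alpha p l \<otimes>\<^bsub>mp2_rat\<^esub> \<gamma>'"
    and R: "transversal L (nL (p ^ min s l)) R" and x: "x \<in> disc L b"
  shows "dc_op p l \<gamma> \<gamma>' (basis_elem x) y = beta_coeff p l s h R x y"
proof (rule lin_op_unique[OF lin_op_dc_op[OF \<gamma> \<gamma>'] x])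
  fix w assume w: "w \<in> Ld"
  define N P Q where "N = p ^ l" and "P = p ^ (2 * l - s)" and "Q = p ^ s"
  have p0: "p > 0" using p(1) by (simp add: prime_gt_0_nat)
  have pos: "N > 0" "P > 0" "Q > 0" using p0 by (auto simp: N_def P_def Q_def)
  obtain RN where RN: "transversal L (nL N) RN" using obtain_transversal_nL[OF pos(1)] by blast
  obtain k d where kd: "coprime k (int p)" "[d = k * h] (mod int (p ^ s))"
    "\<And>\<tau> w. Im \<tau> > 0 \<Longrightarrow> w \<in> Ld \<Longrightarrow>
       dc_op p l \<gamma> \<gamma>' (theta_vec (moebius (fst (mp_beta p l s h)) \<tau>) 0 w) =
       (\<lambda>y. of_real ((real p powr (real s / 2)) ^ lattice_rank L / real (p ^ l) ^ lattice_rank L) *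
         (\<Sum>r\<in>RN. theta_vec \<tau> ((2 * of_int k * real (p ^ (2 * l - s)) / real (p ^ l)) *\<^sub>R r)
                        ((real (p ^ s) / real (p ^ l)) *\<^sub>R w + (2 * of_int d / real (p ^ l)) *\<^sub>R r) y))"
    by (rule dc_op_theta_vec[OF p s \<gamma> \<gamma>' eq RN[unfolded N_def]]) (rule that)
  have "coprime (k * h) (int p)" using kd(1) h by simp
  moreover have "[d = k * h] (mod int p)"
    using kd(2) s(1) by (meson cong_dvd_modulus dvd_power of_nat_dvd_iff)
  ultimately have dp: "coprime d (int p)" by (metis cong_gcd_eq coprime_iff_gcd_eq_1)
  have two: "coprime 2 (int p)" using p(2) by simp
  have kp: "coprime (2 * k) (int (p ^ n))" and dpn: "coprime (2 * d) (int (p ^ n))" for n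
    using kd(1) dp two by auto
  define \<tau> where "\<tau> = (of_nat Q * \<i> - of_int h) / (of_nat P)"
  have \<tau>: "Im \<tau> > 0" using pos by (simp add: \<tau>_def)
  have mob: "moebius (fst (mp_beta p l s h)) \<tau> = \<i>"
    using pos by (simp add: mp_beta_def moebius_mat2 \<tau>_def P_def[symmetric] Q_def[symmetric])
  define D where "D = lattice_rank L"
  define pw where "pw = real p powr (real s / 2)"
  have pwpos: "pw > 0" using p0 by (simp add: pw_def)
  have "pw\<^sup>2 = real p powr (real s)" using p0 by (simp add: pw_def powr_powr[symmetric] powr_power)
  then have pw2: "pw\<^sup>2 = real Q" using p0 by (simp add: powr_realpow Q_def)
  have pwm: "real p powr (- real s / 2) = pw / real Q"
  proof -
    have "real p powr (- real s / 2) = 1 / pw" using p0 by (simp add: pw_def powr_minus_divide)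
    then show ?thesis using pwpos pw2[symmetric] by (simp add: power2_eq_square)
  qed
  have dc: "dc_op p l \<gamma> \<gamma>' (theta_vec \<i> 0 w) y = of_real (pw ^ D / real N ^ D) *
      (\<Sum>r\<in>RN. theta_vec \<tau> ((2 * of_int k * real P / real N) *\<^sub>R r) ((real Q / real N) *\<^sub>R w + (2 * of_int d / real N) *\<^sub>R r) y)"
    using kd(3)[OF \<tau> w] unfolding mob by (simp add: N_def P_def Q_def D_def pw_def)
  show "dc_op p l \<gamma> \<gamma>' (theta_vec \<i> 0 w) y = (\<Sum>x\<in>disc L b. theta_vec \<i> 0 w x * beta_coeff p l s h R x y)"
  proof (cases "y \<in> disc L b")
    case False
    have "beta_coeff p l s h R x y = 0" if "x \<in> disc L b" for x
      using False disc_pow_closed[OF that] by (auto simp: beta_coeff_def basis_elem_def)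
    then show ?thesis using False unfolding dc by (simp add: theta_vec_def)
  next
    case y: True
    have thy: "theta_vec \<tau> u v y = theta \<tau> u v y" for \<tau> u v using y by (simp add: theta_vec_def)
    show ?thesis
    proof (cases "s \<le> l")
      case True
      define m where "m = p ^ (l - s)"
      have m: "m > 0" using p0 by (simp add: m_def)
      have Nm: "N = Q * m" using True by (simp add: N_def Q_def m_def power_add[symmetric])
      have Pm: "P = N * m" using True s by (simp add: N_def P_def m_def power_add[symmetric] mult_2)
      have RQ: "transversal L (nL Q) R" using R True by (simp add: Q_def min_absorb1)
      have \<tau>i: "of_real ((real m)\<^sup>2) * \<tau> + of_real (of_int h / real Q) = \<i>"
        using pos m unfolding \<tau>_def Pm Nm by (simp add: power2_eq_square field_simps)
      have arg: "2 * of_int k * real P / real N = 2 * of_int k * real m" "real Q / real N = 1 / real m"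
        using pos m unfolding Pm Nm by simp_all
      define S2 where "S2 = (\<Sum>x\<in>disc L b. theta \<i> 0 w x * gauss_sum Q (- h) R (class_rep x)
          * basis_elem (x [^]\<^bsub>disc_group L b\<^esub> m) y)"
      have S1: "(\<Sum>r\<in>RN. theta \<tau> ((2 * of_int k * real m) *\<^sub>R r) ((1 / real m) *\<^sub>R w + (2 * of_int d / real N) *\<^sub>R r) y)
        = of_real (real m ^ D) * S2"
        using theta_sum_small[OF pos(3) m _ kd(2)[folded Q_def] _ \<tau> w y RN[unfolded Nm] RQ] kp[of s] dpn[of "l - s"]
        unfolding \<tau>i Nm[symmetric] D_def S2_def by (simp add: Q_def m_def)
      have "dc_op p l \<gamma> \<gamma>' (theta_vec \<i> 0 w) y = of_real (pw ^ D / real N ^ D) *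
          (\<Sum>r\<in>RN. theta \<tau> ((2 * of_int k * real m) *\<^sub>R r) ((1 / real m) *\<^sub>R w + (2 * of_int d / real N) *\<^sub>R r) y)"
        unfolding dc arg by (simp only: thy)
      also have "\<dots> = of_real (pw ^ D / real N ^ D * real m ^ D) * S2"
        unfolding S1 by (simp only: of_real_mult mult.assoc)
      also have "pw ^ D / real N ^ D * real m ^ D = (pw / real Q) ^ D"
        using m by (simp add: Nm power_mult_distrib power_divide)
      also have "of_real ((pw / real Q) ^ D) * S2 = of_real ((pw / real Q) ^ D) *
          (\<Sum>x\<in>disc L b. theta \<i> 0 w x * gauss_sum Q (- h) R (class_rep x) * basis_elem (x [^]\<^bsub>disc_group L b\<^esub> m) y)"
        by (simp only: S2_def)
      also have "\<dots> = (\<Sum>x\<in>disc L b. theta_vec \<i> 0 w x * beta_coeff p l s h R x y)"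
        unfolding sum_distrib_left beta_coeff_def pwm
        by (rule sum.cong) (use True in \<open>auto simp: theta_vec_def D_def Q_def m_def\<close>)
      finally show ?thesis .
    next
      case False
      define m where "m = p ^ (s - l)"
      have m: "m > 0" using p0 by (simp add: m_def)
      have Qm: "Q = N * m" using False by (simp add: N_def Q_def m_def power_add[symmetric])
      have Nm: "N = P * m" using False s by (simp add: N_def P_def m_def power_add[symmetric])
      have RN': "transversal L (nL N) R" using R False by (simp add: N_def min_absorb2)
      have \<tau>i: "of_real (1 / (real m)\<^sup>2) * \<tau> + of_real (of_int h / real (P * m * m)) = \<i>"
        using pos m unfolding \<tau>_def Qm Nm by (simp add: power2_eq_square field_simps)
      have arg: "2 * of_int k * real P / real N = 2 * of_int k / real m" "real Q / real N = real m"
        using pos m unfolding Qm Nm by simp_all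
      define W where "W = (\<Sum>r\<in>R. e (of_real (of_int (- h) / real P * q (class_rep y + r))))"
      have W': "(\<Sum>r\<in>RN. e (of_real (of_int (- h) / real P * q (class_rep y + r)))) = W"
        unfolding W_def
      proof (rule transversal_sum_eq[OF RN' RN nL_subgroup])
        fix v v' assume v: "v \<in> L" "v' \<in> L" "v - v' \<in> nL N"
        then obtain l where "l \<in> L" "v - v' = real P *\<^sub>R (real m *\<^sub>R l)" by (auto simp: Nm)
        then have "v - v' \<in> nL P" using L_scale(2) by blast
        then show "e (of_real (of_int (- h) / real P * q (class_rep y + v))) = e (of_real (of_int (- h) / real P * q (class_rep y + v')))"
          by (rule e_q_periodic[OF class_rep_Ld[OF y] v(1,2) _ pos(2)])
      qed
      have dk': "[d = k * h] (mod int (P * m * m))" using kd(2) by (simp add: Q_def[symmetric] Qm Nm)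
      have "of_real (real m ^ D) * (\<Sum>r\<in>RN. theta \<tau> ((2 * of_int k / real m) *\<^sub>R r) (real m *\<^sub>R w + (2 * of_int d / real N) *\<^sub>R r) y)
        = theta \<i> 0 w (y [^]\<^bsub>disc_group L b\<^esub> m) * W"
      proof -
        have c: "coprime (2 * k) (int P)" "coprime (2 * k) (int m)" unfolding P_def m_def by (rule kp)+
        show ?thesis
          using theta_sum_large[OF pos(2) m c dk' \<tau> w y RN[unfolded Nm], unfolded \<tau>i W', folded Nm D_def] .
      qed
      then have "of_real (pw ^ D / real N ^ D / real m ^ D) * (of_real (real m ^ D) * (\<Sum>r\<in>RN. theta \<tau> ((2 * of_int k / real m) *\<^sub>R r) (real m *\<^sub>R w + (2 * of_int d / real N) *\<^sub>R r) y))
        = of_real (pw ^ D / real N ^ D / real m ^ D) * (theta \<i> 0 w (y [^]\<^bsub>disc_group L b\<^esub> m) * W)" by simp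
      then have "of_real (pw ^ D / real N ^ D) * (\<Sum>r\<in>RN. theta \<tau> ((2 * of_int k / real m) *\<^sub>R r) (real m *\<^sub>R w + (2 * of_int d / real N) *\<^sub>R r) y)
        = of_real (pw ^ D / real N ^ D / real m ^ D) * (theta \<i> 0 w (y [^]\<^bsub>disc_group L b\<^esub> m) * W)"
        using m by (simp add: field_simps)
      moreover have "pw ^ D / real N ^ D / real m ^ D = (pw / real Q) ^ D"
        by (simp add: Qm power_mult_distrib power_divide)
      ultimately have "dc_op p l \<gamma> \<gamma>' (theta_vec \<i> 0 w) y = of_real ((pw / real Q) ^ D) * (theta \<i> 0 w (y [^]\<^bsub>disc_group L b\<^esub> m) * W)"
        unfolding dc arg by (simp only: thy)
      also have "\<dots> = (\<Sum>x\<in>disc L b. if x = y [^]\<^bsub>disc_group L b\<^esub> m then of_real ((pw / real Q) ^ D) * (theta \<i> 0 w x * W) else 0)"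
        using finite_disc disc_pow_closed[OF y] by simp
      also have "\<dots> = (\<Sum>x\<in>disc L b. theta_vec \<i> 0 w x * beta_coeff p l s h R x y)"
        unfolding beta_coeff_def pwm
        by (rule sum.cong) (use False y in \<open>auto simp: theta_vec_def D_def m_def basis_elem_def W_def P_def\<close>)
      finally show ?thesis .
    qed
  qed
qed

text \<open>The definite description is justified by \<open>mp_beta_decomposition\<close> for
  existence and \<open>dc_op_basis\<close> for uniqueness.\<close>

theorem ext_act_beta:
  fixes p l s :: nat and h :: int
  assumes p: "prime p" "odd p" and s: "0 < s" "s < 2 * l" and h: "coprime h (int p)"
    and R: "transversal L (nL (p ^ min s l)) R" and x: "x \<in> disc L b"
  shows "ext_act L b \<rho> p l (mp_beta p l s h) (basis_elem x) = beta_coeff p l s h R x"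
  unfolding ext_act_def dc_op_def[symmetric]
proof (rule the_equality)
  obtain \<gamma> \<gamma>' where g: "\<gamma> \<in> carrier mp2_int" "\<gamma>' \<in> carrier mp2_int"
    "mp_beta p l s h = \<gamma> \<otimes>\<^bsub>mp2_rat\<^esub> mp_alpha p l \<otimes>\<^bsub>mp2_rat\<^esub> \<gamma>'"
    using mp_beta_decomposition[OF p(1) s h] by blast
  then have "dc_op p l \<gamma> \<gamma>' (basis_elem x) = beta_coeff p l s h R x"
    using dc_op_basis[OF p s h g R x] by blast
  then show "\<exists>\<gamma>\<in>carrier mp2_int. \<exists>\<gamma>'\<in>carrier mp2_int. mp_beta p l s h = \<gamma> \<otimes>\<^bsub>mp2_rat\<^esub> mp_alpha p l \<otimes>\<^bsub>mp2_rat\<^esub> \<gamma>' \<and>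
      beta_coeff p l s h R x = dc_op p l \<gamma> \<gamma>' (basis_elem x)"
    using g by metis
next
  fix w assume "\<exists>\<gamma>\<in>carrier mp2_int. \<exists>\<gamma>'\<in>carrier mp2_int. mp_beta p l s h = \<gamma> \<otimes>\<^bsub>mp2_rat\<^esub> mp_alpha p l \<otimes>\<^bsub>mp2_rat\<^esub> \<gamma>' \<and>
      w = dc_op p l \<gamma> \<gamma>' (basis_elem x)"
  then show "w = beta_coeff p l s h R x"
    using dc_op_basis[OF p s h _ _ _ R x] by blast
qed

end

subsection \<open>Ramanujan sums and representation numbers\<close>

lemma moebius_mu_prime_power:
  assumes "prime p"
  shows "moebius_mu (p ^ k) = (if k = 0 then 1 else if k = 1 then -1 else 0)"
proof -
  have "\<not> squarefree (p ^ k)" if "k \<ge> 2"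
    using that assms by (auto simp: squarefree_power_iff)
  moreover have "squarefree p" using assms by (rule squarefree_prime)
  moreover have "card (prime_factors p) = 1" using assms by (simp add: prime_factorization_prime)
  ultimately show ?thesis by (auto simp: moebius_mu_def)
qed

lemma moebius_sum_prime_power:
  fixes g :: "nat \<Rightarrow> real"
  assumes p: "prime p" and s: "s > 0"
  shows "(\<Sum>a | a dvd p ^ s. of_int (moebius_mu (p ^ s div a)) * g a) = g (p ^ s) - g (p ^ (s - 1))"
proof -
  have p1: "p > 1" using p prime_gt_1_nat by blast
  have set: "{a. a dvd p ^ s} = (\<lambda>i. p ^ i) ` {..s}"
    using divides_primepow_nat[OF p] by auto
  have inj: "inj_on (\<lambda>i. p ^ i) {..s}" using p1 by (auto simp: inj_on_def)
  have "(\<Sum>a | a dvd p ^ s. of_int (moebius_mu (p ^ s div a)) * g a) =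
      (\<Sum>i\<le>s. of_int (moebius_mu (p ^ (s - i))) * g (p ^ i))"
    unfolding set sum.reindex[OF inj] using p1 by (intro sum.cong) (auto simp: power_diff)
  also have "\<dots> = (\<Sum>i\<in>{s - 1, s}. of_int (moebius_mu (p ^ (s - i))) * g (p ^ i))"
    by (rule sum.mono_neutral_right) (auto simp: moebius_mu_prime_power[OF p])
  also have "\<dots> = g (p ^ s) - g (p ^ (s - 1))"
    using s by (simp add: moebius_mu_prime_power[OF p])
  finally show ?thesis .
qed

lemma cong_zero_iff: "n > 0 \<Longrightarrow> cong_zero x n \<longleftrightarrow> x / real n \<in> \<int>"
  by (auto simp: cong_zero_def field_simps elim!: Ints_cases)

lemma cong_zero_diff: "cong_zero x n \<Longrightarrow> cong_zero y n \<Longrightarrow> cong_zero (x - y) n"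
  unfolding cong_zero_def by (metis of_int_diff right_diff_distrib)

lemma cong_zero_cong: "cong_zero (x - y) n \<Longrightarrow> cong_zero x n \<longleftrightarrow> cong_zero y n"
  using cong_zero_diff[of x n "x - y"] cong_zero_diff[of "x - y" n "- y"] cong_zero_diff[of 0 n y]
  by (auto simp: cong_zero_def[of 0])

lemma cong_zero_uminus: "cong_zero (- x) n \<longleftrightarrow> cong_zero x n"
  using cong_zero_diff[of 0 n x] cong_zero_diff[of 0 n "- x"] by (auto simp: cong_zero_def[of 0])

lemma sum_roots_of_unity:
  assumes n: "n > 0" and x: "x \<in> \<int>"
  shows "(\<Sum>h\<in>{0<..n}. e (of_real (real h * x / real n))) = (if cong_zero x n then of_nat n else 0)"
proof -
  define z where "z = e (of_real (x / real n))"
  have zp: "e (of_real (real h * x / real n)) = z ^ h" for h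
  proof (induction h)
    case (Suc h)
    have "real (Suc h) * x / real n = x / real n + real h * x / real n" by (simp add: add_divide_distrib distrib_right)
    then have "e (of_real (real (Suc h) * x / real n)) = z * e (of_real (real h * x / real n))"
      by (simp only: of_real_add e_add z_def)
    then show ?case by (simp only: Suc power_Suc)
  qed simp
  have zn: "z ^ n = 1" using zp[of n] n e_int[OF x] by simp
  have img: "{0<..n} = Suc ` {..<n}" by (simp add: image_Suc_lessThan atLeastSucAtMost_greaterThanAtMost[symmetric])
  have "(\<Sum>h\<in>{0<..n}. e (of_real (real h * x / real n))) = z * (\<Sum>h<n. z ^ h)"
    unfolding zp img sum.reindex[OF inj_Suc] by (simp add: o_def sum_distrib_left)
  also have "\<dots> = (if z = 1 then of_nat n else 0)"
    using zn by (simp add: geometric_sum)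
  also have "z = 1 \<longleftrightarrow> cong_zero x n" by (simp only: z_def e_of_real_eq_1_iff cong_zero_iff[OF n])
  finally show ?thesis .
qed

text \<open>The totatives of p^s are all residues except the multiples of p, and the latter
  contribute the full sum modulo p^(s-1).\<close>

lemma ramanujan_sum_prime_power:
  assumes p: "prime p" and s: "s > 0" and x: "x \<in> \<int>"
  shows "(\<Sum>h\<in>totatives (p ^ s). e (of_real (real h * x / real (p ^ s)))) =
    of_real ((if cong_zero x (p ^ s) then real (p ^ s) else 0) - (if cong_zero x (p ^ (s - 1)) then real (p ^ (s - 1)) else 0))"
proof -
  have p0: "p > 0" using p by (simp add: prime_gt_0_nat)
  define q where "q = p ^ (s - 1)"
  have q: "q > 0" "p ^ s = p * q" using p0 power_minus_mult[OF s, of p] by (auto simp: q_def mult.commute)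
  have tot: "totatives (p ^ s) = {0<..p ^ s} - (\<lambda>h. p * h) ` {0<..q}"
  proof -
    have "coprime h (p ^ s) \<longleftrightarrow> \<not> p dvd h" for h
    proof -
      have "coprime p h \<longleftrightarrow> \<not> p dvd h"
        using p prime_imp_coprime[of p h] not_prime_unit[of p] coprime_absorb_left[of p h] by blast
      then show ?thesis using s by (simp add: coprime_power_right_iff coprime_commute)
    qed
    then have "h \<in> totatives (p ^ s) \<longleftrightarrow> h \<in> {0<..p ^ s} \<and> \<not> p dvd h" for h
      by (auto simp: totatives_def)
    moreover have "h \<in> (\<lambda>h. p * h) ` {0<..q} \<longleftrightarrow> h \<in> {0<..p ^ s} \<and> p dvd h" for h
    proof
      assume "h \<in> {0<..p ^ s} \<and> p dvd h"
      moreover from this obtain k where "h = p * k" by (elim conjE dvdE)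
      ultimately show "h \<in> (\<lambda>h. p * h) ` {0<..q}" using p0 by (auto simp: q(2))
    qed (use p0 in \<open>auto simp: q(2)\<close>)
    ultimately show ?thesis by blast
  qed
  have sub: "(\<lambda>h. p * h) ` {0<..q} \<subseteq> {0<..p ^ s}" using p0 by (auto simp: q(2))
  have inj: "inj_on (\<lambda>h. p * h) {0<..q}" using p0 by (auto simp: inj_on_def)
  have "(\<Sum>h\<in>totatives (p ^ s). e (of_real (real h * x / real (p ^ s)))) =
     (\<Sum>h\<in>{0<..p ^ s}. e (of_real (real h * x / real (p ^ s)))) - (\<Sum>h\<in>(\<lambda>h. p * h) ` {0<..q}. e (of_real (real h * x / real (p ^ s))))"
    unfolding tot by (rule sum_diff) (use sub in auto)
  also have "(\<Sum>h\<in>(\<lambda>h. p * h) ` {0<..q}. e (of_real (real h * x / real (p ^ s)))) = (\<Sum>h\<in>{0<..q}. e (of_real (real h * x / real q)))"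
    using p0 by (subst sum.reindex[OF inj]) (simp add: q(2))
  finally show ?thesis
    using sum_roots_of_unity[OF _ x, of "p ^ s"] sum_roots_of_unity[OF q(1) x] p0 by (simp add: q_def)
qed

lemma card_filter_eq_sum:
  assumes "finite A" shows "real (card {x\<in>A. P x}) = (\<Sum>x\<in>A. if P x then 1 else 0)"
  using sum.inter_filter[OF assms, of "\<lambda>_. 1 :: real" P] by simp

section \<open>Sums of Gauss sums as representation numbers\<close>

context framed_lattice
begin

lemma q_shift_cong:
  assumes x: "x \<in> Ld" and vw: "v \<in> L" "w \<in> L" "v - w \<in> nL n"
  shows "cong_zero (q (v + x) - q (w + x)) n"
proof -
  obtain l where l: "l \<in> L" "v = w + real n *\<^sub>R l" using vw(3) by (metis diff_add_cancel add.commute imageE)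
  have "q (v + x) - q (w + x) = real n * (real n * q l + b (x + w) l)"
    using q_add[of "w + x" "real n *\<^sub>R l"]
    unfolding l(2) by (simp add: q_scale bil_simps power2_eq_square algebra_simps)
  moreover have "real n * q l + b (x + w) l \<in> \<int>"
    using q_int[OF l(1)] Ld_b(1)[OF x l(1)] b_int[OF vw(2) l(1)] by (auto simp: bil_simps)
  ultimately show ?thesis by (auto simp: cong_zero_def elim!: Ints_cases)
qed

lemma rep_count_sum:
  assumes \<nu>: "\<nu> \<in> disc L b" and a: "a > 0" and R: "transversal L (nL a) R"
  shows "real (rep_count L b \<nu> m a) = (\<Sum>r\<in>R. if cong_zero (q (r + class_rep \<nu>) - m) a then 1 else 0)"
proof -
  have "real (rep_count L b \<nu> m a) = (\<Sum>v\<in>lattice_mod L a. if cong_zero (q (class_rep v + class_rep \<nu>) - m) a then 1 else 0)"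
    unfolding rep_count_def by (rule card_filter_eq_sum[OF finite_lattice_mod[OF a]])
  also have "\<dots> = (\<Sum>r\<in>R. if cong_zero (q (r + class_rep \<nu>) - m) a then 1 else 0)"
  proof (rule sum_lattice_mod[OF R])
    fix v w assume "v \<in> L" "w \<in> L" "v - w \<in> nL a"
    from q_shift_cong[OF class_rep_Ld[OF \<nu>] this]
    have "cong_zero (q (v + class_rep \<nu>) - m) a \<longleftrightarrow> cong_zero (q (w + class_rep \<nu>) - m) a"
      by (intro cong_zero_cong) simp
    then show "(if cong_zero (q (v + class_rep \<nu>) - m) a then 1 else 0 :: real) = (if cong_zero (q (w + class_rep \<nu>) - m) a then 1 else 0)" by simp
  qed
  finally show ?thesis .
qed

text \<open>Divisibility by p^l makes the gcd in the definition p^l. Moving v by p^l L changes the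
  scaled form by a multiple of p^{2s-l}, which a divides since l \<le> s.\<close>

lemma rep_count_tilde_sum:
  assumes \<nu>: "\<nu> \<in> disc L b" and p: "p > 0" and a: "a dvd p ^ s" "p ^ l dvd a" and sl: "l \<le> s"
    and R: "transversal L (nL (p ^ l)) R"
  shows "real (rep_count_tilde L b p l s \<nu> m a) =
    (\<Sum>r\<in>R. if cong_zero (real p ^ (2 * (s - l)) * q (r + class_rep \<nu>) - m) a then 1 else 0)"
proof -
  have g: "gcd a (p ^ l) = p ^ l" using a(2) by (simp add: gcd_proj2_iff)
  have "real (rep_count_tilde L b p l s \<nu> m a) = (\<Sum>v\<in>lattice_mod L (p ^ l).
      if cong_zero (real p ^ (2 * (s - l)) * q (class_rep v + class_rep \<nu>) - m) a then 1 else 0)"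
    unfolding rep_count_tilde_def g by (rule card_filter_eq_sum[OF finite_lattice_mod]) (use p in simp)
  also have "\<dots> = (\<Sum>r\<in>R. if cong_zero (real p ^ (2 * (s - l)) * q (r + class_rep \<nu>) - m) a then 1 else 0)"
  proof (rule sum_lattice_mod[OF R])
    fix v w assume "v \<in> L" "w \<in> L" "v - w \<in> nL (p ^ l)"
    from q_shift_cong[OF class_rep_Ld[OF \<nu>] this]
    obtain j :: int where j: "q (v + class_rep \<nu>) - q (w + class_rep \<nu>) = real (p ^ l) * of_int j" by (auto simp: cong_zero_def)
    obtain t where t: "p ^ s = a * t" using a(1) by (rule dvdE)
    have "p ^ (2 * (s - l)) * p ^ l = p ^ s * p ^ (s - l)"
    proof -
      have "2 * (s - l) + l = s + (s - l)" using sl by linarith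
      then show ?thesis by (metis power_add)
    qed
    then have "real p ^ (2 * (s - l)) * real (p ^ l) = real a * real (t * p ^ (s - l))"
      unfolding t by (metis mult.assoc of_nat_mult of_nat_power)
    then have "real p ^ (2 * (s - l)) * (real (p ^ l) * of_int j) = real a * of_int (int (t * p ^ (s - l)) * j)"
      by (simp add: mult.assoc[symmetric])
    then have "cong_zero (real p ^ (2 * (s - l)) * (q (v + class_rep \<nu>) - q (w + class_rep \<nu>))) a"
      unfolding j cong_zero_def by blast
    then have "cong_zero (real p ^ (2 * (s - l)) * q (v + class_rep \<nu>) - m) a \<longleftrightarrow> cong_zero (real p ^ (2 * (s - l)) * q (w + class_rep \<nu>) - m) a"
      by (intro cong_zero_cong) (simp add: right_diff_distrib)
    then show "(if cong_zero (real p ^ (2 * (s - l)) * q (v + class_rep \<nu>) - m) a then 1 else 0 :: real) =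
       (if cong_zero (real p ^ (2 * (s - l)) * q (w + class_rep \<nu>) - m) a then 1 else 0)" by simp
  qed
  finally show ?thesis .
qed

text \<open>After the sums are exchanged, each r contributes a Ramanujan sum at the integer n -
  q(\<mu> + r), so solutions are counted modulo p^s and p^(s-1).\<close>

lemma totatives_gauss_sum:
  fixes p s :: nat
  assumes p: "prime p" and s: "s > 0" and \<mu>: "\<mu> \<in> disc L b" and n: "n - qclass b \<mu> \<in> \<int>"
    and R: "transversal L (nL (p ^ s)) R"
  shows "(\<Sum>h\<in>totatives (p ^ s). e (of_real (real h * n / real (p ^ s))) * gauss_sum (p ^ s) (- int h) R (class_rep \<mu>))
    = of_real (real (p ^ s) ^ lattice_rank L * G_sum L b p s \<mu> n)"
proof -
  define D where "D = lattice_rank L"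
  have p0: "p > 0" using p by (simp add: prime_gt_0_nat)
  define Q Q' where "Q = p ^ s" and "Q' = p ^ (s - 1)"
  have Q: "Q > 0" "Q' > 0" "Q = Q' * p" using p0 power_minus_mult[OF s, of p] by (auto simp: Q_def Q'_def)
  obtain R' where R': "transversal L (nL Q') R'" using obtain_transversal_nL[OF Q(2)] by blast
  obtain Rp where Rp: "transversal L (nL p) Rp" using obtain_transversal_nL[OF p0] by blast
  define X where "X = (\<lambda>a r. if cong_zero (q (r + class_rep \<mu>) - n) a then 1 else 0 :: real)"
  have X_per: "X a r = X a r'" if "r \<in> L" "r' \<in> L" "r - r' \<in> nL a" for a r r'
  proof -
    have "cong_zero (q (r + class_rep \<mu>) - n) a \<longleftrightarrow> cong_zero (q (r' + class_rep \<mu>) - n) a"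
      using q_shift_cong[OF class_rep_Ld[OF \<mu>] that] by (intro cong_zero_cong) simp
    then show ?thesis by (simp add: X_def)
  qed
  have int: "n - q (class_rep \<mu> + r) \<in> \<int>" if "r \<in> R" for r
  proof -
    have "q (class_rep \<mu> + r) - q (class_rep \<mu>) \<in> \<int>"
      by (rule q_cong[OF class_rep_Ld[OF \<mu>] transversal_subset[OF R that]])
    from Ints_diff[OF n this] show ?thesis by (simp add: qclass_def)
  qed
  have "(\<Sum>h\<in>totatives Q. e (of_real (real h * n / real Q)) * gauss_sum Q (- int h) R (class_rep \<mu>))
     = (\<Sum>h\<in>totatives Q. \<Sum>r\<in>R. e (of_real (real h * (n - q (class_rep \<mu> + r)) / real Q)))"
    unfolding gauss_sum_def sum_distrib_left e_add[symmetric] of_real_add[symmetric]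
    using Q(1) by (intro sum.cong refl arg_cong[of _ _ "\<lambda>z. e (of_real z)"]) (simp add: field_simps)
  also have "\<dots> = (\<Sum>r\<in>R. \<Sum>h\<in>totatives Q. e (of_real (real h * (n - q (class_rep \<mu> + r)) / real Q)))"
    by (rule sum.swap)
  also have "\<dots> = (\<Sum>r\<in>R. of_real (real Q * X Q r - real Q' * X Q' r))"
  proof (rule sum.cong)
    fix r assume r: "r \<in> R"
    have "cong_zero (n - q (class_rep \<mu> + r)) a \<longleftrightarrow> cong_zero (q (r + class_rep \<mu>) - n) a" for a
      using cong_zero_uminus[of "n - q (class_rep \<mu> + r)" a] by (simp add: add.commute)
    then show "(\<Sum>h\<in>totatives Q. e (of_real (real h * (n - q (class_rep \<mu> + r)) / real Q))) = of_real (real Q * X Q r - real Q' * X Q' r)"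
      using ramanujan_sum_prime_power[OF p s int[OF r]] by (simp add: Q_def Q'_def X_def)
  qed simp
  also have "\<dots> = of_real (real Q * (\<Sum>r\<in>R. X Q r) - real Q' * (\<Sum>r\<in>R. X Q' r))"
    by (simp add: sum_subtractf sum_distrib_left)
  also have "(\<Sum>r\<in>R. X Q r) = real (rep_count L b \<mu> n Q)"
    unfolding X_def by (rule rep_count_sum[OF \<mu> Q(1), symmetric]) (use R in \<open>simp add: Q_def\<close>)
  \<comment> \<open>R covers every residue modulo p^(s-1) exactly p^D times; this is the ratio of
    p^{sD} to the D-th power of p^(s-1) that the weights a^{1-D} require.\<close>
  also have "(\<Sum>r\<in>R. X Q' r) = real p ^ D * real (rep_count L b \<mu> n Q')"
  proof -
    have RQ: "transversal L (nL (Q' * p)) R" using R by (simp only: Q_def[symmetric] Q(3))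
    have "(\<Sum>r\<in>R. X Q' r) = (\<Sum>r\<in>R'. \<Sum>t\<in>Rp. X Q' (r + real Q' *\<^sub>R t))"
    proof (rule transversal_nL_refine[OF R' Rp RQ Q(2)])
      fix v w assume v: "v \<in> L" "w \<in> L" "v - w \<in> nL (Q' * p)"
      then obtain l where "l \<in> L" "v - w = real Q' *\<^sub>R (real p *\<^sub>R l)" by auto
      then have "v - w \<in> nL Q'" using L_scale(2) by blast
      then show "X Q' v = X Q' w" using X_per v by blast
    qed
    also have "\<dots> = (\<Sum>r\<in>R'. \<Sum>t\<in>Rp. X Q' r)"
    proof (intro sum.cong refl X_per)
      fix r t assume "r \<in> R'" "t \<in> Rp"
      then have rt: "r \<in> L" "t \<in> L" using transversal_subset[OF R'] transversal_subset[OF Rp] by auto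
      then show "r \<in> L" "r + real Q' *\<^sub>R t \<in> L" "r + real Q' *\<^sub>R t - r \<in> nL Q'"
        using add_subgroup_add[OF L_subgroup _ L_scale(2)] by auto
    qed
    also have "\<dots> = real (card Rp) * (\<Sum>r\<in>R'. X Q' r)" by (simp add: sum_distrib_left)
    also have "(\<Sum>r\<in>R'. X Q' r) = real (rep_count L b \<mu> n Q')"
      unfolding X_def by (rule rep_count_sum[OF \<mu> Q(2) R', symmetric])
    finally show ?thesis using card_transversal_nL[OF p0 Rp] by (simp add: D_def)
  qed
  also have "real Q * real (rep_count L b \<mu> n Q) - real Q' * (real p ^ D * real (rep_count L b \<mu> n Q'))
      = real Q ^ D * G_sum L b p s \<mu> n"
  proof -
    have pw: "real a ^ D * real a powi (1 - int D) = real a" if "a > 0" for a :: nat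
      using that by (simp add: power_int_diff)
    have "G_sum L b p s \<mu> n = real Q powi (1 - int D) * real (rep_count L b \<mu> n Q)
        - real Q' powi (1 - int D) * real (rep_count L b \<mu> n Q')"
      unfolding G_sum_def mult.assoc moebius_sum_prime_power[OF p s] by (simp add: Q_def Q'_def D_def)
    then have "real Q ^ D * G_sum L b p s \<mu> n = (real Q ^ D * real Q powi (1 - int D)) * real (rep_count L b \<mu> n Q)
        - real p ^ D * (real Q' ^ D * real Q' powi (1 - int D)) * real (rep_count L b \<mu> n Q')"
      by (simp only: right_diff_distrib) (simp add: Q(3) power_mult_distrib)
    then show ?thesis by (simp only: pw[OF Q(1)] pw[OF Q(2)]) simp
  qed
  finally show ?thesis by (simp only: Q_def D_def)
qed

text \<open>The phase q / p^{2l-s} is p^{2(s-l)} q / p^s, so Ramanujan sums modulo p^s apply again.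
  The second claim removes exponents outside p^{2(s-l)}(\<int> + q(y)): for them the congruence
  fails already modulo p^{2(s-l)}.\<close>

lemma totatives_gauss_sum_tilde:
  fixes p l s :: nat
  assumes p: "prime p" and s: "l < s" "s < 2 * l" and y: "y \<in> disc L b"
    and n: "n - real p ^ (2 * (s - l)) * q (class_rep y) \<in> \<int>"
    and R: "transversal L (nL (p ^ l)) R"
  shows "(\<Sum>h\<in>totatives (p ^ s). e (of_real (real h * n / real (p ^ s))) *
      (\<Sum>r\<in>R. e (of_real (of_int (- int h) / real (p ^ (2 * l - s)) * q (class_rep y + r)))))
    = of_real (real (p ^ l) ^ lattice_rank L * G_sum_tilde L b p l s y n)"
    and "\<not> cong_zero (n - real p ^ (2 * (s - l)) * q (class_rep y)) (p ^ (2 * (s - l))) \<Longrightarrow>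
      G_sum_tilde L b p l s y n = 0"
proof -
  define D where "D = lattice_rank L"
  have p0: "p > 0" using p by (simp add: prime_gt_0_nat)
  define Q Q' m2 where "Q = p ^ s" and "Q' = p ^ (s - 1)" and "m2 = p ^ (2 * (s - l))"
  have m2: "m2 > 0" using p0 by (simp add: m2_def)
  have Q: "Q > 0" "Q' > 0" "Q = Q' * p" using p0 s power_minus_mult[of s p] by (auto simp: Q_def Q'_def)
  have QP: "Q = m2 * p ^ (2 * l - s)" 
  proof -
    have "s = 2 * (s - l) + (2 * l - s)" using s by linarith
    then show ?thesis unfolding Q_def m2_def by (metis power_add)
  qed
  \<comment> \<open>The inequality 2(s - l) \<le> s - 1 is s < 2l. Hence also the smaller divisor
    sees the congruence modulo \<open>m2\<close>.\<close>
  have m2Q': "m2 dvd Q'" unfolding m2_def Q'_def by (rule le_imp_power_dvd) (use s in simp)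
  define X where "X = (\<lambda>a r. if cong_zero (real m2 * q (r + class_rep y) - n) a then 1 else 0 :: real)"
  have qint: "q (class_rep y + r) - q (class_rep y) \<in> \<int>" if "r \<in> R" for r
    by (rule q_cong[OF class_rep_Ld[OF y] transversal_subset[OF R that]])
  have int: "n - real m2 * q (class_rep y + r) \<in> \<int>" if "r \<in> R" for r
  proof -
    have "real m2 * (q (class_rep y + r) - q (class_rep y)) \<in> \<int>" by (rule Ints_mult[OF _ qint[OF that]]) simp
    from Ints_diff[OF n this] show ?thesis by (simp add: m2_def right_diff_distrib)
  qed
  have cnt: "real (rep_count_tilde L b p l s y n a) = (\<Sum>r\<in>R. X a r)" if "a = Q \<or> a = Q'" for a
  proof -
    have "a dvd p ^ s" "p ^ l dvd a"
      using that s by (auto simp: Q_def Q'_def intro!: le_imp_power_dvd)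
    from rep_count_tilde_sum[OF y p0 this less_imp_le[OF s(1)] R] show ?thesis by (simp add: X_def m2_def)
  qed
  have gcd: "gcd a (p ^ l) = p ^ l" if "a = Q \<or> a = Q'" for a
  proof -
    have "p ^ l dvd a" using that s by (auto simp: Q_def Q'_def intro!: le_imp_power_dvd)
    then show ?thesis by (simp add: gcd_proj2_iff)
  qed
  have pD: "real (p ^ l) ^ D * real (p ^ l) powi (- int D) = 1"
    using p0 by (simp add: power_int_minus)
  have "G_sum_tilde L b p l s y n = real Q * (real (p ^ l) powi (- int D) * real (rep_count_tilde L b p l s y n Q))
      - real Q' * (real (p ^ l) powi (- int D) * real (rep_count_tilde L b p l s y n Q'))"
    unfolding G_sum_tilde_def mult.assoc
    by (subst moebius_sum_prime_power[OF p]) (use s gcd[of Q] gcd[of Q'] in \<open>auto simp: Q_def Q'_def D_def\<close>)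
  then have G: "G_sum_tilde L b p l s y n = real (p ^ l) powi (- int D) * (real Q * (\<Sum>r\<in>R. X Q r) - real Q' * (\<Sum>r\<in>R. X Q' r))"
    using cnt[of Q] cnt[of Q'] by (simp add: right_diff_distrib mult_ac)
  show "G_sum_tilde L b p l s y n = 0" if nc: "\<not> cong_zero (n - real p ^ (2 * (s - l)) * q (class_rep y)) (p ^ (2 * (s - l)))"
  proof -
    have "X a r = 0" if a: "m2 dvd a" and r: "r \<in> R" for a r
    proof (rule ccontr)
      assume "X a r \<noteq> 0"
      then obtain j :: int where "real m2 * q (r + class_rep y) - n = real a * of_int j" by (auto simp: X_def cong_zero_def split: if_splits)
      moreover obtain t where "a = m2 * t" using a by (rule dvdE)
      moreover obtain i where "q (class_rep y + r) - q (class_rep y) = of_int i" using qint[OF r] by (auto elim: Ints_cases)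
      ultimately have "n - real m2 * q (class_rep y) = real m2 * of_int (i - int t * j)"
        by (simp add: algebra_simps)
      then have "cong_zero (n - real m2 * q (class_rep y)) m2" unfolding cong_zero_def by blast
      then show False using nc by (simp add: m2_def)
    qed
    moreover have "m2 dvd Q" using QP by simp
    ultimately show ?thesis unfolding G using m2Q' by simp
  qed
  have "(\<Sum>h\<in>totatives Q. e (of_real (real h * n / real Q)) * (\<Sum>r\<in>R. e (of_real (of_int (- int h) / real (p ^ (2 * l - s)) * q (class_rep y + r)))))
     = (\<Sum>h\<in>totatives Q. \<Sum>r\<in>R. e (of_real (real h * (n - real m2 * q (class_rep y + r)) / real Q)))"
    unfolding sum_distrib_left e_add[symmetric] of_real_add[symmetric]
    using m2 p0 by (intro sum.cong refl arg_cong[of _ _ "\<lambda>z. e (of_real z)"]) (simp add: QP field_simps)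
  also have "\<dots> = (\<Sum>r\<in>R. \<Sum>h\<in>totatives Q. e (of_real (real h * (n - real m2 * q (class_rep y + r)) / real Q)))"
    by (rule sum.swap)
  also have "\<dots> = (\<Sum>r\<in>R. of_real (real Q * X Q r - real Q' * X Q' r))"
  proof (rule sum.cong)
    fix r assume r: "r \<in> R"
    have "cong_zero (n - real m2 * q (class_rep y + r)) a \<longleftrightarrow> cong_zero (real m2 * q (r + class_rep y) - n) a" for a
      using cong_zero_uminus[of "n - real m2 * q (class_rep y + r)" a] by (simp add: add.commute)
    then show "(\<Sum>h\<in>totatives Q. e (of_real (real h * (n - real m2 * q (class_rep y + r)) / real Q))) = of_real (real Q * X Q r - real Q' * X Q' r)"
      using ramanujan_sum_prime_power[OF p _ int[OF r], of s] s by (simp add: Q_def Q'_def X_def)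
  qed simp
  also have "\<dots> = of_real (real Q * (\<Sum>r\<in>R. X Q r) - real Q' * (\<Sum>r\<in>R. X Q' r))"
    by (simp add: sum_subtractf sum_distrib_left)
  also have "real Q * (\<Sum>r\<in>R. X Q r) - real Q' * (\<Sum>r\<in>R. X Q' r) = real (p ^ l) ^ D * G_sum_tilde L b p l s y n"
    unfolding G mult.assoc[symmetric] pD by simp
  finally show "(\<Sum>h\<in>totatives (p ^ s). e (of_real (real h * n / real (p ^ s))) *
      (\<Sum>r\<in>R. e (of_real (of_int (- int h) / real (p ^ (2 * l - s)) * q (class_rep y + r)))))
    = of_real (real (p ^ l) ^ lattice_rank L * G_sum_tilde L b p l s y n)"
    by (simp only: Q_def D_def)
qed

end

subsection \<open>Fourier expansions\<close>

text \<open>The point z = 0 is excluded because e(\<tau>) never vanishes. Once the lower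
  coefficients are known to be zero, division by z^n and continuity at 0 give the next one.\<close>

lemma powser_zero_coefficients:
  fixes a :: "nat \<Rightarrow> complex"
  assumes "\<And>z. 0 < norm z \<Longrightarrow> norm z < 1 \<Longrightarrow> (\<lambda>n. a n * z ^ n) sums 0"
  shows "a n = 0"
proof (induction n rule: less_induct)
  case (less n)
  define b where "b = (\<lambda>j. a (j + n))"
  have sb: "(\<lambda>j. b j * z ^ j) sums 0" if z: "0 < norm z" "norm z < 1" for z
  proof -
    have "(\<lambda>j. a (j + n) * z ^ (j + n)) sums (0 - (\<Sum>i<n. a i * z ^ i))"
      using sums_split_initial_segment[OF assms[OF z], of n] by simp
    then have "(\<lambda>j. a (j + n) * z ^ (j + n)) sums 0" using less by simp
    then have "(\<lambda>j. (a (j + n) * z ^ (j + n)) / z ^ n) sums (0 / z ^ n)" by (rule sums_divide)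
    then show ?thesis using z by (simp add: b_def power_add)
  qed
  have "summable (\<lambda>j. b j * (1 / 2 :: complex) ^ j)" using sb[of "1 / 2"] by (simp add: sums_iff norm_divide)
  then have "isCont (\<lambda>z. \<Sum>j. b j * z ^ j) 0" by (rule isCont_powser) (simp add: norm_divide)
  then have "((\<lambda>z. \<Sum>j. b j * z ^ j) \<longlongrightarrow> b 0) (at 0)" by (simp add: isCont_def)
  moreover have "((\<lambda>z. \<Sum>j. b j * z ^ j) \<longlongrightarrow> 0) (at 0)"
  proof (rule tendsto_eventually)
    have "\<forall>\<^sub>F z in at (0::complex). z \<in> ball 0 1 - {0}"
      by (rule eventually_at_in_open) auto
    then show "\<forall>\<^sub>F z in at (0::complex). (\<Sum>j. b j * z ^ j) = 0"
    proof eventually_elim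
      case (elim z)
      then show ?case using sb[of z] by (simp add: sums_iff)
    qed
  qed
  ultimately have "b 0 = 0" by (intro LIM_unique)
  then show ?case by (simp add: b_def)
qed

lemma fourier_coefficients_unique:
  fixes d :: "real \<Rightarrow> complex" and \<theta> :: real
  assumes sum: "\<And>\<tau>. \<tau> \<in> UH \<Longrightarrow> ((\<lambda>n. d n * e (of_real n * \<tau>)) has_sum 0) {n. n - \<theta> \<in> \<int> \<and> n \<ge> 0}"
    and n: "n - \<theta> \<in> \<int>" "n \<ge> 0"
  shows "d n = 0"
proof -
  \<comment> \<open>The exponents are r, r + 1, r + 2, ...; taking out e(r \<tau>) leaves a power
    series in e(\<tau>).\<close>
  define r where "r = frac \<theta>"
  have r: "0 \<le> r" "r < 1" by (auto simp: r_def frac_lt_1)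
  have int: "m - \<theta> \<in> \<int> \<longleftrightarrow> m - r \<in> \<int>" for m
  proof -
    have "m - r = (m - \<theta>) + of_int \<lfloor>\<theta>\<rfloor>" by (simp add: r_def frac_def)
    then show ?thesis by (metis Ints_add Ints_of_int Ints_diff add_diff_cancel_right')
  qed
  have idx: "m - \<theta> \<in> \<int> \<and> m \<ge> 0 \<longleftrightarrow> (\<exists>j::nat. m = r + real j)" for m
  proof
    assume "m - \<theta> \<in> \<int> \<and> m \<ge> 0"
    then obtain i :: int where i: "m - r = of_int i" "m \<ge> 0" unfolding int by (auto elim: Ints_cases)
    then have "i > -1" using r by linarith
    then have "m = r + real (nat i)" using i by simp
    then show "\<exists>j::nat. m = r + real j" ..
  next
    assume "\<exists>j::nat. m = r + real j"
    then obtain j :: nat where j: "m = r + real j" ..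
    have "m - r \<in> \<int>" unfolding j by simp
    then have "m - \<theta> \<in> \<int>" using int[of m] by blast
    moreover have "m \<ge> 0" unfolding j using r(1) by simp
    ultimately show "m - \<theta> \<in> \<int> \<and> m \<ge> 0" ..
  qed
  have set: "{m. m - \<theta> \<in> \<int> \<and> m \<ge> 0} = (\<lambda>j. r + real j) ` UNIV" using idx by auto
  have inj: "inj_on (\<lambda>j. r + real j) UNIV" by (auto simp: inj_on_def)
  have "d (r + real j) = 0" for j
  proof (rule powser_zero_coefficients[of "\<lambda>j. d (r + real j)"])
    fix z :: complex assume z: "0 < norm z" "norm z < 1"
    \<comment> \<open>A logarithm of z; it lies in the upper half plane because norm z < 1.\<close>
    define \<tau> where "\<tau> = Ln z / (2 * of_real pi * \<i>)"
    have ez: "e \<tau> = z" using z by (simp add: e_def \<tau>_def)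
    have "ln (norm z) / (2 * pi) < 0" using z by (intro divide_neg_pos) auto
    then have \<tau>: "\<tau> \<in> UH" using z by (simp add: UH_iff \<tau>_def Im_divide power2_eq_square)
    have "((\<lambda>j. d (r + real j) * e (of_real (r + real j) * \<tau>)) has_sum 0) UNIV"
      using sum[OF \<tau>] unfolding set by (subst (asm) has_sum_reindex[OF inj]) (simp add: o_def)
    then have "((\<lambda>j. inverse (e (of_real r * \<tau>)) * (d (r + real j) * e (of_real (r + real j) * \<tau>))) has_sum inverse (e (of_real r * \<tau>)) * 0) UNIV"
      by (rule has_sum_cmult_right)
    moreover have "inverse (e (of_real r * \<tau>)) * (d (r + real j) * e (of_real (r + real j) * \<tau>)) = d (r + real j) * z ^ j" for j
    proof -
      have "e (of_nat j * \<tau>) = z ^ j"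
        unfolding ez[symmetric] e_def by (simp add: exp_of_nat_mult[symmetric] mult_ac)
      then show ?thesis by (simp add: distrib_right e_add)
    qed
    ultimately have "((\<lambda>j. d (r + real j) * z ^ j) has_sum 0) UNIV" by (simp only: mult_zero_right)
    then show "(\<lambda>j. d (r + real j) * z ^ j) sums 0" by (rule has_sum_imp_sums)
  qed
  then show ?thesis using idx[of n] n by auto
qed

lemma fourier_expansion_unique:
  assumes "fourier_expansion L b f c" "fourier_expansion L b f c'"
    and x: "x \<in> disc L b" and n: "n \<in> in_index b x" "n \<ge> 0"
  shows "c x n = c' x n"
proof -
  have "c x n - c' x n = 0"
  proof (rule fourier_coefficients_unique[where \<theta> = "qclass b x"])
    fix \<tau> assume "\<tau> \<in> UH"
    then have "((\<lambda>n. c x n * e (of_real n * \<tau>)) has_sum f \<tau> x) {n \<in> in_index b x. n \<ge> 0}"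
      "((\<lambda>n. c' x n * e (of_real n * \<tau>)) has_sum f \<tau> x) {n \<in> in_index b x. n \<ge> 0}"
      using assms x by (auto simp: fourier_expansion_def)
    from has_sum_add[OF this(1) has_sum_cmult_right[OF this(2), of "- 1"]]
    show "((\<lambda>n. (c x n - c' x n) * e (of_real n * \<tau>)) has_sum 0) {n. n - qclass b x \<in> \<int> \<and> n \<ge> 0}"
      by (simp add: in_index_def left_diff_distrib)
  qed (use n in \<open>auto simp: in_index_def\<close>)
  then show ?thesis by simp
qed

lemma has_sum_sum_finite:
  fixes f :: "'i \<Rightarrow> 'j \<Rightarrow> complex"
  assumes "finite I" "\<And>i. i \<in> I \<Longrightarrow> (f i has_sum S i) A"
  shows "((\<lambda>x. \<Sum>i\<in>I. f i x) has_sum (\<Sum>i\<in>I. S i)) A"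
  using assms by (induction I rule: finite_induct) (auto intro: has_sum_add)

text \<open>The factor p^{-sD/2} is the normalisation in \<open>beta_coeff\<close>, and p^{sD} comes
  from \<open>totatives_gauss_sum\<close>.\<close>

lemma K_const_eq:
  assumes "p > 0"
  shows "K_const D k p l s = real p powr (2 * real l * (k - 1)) * real p powr (- real s * k) *
     (real p powr (- real s / 2)) ^ D * real (p ^ s) ^ D"
proof -
  have 1: "(real p powr (- real s / 2)) ^ D = real p powr (- real s / 2 * real D)"
    using assms by (simp add: powr_power mult.commute)
  have 2: "real (p ^ s) ^ D = real p powr (real s * real D)"
    using powr_realpow[of "real p" "s * D"] assms by (simp add: power_mult)
  show ?thesis unfolding K_const_def 1 2 powr_add[symmetric] by (simp add: algebra_simps)
qed

text \<open>Here p^{-sD/2} meets the factor p^{lD} of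
  \<open>totatives_gauss_sum_tilde\<close>.\<close>

lemma K_const_tilde_eq:
  assumes "p > 0"
  shows "K_const_tilde D k p l s = real p powr (2 * real l * (k - 1)) * real p powr (- real s * k) *
     (real p powr (- real s / 2)) ^ D * real (p ^ l) ^ D"
proof -
  have 1: "(real p powr (- real s / 2)) ^ D = real p powr (- real s / 2 * real D)"
    using assms by (simp add: powr_power mult.commute)
  have 2: "real (p ^ l) ^ D = real p powr (real l * real D)"
    using powr_realpow[of "real p" "l * D"] assms by (simp add: power_mult)
  show ?thesis unfolding K_const_tilde_def 1 2 powr_add[symmetric]
    by (rule arg_cong[of _ _ "\<lambda>x. real p powr x"]) (simp add: field_simps)
qed

lemma n_shift_eq: "m > 0 \<Longrightarrow> n_shift b m \<mu> n = n / (real m)\<^sup>2"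
  by (simp add: n_shift_def field_simps)

section \<open>Fourier expansion of the contribution of \<beta>\<close>

context weil_lattice
begin

lemma qclass_pow:
  assumes "x \<in> disc L b"
  shows "(real m)\<^sup>2 * qclass b x - qclass b (x [^]\<^bsub>disc_group L b\<^esub> (m::nat)) \<in> \<int>"
proof -
  have "x [^]\<^bsub>disc_group L b\<^esub> m = cls (real m *\<^sub>R class_rep x)"
    using disc_pow[of "class_rep x" m] cls_class_rep[OF assms] by simp
  then have "real m *\<^sub>R class_rep x \<in> x [^]\<^bsub>disc_group L b\<^esub> m" by (simp add: cls_self)
  then have "qclass b (x [^]\<^bsub>disc_group L b\<^esub> m) - q (real m *\<^sub>R class_rep x) \<in> \<int>"
    by (rule qclass_cong[OF disc_pow_closed[OF assms]])
  then have "- (qclass b (x [^]\<^bsub>disc_group L b\<^esub> m) - (real m)\<^sup>2 * qclass b x) \<in> \<int>"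
    unfolding q_scale qclass_def by (rule Ints_minus)
  then show ?thesis by simp
qed

text \<open>With m = p^{l-s}, \<beta> sends \<tau> to m^2 \<tau> + h / p^s. An exponent n of f
  becomes m^2 n with a root of unity depending on h, and the sum of these against the Gauss sums is
  \<open>G_sum\<close>. All \<mu> with m \<mu> = y contribute to y.\<close>

lemma hecke_beta_sum_expansion_small:
  fixes p l s :: nat and k :: real
  assumes p: "prime p" "odd p" and s: "0 < s" "s < 2 * l" "s \<le> l"
    and fe: "fourier_expansion L b f c"
  shows "fourier_expansion L b (hecke_beta_sum L b \<rho> k p l s f)
    (\<lambda>y n. of_real (K_const (lattice_rank L) k p l s) *
      (\<Sum>\<mu> | \<mu> \<in> disc L b \<and> \<mu> [^]\<^bsub>disc_group L b\<^esub> (p ^ (l - s)) = y \<and>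
         cong_zero (n - real p ^ (2 * (l - s)) * qclass b \<mu>) (p ^ (2 * (l - s))).
        c \<mu> (n_shift b (p ^ (l - s)) \<mu> n) * of_real (G_sum L b p s \<mu> (n_shift b (p ^ (l - s)) \<mu> n))))"
  unfolding fourier_expansion_def
proof (intro ballI)
  fix \<tau> y assume \<tau>: "\<tau> \<in> UH" and y: "y \<in> disc L b"
  define D where "D = lattice_rank L"
  have p0: "p > 0" using p(1) by (simp add: prime_gt_0_nat)
  define Q m m2 where "Q = p ^ s" and "m = p ^ (l - s)" and "m2 = (real m)\<^sup>2"
  have pos: "Q > 0" "m > 0" "m2 > 0" using p0 by (auto simp: Q_def m_def m2_def)
  have m2: "m2 = real p ^ (2 * (l - s))" by (simp add: m2_def m_def power_mult[symmetric] mult.commute)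
  have m2n: "m2 = real (p ^ (2 * (l - s)))" by (simp add: m2)
  have P: "p ^ (2 * l - s) = Q * m * m"
  proof -
    have "2 * l - s = s + (l - s) + (l - s)" using s by linarith
    then show ?thesis unfolding Q_def m_def by (metis power_add)
  qed
  obtain R where R: "transversal L (nL Q) R" using obtain_transversal_nL[OF pos(1)] by blast
  have R': "transversal L (nL (p ^ min s l)) R" using R s by (simp add: Q_def min_absorb1)
  define Y where "Y = {\<mu> \<in> disc L b. \<mu> [^]\<^bsub>disc_group L b\<^esub> m = y}"
  have finY: "finite Y" using finite_disc by (simp add: Y_def)
  define I where "I = {n \<in> in_index b y. n \<ge> 0}"
  \<comment> \<open>Tells whether n / m^2 is an exponent at \<mu>. The other n get coefficient 0, so
    all \<mu> above y share the index set of y.\<close>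
  define cz where "cz = (\<lambda>\<mu> n. cong_zero (n - m2 * qclass b \<mu>) (p ^ (2 * (l - s))))"
  define \<sigma> where "\<sigma> = (\<lambda>h::nat. (of_nat (p ^ (2 * l - s)) * \<tau> + of_int (int h)) / of_nat (p ^ s))"
  have \<sigma>_eq: "(of_nat (p ^ (2 * l - s)) * \<tau> + of_int (int h)) / of_nat (p ^ s) = \<sigma> h" for h
    by (simp only: \<sigma>_def)
  have \<sigma>: "\<sigma> h = of_real m2 * \<tau> + of_real (real h / real Q)" for h
    using pos unfolding \<sigma>_def P Q_def[symmetric] by (simp add: m2_def power2_eq_square add_divide_distrib)
  have \<sigma>UH: "\<sigma> h \<in> UH" for h using \<tau> pos unfolding \<sigma> by (simp add: UH_iff)
  define \<kappa> where "\<kappa> = complex_of_real (real p powr (2 * real l * (k - 1)) * real p powr (- real s * k)) *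
     of_real ((real p powr (- real s / 2)) ^ D)"
  have hecke: "hecke_beta_sum L b \<rho> k p l s f \<tau> y = (\<Sum>h\<in>totatives Q. \<Sum>\<mu>\<in>Y. \<kappa> * gauss_sum Q (- int h) R (class_rep \<mu>) * f (\<sigma> h) \<mu>)"
    unfolding hecke_beta_sum_def Q_def[symmetric]
  proof (rule sum.cong)
    fix h assume "h \<in> totatives Q"
    then have "coprime h (p ^ s)" by (simp add: totatives_def Q_def)
    then have h: "coprime (int h) (int p)" using s(1) by (simp add: coprime_power_right_iff)
    have "(\<Sum>x\<in>disc L b. f (\<sigma> h) x * ext_act L b \<rho> p l (mp_beta p l s (int h)) (basis_elem x) y)
      = (\<Sum>x\<in>disc L b. if x [^]\<^bsub>disc_group L b\<^esub> m = y then of_real ((real p powr (- real s / 2)) ^ D) * gauss_sum Q (- int h) R (class_rep x) * f (\<sigma> h) x else 0)"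
    proof (rule sum.cong)
      fix x assume x: "x \<in> disc L b"
      show "f (\<sigma> h) x * ext_act L b \<rho> p l (mp_beta p l s (int h)) (basis_elem x) y =
        (if x [^]\<^bsub>disc_group L b\<^esub> m = y then of_real ((real p powr (- real s / 2)) ^ D) * gauss_sum Q (- int h) R (class_rep x) * f (\<sigma> h) x else 0)"
        unfolding ext_act_beta[OF p s(1,2) h R' x] beta_coeff_def
        using s(3) by (auto simp: basis_elem_def Q_def[symmetric] m_def D_def simp del: of_real_power)
    qed simp
    also have "\<dots> = (\<Sum>x\<in>Y. of_real ((real p powr (- real s / 2)) ^ D) * gauss_sum Q (- int h) R (class_rep x) * f (\<sigma> h) x)"
      unfolding Y_def using finite_disc by (rule sum.inter_filter[symmetric])
    finally have inner: "(\<Sum>x\<in>disc L b. f (\<sigma> h) x * ext_act L b \<rho> p l (mp_beta p l s (int h)) (basis_elem x) y) = (\<Sum>x\<in>Y. of_real ((real p powr (- real s / 2)) ^ D) * gauss_sum Q (- int h) R (class_rep x) * f (\<sigma> h) x)" .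
    show "hecke_g L b \<rho> k p l s f (int h) \<tau> y = (\<Sum>\<mu>\<in>Y. \<kappa> * gauss_sum Q (- int h) R (class_rep \<mu>) * f (\<sigma> h) \<mu>)"
      unfolding hecke_g_def \<sigma>_eq inner \<kappa>_def by (simp only: sum_distrib_left mult.assoc)
  qed simp
  have hs: "((\<lambda>n. if cz \<mu> n then c \<mu> (n / m2) * e (of_real n * \<tau>) * e (of_real (real h * (n / m2) / real Q)) else 0) has_sum f (\<sigma> h) \<mu>) I"
    if \<mu>: "\<mu> \<in> Y" for \<mu> h
  proof -
    have \<mu>d: "\<mu> \<in> disc L b" and \<mu>y: "\<mu> [^]\<^bsub>disc_group L b\<^esub> m = y" using \<mu> by (auto simp: Y_def)
    \<comment> \<open>Modulo the integers m^2 q(\<mu>) is q(m \<mu>), so scaling by m^2 maps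
      exponents at \<mu> to exponents at y.\<close>
    have qq: "m2 * qclass b \<mu> - qclass b y \<in> \<int>" using qclass_pow[OF \<mu>d, of m] by (simp add: \<mu>y m2_def)
    have "((\<lambda>n. c \<mu> n * e (of_real n * \<sigma> h)) has_sum f (\<sigma> h) \<mu>) {n \<in> in_index b \<mu>. n \<ge> 0}"
      using fe \<mu>d \<sigma>UH by (auto simp: fourier_expansion_def)
    also have "?this \<longleftrightarrow> ((\<lambda>n. c \<mu> (n / m2) * e (of_real n * \<tau>) * e (of_real (real h * (n / m2) / real Q))) has_sum f (\<sigma> h) \<mu>) {n \<in> I. cz \<mu> n}"
    proof (rule has_sum_reindex_bij_witness[of _ "\<lambda>n. n / m2" "\<lambda>n. m2 * n"])
      fix n assume n: "n \<in> {n \<in> in_index b \<mu>. n \<ge> 0}"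
      then obtain j where j: "n - qclass b \<mu> = of_int j" by (auto simp: in_index_def elim: Ints_cases)
      have 1: "m2 * n - m2 * qclass b \<mu> = real (p ^ (2 * (l - s))) * of_int j"
        using arg_cong[OF j, of "\<lambda>z. m2 * z"] by (simp add: right_diff_distrib m2)
      have "m2 * n - qclass b y = real (p ^ (2 * (l - s))) * of_int j + (m2 * qclass b \<mu> - qclass b y)"
        using 1 by simp
      also have "\<dots> \<in> \<int>" using qq by (intro Ints_add Ints_mult) auto
      finally show "m2 * n \<in> {n \<in> I. cz \<mu> n}"
        using n pos 1 unfolding I_def cz_def cong_zero_def in_index_def by auto
      show "m2 * n / m2 = n" using pos by simp
      have "e (of_real n * \<sigma> h) = e (of_real (m2 * n) * \<tau>) * e (of_real (real h * n / real Q))"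
        unfolding \<sigma> e_add[symmetric] by (simp add: algebra_simps)
      then show "c \<mu> (m2 * n / m2) * e (of_real (m2 * n) * \<tau>) * e (of_real (real h * (m2 * n / m2) / real Q)) = c \<mu> n * e (of_real n * \<sigma> h)"
        using pos by simp
    next
      fix n assume n: "n \<in> {n \<in> I. cz \<mu> n}"
      then obtain j :: int where j: "n - m2 * qclass b \<mu> = m2 * of_int j" unfolding m2n by (auto simp: cz_def cong_zero_def m2n)
      then have "n / m2 - qclass b \<mu> = of_int j" using pos by (simp add: field_simps)
      then show "n / m2 \<in> {n \<in> in_index b \<mu>. n \<ge> 0}" using n pos by (auto simp: in_index_def I_def)
      show "m2 * (n / m2) = n" using pos by simp
    qed simp
    finally show ?thesis
      by (rule has_sum_cong_neutral[THEN iffD1, rotated -1]) auto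
  qed
  have "((\<lambda>n. \<Sum>h\<in>totatives Q. \<Sum>\<mu>\<in>Y. \<kappa> * gauss_sum Q (- int h) R (class_rep \<mu>) *
      (if cz \<mu> n then c \<mu> (n / m2) * e (of_real n * \<tau>) * e (of_real (real h * (n / m2) / real Q)) else 0)) has_sum hecke_beta_sum L b \<rho> k p l s f \<tau> y) I"
    unfolding hecke by (intro has_sum_sum_finite has_sum_cmult_right hs finY) simp
  also have "?this \<longleftrightarrow> ((\<lambda>n. of_real (K_const D k p l s) *
      (\<Sum>\<mu> | \<mu> \<in> disc L b \<and> \<mu> [^]\<^bsub>disc_group L b\<^esub> m = y \<and> cz \<mu> n. c \<mu> (n / m2) * of_real (G_sum L b p s \<mu> (n / m2))) * e (of_real n * \<tau>)) has_sum hecke_beta_sum L b \<rho> k p l s f \<tau> y) I"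
  proof (rule has_sum_cong)
    fix n
    have "(\<Sum>h\<in>totatives Q. \<Sum>\<mu>\<in>Y. \<kappa> * gauss_sum Q (- int h) R (class_rep \<mu>) *
        (if cz \<mu> n then c \<mu> (n / m2) * e (of_real n * \<tau>) * e (of_real (real h * (n / m2) / real Q)) else 0))
      = (\<Sum>\<mu>\<in>Y. \<Sum>h\<in>totatives Q. \<kappa> * gauss_sum Q (- int h) R (class_rep \<mu>) *
        (if cz \<mu> n then c \<mu> (n / m2) * e (of_real n * \<tau>) * e (of_real (real h * (n / m2) / real Q)) else 0))"
      by (rule sum.swap)
    also have "\<dots> = (\<Sum>\<mu>\<in>Y. if cz \<mu> n then of_real (K_const D k p l s) * (c \<mu> (n / m2) * of_real (G_sum L b p s \<mu> (n / m2))) * e (of_real n * \<tau>) else 0)"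
    proof (rule sum.cong)
      fix \<mu> assume \<mu>: "\<mu> \<in> Y"
      show "(\<Sum>h\<in>totatives Q. \<kappa> * gauss_sum Q (- int h) R (class_rep \<mu>) *
        (if cz \<mu> n then c \<mu> (n / m2) * e (of_real n * \<tau>) * e (of_real (real h * (n / m2) / real Q)) else 0)) =
        (if cz \<mu> n then of_real (K_const D k p l s) * (c \<mu> (n / m2) * of_real (G_sum L b p s \<mu> (n / m2))) * e (of_real n * \<tau>) else 0)"
      proof (cases "cz \<mu> n")
        case True
        then obtain j :: int where j: "n - m2 * qclass b \<mu> = m2 * of_int j" unfolding m2n by (auto simp: cz_def cong_zero_def m2n)
        then have "n / m2 - qclass b \<mu> = of_int j" using pos by (simp add: field_simps)
        then have int: "n / m2 - qclass b \<mu> \<in> \<int>" by simp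
        have \<mu>d: "\<mu> \<in> disc L b" using \<mu> by (simp add: Y_def)
        have "(\<Sum>h\<in>totatives Q. \<kappa> * gauss_sum Q (- int h) R (class_rep \<mu>) * (c \<mu> (n / m2) * e (of_real n * \<tau>) * e (of_real (real h * (n / m2) / real Q))))
          = \<kappa> * c \<mu> (n / m2) * e (of_real n * \<tau>) * (\<Sum>h\<in>totatives Q. e (of_real (real h * (n / m2) / real Q)) * gauss_sum Q (- int h) R (class_rep \<mu>))"
          unfolding sum_distrib_left by (rule sum.cong) (simp_all only: mult_ac)
        also have "(\<Sum>h\<in>totatives Q. e (of_real (real h * (n / m2) / real Q)) * gauss_sum Q (- int h) R (class_rep \<mu>)) = of_real (real Q ^ D * G_sum L b p s \<mu> (n / m2))"
          using totatives_gauss_sum[OF p(1) s(1) \<mu>d int R[unfolded Q_def]] by (simp only: Q_def D_def)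
        finally have *: "(\<Sum>h\<in>totatives Q. \<kappa> * gauss_sum Q (- int h) R (class_rep \<mu>) * (c \<mu> (n / m2) * e (of_real n * \<tau>) * e (of_real (real h * (n / m2) / real Q))))
          = \<kappa> * of_real (real Q ^ D) * (c \<mu> (n / m2) * of_real (G_sum L b p s \<mu> (n / m2))) * e (of_real n * \<tau>)"
          by (simp only: of_real_mult mult_ac)
        have "\<kappa> * of_real (real Q ^ D) = of_real (K_const D k p l s)"
          unfolding K_const_eq[OF p0] \<kappa>_def Q_def by (simp only: of_real_mult)
        then show ?thesis using True * by simp
      qed simp
    qed simp
    also have "\<dots> = (\<Sum>\<mu>\<in>{\<mu>\<in>Y. cz \<mu> n}. of_real (K_const D k p l s) * (c \<mu> (n / m2) * of_real (G_sum L b p s \<mu> (n / m2))) * e (of_real n * \<tau>))"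
      by (rule sum.inter_filter[OF finY, symmetric])
    also have "{\<mu>\<in>Y. cz \<mu> n} = {\<mu>. \<mu> \<in> disc L b \<and> \<mu> [^]\<^bsub>disc_group L b\<^esub> m = y \<and> cz \<mu> n}" by (auto simp: Y_def)
    finally show "(\<Sum>h\<in>totatives Q. \<Sum>\<mu>\<in>Y. \<kappa> * gauss_sum Q (- int h) R (class_rep \<mu>) *
        (if cz \<mu> n then c \<mu> (n / m2) * e (of_real n * \<tau>) * e (of_real (real h * (n / m2) / real Q)) else 0))
      = of_real (K_const D k p l s) *
      (\<Sum>\<mu> | \<mu> \<in> disc L b \<and> \<mu> [^]\<^bsub>disc_group L b\<^esub> m = y \<and> cz \<mu> n. c \<mu> (n / m2) * of_real (G_sum L b p s \<mu> (n / m2))) * e (of_real n * \<tau>)"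
      by (simp only: sum_distrib_left sum_distrib_right)
  qed
  finally show "((\<lambda>n. of_real (K_const (lattice_rank L) k p l s) *
      (\<Sum>\<mu> | \<mu> \<in> disc L b \<and> \<mu> [^]\<^bsub>disc_group L b\<^esub> (p ^ (l - s)) = y \<and>
         cong_zero (n - real p ^ (2 * (l - s)) * qclass b \<mu>) (p ^ (2 * (l - s))).
        c \<mu> (n_shift b (p ^ (l - s)) \<mu> n) * of_real (G_sum L b p s \<mu> (n_shift b (p ^ (l - s)) \<mu> n))) * e (of_real n * \<tau>))
      has_sum hecke_beta_sum L b \<rho> k p l s f \<tau> y) {n \<in> in_index b y. n \<ge> 0}"
    using n_shift_eq[OF pos(2), of b] by (simp only: D_def m_def[symmetric] m2_def[symmetric] m2[symmetric] cz_def I_def)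
qed

text \<open>Now exponents are divided by m^2 with m = p^{s-l}, and y receives a contribution from
  the single class p^{s-l} y.\<close>

lemma hecke_beta_sum_expansion_large:
  fixes p l s :: nat and k :: real
  assumes p: "prime p" "odd p" and s: "l < s" "s < 2 * l"
    and fe: "fourier_expansion L b f c"
  shows "fourier_expansion L b (hecke_beta_sum L b \<rho> k p l s f)
    (\<lambda>y n. of_real (K_const_tilde (lattice_rank L) k p l s) *
       c (y [^]\<^bsub>disc_group L b\<^esub> (p ^ (s - l))) (real p ^ (2 * (s - l)) * n) *
       of_real (G_sum_tilde L b p l s y (real p ^ (2 * (s - l)) * n)))"
  unfolding fourier_expansion_def
proof (intro ballI)
  fix \<tau> y assume \<tau>: "\<tau> \<in> UH" and y: "y \<in> disc L b"
  define D where "D = lattice_rank L"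
  have p0: "p > 0" using p(1) by (simp add: prime_gt_0_nat)
  define N Q m m2 where "N = p ^ l" and "Q = p ^ s" and "m = p ^ (s - l)" and "m2 = real p ^ (2 * (s - l))"
  have pos: "N > 0" "Q > 0" "m > 0" "m2 > 0" using p0 by (auto simp: N_def Q_def m_def m2_def)
  have m2: "m2 = (real m)\<^sup>2" by (simp add: m2_def m_def power_mult[symmetric] mult.commute)
  define P where "P = p ^ (2 * l - s)"
  have P0: "P > 0" using p0 by (simp add: P_def)
  have QP: "Q = P * m * m"
  proof -
    have "s = (2 * l - s) + (s - l) + (s - l)" using s by linarith
    then show ?thesis unfolding Q_def m_def P_def by (metis power_add)
  qed
  obtain R where R: "transversal L (nL N) R" using obtain_transversal_nL[OF pos(1)] by blast
  have R': "transversal L (nL (p ^ min s l)) R" using R s by (simp add: N_def min_absorb2)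
  define x0 where "x0 = y [^]\<^bsub>disc_group L b\<^esub> m"
  have x0: "x0 \<in> disc L b" unfolding x0_def by (rule disc_pow_closed[OF y])
  have qq: "m2 * qclass b y - qclass b x0 \<in> \<int>" using qclass_pow[OF y, of m] by (simp add: x0_def m2)
  define I where "I = {n \<in> in_index b x0. n \<ge> 0}"
  define \<sigma> where "\<sigma> = (\<lambda>h::nat. (of_nat (p ^ (2 * l - s)) * \<tau> + of_int (int h)) / of_nat (p ^ s))"
  have \<sigma>_eq: "(of_nat (p ^ (2 * l - s)) * \<tau> + of_int (int h)) / of_nat (p ^ s) = \<sigma> h" for h
    by (simp only: \<sigma>_def)
  have \<sigma>: "\<sigma> h = of_real (1 / m2) * \<tau> + of_real (real h / real Q)" for h
    using P0 pos unfolding \<sigma>_def P_def[symmetric] Q_def[symmetric] m2 QP by (simp add: power2_eq_square add_divide_distrib)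
  have \<sigma>UH: "\<sigma> h \<in> UH" for h using \<tau> pos unfolding \<sigma> by (simp add: UH_iff)
  define \<kappa> where "\<kappa> = complex_of_real (real p powr (2 * real l * (k - 1)) * real p powr (- real s * k)) *
     of_real ((real p powr (- real s / 2)) ^ D)"
  define W where "W = (\<lambda>h::nat. \<Sum>r\<in>R. e (of_real (of_int (- int h) / real (p ^ (2 * l - s)) * q (class_rep y + r))))"
  have W_eq: "(\<Sum>r\<in>R. e (of_real (of_int (- int h) / real (p ^ (2 * l - s)) * q (class_rep y + r)))) = W h" for h
    by (simp only: W_def)
  have hecke: "hecke_beta_sum L b \<rho> k p l s f \<tau> y = (\<Sum>h\<in>totatives Q. \<kappa> * W h * f (\<sigma> h) x0)"
    unfolding hecke_beta_sum_def Q_def[symmetric]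
  proof (rule sum.cong)
    fix h assume "h \<in> totatives Q"
    then have "coprime h (p ^ s)" by (simp add: totatives_def Q_def)
    then have h: "coprime (int h) (int p)" using s(1) by (simp add: coprime_power_right_iff)
    have s0: "0 < s" using s by simp
    have "(\<Sum>x\<in>disc L b. f (\<sigma> h) x * ext_act L b \<rho> p l (mp_beta p l s (int h)) (basis_elem x) y)
      = (\<Sum>x\<in>disc L b. if x = x0 then of_real ((real p powr (- real s / 2)) ^ D) * W h * f (\<sigma> h) x0 else 0)"
    proof (rule sum.cong)
      fix x assume x: "x \<in> disc L b"
      show "f (\<sigma> h) x * ext_act L b \<rho> p l (mp_beta p l s (int h)) (basis_elem x) y =
        (if x = x0 then of_real ((real p powr (- real s / 2)) ^ D) * W h * f (\<sigma> h) x0 else 0)"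
        unfolding ext_act_beta[OF p s0 s(2) h R' x] beta_coeff_def W_eq m_def[symmetric] x0_def[symmetric]
        using s(1) y by (auto simp: basis_elem_def D_def simp del: of_real_power)
    qed simp
    also have "\<dots> = of_real ((real p powr (- real s / 2)) ^ D) * W h * f (\<sigma> h) x0" using finite_disc x0 by simp
    finally have inner: "(\<Sum>x\<in>disc L b. f (\<sigma> h) x * ext_act L b \<rho> p l (mp_beta p l s (int h)) (basis_elem x) y) = of_real ((real p powr (- real s / 2)) ^ D) * W h * f (\<sigma> h) x0" .
    show "hecke_g L b \<rho> k p l s f (int h) \<tau> y = \<kappa> * W h * f (\<sigma> h) x0"
      unfolding hecke_g_def \<sigma>_eq inner \<kappa>_def by (simp only: mult.assoc)
  qed simp
  define g where "g = (\<lambda>n. of_real (K_const_tilde D k p l s) * c x0 n * of_real (G_sum_tilde L b p l s y n) * e (of_real (n / m2) * \<tau>))"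
  have "((\<lambda>n. \<Sum>h\<in>totatives Q. \<kappa> * W h * (c x0 n * e (of_real n * \<sigma> h))) has_sum hecke_beta_sum L b \<rho> k p l s f \<tau> y) I"
    unfolding hecke I_def by (intro has_sum_sum_finite has_sum_cmult_right) (use fe x0 \<sigma>UH in \<open>auto simp: fourier_expansion_def\<close>)
  also have "?this \<longleftrightarrow> (g has_sum hecke_beta_sum L b \<rho> k p l s f \<tau> y) I"
  proof (rule has_sum_cong)
    fix n assume n: "n \<in> I"
    have "n - m2 * q (class_rep y) = (n - qclass b x0) - (m2 * qclass b y - qclass b x0)" by (simp add: qclass_def)
    also have "\<dots> \<in> \<int>" by (rule Ints_diff) (use n qq in \<open>auto simp: I_def in_index_def\<close>)
    finally have int: "n - real p ^ (2 * (s - l)) * q (class_rep y) \<in> \<int>" by (simp add: m2_def)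
    have "(\<Sum>h\<in>totatives Q. \<kappa> * W h * (c x0 n * e (of_real n * \<sigma> h))) =
        \<kappa> * c x0 n * e (of_real (n / m2) * \<tau>) * (\<Sum>h\<in>totatives Q. e (of_real (real h * n / real Q)) * W h)"
      unfolding sum_distrib_left
    proof (rule sum.cong)
      fix h
      have "e (of_real n * \<sigma> h) = e (of_real (n / m2) * \<tau>) * e (of_real (real h * n / real Q))"
        unfolding \<sigma> e_add[symmetric] by (simp add: algebra_simps)
      then show "\<kappa> * W h * (c x0 n * e (of_real n * \<sigma> h)) = \<kappa> * c x0 n * e (of_real (n / m2) * \<tau>) * (e (of_real (real h * n / real Q)) * W h)"
        by (simp only: mult_ac)
    qed simp
    also have "(\<Sum>h\<in>totatives Q. e (of_real (real h * n / real Q)) * W h) = of_real (real N ^ D * G_sum_tilde L b p l s y n)"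
      using totatives_gauss_sum_tilde(1)[OF p(1) s y int R[unfolded N_def]] by (simp only: Q_def W_def N_def D_def)
    also have "\<kappa> * c x0 n * e (of_real (n / m2) * \<tau>) * of_real (real N ^ D * G_sum_tilde L b p l s y n) =
        (\<kappa> * of_real (real N ^ D)) * c x0 n * of_real (G_sum_tilde L b p l s y n) * e (of_real (n / m2) * \<tau>)"
      by (simp only: of_real_mult mult_ac)
    also have "\<kappa> * of_real (real N ^ D) = of_real (K_const_tilde D k p l s)"
      unfolding K_const_tilde_eq[OF p0] \<kappa>_def N_def by (simp only: of_real_mult)
    finally show "(\<Sum>h\<in>totatives Q. \<kappa> * W h * (c x0 n * e (of_real n * \<sigma> h))) = g n" by (simp only: g_def)
  qed
  \<comment> \<open>Exponents outside m^2 (\<int> + q(y)) would not be exponents at y after the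
    division. Their coefficients vanish, so the index set can be cut down before reindexing.\<close>
  also have "\<dots> \<longleftrightarrow> (g has_sum hecke_beta_sum L b \<rho> k p l s f \<tau> y) {n \<in> I. cong_zero (n - m2 * q (class_rep y)) (p ^ (2 * (s - l)))}"
  proof (rule has_sum_cong_neutral)
    fix n assume n: "n \<in> I - {n \<in> I. cong_zero (n - m2 * q (class_rep y)) (p ^ (2 * (s - l)))}"
    have "n - m2 * q (class_rep y) = (n - qclass b x0) - (m2 * qclass b y - qclass b x0)" by (simp add: qclass_def)
    also have "\<dots> \<in> \<int>" by (rule Ints_diff) (use n qq in \<open>auto simp: I_def in_index_def\<close>)
    finally have int: "n - real p ^ (2 * (s - l)) * q (class_rep y) \<in> \<int>" by (simp add: m2_def)
    show "g n = 0"
      using totatives_gauss_sum_tilde(2)[OF p(1) s y int R[unfolded N_def]] n by (simp add: g_def m2_def)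
  qed auto
  also have "\<dots> \<longleftrightarrow> ((\<lambda>n. g (m2 * n)) has_sum hecke_beta_sum L b \<rho> k p l s f \<tau> y) {n \<in> in_index b y. n \<ge> 0}"
  proof (rule has_sum_reindex_bij_witness[of _ "\<lambda>n. m2 * n" "\<lambda>n. n / m2"])
    fix n assume n: "n \<in> {n \<in> I. cong_zero (n - m2 * q (class_rep y)) (p ^ (2 * (s - l)))}"
    then obtain j :: int where "n - m2 * qclass b y = m2 * of_int j" by (auto simp: cong_zero_def m2_def qclass_def)
    then have "n / m2 - qclass b y = of_int j" using pos by (simp add: field_simps)
    then show "n / m2 \<in> {n \<in> in_index b y. n \<ge> 0}" using n pos by (auto simp: in_index_def I_def)
    show "m2 * (n / m2) = n" "g (m2 * (n / m2)) = g n" using pos by simp_all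
  next
    fix n assume n: "n \<in> {n \<in> in_index b y. n \<ge> 0}"
    then obtain j where j: "n - qclass b y = of_int j" by (auto simp: in_index_def elim: Ints_cases)
    have 1: "m2 * n - m2 * qclass b y = real (p ^ (2 * (s - l))) * of_int j"
      using arg_cong[OF j, of "\<lambda>z. m2 * z"] by (simp add: right_diff_distrib m2_def)
    have "m2 * n - qclass b x0 = real (p ^ (2 * (s - l))) * of_int j + (m2 * qclass b y - qclass b x0)"
      using 1 by simp
    also have "\<dots> \<in> \<int>" using qq by (intro Ints_add Ints_mult) auto
    finally show "m2 * n \<in> {n \<in> I. cong_zero (n - m2 * q (class_rep y)) (p ^ (2 * (s - l)))}"
      using n pos 1 unfolding I_def cong_zero_def in_index_def qclass_def by auto
    show "m2 * n / m2 = n" using pos by simp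
  qed simp
  finally show "((\<lambda>n. of_real (K_const_tilde (lattice_rank L) k p l s) *
       c (y [^]\<^bsub>disc_group L b\<^esub> (p ^ (s - l))) (real p ^ (2 * (s - l)) * n) *
       of_real (G_sum_tilde L b p l s y (real p ^ (2 * (s - l)) * n)) * e (of_real n * \<tau>)) has_sum hecke_beta_sum L b \<rho> k p l s f \<tau> y)
       {n \<in> in_index b y. n \<ge> 0}"
    unfolding g_def using pos by (simp add: x0_def m_def m2_def[symmetric] D_def)
qed

end

theorem theorem3:
  fixes L :: "'v::real_vector set"
    and b :: "'v \<Rightarrow> 'v \<Rightarrow> real"
    and \<rho> :: "mp_elem \<Rightarrow> ('v set \<Rightarrow> complex) \<Rightarrow> 'v set \<Rightarrow> complex"
    and f :: "complex \<Rightarrow> 'v set \<Rightarrow> complex"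
    and c :: "'v set \<Rightarrow> real \<Rightarrow> complex"
    and k :: real
    and p l s D :: nat
  assumes "even_lattice L b"
    and "D = lattice_rank L"
    and "weil_representation L b \<rho>"
    and "2 * k \<in> \<int>"
    and "prime p" and "odd p"
    and "0 < s" and "0 < l" and "s < 2 * l"
    and "f \<in> modular_forms L b \<rho> k"
    and "fourier_expansion L b f c"
  shows "(\<exists>bs. fourier_expansion L b (hecke_beta_sum L b \<rho> k p l s f) bs) \<and>
    (\<forall>bs. fourier_expansion L b (hecke_beta_sum L b \<rho> k p l s f) bs \<longrightarrow>
      (\<forall>x\<in>disc L b. \<forall>n\<in>in_index b x. n \<ge> 0 \<longrightarrow>
        (s \<le> l \<longrightarrow>
          (\<forall>y\<in>disc L b. y [^]\<^bsub>disc_group L b\<^esub> (p ^ (l - s)) = x \<longrightarrow>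
            bs x n = of_real (K_const D k p l s) *
              (\<Sum>x' | x' \<in> disc_kernel L b (p ^ (l - s)) \<and>
                  cong_zero (n - real p ^ (2 * (l - s)) * qclass b (y \<otimes>\<^bsub>disc_group L b\<^esub> x'))
                    (p ^ (2 * (l - s))).
                c (y \<otimes>\<^bsub>disc_group L b\<^esub> x')
                  (n_shift b (p ^ (l - s)) (y \<otimes>\<^bsub>disc_group L b\<^esub> x') n) *
                of_real (G_sum L b p s (y \<otimes>\<^bsub>disc_group L b\<^esub> x')
                  (n_shift b (p ^ (l - s)) (y \<otimes>\<^bsub>disc_group L b\<^esub> x') n)))) \<and>
          (x \<notin> disc_image L b (p ^ (l - s)) \<longrightarrow> bs x n = 0)) \<and>
        (l + 1 \<le> s \<longrightarrow>
          bs x n = of_real (K_const_tilde D k p l s) *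
            c (x [^]\<^bsub>disc_group L b\<^esub> (p ^ (s - l))) (real p ^ (2 * (s - l)) * n) *
            of_real (G_sum_tilde L b p l s x (real p ^ (2 * (s - l)) * n)))))"
proof -
  interpret even_lattice L b by fact
  obtain F where F: "finite F" "F \<subseteq> L" "independent F" "span F = span L" "\<And>v. v \<in> F \<Longrightarrow> b v v \<noteq> 0"
    "\<And>v w. v \<in> F \<Longrightarrow> w \<in> F \<Longrightarrow> v \<noteq> w \<Longrightarrow> b v w = 0"
    using obtain_orthogonal_frame by metis
  interpret weil_lattice L b F \<rho>
    by unfold_locales (use F assms(3) in auto)
  note p = \<open>prime p\<close> \<open>odd p\<close>
  show ?thesis
  proof (cases "s \<le> l")
    case True
    define m where "m = p ^ (l - s)"
    note expn = hecke_beta_sum_expansion_small[OF p assms(7,9) True assms(11), of k, folded assms(2) m_def]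
    \<comment> \<open>The preimages of x under multiplication by m form a coset of the kernel, with
      any preimage y as base point.\<close>
    have sum_eq: "(\<Sum>\<mu> | \<mu> \<in> disc L b \<and> \<mu> [^]\<^bsub>disc_group L b\<^esub> m = x \<and> P \<mu>. g \<mu>) =
        (\<Sum>x' | x' \<in> disc_kernel L b m \<and> P (y \<otimes>\<^bsub>disc_group L b\<^esub> x'). g (y \<otimes>\<^bsub>disc_group L b\<^esub> x'))"
      if y: "y \<in> disc L b" "y [^]\<^bsub>disc_group L b\<^esub> m = x" for x y P and g :: "'v set \<Rightarrow> complex"
    proof -
      obtain v where v: "v \<in> Ld" "y = cls v" using y(1) by (rule disc_cases)
      have xv: "x = cls (real m *\<^sub>R v)" using y(2) by (simp add: v disc_pow)
      have add: "cls v \<otimes>\<^bsub>disc_group L b\<^esub> cls u = cls (v + u)" for u by (rule disc_mult)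
      \<comment> \<open>Subtraction of the class y; \<open>class_rep\<close> occurs because t has to
        be a function of the class \<mu>.\<close>
      define t where "t = (\<lambda>\<mu>. cls (class_rep \<mu> - v))"
      have t: "t (cls u) = cls (u - v)" for u
        unfolding t_def cls_eq_iff using class_rep_cls[of u] by simp
      show ?thesis
      proof (rule sum.reindex_bij_witness[of _ "\<lambda>x'. y \<otimes>\<^bsub>disc_group L b\<^esub> x'" t])
        fix \<mu> assume \<mu>: "\<mu> \<in> {\<mu>. \<mu> \<in> disc L b \<and> \<mu> [^]\<^bsub>disc_group L b\<^esub> m = x \<and> P \<mu>}"
        then obtain u where u: "u \<in> Ld" "\<mu> = cls u" by (auto elim: disc_cases)
        have "real m *\<^sub>R u - real m *\<^sub>R v \<in> L" using \<mu> by (simp add: u disc_pow xv cls_eq_iff)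
        then have mem: "real m *\<^sub>R (u - v) \<in> L" by (simp add: scaleR_diff_right)
        show eq: "y \<otimes>\<^bsub>disc_group L b\<^esub> t \<mu> = \<mu>" by (simp add: u t v disc_mult)
        have "t \<mu> \<in> disc_kernel L b m"
          unfolding disc_kernel_eq u t using mem add_subgroup_diff[OF Ld_subgroup u(1) v(1)] by blast
        then show "t \<mu> \<in> {x'. x' \<in> disc_kernel L b m \<and> P (y \<otimes>\<^bsub>disc_group L b\<^esub> x')}" using eq \<mu> by simp
        show "g (y \<otimes>\<^bsub>disc_group L b\<^esub> t \<mu>) = g \<mu>" by (simp only: eq)
      next
        fix x' assume x': "x' \<in> {x'. x' \<in> disc_kernel L b m \<and> P (y \<otimes>\<^bsub>disc_group L b\<^esub> x')}"
        then obtain u where u: "u \<in> Ld" "real m *\<^sub>R u \<in> L" "x' = cls u" by (auto simp: disc_kernel_eq)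
        show "t (y \<otimes>\<^bsub>disc_group L b\<^esub> x') = x'" by (simp add: u v disc_mult t)
        have "y \<otimes>\<^bsub>disc_group L b\<^esub> x' \<in> disc L b"
          using add_subgroup_add[OF Ld_subgroup v(1) u(1)] by (simp add: u v disc_mult cls_in_disc)
        moreover have "(y \<otimes>\<^bsub>disc_group L b\<^esub> x') [^]\<^bsub>disc_group L b\<^esub> m = x"
          using u(2) by (simp add: u(3) v disc_mult disc_pow xv cls_eq_iff scaleR_add_right)
        ultimately show "y \<otimes>\<^bsub>disc_group L b\<^esub> x' \<in> {\<mu>. \<mu> \<in> disc L b \<and> \<mu> [^]\<^bsub>disc_group L b\<^esub> m = x \<and> P \<mu>}"
          using x' by simp
      qed
    qed
    have empty: "{\<mu>. \<mu> \<in> disc L b \<and> \<mu> [^]\<^bsub>disc_group L b\<^esub> m = x \<and> P \<mu>} = {}" if "x \<notin> disc_image L b m" for x P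
      using that by (auto simp: disc_image_def)
    show ?thesis unfolding m_def[symmetric]
    proof (intro conjI allI impI ballI, goal_cases)
      case 1
      then show ?case using expn by blast
    next
      case (2 bs x n y)
      show ?case
        unfolding fourier_expansion_unique[OF 2(1) expn 2(2-4)]
        by (subst sum_eq[OF 2(6,7)]) simp
    next
      case (3 bs x n)
      show ?case
        unfolding fourier_expansion_unique[OF 3(1) expn 3(2-4)] empty[OF 3(6)] by simp
    next
      case 4
      then show ?case using True by simp
    qed
  next
    case False
    then have "l < s" by simp
    note expn = hecke_beta_sum_expansion_large[OF p this assms(9,11), of k, folded assms(2)]
    show ?thesis
      using False expn fourier_expansion_unique[OF _ expn] by auto
  qed
qed

end
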